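(* Work in the hyperbolic plane of curvature $-1$. For $d>0$ and $n\in\mathbb{N}$ let $e_d(n)$ be the maximum number of touching pairs in a packing of $n$ circles of diameter $d$ (equivalently, the maximum number of pairs at distance exactly $d$ in a set of $n$ points with pairwise distances at least $d$), and let $c(d)=\lim_{n\to\infty} e_d(n)/n$. Let $\alpha=\alpha(d)$ and $\alpha_4=\alpha_4(d)$, and let $d(k)$ ($k\ge 7$) and $\overline{d}(k)$ ($k\ge 6$) be as in the context. Then: \begin{enumerate} \item for all $d>0$: $c(d)\le \gamma_1(d):=\frac{\pi}{\alpha}-\sqrt{\left(\frac{\pi}{\alpha}-1\right)\left(\frac{\pi}{\alpha}-3\right)}$; \item if $d=\overline{d}(k)$ for some $k\ge 6$: $c(d)\le \gamma_2(d):=\frac{\pi}{\alpha}-\frac18-\sqrt{\left(\frac{\pi}{\alpha}\right)^2-\frac{17\pi}{4\alpha}+\frac{241}{64}}$; \item if $d=\overline{d}(k)$ for some $k\ge 6$: $c(d)\le \gamma_3(d):=2+\frac{3(d-\pi+3\alpha)}{4(d+\pi-3\alpha)}$; \item if $d\neq d(k)$ for all $k\ge 7$ and $d\neq \overline{d}(k)$ for all $k\ge 6$: $c(d)\le \gamma_4(d):=\frac{\pi}{\alpha}-\frac16-\sqrt{\left(\frac{\pi}{\alpha}\right)^2-\frac{13\pi}{3\alpha}+\frac{145}{36}}$; \item if $d\neq d(k)$ for all $k\ge 7$ and $d\neq \overline{d}(k)$ for all $k\ge 6$: $c(d)\le \gamma_5(d):=\frac83-\frac{4(\pi-3\alpha)}{3(d+\pi-3\alpha)}$;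 \item for all $d>0$: $c(d)\ge \gamma_6(d):=2+\frac{1}{4\lfloor(2\pi-\alpha_4)/\alpha\rfloor-6}$. \end{enumerate}
   Context: Hyperbolic plane of curvature $-1$. The limit $c(d)$ exists (by superadditivity of $e_d$). $\alpha(d)$ is the angle of an equilateral triangle of side length $d$, given by $\cos\alpha=\tanh(d/2)/\tanh d$, equivalently $\sin(\alpha/2)=1/(2\cosh(d/2))$. $\alpha_4(d)$ is the angle of a regular quadrilateral (square) of side length $d$, given by $\sin(\alpha_4/2)=\sqrt{2}\sin(\alpha/2)$. For $k\ge 7$, $d(k)$ is the value of $d$ with $\alpha(d)=2\pi/k$ (edge length of the order-$k$ triangular tiling). For $k\ge 6$, $\overline{d}(k)$ is the value of $d$ with $\alpha_4(d)+(k-1)\alpha(d)=2\pi$ (edge length of the semiregular tiling with $k-1$ equilateral triangles and one square at each vertex). *)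

theory Defs
  imports "HOL-Analysis.Analysis"
begin

text \<open>The hyperbolic plane of curvature \<open>-1\<close> is taken in the Poincare disc model:
  the points are those of the open unit disc of the complex plane.\<close>

definition hyp_plane :: "complex set" where
  "hyp_plane = ball 0 1"

definition hyp_dist :: "complex \<Rightarrow> complex \<Rightarrow> real" where
  "hyp_dist z w =
     arcosh (1 + 2 * (cmod (z - w))\<^sup>2 / ((1 - (cmod z)\<^sup>2) * (1 - (cmod w)\<^sup>2)))"

text \<open>\<open>hyp_packing d P\<close>: the points of \<open>P\<close> are the centres of a packing of circles
  of diameter \<open>d\<close>.\<close>

definition hyp_packing :: "real \<Rightarrow> complex set \<Rightarrow> bool" where
  "hyp_packing d P \<longleftrightarrow>
     P \<subseteq> hyp_plane \<and> (\<forall>p\<in>P. \<forall>q\<in>P. p \<noteq> q \<longrightarrow> d \<le> hyp_dist p q)"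

definition touching_pairs :: "real \<Rightarrow> complex set \<Rightarrow> complex set set" where
  "touching_pairs d P = {{p, q} | p q. p \<in> P \<and> q \<in> P \<and> p \<noteq> q \<and> hyp_dist p q = d}"

definition max_contacts :: "real \<Rightarrow> nat \<Rightarrow> nat" where
  "max_contacts d n =
     Max {card (touching_pairs d P) | P. finite P \<and> card P = n \<and> hyp_packing d P}"

definition contact_limit :: "real \<Rightarrow> real" where
  "contact_limit d = lim (\<lambda>n. real (max_contacts d n) / real n)"

text \<open>Interior angles of the equilateral triangle and of the regular quadrilateral of
  side length \<open>d\<close>, as solutions of \<open>cos \<alpha> = tanh (d/2) / tanh d\<close> and
  \<open>sin (\<alpha>\<^sub>4/2) = sqrt 2 sin (\<alpha>/2)\<close>; see \<open>cos_alpha\<close>, \<open>sin_half_alpha\<close>,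
  \<open>sin_half_alpha4\<close> below.\<close>

definition alpha :: "real \<Rightarrow> real" where
  "alpha d = arccos (tanh (d / 2) / tanh d)"

definition alpha4 :: "real \<Rightarrow> real" where
  "alpha4 d = 2 * arcsin (sqrt 2 * sin (alpha d / 2))"

text \<open>Edge lengths of the order-\<open>k\<close> triangular tiling (\<open>k \<ge> 7\<close>) and of the semiregular
  tiling with \<open>k - 1\<close> triangles and one square at each vertex (\<open>k \<ge> 6\<close>); well defined
  by \<open>ex1_d_tri\<close> and \<open>ex1_d_semi\<close> below.\<close>

definition d_tri :: "nat \<Rightarrow> real" where
  "d_tri k = (THE d. d > 0 \<and> alpha d = 2 * pi / real k)"

definition d_semi :: "nat \<Rightarrow> real" where
  "d_semi k = (THE d. d > 0 \<and> alpha4 d + (real k - 1) * alpha d = 2 * pi)"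

definition gamma1 :: "real \<Rightarrow> real" where
  "gamma1 d = pi / alpha d - sqrt ((pi / alpha d - 1) * (pi / alpha d - 3))"

definition gamma2 :: "real \<Rightarrow> real" where
  "gamma2 d = pi / alpha d - 1 / 8
     - sqrt ((pi / alpha d)\<^sup>2 - 17 * pi / (4 * alpha d) + 241 / 64)"

definition gamma3 :: "real \<Rightarrow> real" where
  "gamma3 d = 2 + 3 * (d - pi + 3 * alpha d) / (4 * (d + pi - 3 * alpha d))"

definition gamma4 :: "real \<Rightarrow> real" where
  "gamma4 d = pi / alpha d - 1 / 6
     - sqrt ((pi / alpha d)\<^sup>2 - 13 * pi / (3 * alpha d) + 145 / 36)"

definition gamma5 :: "real \<Rightarrow> real" where
  "gamma5 d = 8 / 3 - 4 * (pi - 3 * alpha d) / (3 * (d + pi - 3 * alpha d))"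

definition gamma6 :: "real \<Rightarrow> real" where
  "gamma6 d = 2 + 1 / (4 * real_of_int \<lfloor>(2 * pi - alpha4 d) / alpha d\<rfloor> - 6)"

lemma tanh_ratio:
  assumes "(d::real) > 0"
  shows "tanh (d / 2) / tanh d = 1 - 1 / (2 * (cosh (d / 2))\<^sup>2)"
proof -
  define s c where "s = sinh (d / 2)" and "c = cosh (d / 2)"
  have pos: "s > 0" "c > 0" using assms by (auto simp: s_def c_def)
  have sd: "sinh d = 2 * s * c" using sinh_double[of "d / 2"] by (simp add: s_def c_def)
  have cd: "cosh d = c\<^sup>2 + s\<^sup>2" using cosh_double[of "d / 2"] by (simp add: s_def c_def)
  have sc: "s\<^sup>2 = c\<^sup>2 - 1" unfolding s_def c_def by (simp add: cosh_square_eq)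
  have "tanh (d / 2) / tanh d = (s / c) / (2 * s * c / (c\<^sup>2 + s\<^sup>2))"
    unfolding tanh_def sd cd by (simp add: s_def c_def)
  also have "\<dots> = (c\<^sup>2 + s\<^sup>2) / (2 * c\<^sup>2)"
    using pos by (simp add: field_simps power2_eq_square)
  also have "\<dots> = 1 - 1 / (2 * c\<^sup>2)"
    using pos unfolding sc by (simp add: field_simps)
  finally show ?thesis by (simp add: c_def)
qed

lemma half_cosh_inverse_bounds:
  assumes "(d::real) > 0"
  shows "1 / (2 * cosh (d / 2)) > 0" "1 / (2 * cosh (d / 2)) < 1 / 2"
proof -
  have "cosh (d / 2) > 1" using assms cosh_real_strict_mono[of 0 "d/2"] by simp
  then show "1 / (2 * cosh (d / 2)) > 0" "1 / (2 * cosh (d / 2)) < 1 / 2"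
    by (auto simp: field_simps)
qed

lemma alpha_arcsin:
  assumes "d > 0"
  shows "alpha d = 2 * arcsin (1 / (2 * cosh (d / 2)))"
proof -
  define x where "x = 1 / (2 * cosh (d / 2))"
  have x: "0 < x" "x < 1 / 2" using half_cosh_inverse_bounds[OF assms] by (auto simp: x_def)
  have "0 \<le> arcsin x" using x arcsin_le_arcsin[of 0 x] by simp
  moreover have "arcsin x \<le> pi / 2" using x by (intro arcsin_ubound) auto
  moreover have "cos (2 * arcsin x) = 1 - 2 * x\<^sup>2"
    using x by (simp add: cos_double_sin)
  moreover have "1 - 2 * x\<^sup>2 = tanh (d / 2) / tanh d"
    unfolding tanh_ratio[OF assms] x_def by (simp add: power2_eq_square)
  ultimately show ?thesis
    unfolding alpha_def x_def[symmetric] by (metis arccos_cos mult_nonneg_nonneg zero_le_numeral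
        mult.commute pos_le_divide_eq zero_less_numeral)
qed

lemma cos_alpha:
  assumes "d > 0"
  shows "cos (alpha d) = tanh (d / 2) / tanh d"
proof -
  have "0 \<le> tanh (d / 2) / tanh d" using assms by simp
  moreover have "tanh (d / 2) / tanh d \<le> 1" using tanh_ratio[OF assms] by simp
  ultimately show ?thesis unfolding alpha_def by (simp add: cos_arccos)
qed

lemma sin_half_alpha:
  assumes "d > 0"
  shows "sin (alpha d / 2) = 1 / (2 * cosh (d / 2))"
proof -
  have "sin (arcsin (1 / (2 * cosh (d / 2)))) = 1 / (2 * cosh (d / 2))"
    using half_cosh_inverse_bounds[OF assms] by (intro sin_arcsin) linarith+
  then show ?thesis by (simp add: alpha_arcsin[OF assms])
qed

lemma alpha4_arcsin:
  assumes "d > 0"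
  shows "alpha4 d = 2 * arcsin (sqrt 2 * (1 / (2 * cosh (d / 2))))"
  unfolding alpha4_def sin_half_alpha[OF assms] ..

lemma sin_half_alpha4:
  assumes "d > 0"
  shows "sin (alpha4 d / 2) = sqrt 2 * sin (alpha d / 2)"
proof -
  define x where "x = 1 / (2 * cosh (d / 2))"
  have x: "0 < x" "x < 1 / 2" using half_cosh_inverse_bounds[OF assms] by (auto simp: x_def)
  have "sqrt 2 \<le> 2" by (rule real_le_lsqrt) auto
  then have "sqrt 2 * x \<le> 2 * (1 / 2)" using x by (intro mult_mono) auto
  moreover have "0 \<le> sqrt 2 * x" using x by simp
  ultimately show ?thesis
    unfolding alpha4_def sin_half_alpha[OF assms] x_def[symmetric] by simp
qed

text \<open>\<open>angle_sum a b x\<close> is \<open>a \<alpha>\<^sub>4 + b \<alpha>\<close> in terms of \<open>x = sin (\<alpha> / 2)\<close>.\<close>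

definition angle_sum :: "real \<Rightarrow> real \<Rightarrow> real \<Rightarrow> real" where
  "angle_sum a b x = a * (2 * arcsin (sqrt 2 * x)) + b * (2 * arcsin x)"

lemma ex1_angle_sum:
  assumes ab: "a \<ge> 0" "b > 0"
    and s: "0 < s" "s < a * (pi / 2) + b * (pi / 3)"
  shows "\<exists>!d. d > 0 \<and> a * alpha4 d + b * alpha d = s"
proof -
  have bnd: "sqrt 2 * x \<le> 1" "-1 \<le> sqrt 2 * x" if "0 \<le> x" "x \<le> 1 / 2" for x
  proof -
    have "sqrt 2 \<le> 2" by (rule real_le_lsqrt) auto
    then have "sqrt 2 * x \<le> 2 * (1 / 2)" using that by (intro mult_mono) auto
    then show "sqrt 2 * x \<le> 1" by simp
    have "0 \<le> sqrt 2 * x" using that by simp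
    then show "-1 \<le> sqrt 2 * x" by linarith
  qed
  have cont: "continuous_on {0..1/2} (angle_sum a b)"
    unfolding angle_sum_def by (intro continuous_intros) (auto simp: bnd)
  have at0: "angle_sum a b 0 = 0" by (simp add: angle_sum_def)
  have as1: "arcsin (1 / 2) = pi / 6"
    by (intro arcsin_unique) (auto simp: sin_30)
  have as2: "arcsin (sqrt 2 * (1 / 2)) = pi / 4"
    by (intro arcsin_unique) (auto simp: sin_45)
  have at1: "angle_sum a b (1 / 2) = a * (pi / 2) + b * (pi / 3)"
    unfolding angle_sum_def as1 as2 by simp
  have mono: "angle_sum a b x < angle_sum a b y" if "0 \<le> x" "x < y" "y \<le> 1 / 2" for x y
  proof -
    have "arcsin x < arcsin y" using that by (intro arcsin_less_arcsin) auto
    moreover have "arcsin (sqrt 2 * x) \<le> arcsin (sqrt 2 * y)"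
      using that bnd[of x] bnd[of y] by (intro arcsin_le_arcsin) auto
    ultimately show ?thesis unfolding angle_sum_def
      using ab by (intro add_le_less_mono mult_left_mono mult_strict_left_mono) auto
  qed
  have trans: "a * alpha4 d + b * alpha d = angle_sum a b (1 / (2 * cosh (d / 2)))"
    if "d > 0" for d
    unfolding angle_sum_def alpha4_arcsin[OF that] alpha_arcsin[OF that] ..
  obtain x where x: "0 \<le> x" "x \<le> 1 / 2" "angle_sum a b x = s"
    using IVT'[of "angle_sum a b" 0 s "1/2"] cont s at0 at1 by auto
  have x': "0 < x" "x < 1 / 2"
    using x s at0 at1 by (cases "x = 0"; cases "x = 1 / 2"; force)+
  define d where "d = 2 * arcosh (1 / (2 * x))"
  have "1 < 1 / (2 * x)" using x' by (simp add: field_simps)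
  then have d: "d > 0" "cosh (d / 2) = 1 / (2 * x)"
    unfolding d_def by (auto simp: cosh_arcosh_real arcosh_real_gt_1_iff less_imp_le)
  show ?thesis
  proof (rule ex1I[of _ d])
    show "d > 0 \<and> a * alpha4 d + b * alpha d = s"
      using d x' x(3) trans[OF d(1)] by simp
  next
    fix e assume e: "e > 0 \<and> a * alpha4 e + b * alpha e = s"
    define y where "y = 1 / (2 * cosh (e / 2))"
    have y: "0 < y" "y < 1 / 2" using half_cosh_inverse_bounds[of e] e by (auto simp: y_def)
    have "angle_sum a b y = s" using e trans[of e] by (simp add: y_def)
    then have "x = y" using mono[of x y] mono[of y x] x x' y by (cases x y rule: linorder_cases) auto
    then have "cosh (e / 2) = cosh (d / 2)" using d(2) by (simp add: y_def)
    then show "e = d" using e d(1) cosh_real_nonneg_less_iff[of "e/2" "d/2"]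
        cosh_real_nonneg_less_iff[of "d/2" "e/2"] by linarith
  qed
qed

lemma ex1_d_tri:
  assumes "k \<ge> 7"
  shows "\<exists>!d. d > 0 \<and> alpha d = 2 * pi / real k"
proof -
  have "2 * pi / real k < pi / 3" using assms by (simp add: field_simps)
  then show ?thesis using ex1_angle_sum[of 0 1 "2 * pi / real k"] assms by simp
qed

lemma ex1_d_semi:
  assumes "k \<ge> 6"
  shows "\<exists>!d. d > 0 \<and> alpha4 d + (real k - 1) * alpha d = 2 * pi"
proof -
  have "5 * (pi / 3) \<le> (real k - 1) * (pi / 3)" using assms by (intro mult_right_mono) auto
  then have "2 * pi < pi / 2 + (real k - 1) * (pi / 3)" using pi_gt_zero by linarith
  then show ?thesis using ex1_angle_sum[of 1 "real k - 1" "2 * pi"] assms by simp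
qed

end

(* Upper bounds. The lower convex hull of generically perturbed heights over the Klein model is a
   Delaunay triangulation that contains all contacts as edges, and Euler's formula counts its edges
   and triangles. After the triangles that can be reached from outside without crossing a contact
   have been removed, each remaining triangle has on average (discharging) at least the area
   pi - 3 alpha of the equilateral one, up to a deficit proportional to the number of edges that
   are not contacts; if alpha satisfies no tiling equation, then every inner vertex meets such an
   edge. The boundary length is then bounded from below either by the isoperimetric
   inequality (gamma_3, gamma_5) or, after the boundary vertices have been peeled off, by induction
   and the angle sums at the remaining vertices (gamma_1, gamma_2, gamma_4).

   Lower bound. As many equilateral triangles as possible around a vertex, leaving a gap of angle
   at least alpha, are enclosed by two disjoint lines: one through the two ends of the gap, one
   through an opposite side. Repeated reflection in such lines yields packings
   with 2 n - 2 points and 2 e - 1 contacts from n points and e contacts. *)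

theory Submission
  imports Defs
begin

section \<open>Regular triangulations of finite planar point sets\<close>

text \<open>Lengths control the area of a triangle only if it contains its circumcentre; a Delaunay
  triangle may be flat, and in the hyperbolic plane the curve through its vertices need not be a
  circle. Heights on a hemisphere over the Klein disc treat circles, horocycles and equidistant
  curves alike, and the one metric consequence drawn is that the excesses of the two triangles at an
  edge have a nonnegative sum: a flat triangle is paid for by its neighbour across the long side.
  That neighbour must exist, hence the removal of the outer triangles; contacts are shortest sides
  and never the long side of a flat triangle. All upper bounds rest on one inequality, contacts
  \<le> A (n - 1) - B (b + D / 2), with b at least the boundary length and D the area deficit; here
  A = 3 - 2 t and B = 1 - 2 t for t = 0, 1/8, 1/6, and it remains to bound b from below. When
  peeling, this bound contains the desired \<gamma> itself, so \<gamma> is the root of a quadratic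
  equation. The fan of j triangles gives 2 + 1 / (2 j), which is at least \<open>gamma6 d\<close>
  because \<open>alpha4 d\<close> is below twice \<alpha> and j \<ge> 5.\<close>

definition crs :: "complex \<Rightarrow> complex \<Rightarrow> complex \<Rightarrow> real" where
  "crs u v z = Im (cnj (v - u) * (z - u))"

definition aff :: "real \<times> complex \<Rightarrow> complex \<Rightarrow> real" where
  "aff l z = fst l + inner (snd l) z"

lemma crs_eq:
  "crs u v z = (Re v - Re u) * (Im z - Im u) - (Im v - Im u) * (Re z - Re u)"
  by (simp add: crs_def algebra_simps)

lemma crs_rotate: "crs v w u = crs u v w"
  by (simp add: crs_eq algebra_simps)

lemma crs_swap: "crs v u w = - crs u v w"
  by (simp add: crs_eq algebra_simps)

lemma crs_swap': "crs u w v = - crs u v w"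
  by (simp add: crs_eq algebra_simps)

lemma crs_same [simp]: "crs u u z = 0" "crs u v u = 0" "crs u v v = 0"
  by (simp_all add: crs_eq algebra_simps)

lemma aff_diff: "aff (l - m) z = aff l z - aff m z"
  by (simp add: aff_def inner_diff_left)

text \<open>\<open>crs u v\<close> vanishes on the line uv, so adding a multiple of it turns the
  graph of \<open>l\<close> about that line. All tilting arguments use this.\<close>

lemma aff_add_crs: "\<exists>l'. \<forall>z. aff l' z = aff l z + t * crs u v z"
proof
  let ?n = "\<i> * (v - u)"
  show "\<forall>z. aff (fst l - t * inner ?n u, snd l + t *\<^sub>R ?n) z = aff l z + t * crs u v z"
    by (simp add: aff_def crs_eq inner_complex_def algebra_simps)
qed

text \<open>Cramer's rule in the basis a - v, c - v.\<close>

lemma cone_decomp: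
  assumes "crs v a c \<noteq> 0"
  shows "z - v = of_real (crs v z c / crs v a c) * (a - v) + of_real (crs v a z / crs v a c) * (c - v)"
proof -
  have "of_real (crs v a c) * (z - v) = of_real (crs v z c) * (a - v) + of_real (crs v a z) * (c - v)"
    by (simp add: complex_eq_iff crs_eq) algebra
  then have "z - v = (of_real (crs v z c) * (a - v) + of_real (crs v a z) * (c - v)) / of_real (crs v a c)"
    using assms by (metis nonzero_mult_div_cancel_left of_real_eq_0_iff)
  then show ?thesis by (simp add: add_divide_distrib)
qed

lemma aff_cone:
  assumes "z - v = of_real r * (a - v) + of_real s * (c - v)"
  shows "aff l z - aff l v = r * (aff l a - aff l v) + s * (aff l c - aff l v)"
proof -
  have "aff l z - aff l v = inner (snd l) (z - v)" by (simp add: aff_def inner_diff_right)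
  also have "\<dots> = r * inner (snd l) (a - v) + s * inner (snd l) (c - v)"
    unfolding assms by (simp add: inner_add_right flip: scaleR_conv_of_real)
  finally show ?thesis by (simp add: aff_def inner_diff_right)
qed

text \<open>Two planes through the same two lifted points therefore differ by a multiple of
  \<open>crs u v\<close>, and comparing them amounts to a single sign.\<close>

lemma aff_vanish:
  assumes "u \<noteq> v" "aff l u = 0" "aff l v = 0"
  shows "\<exists>t. \<forall>z. aff l z = t * crs u v z"
proof -
  define n where "n = \<i> * (v - u)"
  have nn: "crs u v (u + n) \<noteq> 0"
  proof -
    have "crs u v (u + n) = (Re v - Re u)\<^sup>2 + (Im v - Im u)\<^sup>2"
      by (simp add: crs_eq n_def power2_eq_square algebra_simps)
    then show ?thesis using assms(1) by (auto simp: complex_eq_iff sum_power2_eq_zero_iff)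
  qed
  have "aff l z = aff l (u + n) / crs u v (u + n) * crs u v z" for z
    using aff_cone[OF cone_decomp[OF nn], of l z] assms by simp
  then show ?thesis by blast
qed

lemma ray_decomp:
  assumes "a \<noteq> v" "crs v a b = 0"
  shows "\<exists>r. b - v = of_real r * (a - v)"
proof -
  define x y x' y' where "x = Re a - Re v" and "y = Im a - Im v"
    and "x' = Re b - Re v" and "y' = Im b - Im v"
  have c: "x * y' = y * x'" using assms(2) by (simp add: crs_eq x_def y_def x'_def y'_def)
  have n: "x\<^sup>2 + y\<^sup>2 \<noteq> 0"
    using assms(1) by (auto simp: x_def y_def complex_eq_iff sum_power2_eq_zero_iff)
  have "x' * (x\<^sup>2 + y\<^sup>2) = (x * x' + y * y') * x" "y' * (x\<^sup>2 + y\<^sup>2) = (x * x' + y * y') * y"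
    using c by algebra+
  then have "x' = (x * x' + y * y') / (x\<^sup>2 + y\<^sup>2) * x" "y' = (x * x' + y * y') / (x\<^sup>2 + y\<^sup>2) * y"
    using n by (simp_all add: field_simps)
  then have "b - v = of_real ((x * x' + y * y') / (x\<^sup>2 + y\<^sup>2)) * (a - v)"
    by (simp add: complex_eq_iff x_def y_def x'_def y'_def del: of_real_divide of_real_add of_real_mult of_real_power)
  then show ?thesis by blast
qed

lemma generic_direction:
  assumes "finite (V :: complex set)"
  shows "\<exists>w. inj_on (inner w) V"
proof -
  define bad where "bad = (\<lambda>(z, z'). - (Re z - Re z') / (Im z - Im z')) ` (V \<times> V)"
  have "finite bad" unfolding bad_def using assms by simp
  then obtain k where k: "k \<notin> bad"
    using ex_new_if_finite[OF infinite_UNIV_char_0] by blast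
  have "inj_on (inner (Complex 1 k)) V"
  proof (rule inj_onI)
    fix z z' assume z: "z \<in> V" "z' \<in> V" and e: "inner (Complex 1 k) z = inner (Complex 1 k) z'"
    then have e': "(Re z - Re z') + k * (Im z - Im z') = 0"
      by (simp add: inner_complex_def algebra_simps)
    show "z = z'"
    proof (cases "Im z = Im z'")
      case True then show ?thesis using e' by (simp add: complex_eq_iff)
    next
      case False
      then have "k = - (Re z - Re z') / (Im z - Im z')" using e' by (simp add: field_simps)
      then have "k \<in> bad" unfolding bad_def using z by force
      then show ?thesis using k by simp
    qed
  qed
  then show ?thesis by blast
qed

text \<open>The lower convex hull of the points \<open>pos\<close> lifted to the heights
  \<open>h\<close>, described through supporting planes only. By \<open>generic\<close>, no plane
  contains four lifted points three of which project to a proper triangle, so the lower faces are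
  triangles.\<close>

locale regular_triangulation =
  fixes P :: "'a set" and pos :: "'a \<Rightarrow> complex" and h :: "'a \<Rightarrow> real"
  assumes finite_P: "finite P" and inj_pos: "inj_on pos P"
    and generic: "\<lbrakk>u \<in> P; v \<in> P; w \<in> P; s \<in> P; crs (pos u) (pos v) (pos w) \<noteq> 0;
      \<forall>x\<in>{u, v, w, s}. aff l (pos x) = h x\<rbrakk> \<Longrightarrow> s \<in> {u, v, w}"
begin

abbreviation cr :: "'a \<Rightarrow> 'a \<Rightarrow> 'a \<Rightarrow> real" where
  "cr u v w \<equiv> crs (pos u) (pos v) (pos w)"

definition edge :: "'a \<Rightarrow> 'a \<Rightarrow> bool" where
  "edge u v \<longleftrightarrow> u \<in> P \<and> v \<in> P \<and> u \<noteq> v \<and>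
     (\<exists>l. aff l (pos u) = h u \<and> aff l (pos v) = h v \<and> (\<forall>s\<in>P - {u, v}. aff l (pos s) < h s))"

definition tri :: "'a \<Rightarrow> 'a \<Rightarrow> 'a \<Rightarrow> bool" where
  "tri u v w \<longleftrightarrow> u \<in> P \<and> v \<in> P \<and> w \<in> P \<and> cr u v w > 0 \<and>
     (\<exists>l. aff l (pos u) = h u \<and> aff l (pos v) = h v \<and> aff l (pos w) = h w
       \<and> (\<forall>s\<in>P - {u, v, w}. aff l (pos s) < h s))"

lemma pos_neq: "u \<in> P \<Longrightarrow> v \<in> P \<Longrightarrow> u \<noteq> v \<Longrightarrow> pos u \<noteq> pos v"
  using inj_pos by (auto dest: inj_onD)

lemma edge_sym: "edge u v \<longleftrightarrow> edge v u"
  unfolding edge_def by (auto simp: insert_commute)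

lemma edge_in_P: "edge u v \<Longrightarrow> u \<in> P \<and> v \<in> P \<and> u \<noteq> v"
  by (auto simp: edge_def)

lemma tri_in_P: "tri u v w \<Longrightarrow> u \<in> P \<and> v \<in> P \<and> w \<in> P"
  by (auto simp: tri_def)

lemma tri_pos: "tri u v w \<Longrightarrow> cr u v w > 0"
  by (auto simp: tri_def)

lemma tri_rotate: "tri u v w \<Longrightarrow> tri v w u"
  unfolding tri_def using crs_rotate[of "pos v" "pos w" "pos u"]
  by (auto simp: insert_commute crs_rotate)

lemma tri_distinct: "tri u v w \<Longrightarrow> u \<noteq> v \<and> v \<noteq> w \<and> u \<noteq> w"
  unfolding tri_def by auto

text \<open>The supporting plane is lowered slightly on the side of w by turning it about uv: w then
  lies strictly above it, and the finitely many strict inequalities at the other points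
  survive.\<close>

lemma tri_edge: assumes "tri u v w" shows "edge u v"
proof -
  obtain l where l: "aff l (pos u) = h u" "aff l (pos v) = h v" "aff l (pos w) = h w"
    "\<And>s. s \<in> P - {u, v, w} \<Longrightarrow> aff l (pos s) < h s" and P: "u \<in> P" "v \<in> P" "w \<in> P" and c: "cr u v w > 0"
    using assms unfolding tri_def by blast
  define S where "S = P - {u, v, w}"
  have "\<exists>e>0. \<forall>s\<in>S. aff l (pos s) + e * \<bar>cr u v s\<bar> < h s"
  proof -
    have "\<forall>\<^sub>F e in at_right 0. \<forall>s\<in>S. aff l (pos s) + e * \<bar>cr u v s\<bar> < h s"
    proof (rule eventually_ball_finite)
      show "finite S" using finite_P by (simp add: S_def)
      show "\<forall>s\<in>S. \<forall>\<^sub>F e in at_right 0. aff l (pos s) + e * \<bar>cr u v s\<bar> < h s"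
      proof
        fix s assume "s \<in> S"
        then have lt: "aff l (pos s) + 0 * \<bar>cr u v s\<bar> < h s" using l(4) by (simp add: S_def)
        have "((\<lambda>e. aff l (pos s) + e * \<bar>cr u v s\<bar>) \<longlongrightarrow> aff l (pos s) + 0 * \<bar>cr u v s\<bar>) (at_right 0)"
          by (intro tendsto_intros)
        then show "\<forall>\<^sub>F e in at_right 0. aff l (pos s) + e * \<bar>cr u v s\<bar> < h s"
          using lt order_tendstoD(2) by blast
      qed
    qed
    then have "\<forall>\<^sub>F e in at_right 0. e > 0 \<and> (\<forall>s\<in>S. aff l (pos s) + e * \<bar>cr u v s\<bar> < h s)"
      using eventually_at_right_less by (rule eventually_conj[rotated])
    from eventually_happens[OF this] show ?thesis by auto
  qed
  then obtain e where e: "e > 0" "\<And>s. s \<in> S \<Longrightarrow> aff l (pos s) + e * \<bar>cr u v s\<bar> < h s" by blast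
  obtain l' where l': "\<And>z. aff l' z = aff l z + (- e) * crs (pos u) (pos v) z"
    using aff_add_crs by metis
  have "aff l' (pos s) < h s" if "s \<in> P - {u, v}" for s
  proof (cases "s = w")
    case True then show ?thesis using l' l c e by simp
  next
    case False
    then have "s \<in> S" using that by (auto simp: S_def)
    moreover have "- (e * cr u v s) \<le> e * \<bar>cr u v s\<bar>"
      using e(1) by (metis abs_ge_minus_self minus_mult_right mult_left_mono less_imp_le)
    ultimately show ?thesis using e(2)[of s] l'[of "pos s"] by simp
  qed
  moreover have "aff l' (pos u) = h u" "aff l' (pos v) = h v" using l' l by simp_all
  moreover have "u \<noteq> v" using c by auto
  ultimately show ?thesis using P unfolding edge_def by blast
qed

text \<open>The planes of two triangles left of uv differ by a multiple of \<open>crs u v\<close>,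
  which is positive at both apices. As each plane runs strictly below the apex of the other
  triangle, the multiple would have both signs.\<close>

lemma tri_unique: assumes "tri u v w" "tri u v w'" shows "w = w'"
proof (rule ccontr)
  assume ne: "w \<noteq> w'"
  obtain l where l: "aff l (pos u) = h u" "aff l (pos v) = h v" "aff l (pos w) = h w"
    "\<And>s. s \<in> P - {u, v, w} \<Longrightarrow> aff l (pos s) < h s" and P: "u \<in> P" "v \<in> P" "w \<in> P" and c: "cr u v w > 0"
    using assms(1) unfolding tri_def by blast
  obtain m where m: "aff m (pos u) = h u" "aff m (pos v) = h v" "aff m (pos w') = h w'"
    "\<And>s. s \<in> P - {u, v, w'} \<Longrightarrow> aff m (pos s) < h s" and P': "w' \<in> P" and c': "cr u v w' > 0"
    using assms(2) unfolding tri_def by blast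
  have d: "u \<noteq> v" "u \<noteq> w" "v \<noteq> w" "u \<noteq> w'" "v \<noteq> w'" using c c' by auto
  obtain t where t: "\<And>z. aff (l - m) z = t * crs (pos u) (pos v) z"
    using aff_vanish[of "pos u" "pos v" "l - m"] pos_neq P d l m by (auto simp: aff_diff)
  have "t * cr u v w > 0" using t[of "pos w"] l(3) m(4)[of w] P d ne by (simp add: aff_diff)
  moreover have "t * cr u v w' < 0" using t[of "pos w'"] m(3) l(4)[of w'] P' d ne by (simp add: aff_diff)
  ultimately show False using c c' by (metis mult_less_0_iff not_less_iff_gr_or_eq zero_less_mult_iff)
qed

text \<open>Tilting the supporting plane of an edge to the left until it hits a further point.\<close>

lemma edge_left_tri:
  assumes "edge u v" "x \<in> P" "cr u v x > 0"
  shows "\<exists>w. tri u v w"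
proof -
  obtain l where l: "aff l (pos u) = h u" "aff l (pos v) = h v"
    "\<And>s. s \<in> P - {u, v} \<Longrightarrow> aff l (pos s) < h s" and P: "u \<in> P" "v \<in> P" "u \<noteq> v"
    using assms(1) unfolding edge_def by blast
  define S where "S = {s\<in>P. cr u v s > 0}"
  define q where "q s = (h s - aff l (pos s)) / cr u v s" for s
  have S: "finite S" "S \<noteq> {}" using finite_P assms by (auto simp: S_def)
  have Suv: "s \<noteq> u \<and> s \<noteq> v" if "s \<in> S" for s using that by (auto simp: S_def)
  define \<tau> where "\<tau> = Min (q ` S)"
  have "\<tau> \<in> q ` S" unfolding \<tau>_def using S by (intro Min_in) auto
  then obtain w where w: "w \<in> S" "\<tau> = q w" by auto
  have qpos: "q s > 0" if "s \<in> S" for s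
    using l(3)[of s] that Suv[OF that] by (auto simp: q_def S_def)
  have tau_le: "\<tau> \<le> q s" if "s \<in> S" for s
    unfolding \<tau>_def using S that by (intro Min_le) auto
  obtain l' where l': "\<And>z. aff l' z = aff l z + \<tau> * crs (pos u) (pos v) z"
    using aff_add_crs by metis
  have at3: "aff l' (pos u) = h u" "aff l' (pos v) = h v" "aff l' (pos w) = h w"
    using l' l w by (auto simp: q_def S_def)
  have cw: "cr u v w > 0" "w \<in> P" using w by (auto simp: S_def)
  have "aff l' (pos s) < h s" if s: "s \<in> P - {u, v, w}" for s
  proof (cases "s \<in> S")
    case True
    have "aff l' (pos s) \<noteq> h s"
      using generic[of u v w s l'] P cw s at3 by auto
    moreover have "aff l' (pos s) \<le> h s"
    proof -
      have "\<tau> * cr u v s \<le> q s * cr u v s"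
        using tau_le[OF True] True by (intro mult_right_mono) (auto simp: S_def)
      then show ?thesis using l' True by (simp add: q_def S_def)
    qed
    ultimately show ?thesis by simp
  next
    case False
    then have "cr u v s \<le> 0" using s by (auto simp: S_def)
    then have "\<tau> * cr u v s \<le> 0" using qpos[OF w(1)] w(2)
      by (simp add: mult_le_0_iff)
    then show ?thesis using l'[of "pos s"] l(3)[of s] s by auto
  qed
  then show ?thesis using at3 P cw unfolding tri_def by blast
qed

text \<open>Let m support vb and l the triangle. The difference m - l vanishes at v and is negative
  at a and c, hence negative in the whole open cone; but at b it is positive, since l runs strictly
  below b.\<close>

lemma no_edge_in_cone:
  assumes "tri v a c" "edge v b" "cr v a b > 0" "cr v b c > 0"
  shows False
proof -
  obtain l where l: "aff l (pos v) = h v" "aff l (pos a) = h a" "aff l (pos c) = h c"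
    "\<And>s. s \<in> P - {v, a, c} \<Longrightarrow> aff l (pos s) < h s" and P: "v \<in> P" "a \<in> P" "c \<in> P" and pc: "cr v a c > 0"
    using assms(1) unfolding tri_def by blast
  obtain m where m: "aff m (pos v) = h v" "aff m (pos b) = h b"
    "\<And>s. s \<in> P - {v, b} \<Longrightarrow> aff m (pos s) < h s" and bP: "b \<in> P" "v \<noteq> b"
    using assms(2) unfolding edge_def by blast
  have ne: "b \<noteq> a" "b \<noteq> c" "a \<noteq> v" "c \<noteq> v" using assms(3,4) pc by auto
  have "aff (m - l) (pos b) - aff (m - l) (pos v)
    = (cr v b c / cr v a c) * (aff (m - l) (pos a) - aff (m - l) (pos v))
      + (cr v a b / cr v a c) * (aff (m - l) (pos c) - aff (m - l) (pos v))"
    using pc by (intro aff_cone cone_decomp) simp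
  then have "aff (m - l) (pos b) = (cr v b c / cr v a c) * (aff m (pos a) - h a)
      + (cr v a b / cr v a c) * (aff m (pos c) - h c)"
    using l m by (simp add: aff_diff)
  also have "\<dots> < 0"
    using m(3)[of a] m(3)[of c] P ne assms(3,4) pc by (intro add_neg_neg mult_pos_neg) auto
  finally have "aff (m - l) (pos b) < 0" .
  moreover have "aff (m - l) (pos b) > 0" using m(2) l(4)[of b] bP ne by (simp add: aff_diff)
  ultimately show False by simp
qed

lemma edge_ray_unique:
  assumes "edge v a" "edge v b" "pos b - pos v = of_real r * (pos a - pos v)" "r > 0"
  shows "a = b"
proof (rule ccontr)
  assume ne: "a \<noteq> b"
  obtain l where l: "aff l (pos v) = h v" "aff l (pos a) = h a"
    "\<And>s. s \<in> P - {v, a} \<Longrightarrow> aff l (pos s) < h s" and P: "a \<in> P" "v \<noteq> a"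
    using assms(1) unfolding edge_def by blast
  obtain m where m: "aff m (pos v) = h v" "aff m (pos b) = h b"
    "\<And>s. s \<in> P - {v, b} \<Longrightarrow> aff m (pos s) < h s" and bP: "b \<in> P" "v \<noteq> b"
    using assms(2) unfolding edge_def by blast
  have "aff (m - l) (pos b) - aff (m - l) (pos v)
     = r * (aff (m - l) (pos a) - aff (m - l) (pos v)) + 0 * (aff (m - l) (pos a) - aff (m - l) (pos v))"
    using assms(3) by (intro aff_cone) simp
  then have "aff (m - l) (pos b) = r * aff (m - l) (pos a)" using l m by (simp add: aff_diff)
  moreover have "aff (m - l) (pos b) > 0" using m(2) l(3)[of b] bP ne by (simp add: aff_diff)
  moreover have "aff (m - l) (pos a) < 0" using l(2) m(3)[of a] P ne by (simp add: aff_diff)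
  ultimately show False using assms(4) by (metis mult_pos_neg not_less_iff_gr_or_eq)
qed

section \<open>Darts and the rotation around a triangle\<close>

definition darts :: "('a \<times> 'a) set" where "darts = {(u, v). edge u v}"

definition inner_darts :: "('a \<times> 'a) set" where "inner_darts = {(u, v). \<exists>w. tri u v w}"

definition apex :: "'a \<times> 'a \<Rightarrow> 'a" where "apex \<delta> = (THE w. tri (fst \<delta>) (snd \<delta>) w)"

definition rot :: "'a \<times> 'a \<Rightarrow> 'a \<times> 'a" where "rot \<delta> = (snd \<delta>, apex \<delta>)"

lemma apex_eq: "tri u v w \<Longrightarrow> apex (u, v) = w"
  unfolding apex_def by (auto intro: the_equality tri_unique)

lemma inner_dartsD: "(u, v) \<in> inner_darts \<Longrightarrow> tri u v (apex (u, v))"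
  by (auto simp: inner_darts_def apex_eq)

lemma inner_dartsI: "tri u v w \<Longrightarrow> (u, v) \<in> inner_darts"
  by (auto simp: inner_darts_def)

lemma inner_darts_subset: "inner_darts \<subseteq> darts"
  by (auto simp: inner_darts_def darts_def tri_edge)

lemma darts_subset: "darts \<subseteq> P \<times> P"
  by (auto simp: darts_def edge_def)

lemma finite_darts: "finite darts"
  using darts_subset finite_P finite_subset by blast

lemma finite_inner_darts: "finite inner_darts"
  using inner_darts_subset finite_darts finite_subset by blast

lemma rot_inner: "\<delta> \<in> inner_darts \<Longrightarrow> rot \<delta> \<in> inner_darts"
  by (cases \<delta>) (auto simp: rot_def dest!: inner_dartsD intro: inner_dartsI tri_rotate)

lemma rot_pair: "tri u v w \<Longrightarrow> rot (u, v) = (v, w)"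
  by (simp add: rot_def apex_eq)

lemma rot3: "\<delta> \<in> inner_darts \<Longrightarrow> rot (rot (rot \<delta>)) = \<delta>"
proof (cases \<delta>)
  case (Pair u v)
  assume "\<delta> \<in> inner_darts"
  then have t: "tri u v (apex \<delta>)" using inner_dartsD Pair by simp
  note t' = tri_rotate[OF t] tri_rotate[OF tri_rotate[OF t]]
  show ?thesis using rot_pair[OF t] rot_pair[OF t'(1)] rot_pair[OF t'(2)] Pair by simp
qed

lemma rot_inj: "inj_on rot inner_darts"
  by (metis inj_onI rot3)

lemma sum_rot:
  assumes "S \<subseteq> inner_darts" "\<And>\<delta>. \<delta> \<in> S \<Longrightarrow> rot \<delta> \<in> S"
  shows "(\<Sum>\<delta>\<in>S. f (rot \<delta>)) = (\<Sum>\<delta>\<in>S. f \<delta>)"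
proof -
  have inj: "inj_on rot S" using rot_inj assms(1) inj_on_subset by blast
  have "rot ` S = S"
    using inj assms finite_inner_darts finite_subset
    by (intro card_subset_eq) (auto simp: card_image)
  then show ?thesis using sum.reindex[OF inj, of f] by (simp add: o_def)
qed

end

section \<open>Euler's formula by sweeping a line\<close>

lemma crs_inner:
  "crs v a b * (inner w w) = inner w (a - v) * inner (\<i> * w) (b - v) - inner (\<i> * w) (a - v) * inner w (b - v)"
  by (simp add: crs_eq inner_complex_def) algebra

context regular_triangulation
begin

text \<open>A triangle is an orbit of three inner darts under \<open>rot\<close>, exactly one of
  which starts at the lowest vertex.\<close>

lemma card_bottoms:
  fixes f :: "'a \<Rightarrow> real"
  assumes "inj_on f P"
  shows "real (card inner_darts) =
    3 * real (card {(v, a) \<in> inner_darts. f v < f a \<and> f v < f (apex (v, a))})"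
proof -
  define B where "B \<delta> \<longleftrightarrow> f (fst \<delta>) < f (snd \<delta>) \<and> f (fst \<delta>) < f (apex \<delta>)" for \<delta>
  let ?b = "\<lambda>\<delta>. of_bool (B \<delta>) :: real"
  have one: "?b \<delta> + ?b (rot \<delta>) + ?b (rot (rot \<delta>)) = 1" if "\<delta> \<in> inner_darts" for \<delta>
  proof (cases \<delta>)
    case (Pair u v)
    define w where "w = apex \<delta>"
    have t: "tri u v w" using inner_dartsD Pair that by (simp add: w_def)
    note t' = tri_rotate[OF t] tri_rotate[OF tri_rotate[OF t]]
    have "f u \<noteq> f v" "f v \<noteq> f w" "f u \<noteq> f w"
      using tri_in_P[OF t] tri_distinct[OF t] inj_on_eq_iff[OF assms] by auto
    then show ?thesis
      using Pair rot_pair[OF t] rot_pair[OF t'(1)] apex_eq[OF t] apex_eq[OF t'(1)] apex_eq[OF t'(2)]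
      by (auto simp: B_def)
  qed
  have s: "\<And>\<delta>. \<delta> \<in> inner_darts \<Longrightarrow> rot \<delta> \<in> inner_darts" by (rule rot_inner)
  have "real (card inner_darts) = (\<Sum>\<delta>\<in>inner_darts. ?b \<delta> + ?b (rot \<delta>) + ?b (rot (rot \<delta>)))"
    using one by simp
  also have "\<dots> = 3 * (\<Sum>\<delta>\<in>inner_darts. ?b \<delta>)"
    using sum_rot[OF order_refl s, of ?b] sum_rot[OF order_refl s, of "\<lambda>\<delta>. ?b (rot \<delta>)"]
    by (simp add: sum.distrib)
  also have "(\<Sum>\<delta>\<in>inner_darts. ?b \<delta>) = real (card {\<delta> \<in> inner_darts. B \<delta>})"
    using finite_inner_darts by (simp add: of_bool_def sum.If_cases Int_def)
  also have "{\<delta> \<in> inner_darts. B \<delta>} = {(v, a) \<in> inner_darts. f v < f a \<and> f v < f (apex (v, a))}"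
    by (auto simp: B_def)
  finally show ?thesis .
qed

lemma card_up:
  fixes f :: "'a \<Rightarrow> real"
  assumes "inj_on f P"
  shows "card darts = 2 * card {(v, a) \<in> darts. f v < f a}"
proof -
  let ?U = "{(v, a) \<in> darts. f v < f a}" and ?D = "{(v, a) \<in> darts. f a < f v}"
  have "f v \<noteq> f a" if "edge v a" for v a
    using edge_in_P[OF that] inj_on_eq_iff[OF assms] by auto
  then have "darts = ?U \<union> ?D"
    by (auto simp: darts_def neq_iff)
  moreover have "card ?D = card ?U"
    by (rule bij_betw_same_card[of "\<lambda>(a, b). (b, a)"], rule bij_betwI[where g = "\<lambda>(a, b). (b, a)"])
      (auto simp: darts_def edge_sym)
  moreover have "card (?U \<union> ?D) = card ?U + card ?D"
    using finite_darts by (intro card_Un_disjoint) (auto intro: finite_subset)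
  ultimately show ?thesis by simp
qed

text \<open>Euler's formula: every triangle is counted at its lowest vertex with respect to a generic
  linear function, and a vertex with \<open>m\<close> upward edges is the lowest vertex of \<open>m - 1\<close> triangles.\<close>

lemma euler:
  assumes "P \<noteq> {}"
  obtains \<sigma> :: real where "\<sigma> \<ge> 0"
    "real (card inner_darts) / 3 = 2 * (real (card P) - 1) - (real (card darts) - real (card inner_darts)) - 2 * \<sigma>"
proof -
  obtain w where w: "inj_on (inner w) (pos ` P)"
    using generic_direction[of "pos ` P"] finite_P by auto
  define f where "f a = inner w (pos a)" for a
  have f: "inj_on f P" using comp_inj_on[OF inj_pos w] by (simp add: inj_on_def f_def)
  define up where "up v = {a. edge v a \<and> f v < f a}" for v
  define bot where "bot v = {a. (v, a) \<in> inner_darts \<and> f v < f a \<and> f v < f (apex (v, a))}" for v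
  have fin: "finite (up v)" for v
    by (rule finite_subset[OF _ finite_P]) (auto simp: up_def edge_def)
  have botup: "bot v \<subseteq> up v" for v
    using inner_darts_subset by (auto simp: bot_def up_def darts_def)
  have finb: "finite (bot v)" for v using botup fin finite_subset by blast
  have f_diff: "f a - f v = inner w (pos a - pos v)" for a v by (simp add: f_def inner_diff_right)
  \<comment> \<open>An upward dart opens a triangle lying entirely above v exactly if some other
    upward neighbour lies to its left. The apex cannot lie beyond that neighbour, so it is in the
    cone spanned by two upward directions and lies above v itself.\<close>
  have bot: "bot v = {a \<in> up v. \<exists>b\<in>up v. cr v a b > 0}" for v
  proof (intro equalityI subsetI)
    fix a assume a: "a \<in> bot v"
    then have t: "tri v a (apex (v, a))" by (auto simp: bot_def intro: inner_dartsD)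
    then have "edge v (apex (v, a))" using tri_edge tri_rotate edge_sym by blast
    then have "apex (v, a) \<in> up v" using a by (simp add: bot_def up_def)
    then show "a \<in> {a \<in> up v. \<exists>b\<in>up v. cr v a b > 0}" using a botup tri_pos[OF t] by blast
  next
    fix a assume "a \<in> {a \<in> up v. \<exists>b\<in>up v. cr v a b > 0}"
    then obtain b where a: "edge v a" "f v < f a" and b: "edge v b" "f v < f b" and ab: "cr v a b > 0"
      by (auto simp: up_def)
    obtain c where c: "tri v a c" using edge_left_tri[OF a(1) _ ab] b edge_in_P by blast
    have nc: "cr v b c \<le> 0" using no_edge_in_cone[OF c b(1) ab] by force
    have dec: "f c - f v = cr v c b / cr v a b * (f a - f v) + cr v a c / cr v a b * (f b - f v)"
      unfolding f_diff
      by (subst cone_decomp[of "pos v" "pos a" "pos b" "pos c"])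
        (use ab in \<open>simp_all add: inner_add_right flip: scaleR_conv_of_real of_real_divide\<close>)
    have "cr v c b \<ge> 0" using nc crs_swap'[of "pos v" "pos c" "pos b"] by simp
    then have "f c - f v > 0" unfolding dec
      using ab tri_pos[OF c] a b by (intro add_nonneg_pos mult_nonneg_nonneg mult_pos_pos) auto
    then show "a \<in> bot v" using a c apex_eq[OF c] inner_dartsI[OF c] by (simp add: bot_def)
  qed
  \<comment> \<open>The tangent of the angle from the direction w. On the half plane of upward
    directions it increases counterclockwise and hence sorts \<open>up v\<close> by angle.\<close>
  define key where "key v a = inner (\<i> * w) (pos a - pos v) / inner w (pos a - pos v)" for v a
  have key: "cr v a b > 0 \<longleftrightarrow> key v a < key v b" if "a \<in> up v" "b \<in> up v" for v a b
  proof -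
    have p: "inner w (pos a - pos v) > 0" "inner w (pos b - pos v) > 0"
      using that by (auto simp: up_def f_def inner_diff_right)
    have "w \<noteq> 0" using p by auto
    then have "inner w w > 0" by simp
    then have "cr v a b > 0 \<longleftrightarrow> cr v a b * inner w w > 0" by (metis zero_less_mult_pos2 mult_pos_pos)
    also have "\<dots> \<longleftrightarrow> key v a < key v b"
      unfolding crs_inner[of "pos v" "pos a" "pos b" w] key_def using p by (simp add: field_simps)
    finally show ?thesis .
  qed
  have card_bot: "real (card (bot v)) = real (card (up v)) - of_bool (up v \<noteq> {})" for v
  proof (cases "up v = {}")
    case True then show ?thesis using botup[of v] by simp
  next
    case False
    define M where "M = Max (key v ` up v)"
    have "M \<in> key v ` up v" unfolding M_def using fin False by (intro Max_in) auto
    then obtain m where m: "m \<in> up v" "M = key v m" by auto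
    have le: "key v a \<le> key v m" if "a \<in> up v" for a
      unfolding m(2)[symmetric] M_def using fin that by (intro Max_ge) auto
    have "bot v = up v - {m}"
    proof (intro equalityI subsetI)
      fix a assume "a \<in> bot v"
      then obtain b where "a \<in> up v" "b \<in> up v" "cr v a b > 0" by (auto simp: bot)
      then have "key v a < key v b" "key v b \<le> key v m" using key le by auto
      then show "a \<in> up v - {m}" using \<open>a \<in> up v\<close> by auto
    next
      fix a assume a: "a \<in> up v - {m}"
      have e: "edge v a" "edge v m" and pa: "f v < f a" "f v < f m" using a m by (auto simp: up_def)
      have "key v a \<noteq> key v m"
      proof
        assume eq: "key v a = key v m"
        then have "\<not> cr v a m > 0" "\<not> cr v m a > 0" using key[of a v m] key[of m v a] a m by auto
        then have z: "cr v a m = 0" using crs_swap'[of "pos v" "pos a" "pos m"] by simp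
        have "pos a \<noteq> pos v" using pos_neq edge_in_P[OF e(1)] by metis
        then obtain r where r: "pos m - pos v = of_real r * (pos a - pos v)"
          using ray_decomp[OF _ z] by blast
        then have "f m - f v = r * (f a - f v)"
          unfolding f_diff by (simp add: flip: scaleR_conv_of_real)
        then have "r > 0" using pa by (metis diff_gt_0_iff_gt zero_less_mult_pos2)
        then show False using edge_ray_unique[OF e r] a by simp
      qed
      then have "cr v a m > 0" using key[of a v m] le[of a] a m by force
      then show "a \<in> bot v" using a m by (auto simp: bot)
    qed
    then show ?thesis using m fin False
      by (simp add: card_Diff_singleton of_nat_diff Suc_leI card_gt_0_iff)
  qed
  have "{(v, a) \<in> inner_darts. f v < f a \<and> f v < f (apex (v, a))} = Sigma P bot"
    using inner_darts_subset darts_subset by (auto simp: bot_def)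
  then have c1: "real (card inner_darts) = 3 * (\<Sum>v\<in>P. real (card (bot v)))"
    using card_bottoms[OF f] finite_P finb by simp
  have "{(v, a) \<in> darts. f v < f a} = Sigma P up"
    by (auto simp: up_def darts_def dest: edge_in_P)
  then have c2: "real (card darts) = 2 * (\<Sum>v\<in>P. real (card (up v)))"
    using card_up[OF f] finite_P fin by simp
  \<comment> \<open>Every vertex except the local tops loses one upward neighbour, the last one. The
    global maximum is a local top; \<sigma> counts the surplus ones.\<close>
  define tops where "tops = {v\<in>P. up v = {}}"
  have "f ` P \<noteq> {}" "finite (f ` P)" using assms finite_P by auto
  then obtain v where v: "v \<in> P" "f v = Max (f ` P)" using Max_in by (metis imageE)
  have "up v = {}" using v(2) finite_P by (auto simp: up_def edge_def not_less)
  then have "v \<in> tops" using v by (simp add: tops_def)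
  then have tops: "card tops \<ge> 1" using finite_P by (auto simp: tops_def Suc_le_eq card_gt_0_iff)
  have "(\<Sum>v\<in>P. real (card (bot v))) = (\<Sum>v\<in>P. real (card (up v))) - (\<Sum>v\<in>P. of_bool (up v \<noteq> {}))"
    unfolding card_bot by (simp add: sum_subtractf)
  also have "(\<Sum>v\<in>P. of_bool (up v \<noteq> {}) :: real) = (\<Sum>v\<in>P. 1 - of_bool (up v = {}))"
    by (intro sum.cong) auto
  also have "\<dots> = real (card P) - real (card tops)"
    using finite_P by (simp add: sum_subtractf tops_def of_bool_def sum.If_cases Int_def)
  finally have "real (card inner_darts) / 3 = real (card darts) / 2 - real (card P) + real (card tops)"
    using c1 c2 by simp
  then show thesis using tops by (intro that[of "real (card tops) - 1"]) (auto simp: field_simps)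
qed

end

section \<open>Angular gaps\<close>

text \<open>The gaps telescope: each one leads from a value of f to the next, or from the last value
  to g. The induction removes the largest value, which becomes the new g. Applied around a vertex,
  to the triangles in one corner and to the corners themselves.\<close>

lemma sum_gaps:
  fixes f gap :: "'b \<Rightarrow> real"
  assumes "finite S" "inj_on f S" "S \<noteq> {}" "\<And>a. a \<in> S \<Longrightarrow> 0 \<le> f a \<and> f a < g"
    "b \<in> S" "f b = 0"
    "\<And>a. a \<in> S \<Longrightarrow> gap a > 0 \<and> (f a + gap a = g \<or> f a + gap a \<in> f ` S)"
    "\<And>a x. a \<in> S \<Longrightarrow> x \<in> S \<Longrightarrow> f a < f x \<Longrightarrow> f a + gap a \<le> f x"
  shows "sum gap S = g"
  using assms
proof (induction "card S" arbitrary: S g rule: less_induct)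
  case less
  have fS: "finite (f ` S)" "f ` S \<noteq> {}" using less.prems by auto
  obtain m where m: "m \<in> S" "f m = Max (f ` S)" using Max_in[OF fS] by (metis imageE)
  have mx: "f a \<le> f m" if "a \<in> S" for a using that fS m by simp
  have gm: "f m + gap m = g"
    using less.prems(7)[OF m(1)] mx by (metis imageE less_add_same_cancel1 not_le)
  show ?case
  proof (cases "S = {m}")
    case True then show ?thesis using gm less.prems(5,6) by auto
  next
    case False
    have bm: "b \<noteq> m"
    proof
      assume "b = m"
      then have "f a = 0" if "a \<in> S" for a using mx[OF that] less.prems(4)[OF that] less.prems(6) by auto
      then have "a = m" if "a \<in> S" for a
        using that m(1) inj_on_eq_iff[OF less.prems(2)] by metis
      then show False using False m(1) by blast
    qed
    have lt: "f a < f m" if "a \<in> S - {m}" for a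
      using mx[of a] that m(1) inj_on_eq_iff[OF less.prems(2), of a m] by auto
    have "sum gap (S - {m}) = f m"
    proof (rule less.hyps)
      show "card (S - {m}) < card S" using less.prems(1) m(1) by (rule card_Diff1_less)
      show "inj_on f (S - {m})" using less.prems(2) by (rule inj_on_diff)
      show "S - {m} \<noteq> {}" "b \<in> S - {m}" using less.prems(5) bm by auto
      show "gap a > 0 \<and> (f a + gap a = f m \<or> f a + gap a \<in> f ` (S - {m}))" if a: "a \<in> S - {m}" for a
      proof -
        have "f a + gap a \<le> f m" using less.prems(8)[of a m] lt[OF a] a m(1) by simp
        moreover have "f m < g" using less.prems(4) m(1) by simp
        ultimately show ?thesis using less.prems(7)[of a] a by auto
      qed
    qed (use less.prems lt in auto)
    then show ?thesis using gm m(1) less.prems(1) by (simp add: sum.remove[of S m])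
  qed
qed

section \<open>Generic perturbation of the heights\<close>

text \<open>Lagrange interpolation with the three barycentric functions of the triangle.\<close>

lemma exists_aff:
  assumes "crs u v w \<noteq> 0"
  shows "\<exists>l. aff l u = x \<and> aff l v = y \<and> aff l w = z"
proof -
  have "aff (0, 0) c = 0" for c by (simp add: aff_def)
  then obtain l1 where l1: "\<And>c. aff l1 c = z / crs u v w * crs u v c"
    using aff_add_crs[of "(0, 0)" "z / crs u v w" u v] by auto
  obtain l2 where l2: "\<And>c. aff l2 c = aff l1 c + x / crs u v w * crs v w c"
    using aff_add_crs by metis
  obtain l3 where l3: "\<And>c. aff l3 c = aff l2 c + y / crs u v w * crs w u c"
    using aff_add_crs by metis
  have "aff l3 u = x \<and> aff l3 v = y \<and> aff l3 w = z"
    using assms l1 l2 l3 crs_rotate[of v w u] crs_rotate[of w u v] by (simp add: crs_rotate)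
  then show ?thesis by blast
qed

text \<open>Signed height of the fourth point above the plane through the first three, scaled by
  the area of their triangle.\<close>

definition lift :: "('a \<Rightarrow> complex) \<Rightarrow> ('a \<Rightarrow> real) \<Rightarrow> 'a \<Rightarrow> 'a \<Rightarrow> 'a \<Rightarrow> 'a \<Rightarrow> real" where
  "lift pos h p q r s = h s * crs (pos p) (pos q) (pos r) - (h p * crs (pos s) (pos q) (pos r)
     + h q * crs (pos p) (pos s) (pos r) + h r * crs (pos p) (pos q) (pos s))"

lemma lift_aff:
  assumes "aff l (pos p) = h p" "aff l (pos q) = h q" "aff l (pos r) = h r"
  shows "lift pos h p q r s = (h s - aff l (pos s)) * crs (pos p) (pos q) (pos r)"
  unfolding lift_def assms[symmetric] by (simp add: aff_def inner_complex_def crs_eq algebra_simps)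

lemma eventually_at_right_not_root:
  assumes "(p :: real poly) \<noteq> 0"
  shows "\<forall>\<^sub>F t in at_right 0. poly p t \<noteq> 0"
proof -
  have "\<forall>\<^sub>F t in at_right 0. \<forall>x\<in>{x. poly p x = 0}. t \<noteq> x"
  proof (rule eventually_ball_finite)
    show "finite {x. poly p x = 0}" using assms by (rule poly_roots_finite)
    show "\<forall>x\<in>{x. poly p x = 0}. \<forall>\<^sub>F t in at_right 0. t \<noteq> x"
    proof
      fix x :: real
      show "\<forall>\<^sub>F t in at_right 0. t \<noteq> x"
      proof (cases "x > 0")
        case True
        then have "\<forall>\<^sub>F t in at_right 0. t < x" by (rule eventually_at_right_real[THEN eventually_mono]) auto
        then show ?thesis by (rule eventually_mono) auto
      next
        case False
          have "\<forall>\<^sub>F t in at_right 0. (0::real) < t" by (rule eventually_at_right_less)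
          then show ?thesis by (rule eventually_mono) (use False in auto)
      qed
    qed
  qed
  then show ?thesis by (rule eventually_mono) auto
qed

text \<open>The heights receive distinct positive powers of t, so every relevant \<open>lift\<close>
  is a nonzero polynomial in t without small positive roots. Strict inequalities are open
  conditions: the supports of the pairs in Q persist, and so would a point strictly below a face of
  the original heights; hence every perturbed triangle still spans a weakly supporting plane of the
  original ones.\<close>

lemma perturbed_heights:
  fixes P :: "'a set" and pos :: "'a \<Rightarrow> complex" and h\<^sub>0 :: "'a \<Rightarrow> real"
  assumes P: "finite P" "inj_on pos P" and Q: "Q \<subseteq> P \<times> P"
    and supp: "\<And>p q. (p, q) \<in> Q \<Longrightarrow> p \<noteq> q \<and> (\<exists>l. aff l (pos p) = h\<^sub>0 p \<and> aff l (pos q) = h\<^sub>0 q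
      \<and> (\<forall>s\<in>P - {p, q}. aff l (pos s) < h\<^sub>0 s))"
  obtains h where "regular_triangulation P pos h"
    "\<And>p q. (p, q) \<in> Q \<Longrightarrow> regular_triangulation.edge P pos h p q"
    "\<And>u v w s. regular_triangulation.tri P pos h u v w \<Longrightarrow> s \<in> P \<Longrightarrow>
       \<exists>l. aff l (pos u) = h\<^sub>0 u \<and> aff l (pos v) = h\<^sub>0 v \<and> aff l (pos w) = h\<^sub>0 w \<and> aff l (pos s) \<le> h\<^sub>0 s"
proof -
  obtain i\<^sub>0 :: "'a \<Rightarrow> nat" where "inj_on i\<^sub>0 P" using P(1) finite_imp_inj_to_nat_seg by blast
  define i where "i a = Suc (i\<^sub>0 a)" for a
  have i: "inj_on i P" "\<And>a. i a > 0" using \<open>inj_on i\<^sub>0 P\<close> by (auto simp: i_def inj_on_def)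
  define h where "h t a = h\<^sub>0 a + t ^ i a" for t :: real and a
  have h_tendsto: "((\<lambda>t. h t a) \<longlongrightarrow> h\<^sub>0 a) (at_right 0)" for a
  proof -
    have "((\<lambda>t. h\<^sub>0 a + t ^ i a) \<longlongrightarrow> h\<^sub>0 a + 0 ^ i a) (at_right 0)" by (intro tendsto_intros)
    then show ?thesis using i(2)[of a] by (simp add: h_def zero_power)
  qed
  define gen where "gen t \<longleftrightarrow> (\<forall>(p, q, r, s) \<in> P \<times> P \<times> P \<times> P.
     crs (pos p) (pos q) (pos r) \<noteq> 0 \<longrightarrow> s \<notin> {p, q, r} \<longrightarrow> lift pos (h t) p q r s \<noteq> 0)" for t
  have ev1: "\<forall>\<^sub>F t in at_right 0. gen t"
    unfolding gen_def
  proof (rule eventually_ball_finite)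
    show "finite (P \<times> P \<times> P \<times> P)" using P(1) by auto
    have "\<forall>\<^sub>F t in at_right 0. lift pos (h t) p q r s \<noteq> 0"
      if in_P: "p \<in> P" "q \<in> P" "r \<in> P" "s \<in> P" and c: "crs (pos p) (pos q) (pos r) \<noteq> 0" and s: "s \<notin> {p, q, r}"
      for p q r s
    proof -
      define f where "f = [:lift pos h\<^sub>0 p q r s:] + monom (crs (pos p) (pos q) (pos r)) (i s)
         - monom (crs (pos s) (pos q) (pos r)) (i p) - monom (crs (pos p) (pos s) (pos r)) (i q)
         - monom (crs (pos p) (pos q) (pos s)) (i r)"
      \<comment> \<open>The exponent of s occurs in one monomial only, and being positive it does
        not meet the constant term.\<close>
      have "i s \<noteq> i p" "i s \<noteq> i q" "i s \<noteq> i r" using in_P s inj_on_eq_iff[OF i(1)] by auto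
      then have "coeff f (i s) = crs (pos p) (pos q) (pos r)"
        using i(2)[of s] by (simp add: f_def coeff_pCons split: nat.split)
      then have "f \<noteq> 0" using c by auto
      moreover have "poly f t = lift pos (h t) p q r s" for t
        by (simp add: f_def poly_monom lift_def h_def algebra_simps)
      ultimately show ?thesis using eventually_at_right_not_root[of f] by simp
    qed
    then show "\<forall>z\<in>P \<times> P \<times> P \<times> P. \<forall>\<^sub>F t in at_right 0. case z of (p, q, r, s) \<Rightarrow>
       crs (pos p) (pos q) (pos r) \<noteq> 0 \<longrightarrow> s \<notin> {p, q, r} \<longrightarrow> lift pos (h t) p q r s \<noteq> 0"
      by (auto split: prod.splits intro: eventually_mono[OF always_eventually]) 
  qed
  define weak where "weak t \<longleftrightarrow> (\<forall>(p, q, r, s) \<in> P \<times> P \<times> P \<times> P.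
     lift pos h\<^sub>0 p q r s < 0 \<longrightarrow> lift pos (h t) p q r s < 0)" for t
  have weakD: "lift pos (h t) p q r s < 0"
    if "weak t" "p \<in> P" "q \<in> P" "r \<in> P" "s \<in> P" "lift pos h\<^sub>0 p q r s < 0" for t p q r s
    using that unfolding weak_def by blast
  have ev2: "\<forall>\<^sub>F t in at_right 0. weak t"
    unfolding weak_def
  proof (rule eventually_ball_finite)
    show "finite (P \<times> P \<times> P \<times> P)" using P(1) by auto
    have "\<forall>\<^sub>F t in at_right 0. lift pos (h t) p q r s < 0" if "lift pos h\<^sub>0 p q r s < 0" for p q r s
    proof -
      have "((\<lambda>t. lift pos (h t) p q r s) \<longlongrightarrow> lift pos h\<^sub>0 p q r s) (at_right 0)"
        unfolding lift_def by (intro tendsto_intros h_tendsto)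
      then show ?thesis using that order_tendstoD(2) by blast
    qed
    then show "\<forall>z\<in>P \<times> P \<times> P \<times> P. \<forall>\<^sub>F t in at_right 0. case z of (p, q, r, s) \<Rightarrow>
       lift pos h\<^sub>0 p q r s < 0 \<longrightarrow> lift pos (h t) p q r s < 0"
      by (auto split: prod.splits)
  qed
  define supp' where "supp' t \<longleftrightarrow> (\<forall>(p, q) \<in> Q. \<exists>l. aff l (pos p) = h t p \<and> aff l (pos q) = h t q
      \<and> (\<forall>s\<in>P - {p, q}. aff l (pos s) < h t s))" for t
  have ev3: "\<forall>\<^sub>F t in at_right 0. supp' t"
    unfolding supp'_def
  proof (rule eventually_ball_finite)
    show "finite Q" using P(1) Q finite_subset by blast
    have "\<forall>\<^sub>F t in at_right 0. \<exists>l. aff l (pos p) = h t p \<and> aff l (pos q) = h t q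
      \<and> (\<forall>s\<in>P - {p, q}. aff l (pos s) < h t s)" if pq: "(p, q) \<in> Q" for p q
    proof -
      obtain l where l: "aff l (pos p) = h\<^sub>0 p" "aff l (pos q) = h\<^sub>0 q"
        "\<And>s. s \<in> P - {p, q} \<Longrightarrow> aff l (pos s) < h\<^sub>0 s" and ne: "p \<noteq> q" using supp[OF pq] by blast
      have ne': "pos p \<noteq> pos q" using ne pq Q inj_on_eq_iff[OF P(2)] by blast
      define e where "e = pos q - pos p"
      have e: "inner e e > 0" using ne' by (simp add: e_def)
      \<comment> \<open>\<open>m t\<close> is the affine function, constant perpendicular to the
        segment, that takes the perturbations at p and q as values. It tends to 0 with t, so adding
        it to the old support leaves the other points strictly above.\<close>
      define k where "k t = (t ^ i q - t ^ i p) / inner e e" for t :: real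
      define m where "m t = (t ^ i p - k t * inner e (pos p), k t *\<^sub>R e)" for t :: real
      have am: "aff (m t) z = t ^ i p + k t * inner e (z - pos p)" for t z
        by (simp add: m_def aff_def inner_diff_right algebra_simps)
      have "\<forall>\<^sub>F t in at_right 0. \<forall>s\<in>P - {p, q}. aff l (pos s) + aff (m t) (pos s) < h t s"
      proof (rule eventually_ball_finite)
        show "finite (P - {p, q})" using P(1) by simp
        show "\<forall>s\<in>P - {p, q}. \<forall>\<^sub>F t in at_right 0. aff l (pos s) + aff (m t) (pos s) < h t s"
        proof
          fix s assume s: "s \<in> P - {p, q}"
          have "((\<lambda>t. h t s - (aff l (pos s) + aff (m t) (pos s))) \<longlongrightarrow>
             h\<^sub>0 s - (aff l (pos s) + (0 ^ i p + (0 ^ i q - 0 ^ i p) / inner e e * inner e (pos s - pos p)))) (at_right 0)"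
            unfolding am k_def using e by (intro tendsto_intros h_tendsto) auto
          from order_tendstoD(1)[OF this, of 0] have "\<forall>\<^sub>F t in at_right 0. 0 < h t s - (aff l (pos s) + aff (m t) (pos s))"
            using l(3)[OF s] i(2)[of p] i(2)[of q] by (simp add: zero_power)
          then show "\<forall>\<^sub>F t in at_right 0. aff l (pos s) + aff (m t) (pos s) < h t s"
            by (simp only: diff_gt_0_iff_gt)
        qed
      qed
      then show ?thesis
      proof (rule eventually_mono)
        fix t assume *: "\<forall>s\<in>P - {p, q}. aff l (pos s) + aff (m t) (pos s) < h t s"
        have "aff (l + m t) z = aff l z + aff (m t) z" for z by (simp add: aff_def inner_add_left)
        moreover have "aff (m t) (pos p) = t ^ i p" "aff (m t) (pos q) = t ^ i q"
          unfolding am k_def using e by (simp_all add: e_def)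
        ultimately show "\<exists>l. aff l (pos p) = h t p \<and> aff l (pos q) = h t q
            \<and> (\<forall>s\<in>P - {p, q}. aff l (pos s) < h t s)"
          using l * by (intro exI[of _ "l + m t"]) (auto simp: h_def)
      qed
    qed
    then show "\<forall>z\<in>Q. \<forall>\<^sub>F t in at_right 0. case z of (p, q) \<Rightarrow> \<exists>l. aff l (pos p) = h t p \<and> aff l (pos q) = h t q
      \<and> (\<forall>s\<in>P - {p, q}. aff l (pos s) < h t s)" by auto
  qed
  have "\<forall>\<^sub>F t :: real in at_right 0. gen t \<and> weak t \<and> supp' t"
    using ev1 ev2 ev3 by eventually_elim auto
  from eventually_happens[OF this] obtain t where t: "gen t" "weak t" "supp' t" by auto
  interpret regular_triangulation P pos "h t"
  proof
    fix u v w s l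
    assume *: "u \<in> P" "v \<in> P" "w \<in> P" "s \<in> P" "crs (pos u) (pos v) (pos w) \<noteq> 0"
      "\<forall>x\<in>{u, v, w, s}. aff l (pos x) = h t x"
    then have "lift pos (h t) u v w s = 0" by (subst lift_aff[of l]) auto
    then show "s \<in> {u, v, w}" using t(1) * unfolding gen_def by fastforce
  qed (use P in auto)
  show thesis
  proof (rule that[of "h t"])
    show "regular_triangulation P pos (h t)" by (rule regular_triangulation_axioms)
    show "edge p q" if "(p, q) \<in> Q" for p q
    proof -
      have "p \<in> P" "q \<in> P" "p \<noteq> q" using that supp[OF that] Q by auto
      moreover have "\<exists>l. aff l (pos p) = h t p \<and> aff l (pos q) = h t q
          \<and> (\<forall>s\<in>P - {p, q}. aff l (pos s) < h t s)"
        using t(3) that unfolding supp'_def by blast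
      ultimately show ?thesis unfolding edge_def by blast
    qed
    show "\<exists>l. aff l (pos u) = h\<^sub>0 u \<and> aff l (pos v) = h\<^sub>0 v \<and> aff l (pos w) = h\<^sub>0 w \<and> aff l (pos s) \<le> h\<^sub>0 s"
      if T: "tri u v w" "s \<in> P" for u v w s
    proof -
      have c: "cr u v w > 0" using T by (rule_tac tri_pos)
      obtain m where m: "aff m (pos u) = h t u" "aff m (pos v) = h t v" "aff m (pos w) = h t w"
        "\<And>s. s \<in> P - {u, v, w} \<Longrightarrow> aff m (pos s) < h t s" using T unfolding tri_def by blast
      have "aff m (pos s) \<le> h t s" using m T(2) by (cases "s \<in> {u, v, w}") (auto simp: less_imp_le)
      then have "lift pos (h t) u v w s \<ge> 0"
        using c by (simp add: lift_aff[OF m(1-3)])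
      then have nn: "lift pos h\<^sub>0 u v w s \<ge> 0"
        using weakD[OF t(2)] T(2) tri_in_P[OF T(1)] by (meson not_le)
      obtain l where l: "aff l (pos u) = h\<^sub>0 u" "aff l (pos v) = h\<^sub>0 v" "aff l (pos w) = h\<^sub>0 w"
        using exists_aff[of "pos u" "pos v" "pos w"] c by fastforce
      then have "(h\<^sub>0 s - aff l (pos s)) * cr u v w \<ge> 0" using nn lift_aff[OF l] by metis
      then have "aff l (pos s) \<le> h\<^sub>0 s" using c by (simp add: zero_le_mult_iff)
      then show ?thesis using l by blast
    qed
  qed
qed

section \<open>The hyperbolic plane\<close>

definition ch :: "complex \<Rightarrow> complex \<Rightarrow> real" where
  "ch z w = 1 + 2 * (cmod (z - w))\<^sup>2 / ((1 - (cmod z)\<^sup>2) * (1 - (cmod w)\<^sup>2))"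

definition klein :: "complex \<Rightarrow> complex" where
  "klein z = (2 / (1 + (cmod z)\<^sup>2)) *\<^sub>R z"

text \<open>The point over \<open>klein z\<close> at this height lies on the lower unit hemisphere,
  and stereographic projection from the opposite pole returns z. Planes cut the hemisphere in
  circles, so supporting planes of the lower hull are empty circles of the Poincare disc; horocycles
  and equidistant curves are included as circles that touch or cross the unit circle.\<close>

definition klein_height :: "complex \<Rightarrow> real" where
  "klein_height z = - (1 - (cmod z)\<^sup>2) / (1 + (cmod z)\<^sup>2)"

definition mob :: "complex \<Rightarrow> complex \<Rightarrow> complex" where
  "mob a z = (z - a) / (1 - cnj a * z)"

lemma in_disc_iff: "z \<in> hyp_plane \<longleftrightarrow> cmod z < 1"
  by (simp add: hyp_plane_def)

lemma disc_sq: "cmod z < 1 \<Longrightarrow> 1 - (cmod z)\<^sup>2 > 0"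
  by (simp add: power_less_one_iff abs_square_less_1)

lemma ch_ge_1: "cmod z < 1 \<Longrightarrow> cmod w < 1 \<Longrightarrow> ch z w \<ge> 1"
  using disc_sq[of z] disc_sq[of w] by (simp add: ch_def)

lemma ch_gt_1: "cmod z < 1 \<Longrightarrow> cmod w < 1 \<Longrightarrow> z \<noteq> w \<Longrightarrow> ch z w > 1"
  using disc_sq[of z] disc_sq[of w] by (simp add: ch_def)

lemma ch_sym: "ch z w = ch w z"
  by (simp add: ch_def norm_minus_commute mult.commute)

lemma cosh_hyp_dist: "cmod z < 1 \<Longrightarrow> cmod w < 1 \<Longrightarrow> cosh (hyp_dist z w) = ch z w"
  using ch_ge_1[of z w] by (simp add: hyp_dist_def ch_def)

lemma hyp_dist_nonneg: "cmod z < 1 \<Longrightarrow> cmod w < 1 \<Longrightarrow> hyp_dist z w \<ge> 0"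
  using ch_ge_1[of z w] by (simp add: hyp_dist_def ch_def)

lemma hyp_dist_ge_iff:
  assumes "cmod z < 1" "cmod w < 1" "d \<ge> 0"
  shows "d \<le> hyp_dist z w \<longleftrightarrow> cosh d \<le> ch z w"
  using cosh_real_nonneg_le_iff[of d "hyp_dist z w"] hyp_dist_nonneg[of z w] assms by (simp add: cosh_hyp_dist)

lemma hyp_dist_eq_iff:
  assumes "cmod z < 1" "cmod w < 1" "d \<ge> 0"
  shows "hyp_dist z w = d \<longleftrightarrow> ch z w = cosh d"
proof -
  have h: "hyp_dist z w \<ge> 0" "ch z w = cosh (hyp_dist z w)"
    using assms hyp_dist_nonneg by (simp_all add: cosh_hyp_dist)
  show ?thesis
    unfolding h(2) using cosh_real_nonneg_le_iff[OF assms(3) h(1)] cosh_real_nonneg_le_iff[OF h(1) assms(3)]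
    by (metis order_antisym order_refl)
qed

lemma one_minus_cnj_mult_pos:
  assumes "cmod z < 1" "cmod w < 1"
  shows "Re (1 - cnj z * w) > 0"
proof -
  have "Re (cnj z * w) \<le> cmod (cnj z * w)" by (rule complex_Re_le_cmod)
  also have "\<dots> < 1" using assms mult_strict_mono[of "cmod z" 1 "cmod w" 1]
    by (cases "w = 0") (auto simp: norm_mult)
  finally show ?thesis by simp
qed

lemma one_minus_cnj_mult_neq: "cmod z < 1 \<Longrightarrow> cmod w < 1 \<Longrightarrow> 1 - cnj z * w \<noteq> 0"
  using one_minus_cnj_mult_pos[of z w] by (metis less_irrefl zero_complex.sel(1))

text \<open>The vector (1, \<open>klein z\<close>) divided by \<open>- klein_height z\<close> is the
  point of the hyperboloid over z, and \<open>ch\<close> is the Lorentz product of two such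
  points.\<close>

lemma klein_ch:
  assumes "cmod z < 1" "cmod w < 1"
  shows "ch z w * klein_height z * klein_height w = 1 - inner (klein z) (klein w)"
proof -
  define a b where "a = (cmod z)\<^sup>2" and "b = (cmod w)\<^sup>2"
  have ab: "1 - a > 0" "1 - b > 0" "1 + a > 0" "1 + b > 0"
    using disc_sq assms by (auto simp: a_def b_def add_pos_nonneg)
  have n: "(cmod (z - w))\<^sup>2 = a + b - 2 * inner z w"
    by (simp add: a_def b_def power2_norm_eq_inner inner_diff_left inner_diff_right inner_commute)
  have "(1 + a) * (1 + b) - 4 * inner z w = (1 - a) * (1 - b) + 2 * (cmod (z - w))\<^sup>2"
    unfolding n by (simp add: algebra_simps)
  then have "1 - 4 * inner z w / ((1 + a) * (1 + b))
      = ((1 - a) * (1 - b) + 2 * (cmod (z - w))\<^sup>2) / ((1 + a) * (1 + b))"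
    using ab by (simp add: divide_simps)
  moreover have *: "(1 + 2 * X / (A * B)) * (- A / a') * (- B / b') = (A * B + 2 * X) / (a' * b')"
    if "A \<noteq> 0" "B \<noteq> 0" "a' \<noteq> 0" "b' \<noteq> 0" for A B X a' b' :: real
    using that by (simp add: field_simps)
  moreover have "ch z w * klein_height z * klein_height w
     = ((1 - a) * (1 - b) + 2 * (cmod (z - w))\<^sup>2) / ((1 + a) * (1 + b))"
    unfolding ch_def klein_height_def a_def[symmetric] b_def[symmetric]
    by (rule *) (use ab in auto)
  ultimately show ?thesis
    unfolding klein_def a_def[symmetric] b_def[symmetric] by (simp add: mult.commute)
qed

lemma klein_height_neg: "cmod z < 1 \<Longrightarrow> klein_height z < 0"
  using disc_sq[of z] by (simp add: klein_height_def field_simps add_pos_nonneg)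

lemma inj_on_klein: "inj_on klein (ball 0 1)"
proof (rule inj_onI)
  fix z w assume zw: "z \<in> ball 0 1" "w \<in> ball 0 1" "klein z = klein w"
  then have d: "cmod z < 1" "cmod w < 1" by auto
  have c1: "ch z z = 1" "ch w w = 1" by (simp_all add: ch_def)
  have e1: "ch z w * klein_height z * klein_height w = (klein_height z)\<^sup>2"
    using klein_ch[of z w] klein_ch[of z z] d zw(3) c1 by (simp add: power2_eq_square)
  have "ch z w * klein_height z * klein_height w = (klein_height w)\<^sup>2"
    using klein_ch[of z w] klein_ch[of w w] d zw(3) c1 by (simp add: power2_eq_square)
  then have "(- klein_height z)\<^sup>2 = (- klein_height w)\<^sup>2" using e1 by simp
  then have "klein_height z = klein_height w"
    using klein_height_neg[OF d(1)] klein_height_neg[OF d(2)] power2_eq_imp_eq[of "- klein_height z" "- klein_height w"] by simp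
  then have "ch z w * (klein_height z * klein_height z) = 1 * (klein_height z * klein_height z)"
    using e1 by (simp add: power2_eq_square)
  then have "ch z w = 1" using klein_height_neg[OF d(1)] by simp
  then show "z = w" using ch_gt_1 d by fastforce
qed

lemma crs_klein:
  "crs (klein p) (klein q) (klein r) * ((1 + (cmod p)\<^sup>2) * (1 + (cmod q)\<^sup>2) * (1 + (cmod r)\<^sup>2))
   = 4 * ((1 + (cmod p)\<^sup>2) * Im (cnj q * r) + (1 + (cmod q)\<^sup>2) * Im (cnj r * p) + (1 + (cmod r)\<^sup>2) * Im (cnj p * q))"
proof -
  define a b c where "a = 1 + (cmod p)\<^sup>2" and "b = 1 + (cmod q)\<^sup>2" and "c = 1 + (cmod r)\<^sup>2"
  have "a > 0" "b > 0" "c > 0" by (auto simp: a_def b_def c_def add_pos_nonneg)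
  then show ?thesis
    unfolding klein_def crs_eq a_def[symmetric] b_def[symmetric] c_def[symmetric]
    by (simp add: field_simps)
qed

lemma mob_orientation_poly:
  "Im (cnj (q - p) * (r - p) * (1 - cnj p * q) * (1 - p * cnj r)) =
   (1 - (cmod p)\<^sup>2) * ((1 + (cmod p)\<^sup>2) * Im (cnj q * r) + (1 + (cmod q)\<^sup>2) * Im (cnj r * p) + (1 + (cmod r)\<^sup>2) * Im (cnj p * q))"
  unfolding cmod_power2 by (simp add: power2_eq_square algebra_simps)

lemma mob_divide:
  assumes "cmod p < 1" "cmod q < 1" "cmod r < 1" "p \<noteq> q"
  shows "mob p r / mob p q = of_real (1 / ((cmod (q - p))\<^sup>2 * (cmod (1 - cnj p * r))\<^sup>2)) *
    (cnj (q - p) * (r - p) * (1 - cnj p * q) * (1 - p * cnj r))"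
proof -
  have n: "q - p \<noteq> 0" "1 - cnj p * r \<noteq> 0" "1 - cnj p * q \<noteq> 0" "1 - p * cnj r \<noteq> 0"
    using assms one_minus_cnj_mult_neq[of p r] one_minus_cnj_mult_neq[of p q] one_minus_cnj_mult_neq[of r p]
    by (auto simp: mult.commute)
  have c: "of_real ((cmod (q - p))\<^sup>2) = (q - p) * cnj (q - p)"
    "of_real ((cmod (1 - cnj p * r))\<^sup>2) = (1 - cnj p * r) * (1 - p * cnj r)"
    by (simp_all add: complex_norm_square flip: of_real_power)
  have n': "cnj (q - p) \<noteq> 0" using n(1) by (metis complex_cnj_zero_iff)
  have "E / B / (A / D) = 1 / (A * A' * (B * B')) * (A' * E * D * B')"
    if "A \<noteq> 0" "A' \<noteq> 0" "B \<noteq> 0" "B' \<noteq> 0" "D \<noteq> 0" for A A' B B' D E :: complex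
    using that by (simp add: field_simps)
  from this[OF n(1) n' n(2) n(4) n(3)] show ?thesis
    unfolding of_real_divide of_real_mult c mob_def of_real_1 by simp
qed

lemma Im_of_real_mult: "Im (of_real x * z) = x * Im z"
  by simp

text \<open>The hull lives in the Klein model, angles in the conformal disc. Both orientations are
  the sign of the same polynomial C, up to positive factors.\<close>

lemma mob_orientation:
  assumes "cmod p < 1" "cmod q < 1" "cmod r < 1" "p \<noteq> q"
  shows "Im (mob p r / mob p q) > 0 \<longleftrightarrow> crs (klein p) (klein q) (klein r) > 0"
proof -
  define C where "C = (1 + (cmod p)\<^sup>2) * Im (cnj q * r) + (1 + (cmod q)\<^sup>2) * Im (cnj r * p) + (1 + (cmod r)\<^sup>2) * Im (cnj p * q)"
  have "(1 + (cmod p)\<^sup>2) * (1 + (cmod q)\<^sup>2) * (1 + (cmod r)\<^sup>2) > 0" by (simp add: add_pos_nonneg)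
  then have "crs (klein p) (klein q) (klein r) > 0 \<longleftrightarrow>
     crs (klein p) (klein q) (klein r) * ((1 + (cmod p)\<^sup>2) * (1 + (cmod q)\<^sup>2) * (1 + (cmod r)\<^sup>2)) > 0"
    by (metis zero_less_mult_pos2 mult_pos_pos)
  also have "\<dots> \<longleftrightarrow> C > 0" unfolding crs_klein C_def[symmetric] by simp
  finally have 1: "crs (klein p) (klein q) (klein r) > 0 \<longleftrightarrow> C > 0" .
  have pos: "1 / ((cmod (q - p))\<^sup>2 * (cmod (1 - cnj p * r))\<^sup>2) > 0"
    using assms one_minus_cnj_mult_neq[of p r] by simp
  have "Im (mob p r / mob p q) = 1 / ((cmod (q - p))\<^sup>2 * (cmod (1 - cnj p * r))\<^sup>2) * ((1 - (cmod p)\<^sup>2) * C)"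
    unfolding mob_divide[OF assms] C_def mob_orientation_poly[symmetric] by (rule Im_of_real_mult)
  then have "Im (mob p r / mob p q) = 1 / ((cmod (q - p))\<^sup>2 * (cmod (1 - cnj p * r))\<^sup>2) * (1 - (cmod p)\<^sup>2) * C"
    by (simp only: mult.assoc)
  moreover have "1 / ((cmod (q - p))\<^sup>2 * (cmod (1 - cnj p * r))\<^sup>2) * (1 - (cmod p)\<^sup>2) > 0"
    using pos disc_sq[OF assms(1)] by (rule mult_pos_pos)
  ultimately have "Im (mob p r / mob p q) > 0 \<longleftrightarrow> C > 0"
    by (metis mult_pos_pos zero_less_mult_pos)
  then show ?thesis using 1 by simp
qed

section \<open>Trigonometry of hyperbolic triangles\<close>

lemma cosh_gt_1: "(d::real) > 0 \<Longrightarrow> cosh d > 1"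
  using cosh_real_strict_mono[of 0 d] by simp

lemma cosh_half_sq: "(cosh (d / 2))\<^sup>2 = (1 + cosh d) / 2" for d :: real
  using cosh_double_cosh[of "d / 2"] by simp

lemma cos_alpha_cosh: "d > 0 \<Longrightarrow> cos (alpha d) = cosh d / (1 + cosh d)"
  using cosh_gt_1[of d] by (simp add: cos_alpha tanh_ratio cosh_half_sq field_simps)

lemma alpha_bounds:
  assumes "d > 0" shows "0 < alpha d" "alpha d < pi / 3"
proof -
  note x = half_cosh_inverse_bounds[OF assms]
  show "0 < alpha d" unfolding alpha_arcsin[OF assms] using x arcsin_less_arcsin[of 0 "1 / (2 * cosh (d / 2))"] by simp
  have "arcsin (1 / 2) = pi / 6" by (intro arcsin_unique) (auto simp: sin_30)
  moreover have "arcsin (1 / (2 * cosh (d / 2))) < arcsin (1 / 2)"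
    by (intro arcsin_less_arcsin) (use x in linarith)+
  ultimately show "alpha d < pi / 3" unfolding alpha_arcsin[OF assms] by simp
qed

lemma alpha_half_bounds: "d > 0 \<Longrightarrow> 0 < alpha d / 2 \<and> alpha d / 2 < pi / 6"
  using alpha_bounds[of d] by simp

lemma cosh_half_sq_alpha:
  assumes "d > 0" shows "(cosh (d / 2))\<^sup>2 = 1 / (4 * (sin (alpha d / 2))\<^sup>2)"
  unfolding sin_half_alpha[OF assms] by (simp add: power_divide power_mult_distrib)

text \<open>The altitude cuts the equilateral triangle into right triangles with hypotenuse d and
  acute angles \<alpha> / 2 and \<alpha>; the product of their tangents is 1 / cosh of the
  hypotenuse.\<close>

lemma tan_alpha_half:
  assumes "d > 0" shows "tan (alpha d / 2) * tan (alpha d) = 1 / cosh d"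
proof -
  have c: "cosh d > 1" using cosh_gt_1 assms by simp
  have b: "0 < alpha d / 2" "alpha d / 2 < pi / 6" using alpha_half_bounds assms by auto
  have cp: "cos (alpha d / 2) > 0" using b by (intro cos_gt_zero_pi) auto
  have "cos (alpha d) = 1 - 2 * (sin (alpha d / 2))\<^sup>2" using cos_double_sin[of "alpha d / 2"] by simp
  then have s2: "2 * (sin (alpha d / 2))\<^sup>2 = 1 / (1 + cosh d)" using c cos_alpha_cosh[OF assms] by (simp add: field_simps)
  have "sin (alpha d) = 2 * sin (alpha d / 2) * cos (alpha d / 2)" using sin_double[of "alpha d / 2"] by simp
  then have "tan (alpha d / 2) * tan (alpha d) = 2 * (sin (alpha d / 2))\<^sup>2 / cos (alpha d)"
    using cp by (simp add: tan_def power2_eq_square)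
  also have "\<dots> = 1 / cosh d" unfolding s2 cos_alpha_cosh[OF assms] using c by simp
  finally show ?thesis .
qed

lemma sin_less_sin:
  assumes "0 < x" "x < y" "x + y < pi" shows "sin x < sin (y::real)"
proof (cases "y \<le> pi / 2")
  case True then show ?thesis using assms by (intro sin_monotone_2pi) auto
next
  case False
  then have "sin x < sin (pi - y)" using assms by (intro sin_monotone_2pi) auto
  then show ?thesis by simp
qed

text \<open>In the extremal case \<open>Y = (S - Z) / 2\<close> the left-hand side is
  \<open>cos Z / (cos Z - cos S)\<close>, which is largest at \<open>Z = S / 3\<close>.\<close>

lemma three_angle_bound_aux:
  fixes S Y Z :: real
  assumes S: "0 < S" "S < pi / 2" and Z: "0 \<le> Z" "Z \<le> Y" and YZ: "2 * Y + Z \<le> S"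
  shows "4 * (sin (S / 3))\<^sup>2 * (cos Y * cos Z) \<le> sin (S - Y) * sin (S - Z)"
proof -
  define W where "W = (S - Z) / 2"
  have W: "Y \<le> W" "W \<le> pi / 2" "S - W = (S + Z) / 2" "S - Z = 2 * W"
    using assms by (auto simp: W_def field_simps)
  have sZ: "sin (S - Z) > 0" and sW: "sin (S - W) > 0" and sY: "sin (S - Y) > 0" and cZ: "cos Z > 0" and cW: "cos W > 0"
    using assms by (auto simp: W_def field_simps intro!: sin_gt_zero cos_gt_zero_pi)
  \<comment> \<open>The quotient cos Y / sin (S - Y) increases with Y as S is below a right angle,
    so Y may be pushed up to its largest value W.\<close>
  have "sin (S - Y) * cos W - cos Y * sin (S - W) = cos S * sin (W - Y)"
    by (simp add: sin_diff cos_diff algebra_simps)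
  moreover have "cos S * sin (W - Y) \<ge> 0"
    using S W Z by (intro mult_nonneg_nonneg sin_ge_zero cos_ge_zero) auto
  ultimately have 1: "cos Y * sin (S - W) \<le> sin (S - Y) * cos W" by simp
  define t where "t = cos (S / 3)"
  have tZ: "t \<le> cos Z" unfolding t_def using Z YZ S by (intro cos_monotone_0_pi_le) auto
  have tpos: "t > 0" unfolding t_def using S by (intro cos_gt_zero_pi) auto
  have cS: "cos S \<ge> 0" using S by (intro cos_ge_zero) auto
  have c3: "cos S = 4 * t ^ 3 - 3 * t" using cos_treble_cos[of "S / 3"] by (simp add: t_def)
  have s2: "(sin (S / 3))\<^sup>2 = 1 - t\<^sup>2" by (simp add: t_def sin_squared_eq)
  have "cos Z * (t - cos S) \<le> t * (cos Z - cos S)"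
    using mult_right_mono[OF tZ cS] by (simp add: algebra_simps)
  moreover have "t - cos S = t * (4 * (sin (S / 3))\<^sup>2)" unfolding c3 s2 by (simp add: algebra_simps power2_eq_square power3_eq_cube)
  ultimately have "t * (cos Z * (4 * (sin (S / 3))\<^sup>2)) \<le> t * (cos Z - cos S)" by (simp add: ac_simps)
  then have 2: "4 * (sin (S / 3))\<^sup>2 * cos Z \<le> cos Z - cos S" using tpos by (simp add: ac_simps)
  have "cos Z - cos S = 2 * sin ((S + Z) / 2) * sin ((S - Z) / 2)"
    using cos_diff_cos[of Z S] by (simp add: add.commute)
  then have 3: "cos Z - cos S = 2 * sin (S - W) * sin W" by (simp only: W(3)) (simp add: W_def)
  have "4 * (sin (S / 3))\<^sup>2 * (cos Y * cos Z) * sin (S - W) = (4 * (sin (S / 3))\<^sup>2 * cos Z) * (cos Y * sin (S - W))"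
    by (simp add: ac_simps)
  also have "\<dots> \<le> (cos Z - cos S) * (sin (S - Y) * cos W)"
  proof (rule mult_mono[OF 2 1])
    show "0 \<le> cos Z - cos S" using 2 cZ by (meson mult_nonneg_nonneg order_trans zero_le_power2 less_imp_le zero_le_numeral)
    show "0 \<le> cos Y * sin (S - W)" using sW S Z YZ by (intro mult_nonneg_nonneg cos_ge_zero) auto
  qed
  also have "\<dots> = sin (S - Y) * sin (S - Z) * sin (S - W)"
    unfolding 3 W(4) sin_double by (simp add: ac_simps)
  finally show ?thesis using sW by simp
qed

lemma three_angle_bound:
  fixes S X Y Z :: real
  assumes "S = X + Y + Z" "0 < S" "S < pi / 2" "0 \<le> Y" "0 \<le> Z" "Y \<le> X" "Z \<le> X"
  shows "4 * (sin (S / 3))\<^sup>2 * (cos Y * cos Z) \<le> sin (S - Y) * sin (S - Z)"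
proof (cases "Z \<le> Y")
  case True
  show ?thesis by (rule three_angle_bound_aux) (use assms True in linarith)+
next
  case False
  have "4 * (sin (S / 3))\<^sup>2 * (cos Z * cos Y) \<le> sin (S - Z) * sin (S - Y)"
    by (rule three_angle_bound_aux) (use assms False in linarith)+
  then show ?thesis by (simp only: mult.commute[of "cos Z"] mult.commute[of "sin (S - Z)"])
qed

text \<open>The data are symmetric, so that any fact about the side a passes to the other sides
  through \<open>rotated\<close> and \<open>mirrored\<close>.\<close>

locale hyp_triangle =
  fixes a b c A B C :: real
  assumes sides: "a > 0" "b > 0" "c > 0"
    and angles: "A > 0" "B > 0" "C > 0" and angle_sum: "A + B + C < pi"
    and cosA: "cosh a = cosh b * cosh c - sinh b * sinh c * cos A"
    and cosB: "cosh b = cosh c * cosh a - sinh c * sinh a * cos B"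
    and cosC: "cosh c = cosh a * cosh b - sinh a * sinh b * cos C"
begin

lemma rotated: "hyp_triangle b c a B C A"
  by (rule hyp_triangle.intro[OF sides(2,3,1) angles(2,3,1) _ cosB cosC cosA]) (use angle_sum in simp)

lemma mirrored: "hyp_triangle a c b A C B"
proof (rule hyp_triangle.intro[OF sides(1,3,2) angles(1,3,2)])
  show "A + C + B < pi" using angle_sum by simp
  show "cosh a = cosh c * cosh b - sinh c * sinh b * cos A" by (rule trans[OF cosA]) (simp add: ac_simps)
  show "cosh c = cosh b * cosh a - sinh b * sinh a * cos C" by (rule trans[OF cosC]) (simp add: ac_simps)
  show "cosh b = cosh a * cosh c - sinh a * sinh c * cos B" by (rule trans[OF cosB]) (simp add: ac_simps)
qed

lemma cos_eqs:
  "sinh b * sinh c * cos A = cosh b * cosh c - cosh a"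
  "sinh c * sinh a * cos B = cosh c * cosh a - cosh b"
  "sinh a * sinh b * cos C = cosh a * cosh b - cosh c"
  using cosA cosB cosC by linarith+

lemma sinh_pos: "sinh a > 0" "sinh b > 0" "sinh c > 0"
  using sides by simp_all

lemma sin_pos: "sin A > 0" "sin B > 0" "sin C > 0"
  using angles angle_sum by (auto intro!: sin_gt_zero)

text \<open>The right-hand side is the Gram determinant of the three vertices on the hyperboloid. It
  is symmetric in the sides, which is what yields the sine law.\<close>

lemma gram: "(sinh b * sinh c * sin A)\<^sup>2 =
  1 - (cosh a)\<^sup>2 - (cosh b)\<^sup>2 - (cosh c)\<^sup>2 + 2 * cosh a * cosh b * cosh c"
proof -
  have "(sinh b * sinh c * sin A)\<^sup>2 = (sinh b)\<^sup>2 * (sinh c)\<^sup>2 - (sinh b * sinh c * cos A)\<^sup>2"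
    by (simp add: power_mult_distrib sin_squared_eq algebra_simps)
  also have "sinh b * sinh c * cos A = cosh b * cosh c - cosh a" by (rule cos_eqs)
  finally have "(sinh b * sinh c * sin A)\<^sup>2
      = ((cosh b)\<^sup>2 - 1) * ((cosh c)\<^sup>2 - 1) - (cosh b * cosh c - cosh a)\<^sup>2"
    by (simp only: sinh_square_eq)
  then show ?thesis by (simp add: power2_eq_square algebra_simps)
qed

end

context hyp_triangle
begin

lemma sine_law: "sinh a * sin B = sinh b * sin A"
proof -
  interpret R: hyp_triangle b c a B C A by (rule rotated)
  have "(sinh c * sinh a * sin B)\<^sup>2 = (sinh b * sinh c * sin A)\<^sup>2"
    unfolding gram R.gram by (simp add: algebra_simps)
  then have "sinh c * sinh a * sin B = sinh b * sinh c * sin A"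
    by (rule power2_eq_imp_eq) (use sinh_pos sin_pos in \<open>simp_all add: less_imp_le\<close>)
  then have "sinh c * (sinh a * sin B) = sinh c * (sinh b * sin A)" by (simp add: ac_simps)
  then show ?thesis using sinh_pos(3) by (simp only: mult_cancel_left) simp
qed

lemma side_less_iff: "a < b \<longleftrightarrow> A < B"
proof -
  have lt: "A < B \<Longrightarrow> sin A < sin B" "B < A \<Longrightarrow> sin B < sin A"
    using sin_less_sin angles angle_sum by auto
  have "A < B \<longleftrightarrow> sin A < sin B" using lt by (cases A B rule: linorder_cases) auto
  also have "\<dots> \<longleftrightarrow> sinh b * sin A < sinh b * sin B" using sinh_pos by simp
  also have "\<dots> \<longleftrightarrow> sinh a < sinh b" unfolding sine_law[symmetric] using sin_pos by simp
  also have "\<dots> \<longleftrightarrow> a < b" by simp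
  finally show ?thesis by simp
qed

end

context hyp_triangle
begin

text \<open>Multiplied by k, both cosine terms become polynomials in the cosh of the sides, and the
  product of the two sines becomes the Gram determinant.\<close>

lemma dual_cosine_law: "cos A = - cos B * cos C + sin B * sin C * cosh a"
proof -
  interpret L: hyp_triangle c a b C A B by (rule hyp_triangle.rotated[OF rotated])
  define D where "D = sinh b * sinh c * sin A"
  have D: "sinh c * sinh a * sin B = D" "sinh a * sinh b * sin C = D"
    using sine_law L.sine_law by (simp_all add: D_def ac_simps)
  define k where "k = (sinh a)\<^sup>2 * sinh b * sinh c"
  have k: "k > 0" using sinh_pos by (simp add: k_def)
  have "k * cos A = (sinh a)\<^sup>2 * (cosh b * cosh c - cosh a)"
    unfolding cos_eqs[symmetric] k_def by (simp add: ac_simps)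
  then have 1: "k * cos A = ((cosh a)\<^sup>2 - 1) * (cosh b * cosh c - cosh a)" by (simp add: sinh_square_eq)
  have 2: "k * (cos B * cos C) = (cosh c * cosh a - cosh b) * (cosh a * cosh b - cosh c)"
    unfolding cos_eqs[symmetric] k_def by (simp add: power2_eq_square ac_simps)
  have "k * (sin B * sin C) = (sinh c * sinh a * sin B) * (sinh a * sinh b * sin C)"
    by (simp add: k_def power2_eq_square ac_simps)
  then have "k * (sin B * sin C) = D\<^sup>2" unfolding D by (simp add: power2_eq_square)
  then have 3: "k * (sin B * sin C) = 1 - (cosh a)\<^sup>2 - (cosh b)\<^sup>2 - (cosh c)\<^sup>2 + 2 * cosh a * cosh b * cosh c"
    unfolding D_def gram .
  have "k * cos A + k * (cos B * cos C) = k * (sin B * sin C) * cosh a"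
    unfolding 1 2 3 by (simp add: algebra_simps power2_eq_square)
  then have "k * cos A = k * (- cos B * cos C + sin B * sin C * cosh a)"
    by (simp add: algebra_simps)
  then show ?thesis using k by simp
qed

lemma half_side: "(cosh (a / 2))\<^sup>2 * (sin B * sin C) = cos ((A + C - B) / 2) * cos ((A + B - C) / 2)"
proof -
  have "2 * (cos ((A + C - B) / 2) * cos ((A + B - C) / 2)) = cos (C - B) + cos A"
  proof -
    have "(A + C - B) / 2 - (A + B - C) / 2 = C - B" "(A + C - B) / 2 + (A + B - C) / 2 = A"
      by (simp_all add: field_simps)
    then show ?thesis by (simp add: cos_times_cos)
  qed
  then show ?thesis unfolding cosh_half_sq dual_cosine_law by (simp add: cos_diff algebra_simps)
qed

text \<open>With S half the angle sum, X, Y, Z are S minus each angle; their nonnegativity says that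
  no side separates the triangle from its circumcentre. \<open>half_side\<close> expresses cosh^2 of
  half the shortest side by cos Y cos Z, and \<open>three_angle_bound\<close> turns this into sin (S
  / 3) \<le> 1 / (2 cosh (d / 2)), which is sin (\<alpha> / 2).\<close>

lemma angle_sum_le_aux:
  assumes "d > 0" "d \<le> a" "A \<le> B" "A \<le> C" "B \<le> A + C" "C \<le> A + B"
  shows "A + B + C \<le> 3 * alpha d"
proof -
  define S X Y Z where "S = (A + B + C) / 2" and "X = (B + C - A) / 2" and "Y = (A + C - B) / 2"
    and "Z = (A + B - C) / 2"
  have e: "S - Y = B" "S - Z = C" by (simp_all add: S_def Y_def Z_def field_simps)
  have bnd: "4 * (sin (S / 3))\<^sup>2 * (cos Y * cos Z) \<le> sin (S - Y) * sin (S - Z)"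
    by (rule three_angle_bound[where X = X]) (use assms angles angle_sum in \<open>auto simp: S_def X_def Y_def Z_def field_simps\<close>)
  have s: "sin B * sin C > 0" using sin_pos by simp
  have "4 * (sin (S / 3))\<^sup>2 * (cosh (a / 2))\<^sup>2 * (sin B * sin C) \<le> 1 * (sin B * sin C)"
    using bnd half_side unfolding e by (simp add: Y_def Z_def mult.assoc)
  then have "4 * (sin (S / 3))\<^sup>2 * (cosh (a / 2))\<^sup>2 \<le> 1"
    using s by (meson mult_le_cancel_right not_le order_less_asym)
  moreover have "(cosh (d / 2))\<^sup>2 \<le> (cosh (a / 2))\<^sup>2"
    using assms by (intro power_mono) (auto simp: cosh_real_nonneg_le_iff)
  ultimately have "4 * (sin (S / 3))\<^sup>2 * (cosh (d / 2))\<^sup>2 \<le> 1"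
    by (meson mult_left_mono order_trans zero_le_numeral zero_le_power2 mult_nonneg_nonneg)
  then have "(sin (S / 3))\<^sup>2 \<le> (sin (alpha d / 2))\<^sup>2"
    unfolding cosh_half_sq_alpha[OF assms(1)]
    using alpha_half_bounds[OF assms(1)] sin_gt_zero[of "alpha d / 2"] by (simp add: divide_simps)
  moreover have "sin (alpha d / 2) \<ge> 0" using alpha_half_bounds[OF assms(1)] by (intro sin_ge_zero) auto
  ultimately have "sin (S / 3) \<le> sin (alpha d / 2)" by (rule power2_le_imp_le)
  then have "S / 3 \<le> alpha d / 2"
    using alpha_half_bounds[OF assms(1)] angles angle_sum
    by (subst (asm) sin_mono_le_eq) (auto simp: S_def)
  then show ?thesis by (simp add: S_def)
qed

end

context hyp_triangle
begin

lemma angle_sum_le: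
  assumes "d > 0" "d \<le> a" "d \<le> b" "d \<le> c" "A \<le> B + C" "B \<le> A + C" "C \<le> A + B"
  shows "A + B + C \<le> 3 * alpha d"
proof -
  interpret R: hyp_triangle b c a B C A by (rule rotated)
  interpret L: hyp_triangle c a b C A B by (rule R.rotated)
  consider "A \<le> B" "A \<le> C" | "B \<le> A" "B \<le> C" | "C \<le> A" "C \<le> B" by linarith
  then show ?thesis
  proof cases
    case 1 then show ?thesis using angle_sum_le_aux assms by auto
  next
    case 2 then show ?thesis using R.angle_sum_le_aux[of d] assms by auto
  next
    case 3 then show ?thesis using L.angle_sum_le_aux[of d] assms by auto
  qed
qed

lemma angle_from_cos:
  assumes "cos (alpha d) \<le> cos A" "d > 0" shows "A \<le> alpha d"
proof (rule ccontr)
  assume "\<not> ?thesis"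
  then have "cos A < cos (alpha d)"
    using alpha_bounds[OF assms(2)] angles angle_sum by (intro cos_monotone_0_pi) auto
  then show False using assms by simp
qed

lemma apex_angle:
  assumes "b = d" "c = d"
  shows "cos A = ((cosh d)\<^sup>2 - cosh a) / ((cosh d)\<^sup>2 - 1)"
proof -
  have d: "d > 0" using sides assms by simp
  have "(sinh d)\<^sup>2 * cos A = (cosh d)\<^sup>2 - cosh a"
    using cos_eqs(1) assms by (simp add: power2_eq_square)
  moreover have "(sinh d)\<^sup>2 = (cosh d)\<^sup>2 - 1" by (rule sinh_square_eq)
  moreover have "(cosh d)\<^sup>2 - 1 > 0" using cosh_gt_1[OF d] by (simp add: one_less_power)
  ultimately show ?thesis by (simp add: field_simps)
qed

lemma cos_alpha_alt: assumes "d > 0" shows "cos (alpha d) = ((cosh d)\<^sup>2 - cosh d) / ((cosh d)\<^sup>2 - 1)"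
proof -
  have "cosh d - 1 \<noteq> 0" using cosh_gt_1[OF assms] by linarith
  moreover have "((cosh d)\<^sup>2 - cosh d) / ((cosh d)\<^sup>2 - 1) = (cosh d * (cosh d - 1)) / ((1 + cosh d) * (cosh d - 1))"
    by (simp add: power2_eq_square algebra_simps)
  moreover have "C * (C - 1) / ((1 + C) * (C - 1)) = C / (1 + C)" if "C - 1 \<noteq> 0" for C :: real
    using that by simp
  ultimately have "((cosh d)\<^sup>2 - cosh d) / ((cosh d)\<^sup>2 - 1) = cosh d / (1 + cosh d)"
    by metis
  then show ?thesis using cos_alpha_cosh assms by simp
qed

lemma apex_angle_ge:
  assumes "b = d" "c = d" "d \<le> a" shows "alpha d \<le> A"
proof -
  have d: "d > 0" using sides assms by simp
  have "(cosh d)\<^sup>2 - 1 > 0" using cosh_gt_1[OF d] by (simp add: one_less_power)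
  moreover have "cosh d \<le> cosh a" using d assms by (simp add: cosh_real_nonneg_le_iff)
  ultimately have "cos A \<le> cos (alpha d)"
    unfolding apex_angle[OF assms(1,2)] cos_alpha_alt[OF d] by (intro divide_right_mono) auto
  then show ?thesis using alpha_bounds[OF d] angles angle_sum cos_monotone_0_pi[of A "alpha d"]
    by linarith
qed

lemma apex_angle_gt:
  assumes "b = d" "c = d" "d < a" shows "alpha d < A"
proof -
  have d: "d > 0" using sides assms by simp
  have "(cosh d)\<^sup>2 - 1 > 0" using cosh_gt_1[OF d] by (simp add: one_less_power)
  moreover have "cosh d < cosh a" using d assms by (simp add: cosh_real_nonneg_less_iff)
  ultimately have "cos A < cos (alpha d)"
    unfolding apex_angle[OF assms(1,2)] cos_alpha_alt[OF d] by (intro divide_strict_right_mono) auto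
  then show ?thesis using alpha_bounds[OF d] angles angle_sum cos_monotone_0_pi_le[of A "alpha d"]
    by linarith
qed

lemma equilateral_angle:
  assumes "a = d" "b = d" "c = d" shows "A = alpha d"
proof -
  have d: "d > 0" using sides assms by simp
  have "cos A = cos (alpha d)" unfolding apex_angle[OF assms(2,3)] cos_alpha_alt[OF d] using assms by simp
  then show ?thesis using alpha_bounds[OF d] angles angle_sum cos_inj_pi[of A "alpha d"] by simp
qed

text \<open>After squaring, the claim is a polynomial inequality in K = cosh d and the cosh of the
  two other sides. Its slack is a sum of nonnegative terms in x - y and e = x y - K^2, both of which
  vanish for the equilateral triangle.\<close>

lemma base_angle_le:
  assumes "a = d" "d \<le> b" "d \<le> c" shows "A \<le> alpha d"
proof (rule angle_from_cos)
  show d: "d > 0" using sides assms by simp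
  define K x y where "K = cosh d" and "x = cosh b" and "y = cosh c"
  have K: "K > 1" using cosh_gt_1[OF d] by (simp add: K_def)
  have xy: "K \<le> x" "K \<le> y" using d assms by (simp_all add: K_def x_def y_def cosh_real_nonneg_le_iff)
  define e where "e = x * y - K\<^sup>2"
  have e: "e \<ge> 0" using xy K mult_mono[of K x K y] by (simp add: e_def power2_eq_square)
  have "(x * y - K)\<^sup>2 * (K + 1)\<^sup>2 - K\<^sup>2 * ((x\<^sup>2 - 1) * (y\<^sup>2 - 1)) =
     K\<^sup>2 * (x - y)\<^sup>2 + (2 * K + 1) * e\<^sup>2 + 2 * e * (K\<^sup>2 - 1) * K"
    unfolding e_def by (simp add: power2_eq_square algebra_simps)
  also have "\<dots> \<ge> 0" using e K by (intro add_nonneg_nonneg mult_nonneg_nonneg) (auto simp: power2_eq_square intro: less_imp_le mult_mono[of 1 K 1 K, simplified])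
  finally have "K\<^sup>2 * ((x\<^sup>2 - 1) * (y\<^sup>2 - 1)) \<le> ((x * y - K) * (K + 1))\<^sup>2" by (simp add: power_mult_distrib)
  moreover have "x\<^sup>2 - 1 = (sinh b)\<^sup>2" "y\<^sup>2 - 1 = (sinh c)\<^sup>2" by (simp_all add: x_def y_def sinh_square_eq)
  ultimately have "(K * (sinh b * sinh c))\<^sup>2 \<le> ((x * y - K) * (K + 1))\<^sup>2" by (simp add: power_mult_distrib)
  moreover have "(x * y - K) * (K + 1) \<ge> 0"
  proof -
    have "K * 1 \<le> x * y" using xy K by (intro mult_mono) auto
    then show ?thesis using K by simp
  qed
  ultimately have "K * (sinh b * sinh c) \<le> (x * y - K) * (K + 1)" by (rule power2_le_imp_le)
  also have "x * y - K = sinh b * sinh c * cos A"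
    unfolding cos_eqs using assms(1) by (simp add: K_def x_def y_def)
  finally have "(sinh b * sinh c) * K \<le> (sinh b * sinh c) * (cos A * (K + 1))" by (simp add: ac_simps)
  then have "K \<le> cos A * (K + 1)" using sinh_pos by simp
  then show "cos (alpha d) \<le> cos A" unfolding cos_alpha_cosh[OF d] using K by (simp add: K_def field_simps)
qed

end

section \<open>Isosceles triangles with legs d\<close>

locale isosceles = hyp_triangle +
  fixes d :: real
  assumes legs: "b = d" "c = d" and base: "d \<le> a"
begin

lemma d_pos: "d > 0" using sides legs by simp

lemma base_angles: "C = B"
proof -
  interpret R: hyp_triangle b c a B C A by (rule rotated)
  interpret M: hyp_triangle c b a C B A by (rule hyp_triangle.rotated[OF mirrored])
  show ?thesis using R.side_less_iff M.side_less_iff legs by auto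
qed

lemma half_angles: "0 < A / 2" "A / 2 < pi / 2" "0 < B" "B < pi / 2" "A / 2 + B < pi / 2"
  using angles angle_sum base_angles by auto

lemma tan_pos: "tan (A / 2) > 0" "tan B > 0"
  using half_angles by (auto intro!: tan_gt_zero)

text \<open>The altitude makes right triangles with hypotenuse d and angles A / 2 and B. So these
  two angles determine each other, and the triangles form a one-parameter family.\<close>

lemma tan_rel: "tan (A / 2) * tan B = 1 / cosh d"
proof -
  interpret R: hyp_triangle b c a B C A by (rule rotated)
  have cp: "cos (A / 2) > 0" "cos B > 0" using half_angles by (auto intro!: cos_gt_zero_pi)
  have "cos B = - cos B * cos A + sin B * sin A * cosh d"
    using R.dual_cosine_law legs base_angles by (simp add: ac_simps)
  then have "cos B * (1 + cos A) = sin B * sin A * cosh d" by (simp add: algebra_simps)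
  moreover have "1 + cos A = 2 * (cos (A / 2))\<^sup>2" using cos_double_cos[of "A / 2"] by simp
  moreover have "sin A = 2 * sin (A / 2) * cos (A / 2)" using sin_double[of "A / 2"] by simp
  ultimately have "cos (A / 2) * (cos B * cos (A / 2)) = cos (A / 2) * (sin B * sin (A / 2) * cosh d)"
    by (simp add: power2_eq_square ac_simps)
  then have "cos B * cos (A / 2) = sin B * sin (A / 2) * cosh d" using cp by simp
  moreover have "cosh d > 0" using cosh_gt_1[OF d_pos] by simp
  moreover have "x / u * (y / v) = 1 / K" if "v * u = y * x * K" "u > 0" "v > 0" "K > 0" for x y u v K :: real
  proof -
    have "u * v > 0" using that by simp
    then have "x \<noteq> 0" "y \<noteq> 0" using that(1) by (auto simp: mult.commute)
    then show ?thesis using that by (simp add: field_simps)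
  qed
  ultimately show ?thesis using cp unfolding tan_def by metis
qed

lemma A_ge: "alpha d \<le> A"
  using apex_angle_ge legs base by simp

lemma tan_A_ge: "tan (alpha d / 2) \<le> tan (A / 2)"
  using A_ge half_angles alpha_half_bounds[OF d_pos] by (subst tan_mono_le_eq) auto

lemma tan_alpha_pos: "tan (alpha d / 2) > 0" "tan (alpha d) > 0"
  using alpha_bounds[OF d_pos] by (auto intro!: tan_gt_zero)

lemma base_angle_less: assumes "d < a" shows "B < alpha d"
proof -
  have "alpha d < A" using apex_angle_gt legs assms by simp
  then have "tan (alpha d / 2) < tan (A / 2)"
    using half_angles alpha_half_bounds[OF d_pos] by (intro tan_monotone) auto
  then have "tan (alpha d / 2) * tan B < tan (A / 2) * tan B" using tan_pos by simp
  then have "tan (alpha d / 2) * tan B < tan (alpha d / 2) * tan (alpha d)"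
    using tan_rel tan_alpha_half[OF d_pos] by simp
  then have "tan B < tan (alpha d)" using tan_alpha_pos by simp
  then show ?thesis using half_angles alpha_bounds[OF d_pos] by (subst (asm) tan_mono_lt_eq) auto
qed

text \<open>With y = tan (A / 2) and k = 1 / cosh d one has tan (A / 2 + B) = (y + k / y) / (1 - k).
  This takes the equilateral value at tan (\<alpha> / 2) and again at k / tan (\<alpha> / 2) = tan
  \<alpha>, and is not larger in between. As A \<ge> \<alpha>, a larger sum forces A / 2 beyond
  \<alpha>.\<close>

lemma large_angle_sum:
  assumes "A + B + C > 3 * alpha d"
  shows "B < alpha d / 2" "A > 2 * alpha d"
proof -
  define y\<^sub>0 y k where "y\<^sub>0 = tan (alpha d / 2)" and "y = tan (A / 2)" and "k = 1 / cosh d"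
  have k: "0 < k" "k < 1" using cosh_gt_1[OF d_pos] by (auto simp: k_def)
  have t0: "tan (alpha d) = k / y\<^sub>0" using tan_alpha_half[OF d_pos] tan_alpha_pos by (simp add: y\<^sub>0_def k_def field_simps)
  have tB: "tan B = k / y" using tan_rel tan_pos by (simp add: y_def k_def field_simps)
  have yp: "y\<^sub>0 > 0" "y > 0" "y\<^sub>0 \<le> y" using tan_alpha_pos tan_pos tan_A_ge by (auto simp: y\<^sub>0_def y_def)
  have a3: "alpha d / 2 + alpha d < pi / 2" "0 < alpha d" using alpha_bounds[OF d_pos] by auto
  show B: "B < alpha d / 2"
  proof (rule ccontr)
    assume "\<not> ?thesis"
    then have "y\<^sub>0 \<le> tan B" unfolding y\<^sub>0_def using half_angles a3 by (subst tan_mono_le_eq) auto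
    then have "y * y\<^sub>0 \<le> k" using yp by (simp add: tB field_simps)
    then have "(y - y\<^sub>0) * (k - y * y\<^sub>0) \<ge> 0" using yp by simp
    then have "(y + k / y) \<le> y\<^sub>0 + k / y\<^sub>0" using yp by (simp add: field_simps)
    then have "(y + k / y) / (1 - k) \<le> (y\<^sub>0 + k / y\<^sub>0) / (1 - k)" using k by (intro divide_right_mono) auto
    moreover have "tan (A / 2 + B) = (y + k / y) / (1 - k)"
      using half_angles tan_rel
      by (subst tan_add) (auto simp: y_def[symmetric] tB k_def[symmetric] intro!: less_imp_neq[THEN not_sym] cos_gt_zero_pi)
    moreover have "tan (alpha d / 2 + alpha d) = (y\<^sub>0 + k / y\<^sub>0) / (1 - k)"
      using a3 tan_alpha_half[OF d_pos]
      by (subst tan_add) (auto simp: y\<^sub>0_def[symmetric] t0 k_def[symmetric] intro!: less_imp_neq[THEN not_sym] cos_gt_zero_pi)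
    ultimately have "tan (A / 2 + B) \<le> tan (alpha d / 2 + alpha d)" by simp
    then have "A / 2 + B \<le> alpha d / 2 + alpha d"
      using half_angles a3 by (subst (asm) tan_mono_le_eq) auto
    then show False using assms base_angles by simp
  qed
  have "tan B < y\<^sub>0" unfolding y\<^sub>0_def using B half_angles a3 by (intro tan_monotone) auto
  then have "k / y\<^sub>0 < y" using yp by (simp add: tB field_simps)
  then have "tan (alpha d) < tan (A / 2)" by (simp add: t0 y_def)
  then have "alpha d < A / 2" using half_angles a3 by (subst (asm) tan_mono_lt_eq) auto
  then show "A > 2 * alpha d" by simp
qed

lemma thin_iff: "A > 2 * B \<longleftrightarrow> (tan (A / 2))\<^sup>2 > 1 / cosh d"
proof -
  have "A > 2 * B \<longleftrightarrow> tan B < tan (A / 2)" using half_angles by (subst tan_mono_lt_eq) auto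
  also have "\<dots> \<longleftrightarrow> tan (A / 2) * tan B < tan (A / 2) * tan (A / 2)" using tan_pos by simp
  finally show ?thesis unfolding tan_rel by (simp add: power2_eq_square)
qed

text \<open>Two copies glued along the base form a rhombus with angles A and 2 B, here a
  square.\<close>

lemma square_angle: assumes "A = 2 * B" shows "A = alpha4 d"
proof -
  have B: "A / 2 = B" using assms by simp
  have cp: "cos B > 0" "sin B > 0" using half_angles by (auto intro!: cos_gt_zero_pi sin_gt_zero)
  have K: "cosh d > 1" using cosh_gt_1[OF d_pos] .
  have "(tan B)\<^sup>2 = 1 / cosh d" using tan_rel B by (simp add: power2_eq_square)
  then have "(sin B)\<^sup>2 * cosh d = (cos B)\<^sup>2" using cp K by (simp add: tan_def power_divide field_simps)
  then have "(sin B)\<^sup>2 = 1 / (1 + cosh d)" using K by (simp add: cos_squared_eq field_simps)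
  moreover have "(sqrt 2 * sin (alpha d / 2))\<^sup>2 = 1 / (1 + cosh d)"
  proof -
    have "(sqrt 2 * sin (alpha d / 2))\<^sup>2 = 2 * (1 / (2 * cosh (d / 2)))\<^sup>2"
      unfolding sin_half_alpha[OF d_pos] by (simp only: power_mult_distrib) simp
    also have "\<dots> = 1 / (1 + cosh d)" unfolding power_divide power_mult_distrib cosh_half_sq
      by (simp add: power2_eq_square) (simp add: divide_simps)
    finally show ?thesis .
  qed
  moreover have "sin (alpha d / 2) \<ge> 0" using alpha_half_bounds[OF d_pos] by (intro sin_ge_zero) auto
  ultimately have "sin B = sqrt 2 * sin (alpha d / 2)"
    using cp by (intro power2_eq_imp_eq[of "sin B"]) auto
  then have "alpha4 d = 2 * arcsin (sin B)" by (simp add: alpha4_def)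
  then show ?thesis using half_angles assms by (simp add: arcsin_sin)
qed

end

text \<open>By \<open>thin_iff\<close> the condition A > 2 B is a threshold for the apex angle, and
  the base grows with the apex angle.\<close>

lemma isosceles_apex_less:
  assumes "isosceles a b c A B C d" "isosceles a' b' c' A' B' C' d" "A > 2 * B" "A' \<le> 2 * B'"
  shows "a' < a"
proof -
  interpret X: isosceles a b c A B C d by fact
  interpret Y: isosceles a' b' c' A' B' C' d by fact
  have "(tan (A' / 2))\<^sup>2 < (tan (A / 2))\<^sup>2"
    using X.thin_iff Y.thin_iff assms(3,4) by linarith
  then have "tan (A' / 2) < tan (A / 2)" using X.tan_pos by (auto intro: power2_less_imp_less)
  then have "A' < A" using X.half_angles Y.half_angles by (subst (asm) tan_mono_lt_eq) auto
  then have "cos A < cos A'" using X.angles Y.angles X.angle_sum by (intro cos_monotone_0_pi) auto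
  moreover have "(cosh d)\<^sup>2 - 1 > 0" using cosh_gt_1[OF X.d_pos] by (simp add: one_less_power)
  ultimately have "cosh a' < cosh a"
    unfolding X.apex_angle[OF X.legs] Y.apex_angle[OF Y.legs] by (simp add: divide_less_cancel)
  then show ?thesis using X.sides Y.sides by (simp add: cosh_real_nonneg_less_iff)
qed

section \<open>Angles and areas in the disc\<close>

text \<open>The isometry \<open>mob p\<close> carries p to the origin, where geodesics through p
  become radii; the angle is counted counterclockwise from q to r, in the range from 0 to below a
  full turn.\<close>

definition ang :: "complex \<Rightarrow> complex \<Rightarrow> complex \<Rightarrow> real" where
  "ang p q r = Arg2pi (mob p r / mob p q)"

text \<open>Signed area of the triangle with vertices \<open>0\<close>, \<open>z\<close>, \<open>w\<close>.\<close>

definition sar :: "complex \<Rightarrow> complex \<Rightarrow> real" where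
  "sar z w = - 2 * Arg (1 - cnj z * w)"

definition pos3 :: "complex \<Rightarrow> complex \<Rightarrow> complex \<Rightarrow> bool" where
  "pos3 p q r \<longleftrightarrow> cmod p < 1 \<and> cmod q < 1 \<and> cmod r < 1 \<and> crs (klein p) (klein q) (klein r) > 0"

lemma pos3_rotate: "pos3 p q r \<Longrightarrow> pos3 q r p"
  by (simp add: pos3_def crs_rotate)

lemma pos3_distinct: "pos3 p q r \<Longrightarrow> p \<noteq> q \<and> q \<noteq> r \<and> p \<noteq> r"
  by (auto simp: pos3_def)

section \<open>Moebius maps as isometries of the disc\<close>

lemma mob_self [simp]: "mob a a = 0"
  by (simp add: mob_def)

lemma mob_eq_0_iff: "cmod a < 1 \<Longrightarrow> cmod z < 1 \<Longrightarrow> mob a z = 0 \<longleftrightarrow> z = a"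
  using one_minus_cnj_mult_neq[of a z] by (simp add: mob_def)

lemma one_minus_mob:
  assumes "cmod a < 1" "cmod z < 1" "cmod w < 1"
  shows "1 - cnj (mob a z) * mob a w
    = of_real (1 - (cmod a)\<^sup>2) * (1 - cnj z * w) / ((1 - a * cnj z) * (1 - cnj a * w))"
proof -
  have n: "1 - a * cnj z \<noteq> 0" "1 - cnj a * w \<noteq> 0"
    using one_minus_cnj_mult_neq[of z a] one_minus_cnj_mult_neq[of a w] assms by (auto simp: mult.commute)
  have "1 - cnj (mob a z) * mob a w
     = ((1 - a * cnj z) * (1 - cnj a * w) - (cnj z - cnj a) * (w - a)) / ((1 - a * cnj z) * (1 - cnj a * w))"
  proof -
    have "1 - x / y * (x' / y') = (y * y' - x * x') / (y * y')" if "y \<noteq> 0" "y' \<noteq> 0" for x y x' y' :: complex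
      using that by (simp add: field_simps)
    from this[OF n] show ?thesis by (simp add: mob_def)
  qed
  also have "(1 - a * cnj z) * (1 - cnj a * w) - (cnj z - cnj a) * (w - a) = (1 - a * cnj a) * (1 - cnj z * w)"
    by (simp add: algebra_simps)
  also have "1 - a * cnj a = of_real (1 - (cmod a)\<^sup>2)" by (simp add: complex_norm_square flip: of_real_power)
  finally show ?thesis .
qed

lemma one_minus_mob_sq:
  assumes "cmod a < 1" "cmod z < 1"
  shows "1 - (cmod (mob a z))\<^sup>2 = (1 - (cmod a)\<^sup>2) * (1 - (cmod z)\<^sup>2) / (cmod (1 - cnj a * z))\<^sup>2"
proof -
  have e: "of_real (1 - (cmod w)\<^sup>2) = 1 - cnj w * w" for w
    by (simp add: complex_norm_square mult.commute flip: of_real_power)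
  have "(1 - a * cnj z) * (1 - cnj a * z) = of_real ((cmod (1 - cnj a * z))\<^sup>2)"
    by (simp add: complex_norm_square mult.commute flip: of_real_power)
  then have "(of_real (1 - (cmod (mob a z))\<^sup>2) :: complex)
      = of_real ((1 - (cmod a)\<^sup>2) * (1 - (cmod z)\<^sup>2) / (cmod (1 - cnj a * z))\<^sup>2)"
    unfolding of_real_divide of_real_mult e[of "mob a z"] one_minus_mob[OF assms(1,2,2)] e[of z] by simp
  then show ?thesis by (simp only: of_real_eq_iff)
qed

lemma mob_in_disc: assumes "cmod a < 1" "cmod z < 1" shows "cmod (mob a z) < 1"
proof -
  have "1 - (cmod (mob a z))\<^sup>2 > 0" unfolding one_minus_mob_sq[OF assms]
    using disc_sq assms one_minus_cnj_mult_neq[of a z] by (intro divide_pos_pos mult_pos_pos) auto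
  then show ?thesis by (simp add: power_less_one_iff abs_square_less_1)
qed

lemma mob_diff:
  assumes "cmod a < 1" "cmod z < 1" "cmod w < 1"
  shows "mob a z - mob a w = of_real (1 - (cmod a)\<^sup>2) * (z - w) / ((1 - cnj a * z) * (1 - cnj a * w))"
proof -
  have n: "1 - cnj a * z \<noteq> 0" "1 - cnj a * w \<noteq> 0" using one_minus_cnj_mult_neq assms by auto
  have "mob a z - mob a w = ((z - a) * (1 - cnj a * w) - (w - a) * (1 - cnj a * z)) / ((1 - cnj a * z) * (1 - cnj a * w))"
    unfolding mob_def using n by (subst diff_frac_eq) auto
  also have "(z - a) * (1 - cnj a * w) - (w - a) * (1 - cnj a * z) = (1 - a * cnj a) * (z - w)"
    by (simp add: algebra_simps)
  also have "1 - a * cnj a = of_real (1 - (cmod a)\<^sup>2)" by (simp add: complex_norm_square flip: of_real_power)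
  finally show ?thesis .
qed

lemma ch_mob:
  assumes "cmod a < 1" "cmod z < 1" "cmod w < 1"
  shows "ch (mob a z) (mob a w) = ch z w"
proof -
  define A U V where "A = 1 - (cmod a)\<^sup>2" and "U = (cmod (1 - cnj a * z))\<^sup>2" and "V = (cmod (1 - cnj a * w))\<^sup>2"
  have p: "A > 0" "U > 0" "V > 0"
    using disc_sq assms one_minus_cnj_mult_neq[of a z] one_minus_cnj_mult_neq[of a w] by (auto simp: A_def U_def V_def)
  have "(cmod (mob a z - mob a w))\<^sup>2 = A\<^sup>2 * (cmod (z - w))\<^sup>2 / (U * V)"
    unfolding mob_diff[OF assms] norm_divide norm_mult norm_of_real power_divide power_mult_distrib
    by (simp add: A_def U_def V_def)
  then show ?thesis
    unfolding ch_def one_minus_mob_sq[OF assms(1,2)] one_minus_mob_sq[OF assms(1,3)]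
      A_def[symmetric] U_def[symmetric] V_def[symmetric]
    using p by (simp add: power2_eq_square)
qed

lemma ch_0: "cmod m < 1 \<Longrightarrow> ch 0 m = (1 + (cmod m)\<^sup>2) / (1 - (cmod m)\<^sup>2)"
  using disc_sq[of m] by (simp add: ch_def field_simps)

lemma sinh_hyp_dist:
  assumes "cmod p < 1" "cmod q < 1"
  shows "sinh (hyp_dist p q) = 2 * cmod (mob p q) / (1 - (cmod (mob p q))\<^sup>2)"
proof -
  define m where "m = cmod (mob p q)"
  have m: "1 - m\<^sup>2 > 0" using disc_sq mob_in_disc assms by (simp add: m_def)
  have "ch p q = ch (mob p p) (mob p q)" using ch_mob assms by metis
  then have c: "cosh (hyp_dist p q) = (1 + m\<^sup>2) / (1 - m\<^sup>2)"
    using cosh_hyp_dist[OF assms] ch_0[OF mob_in_disc[OF assms]] by (simp add: m_def)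
  have "(sinh (hyp_dist p q))\<^sup>2 = (2 * m / (1 - m\<^sup>2))\<^sup>2"
  proof -
    have "((1 + x) / (1 - x))\<^sup>2 - 1 = 4 * x / (1 - x)\<^sup>2" if "1 - x > 0" for x :: real
    proof -
      have "((1 + x) / (1 - x))\<^sup>2 - 1 = ((1 + x)\<^sup>2 - (1 - x)\<^sup>2) / (1 - x)\<^sup>2"
        using that by (simp add: power_divide diff_divide_distrib)
      also have "(1 + x)\<^sup>2 - (1 - x)\<^sup>2 = 4 * x" by (simp add: power2_eq_square algebra_simps)
      finally show ?thesis .
    qed
    from this[OF m] show ?thesis unfolding sinh_square_eq c by (simp add: power_divide power_mult_distrib)
  qed
  then show ?thesis unfolding m_def[symmetric]
    by (rule power2_eq_imp_eq) (use m hyp_dist_nonneg[OF assms] in \<open>auto simp: m_def\<close>)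
qed

text \<open>With p moved to the origin this is the Euclidean law of cosines for
  \<open>mob p q\<close> and \<open>mob p r\<close>, rewritten by the formulas for cosh and sinh of
  the distance to the origin.\<close>

lemma cosine_law:
  assumes "cmod p < 1" "cmod q < 1" "cmod r < 1" "p \<noteq> q"
  shows "ch q r = ch p q * ch p r - sinh (hyp_dist p q) * sinh (hyp_dist p r) * cos (ang p q r)"
proof -
  define m n where "m = mob p q" and "n = mob p r"
  have d: "cmod m < 1" "cmod n < 1" "m \<noteq> 0" using mob_in_disc mob_eq_0_iff assms by (auto simp: m_def n_def)
  define M N where "M = (cmod m)\<^sup>2" and "N = (cmod n)\<^sup>2"
  have MN: "1 - M > 0" "1 - N > 0" using disc_sq d by (auto simp: M_def N_def)
  have c1: "ch q r = ch m n" using ch_mob assms by (simp add: m_def n_def)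
  have c2: "ch p q = (1 + M) / (1 - M)" "ch p r = (1 + N) / (1 - N)"
    using ch_mob[of p p q] ch_mob[of p p r] ch_0 d assms by (simp_all add: M_def N_def m_def n_def)
  have s: "sinh (hyp_dist p q) = 2 * cmod m / (1 - M)" "sinh (hyp_dist p r) = 2 * cmod n / (1 - N)"
    using sinh_hyp_dist assms by (simp_all add: M_def N_def m_def n_def)
  have "cmod m * cmod n * cos (ang p q r) = (cmod m)\<^sup>2 * Re (n / m)"
    using cos_Arg2pi[of "n / m"] d by (simp add: ang_def m_def n_def norm_divide power2_eq_square field_simps)
  also have "\<dots> = inner m n"
    using d by (simp add: Re_divide cmod_power2 inner_complex_def mult.commute)
  finally have i: "cmod m * cmod n * cos (ang p q r) = inner m n" .
  have "(cmod (m - n))\<^sup>2 = M + N - 2 * inner m n"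
    by (simp add: M_def N_def power2_norm_eq_inner inner_diff_left inner_diff_right inner_commute)
  then have "ch m n = 1 + 2 * (M + N - 2 * inner m n) / ((1 - M) * (1 - N))" by (simp add: ch_def M_def N_def)
  also have "\<dots> = ((1 - M) * (1 - N) + 2 * (M + N - 2 * inner m n)) / ((1 - M) * (1 - N))"
    using MN by (simp add: add_divide_distrib)
  also have "(1 - M) * (1 - N) + 2 * (M + N - 2 * inner m n) = (1 + M) * (1 + N) - 4 * inner m n"
    by (simp add: algebra_simps)
  finally have "ch q r = (1 + M) / (1 - M) * ((1 + N) / (1 - N)) - 4 * inner m n / ((1 - M) * (1 - N))"
    unfolding c1 by (simp add: diff_divide_distrib)
  also have "4 * inner m n / ((1 - M) * (1 - N)) = sinh (hyp_dist p q) * sinh (hyp_dist p r) * cos (ang p q r)"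
    unfolding s i[symmetric] by simp
  finally show ?thesis unfolding c2 .
qed

lemma ang_bounds: "pos3 p q r \<Longrightarrow> 0 < ang p q r \<and> ang p q r < pi"
  unfolding ang_def Arg2pi_lt_pi using mob_orientation[of p q r] pos3_distinct[of p q r] by (auto simp: pos3_def)

lemma Arg_bounds: "cmod z < 1 \<Longrightarrow> cmod w < 1 \<Longrightarrow> \<bar>Arg (1 - cnj z * w)\<bar> < pi / 2"
  using one_minus_cnj_mult_pos[of z w] one_minus_cnj_mult_neq[of z w] Arg_Re_pos by blast

lemma cis_eq_1_imp: "cis t = 1 \<Longrightarrow> \<bar>t\<bar> < 2 * pi \<Longrightarrow> t = 0"
proof -
  assume "cis t = 1" and b: "\<bar>t\<bar> < 2 * pi"
  then have "cos t = 1" by (metis cis.sel(1) one_complex.sel(1))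
  then obtain n :: int where n: "t = of_int n * 2 * pi" using cos_one_2pi_int by auto
  then have "\<bar>of_int n\<bar> * (2 * pi) < 1 * (2 * pi)" using b by (simp add: abs_mult)
  then have "\<bar>real_of_int n\<bar> < 1" by (subst (asm) mult_less_cancel_right_pos) auto
  then show ?thesis using n by simp
qed

lemma sgn_of_real_pos: "x > 0 \<Longrightarrow> sgn (of_real x :: complex) = 1"
  by (simp add: sgn_of_real)

text \<open>The area of a triangle moved to the origin equals the boundary sum of signed areas seen
  from the origin. The identity for \<open>1 - cnj (mob a z) * mob a w\<close> gives it modulo full
  turns; four arguments below a right angle leave no room for one.\<close>

lemma sar_cocycle:
  assumes "cmod a < 1" "cmod z < 1" "cmod w < 1"
  shows "sar (mob a z) (mob a w) = sar a z + sar z w + sar w a"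
proof -
  define x u v y where "x = 1 - cnj (mob a z) * mob a w" and "u = 1 - cnj z * w"
    and "v = 1 - cnj z * a" and "y = 1 - cnj a * w"
  have n: "x \<noteq> 0" "u \<noteq> 0" "v \<noteq> 0" "y \<noteq> 0" "1 - a * cnj z \<noteq> 0"
    using one_minus_cnj_mult_neq mob_in_disc assms by (auto simp: x_def u_def v_def y_def mult.commute)
  have "x * (v * y) = of_real (1 - (cmod a)\<^sup>2) * u"
    unfolding x_def one_minus_mob[OF assms] using n by (simp add: u_def v_def y_def mult.commute)
  then have "sgn x * (sgn v * sgn y) = sgn (of_real (1 - (cmod a)\<^sup>2)) * sgn u" by (metis sgn_mult)
  then have "cis (Arg x) * (cis (Arg v) * cis (Arg y)) = cis (Arg u)"
    using n disc_sq[OF assms(1)] by (simp add: cis_Arg sgn_of_real_pos del: of_real_diff)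
  then have "cis (Arg x + Arg v + Arg y - Arg u) = 1"
    by (simp add: cis_mult add.assoc flip: cis_divide)
  moreover have "\<bar>Arg x + Arg v + Arg y - Arg u\<bar> < 2 * pi"
    using Arg_bounds[OF mob_in_disc[OF assms(1,2)] mob_in_disc[OF assms(1,3)]]
      Arg_bounds[OF assms(2,3)] Arg_bounds[OF assms(2,1)] Arg_bounds[OF assms(1,3)]
    unfolding x_def[symmetric] u_def[symmetric] v_def[symmetric] y_def[symmetric] by linarith
  ultimately have "Arg x + Arg v + Arg y - Arg u = 0" by (rule cis_eq_1_imp)
  moreover have "Arg (1 - cnj a * z) = - Arg v" "Arg (1 - cnj w * a) = - Arg y"
  proof -
    have "1 - cnj a * z = cnj v" "1 - cnj w * a = cnj y" by (simp_all add: v_def y_def mult.commute)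
    moreover have "Arg v \<noteq> pi" "Arg y \<noteq> pi"
      using Arg_bounds[OF assms(2,1)] Arg_bounds[OF assms(1,3)] unfolding v_def[symmetric] y_def[symmetric] by auto
    moreover have "Re v > 0" "Re y > 0"
      using one_minus_cnj_mult_pos assms unfolding v_def y_def by blast+
    moreover have "Arg (cnj x) = - Arg x" if "Arg x \<noteq> pi" "Re x > 0" for x
      using that by (auto simp: Arg_cnj Arg_eq_0)
    ultimately show "Arg (1 - cnj a * z) = - Arg v" "Arg (1 - cnj w * a) = - Arg y" by metis+
  qed
  ultimately show ?thesis by (simp add: sar_def x_def u_def)
qed

lemma sar_antisym: assumes "cmod z < 1" "cmod w < 1" shows "sar z w + sar w z = 0"
proof -
  have "1 - cnj z * z = of_real (1 - (cmod z)\<^sup>2)"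
    by (simp add: complex_norm_square mult.commute flip: of_real_power)
  then have "Arg (1 - cnj z * z) = 0" using disc_sq[OF assms(1)] by (simp only: Arg_of_real) simp
  then show ?thesis using sar_cocycle[of z z w] assms by (simp add: sar_def)
qed

lemma sar_triangle_bounds:
  assumes "pos3 p q r"
  shows "0 < sar p q + sar q r + sar r p" "sar p q + sar q r + sar r p < pi"
proof -
  have d: "cmod p < 1" "cmod q < 1" "cmod r < 1" using assms by (auto simp: pos3_def)
  define m n where "m = mob p q" and "n = mob p r"
  have md: "cmod m < 1" "cmod n < 1" "m \<noteq> 0"
    using mob_in_disc mob_eq_0_iff d pos3_distinct[OF assms] by (auto simp: m_def n_def)
  have "Im (n / m) > 0" using mob_orientation[of p q r] d assms pos3_distinct[OF assms] by (simp add: pos3_def m_def n_def)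
  moreover have "Im (n / m) = Im (cnj m * n) / (cmod m)\<^sup>2"
    by (simp add: Im_divide cmod_power2 algebra_simps)
  ultimately have "Im (1 - cnj m * n) < 0" using md by (simp add: zero_less_divide_iff)
  then have "Arg (1 - cnj m * n) < 0" by (simp add: Arg_neg_iff)
  moreover have "\<bar>Arg (1 - cnj m * n)\<bar> < pi / 2" by (rule Arg_bounds[OF md(1,2)])
  ultimately have "0 < sar m n" "sar m n < pi" by (auto simp: sar_def)
  then show "0 < sar p q + sar q r + sar r p" "sar p q + sar q r + sar r p < pi"
    using sar_cocycle[OF d] by (simp_all add: m_def n_def)
qed

lemma cis_Arg2pi: "z \<noteq> 0 \<Longrightarrow> cis (Arg2pi z) = sgn z"
  using Arg2pi[of z] unfolding is_Arg_def
  by (metis cis_conv_exp sgn_eq nonzero_mult_div_cancel_left norm_eq_zero of_real_eq_0_iff)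

text \<open>The quantity sinh a sinh b sinh c (cos A + cos B) equals sinh (a + b) (cosh c - cosh (a
  - b)), which is positive by the strict triangle inequality contained in cos C < 1.\<close>

lemma two_angles_less_pi:
  fixes a b c A B C :: real
  assumes "a > 0" "b > 0" "c > 0" "0 < A" "A < pi" "0 < B" "B < pi" "0 < C" "C < pi"
    and cA: "cosh a = cosh b * cosh c - sinh b * sinh c * cos A"
    and cB: "cosh b = cosh c * cosh a - sinh c * sinh a * cos B"
    and cC: "cosh c = cosh a * cosh b - sinh a * sinh b * cos C"
  shows "A + B < pi"
proof -
  have s: "sinh a > 0" "sinh b > 0" "sinh c > 0" using assms(1-3) by simp_all
  have "cos C < cos 0" using assms(8,9) by (intro cos_monotone_0_pi) auto
  then have "sinh a * sinh b * cos C < sinh a * sinh b * 1" using s by simp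
  then have pos: "0 < cosh c - (cosh a * cosh b - sinh a * sinh b)" using cC by linarith
  have e: "sinh b * sinh c * cos A = cosh b * cosh c - cosh a" "sinh c * sinh a * cos B = cosh c * cosh a - cosh b"
    using cA cB by linarith+
  have "sinh a * sinh b * sinh c * (cos A + cos B) = sinh a * (sinh b * sinh c * cos A) + sinh b * (sinh c * sinh a * cos B)"
    by (simp add: algebra_simps)
  also have "\<dots> = (sinh a * cosh b + cosh a * sinh b) * cosh c - (sinh a * cosh a + sinh b * cosh b)"
    unfolding e by (simp add: algebra_simps)
  also have "sinh a * cosh a + sinh b * cosh b = (sinh a * cosh b + cosh a * sinh b) * (cosh a * cosh b - sinh a * sinh b)"
  proof -
    have "(sinh a * cosh b + cosh a * sinh b) * (cosh a * cosh b - sinh a * sinh b)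
       = sinh a * cosh a * ((cosh b)\<^sup>2 - (sinh b)\<^sup>2) + sinh b * cosh b * ((cosh a)\<^sup>2 - (sinh a)\<^sup>2)"
      by (simp add: power2_eq_square algebra_simps)
    then show ?thesis by (simp add: cosh_square_eq)
  qed
  also have "(sinh a * cosh b + cosh a * sinh b) * cosh c - (sinh a * cosh b + cosh a * sinh b) * (cosh a * cosh b - sinh a * sinh b)
     = (sinh a * cosh b + cosh a * sinh b) * (cosh c - (cosh a * cosh b - sinh a * sinh b))"
    by (simp add: algebra_simps)
  also have "\<dots> > 0" using s pos by (intro mult_pos_pos add_pos_pos) auto
  finally have "cos A + cos B > 0" using s by (meson mult_pos_pos zero_less_mult_pos)
  then have "cos (pi - B) < cos A" by simp
  then have "A < pi - B" using assms(4-7) by (subst (asm) cos_mono_less_eq) auto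
  then show ?thesis by simp
qed

text \<open>Gauss-Bonnet. The product of the three quotients defining the angles, times the
  conjugate of U, is - U, while U has argument minus half the area; so angle sum plus area is pi
  modulo full turns. The angles at p and q have sum below pi and the third angle and the area are
  below pi each, which excludes every other multiple.\<close>

lemma
  assumes "pos3 p q r"
  shows angle_sum_area: "ang p q r + ang q r p + ang r p q = pi - (sar p q + sar q r + sar r p)"
    and hyp_triangle_pos3: "hyp_triangle (hyp_dist q r) (hyp_dist r p) (hyp_dist p q) (ang p q r) (ang q r p) (ang r p q)"
proof -
  have d: "cmod p < 1" "cmod q < 1" "cmod r < 1" and ne: "p \<noteq> q" "q \<noteq> r" "p \<noteq> r"
    using assms pos3_distinct[OF assms] by (auto simp: pos3_def)
  note ab = ang_bounds[OF assms] ang_bounds[OF pos3_rotate[OF assms]] ang_bounds[OF pos3_rotate[OF pos3_rotate[OF assms]]]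
  have hs: "hyp_dist z w = hyp_dist w z" for z w by (simp add: hyp_dist_def norm_minus_commute mult.commute)
  have hp: "hyp_dist z w > 0" if "cmod z < 1" "cmod w < 1" "z \<noteq> w" for z w
    using ch_gt_1[OF that] cosh_hyp_dist[OF that(1,2)] hyp_dist_nonneg[OF that(1,2)]
    by (metis cosh_0 less_eq_real_def less_irrefl)
  have c1: "cosh (hyp_dist q r) = cosh (hyp_dist r p) * cosh (hyp_dist p q) - sinh (hyp_dist r p) * sinh (hyp_dist p q) * cos (ang p q r)"
    using cosine_law[OF d ne(1)] d by (simp add: cosh_hyp_dist ch_sym[of r p] hs[of r p])
  have c2: "cosh (hyp_dist r p) = cosh (hyp_dist p q) * cosh (hyp_dist q r) - sinh (hyp_dist p q) * sinh (hyp_dist q r) * cos (ang q r p)"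
    using cosine_law[OF d(2,3,1) ne(2)] d by (simp add: cosh_hyp_dist ch_sym[of q p] hs[of q p])
  have c3: "cosh (hyp_dist p q) = cosh (hyp_dist q r) * cosh (hyp_dist r p) - sinh (hyp_dist q r) * sinh (hyp_dist r p) * cos (ang r p q)"
    using cosine_law[OF d(3,1,2)] ne d by (simp add: cosh_hyp_dist ch_sym[of r q] hs[of r q])
  have lt: "ang p q r + ang q r p < pi"
    by (rule two_angles_less_pi[OF _ _ _ _ _ _ _ _ _ c1 c2 c3]) (use ab hp d ne in auto)
  define \<Sigma> where "\<Sigma> = sar p q + sar q r + sar r p"
  define U where "U = (1 - cnj p * q) * (1 - cnj q * r) * (1 - cnj r * p)"
  have nz: "1 - cnj p * q \<noteq> 0" "1 - cnj q * r \<noteq> 0" "1 - cnj r * p \<noteq> 0"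
    "1 - cnj q * p \<noteq> 0" "1 - cnj r * q \<noteq> 0" "1 - cnj p * r \<noteq> 0"
    using one_minus_cnj_mult_neq d by auto
  have "mob p r / mob p q * (mob q p / mob q r) * (mob r q / mob r p) * cnj U = - U"
  proof -
    have "cnj U = (1 - cnj q * p) * (1 - cnj r * q) * (1 - cnj p * r)" by (simp add: U_def mult.commute)
    then show ?thesis unfolding U_def mob_def using nz ne by (simp add: divide_simps) (simp add: algebra_simps)
  qed
  then have "sgn (mob p r / mob p q) * sgn (mob q p / mob q r) * sgn (mob r q / mob r p) * sgn (cnj U) = - sgn U"
    by (metis sgn_mult sgn_minus)
  moreover have "mob p r / mob p q \<noteq> 0" "mob q p / mob q r \<noteq> 0" "mob r q / mob r p \<noteq> 0"
    using mob_eq_0_iff d ne by auto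
  moreover have U: "sgn U = cis (- \<Sigma> / 2)"
  proof -
    have "sgn U = cis (Arg (1 - cnj p * q)) * cis (Arg (1 - cnj q * r)) * cis (Arg (1 - cnj r * p))"
      using nz by (simp add: U_def sgn_mult cis_Arg)
    also have "\<dots> = cis (Arg (1 - cnj p * q) + Arg (1 - cnj q * r) + Arg (1 - cnj r * p))"
      by (simp only: cis_mult)
    also have "Arg (1 - cnj p * q) + Arg (1 - cnj q * r) + Arg (1 - cnj r * p) = - \<Sigma> / 2"
      by (simp add: \<Sigma>_def sar_def)
    finally show ?thesis .
  qed
  moreover have "sgn (cnj U) = cis (\<Sigma> / 2)"
  proof -
    have "sgn (cnj U) = cnj (sgn U)" by (simp add: sgn_eq)
    then show ?thesis unfolding U by (simp add: cis_cnj)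
  qed
  ultimately have "cis (ang p q r) * cis (ang q r p) * cis (ang r p q) * cis (\<Sigma> / 2) = - cis (- \<Sigma> / 2)"
    by (simp add: ang_def cis_Arg2pi)
  then have "cis (ang p q r + ang q r p + ang r p q + \<Sigma> / 2) = cis (pi - \<Sigma> / 2)"
    by (simp add: cis_mult add.assoc minus_cis)
  then have "cis ((ang p q r + ang q r p + ang r p q + \<Sigma> / 2) - (pi - \<Sigma> / 2)) = 1"
    by (metis cis_divide cis_neq_zero divide_self)
  then have "(ang p q r + ang q r p + ang r p q + \<Sigma> / 2) - (pi - \<Sigma> / 2) = 0"
    using lt ab sar_triangle_bounds[OF assms] by (intro cis_eq_1_imp) (auto simp: \<Sigma>_def)
  then show main: "ang p q r + ang q r p + ang r p q = pi - (sar p q + sar q r + sar r p)"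
    by (simp add: \<Sigma>_def field_simps)
  show "hyp_triangle (hyp_dist q r) (hyp_dist r p) (hyp_dist p q) (ang p q r) (ang q r p) (ang r p q)"
    by (rule hyp_triangle.intro[OF _ _ _ _ _ _ _ c1 c2 c3])
      (use ab hp d ne sar_triangle_bounds[OF assms] main in auto)
qed

section \<open>The isoperimetric inequality for a single edge\<close>

lemma cos_cosh_le_1:
  assumes "0 \<le> x" "x \<le> pi / 2" shows "cos x * cosh x \<le> (1::real)"
proof -
  have g: "sin y * cosh y - cos y * sinh y \<ge> 0" if "0 \<le> y" "y \<le> pi / 2" for y :: real
  proof -
    have "sin 0 * cosh 0 - cos 0 * sinh 0 \<le> sin y * cosh y - cos y * sinh y"
    proof (rule DERIV_nonneg_imp_nondecreasing[OF that(1)])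
      fix t assume t: "0 \<le> t" "t \<le> y"
      have "((\<lambda>t. sin t * cosh t - cos t * sinh t) has_real_derivative (2 * sin t * sinh t)) (at t)"
        by (auto intro!: derivative_eq_intros simp: algebra_simps)
      moreover have "2 * sin t * sinh t \<ge> 0" using t that by (intro mult_nonneg_nonneg sin_ge_zero) auto
      ultimately show "\<exists>D. ((\<lambda>t. sin t * cosh t - cos t * sinh t) has_real_derivative D) (at t) \<and> 0 \<le> D" by blast
    qed
    then show ?thesis by simp
  qed
  have "cos x * cosh x \<le> cos 0 * cosh 0"
  proof (rule DERIV_nonpos_imp_nonincreasing[OF assms(1)])
    fix t assume t: "0 \<le> t" "t \<le> x"
    have "((\<lambda>t. cos t * cosh t) has_real_derivative (- (sin t * cosh t - cos t * sinh t))) (at t)"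
      by (auto intro!: derivative_eq_intros simp: algebra_simps)
    moreover have "- (sin t * cosh t - cos t * sinh t) \<le> 0" using g[of t] t assms by auto
    ultimately show "\<exists>D. ((\<lambda>t. cos t * cosh t) has_real_derivative D) (at t) \<and> D \<le> 0" by blast
  qed
  then show ?thesis by simp
qed

text \<open>Let \<phi> be half the area and t half the length. Estimating the real part of
  \<open>1 - cnj z * w\<close> gives 1 \<le> cos \<phi> cosh t, whereas cos \<phi> cosh \<phi> \<le>
  1; hence \<phi> \<le> t. Summed over a boundary, area is at most perimeter.\<close>

lemma sar_le_dist:
  assumes "cmod z < 1" "cmod w < 1"
  shows "\<bar>sar z w\<bar> \<le> hyp_dist z w"
proof (rule ccontr)
  define t \<phi> where "t = hyp_dist z w / 2" and "\<phi> = \<bar>Arg (1 - cnj z * w)\<bar>"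
  assume "\<not> ?thesis"
  then have lt: "t < \<phi>" by (simp add: sar_def t_def \<phi>_def abs_mult)
  have t: "0 \<le> t" using hyp_dist_nonneg assms by (simp add: t_def)
  have \<phi>: "\<phi> < pi / 2" using Arg_bounds[OF assms] by (simp add: \<phi>_def)
  define v where "v = 1 - cnj z * w"
  have v: "v \<noteq> 0" "Re v > 0" using one_minus_cnj_mult_neq one_minus_cnj_mult_pos assms by (auto simp: v_def)
  have cphi: "cmod v * cos \<phi> = Re v"
    using v by (simp add: \<phi>_def v_def[symmetric] cos_Arg)
  define Y X where "Y = (1 - (cmod z)\<^sup>2) * (1 - (cmod w)\<^sup>2)" and "X = (cmod (z - w))\<^sup>2"
  have Y: "Y > 0" using disc_sq assms by (simp add: Y_def)
  have X: "X \<ge> 0" by (simp add: X_def)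
  have v2: "(cmod v)\<^sup>2 = Y + X"
    unfolding v_def Y_def X_def cmod_power2 by (simp add: power2_eq_square algebra_simps)
  have imv: "(Im v)\<^sup>2 \<le> X"
  proof -
    have "\<bar>Im v\<bar> = \<bar>Im (cnj z * (z - w))\<bar>" by (simp add: v_def algebra_simps)
    also have "\<dots> \<le> cmod (cnj z * (z - w))" by (rule abs_Im_le_cmod)
    also have "\<dots> \<le> 1 * cmod (z - w)" unfolding norm_mult using assms by (intro mult_right_mono) auto
    finally have "\<bar>Im v\<bar>\<^sup>2 \<le> (cmod (z - w))\<^sup>2" by (intro power_mono) auto
    then show ?thesis by (simp add: X_def)
  qed
  have "(cosh t)\<^sup>2 = 1 + X / Y"
    unfolding t_def cosh_half_sq cosh_hyp_dist[OF assms] ch_def X_def Y_def by (simp add: field_simps)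
  then have ct: "(cosh t)\<^sup>2 * Y = Y + X" using Y by (simp add: field_simps)
  have "Y \<le> (Re v)\<^sup>2" using v2 imv unfolding cmod_power2 by simp
  then have "(cosh t)\<^sup>2 * Y \<le> (cosh t)\<^sup>2 * (Re v)\<^sup>2" by (intro mult_left_mono) auto
  then have "(cmod v)\<^sup>2 * 1 \<le> (cmod v)\<^sup>2 * (cos \<phi> * cosh t)\<^sup>2"
    unfolding cphi[symmetric] ct v2[symmetric] by (simp add: power_mult_distrib ac_simps)
  then have "1 \<le> (cos \<phi> * cosh t)\<^sup>2" using v by simp
  moreover have "cos \<phi> > 0" using \<phi> lt t by (intro cos_gt_zero_pi) auto
  ultimately have "1 \<le> cos \<phi> * cosh t" by (metis abs_le_square_iff abs_of_pos cosh_real_pos mult_pos_pos one_power2 power2_le_imp_le less_imp_le)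
  also have "\<dots> < cos \<phi> * cosh \<phi>"
    using \<open>cos \<phi> > 0\<close> lt t by (simp add: cosh_real_nonneg_less_iff)
  also have "\<dots> \<le> 1" using \<phi> lt t by (intro cos_cosh_le_1) auto
  finally show False by simp
qed

section \<open>Delaunay edges\<close>

definition excess :: "complex \<Rightarrow> complex \<Rightarrow> complex \<Rightarrow> real" where
  "excess p q r = ang p q r + ang q r p - ang r p q"

text \<open>The first two factors carry the inscribed angle over pq. The last factor turns the
  Euclidean chord into the hyperbolic one: the imaginary part becomes minus the orientation
  polynomial of \<open>crs_klein\<close>.\<close>

definition chordW :: "complex \<Rightarrow> complex \<Rightarrow> complex \<Rightarrow> complex" where
  "chordW p q r = (r - p) * cnj (r - q) * (1 - cnj p * q)"

lemma chordW_swap: "chordW q p s = cnj (chordW p q s)"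
  by (simp add: chordW_def mult.commute)

lemma Im_chordW: "Im (chordW p q r) = - ((1 + (cmod p)\<^sup>2) * Im (cnj q * r)
    + (1 + (cmod q)\<^sup>2) * Im (cnj r * p) + (1 + (cmod r)\<^sup>2) * Im (cnj p * q))"
  unfolding cmod_power2 chordW_def by (simp add: power2_eq_square algebra_simps)

lemma Im_chordW_neg: assumes "pos3 p q r" shows "Im (chordW p q r) < 0"
proof -
  define k where "k = (1 + (cmod p)\<^sup>2) * (1 + (cmod q)\<^sup>2) * (1 + (cmod r)\<^sup>2)"
  have "k > 0" by (simp add: k_def add_pos_nonneg)
  moreover have "crs (klein p) (klein q) (klein r) > 0" using assms by (simp add: pos3_def)
  ultimately have "crs (klein p) (klein q) (klein r) * k > 0" by simp
  then show ?thesis unfolding k_def crs_klein Im_chordW by simp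
qed

text \<open>Up to a positive factor, \<open>\<i> W\<close> squares to the quotient of unit complex numbers with
  argument \<open>excess\<close>; so the excess is the angle between the edge and the circumradius, doubled.\<close>

lemma excess_eq:
  assumes "pos3 p q r"
  shows "excess p q r = 2 * Arg (\<i> * chordW p q r)"
proof -
  have d: "cmod p < 1" "cmod q < 1" "cmod r < 1" and ne: "p \<noteq> q" "q \<noteq> r" "p \<noteq> r"
    using assms pos3_distinct[OF assms] by (auto simp: pos3_def)
  define V where "V = \<i> * chordW p q r"
  have ReV: "Re V > 0" using Im_chordW_neg[OF assms] by (simp add: V_def)
  then have V0: "V \<noteq> 0" by auto
  define K1 K2 where "K1 = (cmod (1 - cnj p * r))\<^sup>2 * ((cmod (r - q))\<^sup>2)\<^sup>2 * (cmod (1 - cnj p * q))\<^sup>2"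
    and "K2 = (cmod (1 - cnj q * r))\<^sup>2"
  have nz: "1 - cnj p * q \<noteq> 0" "1 - cnj q * r \<noteq> 0" "1 - cnj r * p \<noteq> 0"
    "1 - cnj q * p \<noteq> 0" "1 - cnj r * q \<noteq> 0" "1 - cnj p * r \<noteq> 0"
    using one_minus_cnj_mult_neq d by auto
  have K: "K1 > 0" "K2 > 0" using nz ne by (auto simp: K1_def K2_def)
  have c: "of_real ((cmod x)\<^sup>2) = x * cnj x" for x by (simp add: complex_norm_square flip: of_real_power)
  have K1c: "of_real K1 = (1 - cnj p * r) * (1 - cnj r * p) * ((r - q) * cnj (r - q))\<^sup>2 * ((1 - cnj p * q) * (1 - cnj q * p))"
    unfolding K1_def of_real_mult of_real_power[of "(cmod (r - q))\<^sup>2" 2] c by (simp add: mult.commute)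
  have K2c: "of_real K2 = (1 - cnj q * r) * (1 - cnj r * q)"
    unfolding K2_def c by (simp add: mult.commute)
  have gen: "e / w / (- g / u) * (g / u' / (f / v)) * (w * w' * (f * f')\<^sup>2 * (u * u'))
      = (- f / v') / (- e / w') * (\<i> * (e * f' * u))\<^sup>2 * (v * v')"
    if "e \<noteq> 0" "f \<noteq> 0" "g \<noteq> 0" "u \<noteq> 0" "u' \<noteq> 0" "v \<noteq> 0" "v' \<noteq> 0" "w \<noteq> 0" "w' \<noteq> 0"
    for e f f' g u u' v v' w w' :: complex
    using that by (simp add: power_mult_distrib power2_eq_square field_simps)
  have "mob p r / mob p q * (mob q p / mob q r) * of_real K1 = mob r q / mob r p * V\<^sup>2 * of_real K2"
  proof -
    have "r - p \<noteq> 0" "r - q \<noteq> 0" "p - q \<noteq> 0" using ne by auto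
    from gen[OF this nz(1) nz(4) nz(2) nz(5) nz(6) nz(3), of "cnj (r - q)"]
    show ?thesis unfolding K1c K2c V_def chordW_def mob_def by simp
  qed
  then have "sgn (mob p r / mob p q) * sgn (mob q p / mob q r) * sgn (of_real K1)
      = sgn (mob r q / mob r p) * (sgn V * sgn V) * sgn (of_real K2)"
    by (metis sgn_mult power2_eq_square)
  moreover have "mob p r / mob p q \<noteq> 0" "mob q p / mob q r \<noteq> 0" "mob r q / mob r p \<noteq> 0"
    using mob_eq_0_iff d ne by auto
  ultimately have "cis (ang p q r) * cis (ang q r p) = cis (ang r p q) * (cis (Arg V) * cis (Arg V))"
    using K V0 by (simp add: ang_def cis_Arg2pi cis_Arg sgn_of_real_pos)
  then have "cis (ang p q r + ang q r p) = cis (ang r p q + (Arg V + Arg V))" by (simp only: cis_mult)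
  then have "cis ((ang p q r + ang q r p) - (ang r p q + (Arg V + Arg V))) = 1"
    by (metis cis_divide cis_neq_zero divide_self)
  moreover have "\<bar>Arg V\<bar> < pi / 2" using ReV Arg_Re_pos by blast
  ultimately have "(ang p q r + ang q r p) - (ang r p q + (Arg V + Arg V)) = 0"
    using ang_bounds[OF assms] ang_bounds[OF pos3_rotate[OF assms]] ang_bounds[OF pos3_rotate[OF pos3_rotate[OF assms]]]
      hyp_triangle.angle_sum[OF hyp_triangle_pos3[OF assms]]
    by (intro cis_eq_1_imp) auto
  then show ?thesis by (simp add: excess_def V_def)
qed

text \<open>The circles through p and q form a real pencil. Its parameter \<kappa> has the
  coefficient of |z|^2 as real part, and the imaginary part moves the centre along the bisector; F p
  = F q forces the linear part into this form.\<close>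

lemma circle_through_two:
  assumes "p \<noteq> q" "\<And>z. F z = a * (cmod z)\<^sup>2 + 2 * inner w z + b" "F p = 0" "F q = 0"
  obtains \<kappa> where "\<And>z. F z = Re (\<kappa> * ((z - p) * cnj (z - q)))" "Re \<kappa> = a"
proof -
  define u where "u = 2 * cnj w + of_real a * (cnj p + cnj q)"
  have "Re (u * (p - q)) = F p - F q"
    unfolding assms(2) cmod_power2 by (simp add: u_def inner_complex_def power2_eq_square algebra_simps)
  then have "u * (p - q) = \<i> * of_real (Im (u * (p - q)))" using assms by (simp add: complex_eq_iff)
  then have e: "u * ((p - q) * cnj (p - q)) = \<i> * of_real (Im (u * (p - q))) * cnj (p - q)"
    by (metis mult.assoc)
  have n: "(p - q) * cnj (p - q) = of_real ((cmod (p - q))\<^sup>2)" by (simp add: complex_norm_square flip: of_real_power)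
  have "u * of_real ((cmod (p - q))\<^sup>2) = \<i> * of_real (Im (u * (p - q))) * cnj (p - q)"
    using e unfolding n .
  moreover have "of_real ((cmod (p - q))\<^sup>2) \<noteq> (0 :: complex)" using assms(1) by simp
  ultimately have "u = \<i> * of_real (Im (u * (p - q))) * cnj (p - q) / of_real ((cmod (p - q))\<^sup>2)"
    by (metis nonzero_eq_divide_eq)
  then have u: "u = \<i> * of_real (Im (u * (p - q)) / (cmod (p - q))\<^sup>2) * cnj (p - q)"
    by (simp only: of_real_divide times_divide_eq_left times_divide_eq_right)
  define y where "y = Im (u * (p - q)) / (cmod (p - q))\<^sup>2"
  define \<kappa> where "\<kappa> = Complex a y"
  have u': "u = \<i> * of_real y * cnj (p - q)" using u by (simp add: y_def)
  have "F z - F p = Re (\<kappa> * ((z - p) * cnj (z - q)))" for z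
  proof -
    have "Re u = y * (Im p - Im q)" "Im u = y * (Re p - Re q)" unfolding u' by (simp_all add: algebra_simps)
    then have w: "2 * Re w = y * (Im p - Im q) - a * (Re p + Re q)" "2 * Im w = - y * (Re p - Re q) - a * (Im p + Im q)"
      by (simp_all add: u_def algebra_simps)
    have "F z - F p = a * ((cmod z)\<^sup>2 - (cmod p)\<^sup>2) + (2 * Re w) * (Re z - Re p) + (2 * Im w) * (Im z - Im p)"
      unfolding assms(2) by (simp add: inner_complex_def algebra_simps)
    also have "\<dots> = Re (\<kappa> * ((z - p) * cnj (z - q)))"
      unfolding w cmod_power2 \<kappa>_def by (simp add: power2_eq_square algebra_simps)
    finally show ?thesis .
  qed
  then show thesis using that[of \<kappa>] assms(3) by (simp add: \<kappa>_def)
qed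

text \<open>F is the equation of the curve through p, q, r, which s does not enter. In the pencil of
  curves through p and q it is Re (k W) with W = \<open>chordW p q\<close>, so F r = 0 and F s \<le>
  0 compare the arguments of W at r and s, and these are the two excesses.\<close>

lemma delaunay_excess:
  assumes r: "pos3 p q r" and s: "pos3 q p s"
    and l: "aff l (klein p) = klein_height p" "aff l (klein q) = klein_height q" "aff l (klein r) = klein_height r"
    and le: "aff l (klein s) \<le> klein_height s"
  shows "excess p q r + excess q p s \<ge> 0"
proof -
  have d: "cmod p < 1" "cmod q < 1" and ne: "p \<noteq> q"
    using r pos3_distinct[OF r] by (auto simp: pos3_def)
  define a where "a = fst l - 1"
  define F where "F z = a * (cmod z)\<^sup>2 + 2 * inner (snd l) z + (a + 2)" for z
  have F: "F z = (aff l (klein z) - klein_height z) * (1 + (cmod z)\<^sup>2)" for z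
  proof -
    have m: "1 + (cmod z)\<^sup>2 \<noteq> 0" by (metis add_pos_nonneg less_irrefl zero_le_power2 zero_less_one)
    have l: "aff l (klein z) = fst l + 2 * inner (snd l) z / (1 + (cmod z)\<^sup>2)"
      by (simp add: aff_def klein_def)
    have gen: "(c - 1) * y + 2 * x + (c - 1 + 2) = (c + 2 * x / m - - (1 - y) / m) * m"
      if "y = m - 1" "m \<noteq> 0" for c x m y :: real
      using that(2) unfolding that(1) by (simp add: field_simps)
    show ?thesis unfolding F_def a_def l klein_height_def by (rule gen) (use m in auto)
  qed
  have F0: "F p = 0" "F q = 0" "F r = 0" unfolding F l by simp_all
  have Fs: "F s \<le> 0" unfolding F using le by (intro mult_nonpos_nonneg) auto
  obtain \<kappa> where \<kappa>: "\<And>z. F z = Re (\<kappa> * ((z - p) * cnj (z - q)))" "Re \<kappa> = a"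
    using circle_through_two[OF ne F_def F0(1,2)] by blast
  define v where "v = 1 - cnj p * q"
  have v: "v \<noteq> 0" using one_minus_cnj_mult_neq d by (simp add: v_def)
  define k where "k = \<kappa> / v"
  have k: "\<kappa> = k * v" using v by (simp add: k_def)
  have FW: "F z = Re k * Re (chordW p q z) - Im k * Im (chordW p q z)" for z
  proof -
    have "F z = Re (k * chordW p q z)" unfolding \<kappa> k chordW_def v_def by (simp add: ac_simps)
    then show ?thesis by simp
  qed
  \<comment> \<open>The coefficient of |z|^2 and the constant term of F differ by 2, a trace of the
    hemisphere. This fixes the sign of Re k whatever kind of curve F describes.\<close>
  have k1: "Re k < 0"
  proof -
    have "Re (\<kappa> * (p * cnj q)) = a + 2" using \<kappa>(1)[of 0] by (simp add: F_def)
    then have "Re (\<kappa> * (p * cnj q - 1)) = 2" using \<kappa>(2) by (simp add: algebra_simps)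
    moreover have "\<kappa> * (p * cnj q - 1) = - (k * of_real ((cmod v)\<^sup>2))"
    proof -
      have c: "of_real ((cmod v)\<^sup>2) = v * cnj v" by (simp add: complex_norm_square flip: of_real_power)
      have pq: "p * cnj q - 1 = - cnj v" by (simp add: v_def)
      show ?thesis unfolding k pq c by (simp add: mult.assoc)
    qed
    ultimately have "- (Re k * (cmod v)\<^sup>2) = 2" by simp
    then have "Re k * (cmod v)\<^sup>2 < 0" by linarith
    then show ?thesis using v by (simp add: mult_less_0_iff)
  qed
  define R S where "R = chordW p q r" and "S = chordW p q s"
  have R: "Im R < 0" using Im_chordW_neg[OF r] by (simp add: R_def)
  have S: "Im S > 0" using Im_chordW_neg[OF s] unfolding chordW_swap[of q p] by (simp add: S_def)
  have e1: "Re k * Re R = Im k * Im R" using F0(3) unfolding FW R_def by simp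
  have "Re k * (Re R * Im S - Im R * Re S) = - Im R * (Re k * Re S - Im k * Im S)"
    using arg_cong[OF e1, of "\<lambda>x. x * Im S"] by (simp add: algebra_simps)
  also have "\<dots> \<le> 0" using Fs R unfolding FW[of s] S_def[symmetric] by (intro mult_nonneg_nonpos) auto
  finally have key: "Re R * Im S - Im R * Re S \<ge> 0" using k1 by (simp add: mult_le_0_iff)
  define V1 V2 where "V1 = \<i> * R" and "V2 = \<i> * cnj S"
  have V: "Re V1 > 0" "Re V2 > 0" using R S by (simp_all add: V1_def V2_def)
  then have V0: "V1 \<noteq> 0" "V2 \<noteq> 0" by auto
  have ar: "\<bar>Arg V1\<bar> < pi / 2" "\<bar>Arg V2\<bar> < pi / 2" using V Arg_Re_pos by blast+
  have "cis (Arg V1 + Arg V2) = sgn (V1 * V2)" using V0 by (simp add: cis_Arg sgn_mult flip: cis_mult)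
  then have "sin (Arg V1 + Arg V2) = Im (sgn (V1 * V2))" by (metis cis.sel(2))
  also have "\<dots> = Im (V1 * V2) / cmod (V1 * V2)" by (simp add: Im_sgn)
  also have "\<dots> \<ge> 0" using key by (intro divide_nonneg_nonneg) (auto simp: V1_def V2_def algebra_simps)
  finally have sn: "sin (Arg V1 + Arg V2) \<ge> 0" .
  have "Arg V1 + Arg V2 \<ge> 0"
  proof (rule ccontr)
    assume "\<not> ?thesis"
    then have "sin (- (Arg V1 + Arg V2)) > 0" using ar by (intro sin_gt_zero) auto
    then show False using sn by (simp only: sin_minus)
  qed
  then show ?thesis unfolding excess_eq[OF r] excess_eq[OF s] chordW_swap[of q p]
    by (simp add: V1_def V2_def R_def S_def)
qed

text \<open>The plane of the circle with diameter pq. The sum of p and q on the hyperboloid is a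
  multiple of their midpoint, so \<open>ch p s + ch q s\<close> measures the distance of s from it:
  the sum is 1 + cosh d at p and q, and at least 2 cosh d at every other centre.\<close>

lemma contact_support:
  assumes d: "d > 0" and p: "cmod p < 1" and q: "cmod q < 1" and c: "ch p q = cosh d"
    and S: "\<And>s. s \<in> S \<Longrightarrow> cmod s < 1 \<and> cosh d \<le> ch p s \<and> cosh d \<le> ch q s"
  shows "\<exists>l. aff l (klein p) = klein_height p \<and> aff l (klein q) = klein_height q
    \<and> (\<forall>s\<in>S. aff l (klein s) < klein_height s)"
proof -
  define K where "K = 1 + cosh d"
  have K: "K > 0" using cosh_gt_1[OF d] by (simp add: K_def)
  define hp hq where "hp = klein_height p" and "hq = klein_height q"
  have h: "hp < 0" "hq < 0" using klein_height_neg p q by (auto simp: hp_def hq_def)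
  define l where "l = ((1 / hp + 1 / hq) / K, - ((1 / (hp * K)) *\<^sub>R klein p + (1 / (hq * K)) *\<^sub>R klein q))"
  have l: "aff l (klein s) = klein_height s * ((ch p s + ch q s) / K)" if "cmod s < 1" for s
  proof -
    have "aff l (klein s) = ((1 - inner (klein p) (klein s)) / hp + (1 - inner (klein q) (klein s)) / hq) / K"
      using h K by (simp add: l_def aff_def inner_add_left inner_diff_left field_simps)
    also have "1 - inner (klein p) (klein s) = ch p s * hp * klein_height s"
      using klein_ch[OF p that] by (simp add: hp_def)
    also have "1 - inner (klein q) (klein s) = ch q s * hq * klein_height s"
      using klein_ch[OF q that] by (simp add: hq_def)
    finally show ?thesis using h K by (simp add: field_simps)
  qed
  have "ch p p = 1" "ch q q = 1" by (simp_all add: ch_def)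
  then have "aff l (klein p) = klein_height p" "aff l (klein q) = klein_height q"
    using l[OF p] l[OF q] c K by (simp_all add: ch_sym[of q p] K_def add.commute[of "cosh d" 1])
  moreover have "aff l (klein s) < klein_height s" if "s \<in> S" for s
  proof -
    have "cmod s < 1" "ch p s + ch q s \<ge> 2 * cosh d" using S[OF that] by auto
    then have "(ch p s + ch q s) / K > 1" using cosh_gt_1[OF d] K by (simp add: K_def)
    then have "klein_height s * ((ch p s + ch q s) / K) < klein_height s * 1"
      using klein_height_neg[OF \<open>cmod s < 1\<close>] by (rule mult_strict_left_mono_neg)
    then show ?thesis using l[OF \<open>cmod s < 1\<close>] by simp
  qed
  ultimately show ?thesis by blast
qed

section \<open>Fans of triangles around a vertex\<close>

text \<open>The differential of the chart change from the disc model centred at \<open>v\<close> to the Klein model.\<close>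

lemma klein_mob_diff:
  assumes "cmod v < 1" "cmod a < 1"
  shows "\<exists>k>0. klein a - klein v = of_real k * (mob v a - v\<^sup>2 * cnj (mob v a))"
proof -
  define A V D where "A = 1 + (cmod a)\<^sup>2" and "V = 1 + (cmod v)\<^sup>2" and "D = (cmod (1 - cnj v * a))\<^sup>2"
  have n: "1 - cnj v * a \<noteq> 0" "1 - v * cnj a \<noteq> 0"
    using one_minus_cnj_mult_neq[of v a] one_minus_cnj_mult_neq[of a v] assms by (auto simp: mult.commute)
  have pos: "A > 0" "V > 0" "D > 0" "1 - (cmod v)\<^sup>2 > 0"
    using n disc_sq assms by (auto simp: A_def V_def D_def add_pos_nonneg)
  have c: "of_real ((cmod x)\<^sup>2) = x * cnj x" for x by (simp add: complex_norm_square flip: of_real_power)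
  have AV: "of_real A = 1 + a * cnj a" "of_real V = 1 + v * cnj v" "of_real (1 - (cmod v)\<^sup>2) = 1 - v * cnj v"
    "of_real D = (1 - cnj v * a) * (1 - v * cnj a)"
    unfolding A_def V_def D_def of_real_add of_real_diff c by simp_all
  have "of_real D * (mob v a - v\<^sup>2 * cnj (mob v a)) = (a - v) * (1 - v * cnj a) - v\<^sup>2 * (cnj a - cnj v) * (1 - cnj v * a)"
  proof -
    have "x * y * (e / x - w * (f / y)) = e * y - w * f * x" if "x \<noteq> 0" "y \<noteq> 0" for x y e f w :: complex
      using that by (simp add: field_simps)
    from this[OF n] show ?thesis unfolding AV mob_def by simp
  qed
  also have "\<dots> = (1 - v * cnj v) * (a * (1 + v * cnj v) - v * (1 + a * cnj a))"
    by (simp add: power2_eq_square algebra_simps)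
  finally have e: "of_real D * (mob v a - v\<^sup>2 * cnj (mob v a)) = of_real (1 - (cmod v)\<^sup>2) * (a * of_real V - v * of_real A)"
    unfolding AV .
  have "klein a - klein v = of_real (2 / A) * a - of_real (2 / V) * v"
    by (simp add: klein_def A_def V_def scaleR_conv_of_real)
  also have "\<dots> = of_real (2 / (A * V)) * (a * of_real V - v * of_real A)"
    using pos by (simp add: field_simps)
  also have "\<dots> = of_real (2 / (A * V * (1 - (cmod v)\<^sup>2))) * (of_real (1 - (cmod v)\<^sup>2) * (a * of_real V - v * of_real A))"
  proof -
    have "of_real (2 / X) * Y = of_real (2 / (X * M)) * (of_real M * Y)" if "M > 0" for X M :: real and Y :: complex
      using that by simp
    from this[OF pos(4)] show ?thesis .
  qed
  also have "\<dots> = of_real (2 * D / (A * V * (1 - (cmod v)\<^sup>2))) * (mob v a - v\<^sup>2 * cnj (mob v a))"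
    unfolding e[symmetric] by simp
  finally show ?thesis using pos by (intro exI[of _ "2 * D / (A * V * (1 - (cmod v)\<^sup>2))"]) auto
qed

lemma ang_range: "0 \<le> ang v b a" "ang v b a < 2 * pi"
  unfolding ang_def using Arg2pi[of "mob v a / mob v b"] by auto

lemma ang_self: "cmod v < 1 \<Longrightarrow> cmod b < 1 \<Longrightarrow> b \<noteq> v \<Longrightarrow> ang v b b = 0"
  using mob_eq_0_iff[of v b] by (simp add: ang_def Arg2pi_eq_0)

lemma ang_relative:
  assumes "cmod v < 1" "cmod a < 1" "cmod b < 1" "cmod c < 1" "a \<noteq> v" "b \<noteq> v" "c \<noteq> v"
  shows "ang v a c = (if ang v b a \<le> ang v b c then ang v b c - ang v b a else ang v b c - ang v b a + 2 * pi)"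
proof -
  have n: "mob v a \<noteq> 0" "mob v b \<noteq> 0" "mob v c \<noteq> 0" using mob_eq_0_iff assms by auto
  have "(mob v c / mob v b) / (mob v a / mob v b) = mob v c / mob v a" using n by simp
  moreover have "mob v c / mob v b \<noteq> 0" "mob v a / mob v b \<noteq> 0" using n by auto
  ultimately show ?thesis using Arg2pi_diff[of "mob v c / mob v b" "mob v a / mob v b"]
    unfolding ang_def by (auto split: if_splits)
qed

text \<open>\<open>weakly_delaunay\<close> refers to the unperturbed heights and is not strict: the
  perturbation breaks ties between points on a common circle, and their plane touches all of
  them.\<close>

locale packing =
  fixes P :: "complex set" and d :: real and h :: "complex \<Rightarrow> real"
  assumes d_pos: "d > 0" and P_disc: "\<And>p. p \<in> P \<Longrightarrow> cmod p < 1"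
    and separated: "\<And>p q. p \<in> P \<Longrightarrow> q \<in> P \<Longrightarrow> p \<noteq> q \<Longrightarrow> cosh d \<le> ch p q"
    and triangulation: "regular_triangulation P klein h"
    and contact_edge: "\<And>p q. p \<in> P \<Longrightarrow> q \<in> P \<Longrightarrow> ch p q = cosh d \<Longrightarrow> regular_triangulation.edge P klein h p q"
    and weakly_delaunay: "\<And>u v w s. regular_triangulation.tri P klein h u v w \<Longrightarrow> s \<in> P \<Longrightarrow>
       \<exists>l. aff l (klein u) = klein_height u \<and> aff l (klein v) = klein_height v
         \<and> aff l (klein w) = klein_height w \<and> aff l (klein s) \<le> klein_height s"
begin

sublocale regular_triangulation P klein h by (rule triangulation)

abbreviation (input) \<alpha> :: real where "\<alpha> \<equiv> alpha d"

definition con :: "(complex \<times> complex) set" where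
  "con = {(u, v). u \<in> P \<and> v \<in> P \<and> ch u v = cosh d}"

lemma con_sym: "(u, v) \<in> con \<longleftrightarrow> (v, u) \<in> con"
  by (auto simp: con_def ch_sym)

lemma con_darts: "con \<subseteq> darts"
  using contact_edge by (auto simp: con_def darts_def)

lemma finite_con: "finite con"
  using con_darts finite_darts finite_subset by blast

lemma dart_in_P: "(u, v) \<in> darts \<Longrightarrow> u \<in> P \<and> v \<in> P \<and> u \<noteq> v"
  by (auto simp: darts_def dest: edge_in_P)

lemma darts_sym: "(u, v) \<in> darts \<longleftrightarrow> (v, u) \<in> darts"
  by (auto simp: darts_def edge_sym)

lemma tri_pos3: "tri u v w \<Longrightarrow> pos3 u v w"
  using tri_pos tri_in_P P_disc by (auto simp: pos3_def)

subsection \<open>Inner and outer darts\<close>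

text \<open>The left triangle of a dart is outer if it can be reached from outside the convex hull
  without crossing a contact edge; \<open>layer n\<close> collects those reachable by at most \<open>n\<close> crossings.\<close>

definition orb :: "complex \<times> complex \<Rightarrow> (complex \<times> complex) set" where
  "orb \<delta> = {\<delta>, rot \<delta>, rot (rot \<delta>)}"

primrec layer :: "nat \<Rightarrow> (complex \<times> complex) set" where
  "layer 0 = {}"
| "layer (Suc n) = {\<delta> \<in> inner_darts. \<exists>\<epsilon>\<in>orb \<delta>. \<epsilon> \<notin> con \<and> (prod.swap \<epsilon> \<in> inner_darts \<longrightarrow> prod.swap \<epsilon> \<in> layer n)}"

definition outer :: "(complex \<times> complex) set" where "outer = (\<Union>n. layer n)"

definition In :: "(complex \<times> complex) set" where "In = inner_darts - outer"

definition hull_darts :: "(complex \<times> complex) set" where "hull_darts = darts - inner_darts"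

lemma orb_rot: "\<delta> \<in> inner_darts \<Longrightarrow> orb (rot \<delta>) = orb \<delta>"
  by (auto simp: orb_def rot3)

lemma layer_subset: "layer n \<subseteq> inner_darts"
  by (cases n) auto

lemma outer_subset: "outer \<subseteq> inner_darts"
  using layer_subset by (auto simp: outer_def)

lemma layer_rot: "\<delta> \<in> layer n \<Longrightarrow> rot \<delta> \<in> layer n"
  by (cases n) (auto simp: orb_rot rot_inner)

lemma outer_rot: "\<delta> \<in> outer \<Longrightarrow> rot \<delta> \<in> outer"
  unfolding outer_def using layer_rot by blast

lemma In_inner: "\<delta> \<in> In \<Longrightarrow> \<delta> \<in> inner_darts"
  by (simp add: In_def)

lemma In_rot: "\<delta> \<in> In \<Longrightarrow> rot \<delta> \<in> In"
  by (metis DiffD1 DiffD2 DiffI In_def outer_rot rot3 rot_inner)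

lemma outer_boundary:
  assumes "\<delta> \<in> inner_darts" "prod.swap \<delta> \<notin> inner_darts" "\<delta> \<notin> con" shows "\<delta> \<in> outer"
proof -
  have "\<delta> \<in> layer (Suc 0)" using assms by (auto simp: orb_def)
  then show ?thesis unfolding outer_def by blast
qed

lemma outer_cross:
  assumes "\<delta> \<in> outer" "prod.swap \<delta> \<in> inner_darts" "\<delta> \<notin> con" shows "prod.swap \<delta> \<in> outer"
proof -
  obtain n where "\<delta> \<in> layer n" using assms(1) by (auto simp: outer_def)
  moreover have "prod.swap \<delta> \<notin> con" using assms(3) con_sym by (cases \<delta>) auto
  ultimately have "prod.swap \<delta> \<in> layer (Suc n)" using assms(2) by (auto simp: orb_def)
  then show ?thesis unfolding outer_def by blast
qed

text \<open>This is the purpose of the layers: beyond a non-contact side of an inner triangle there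
  is again an inner triangle, so discharging across such sides never leaves
  \<open>In\<close>.\<close>

lemma In_cross: "\<delta> \<in> In \<Longrightarrow> \<delta> \<notin> con \<Longrightarrow> prod.swap \<delta> \<in> In"
  using outer_boundary[of \<delta>] outer_cross[of "prod.swap \<delta>"] con_sym
  by (cases \<delta>) (auto simp: In_def)

lemma finite_In: "finite In"
  using finite_inner_darts by (simp add: In_def)

lemma sum_In_rot: "(\<Sum>\<delta>\<in>In. f (rot \<delta>)) = (\<Sum>\<delta>\<in>In. f \<delta>)"
  by (rule sum_rot) (auto simp: In_inner In_rot)

text \<open>Every outer triangle has a side leading one layer outwards, and different triangles
  use different edges.\<close>

lemma card_outer: "2 * card outer \<le> 3 * card ((outer \<union> hull_darts) - con)"
proof -
  define rank where "rank \<delta> = (LEAST n. \<delta> \<in> layer n)" for \<delta>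
  have rank_in: "\<delta> \<in> layer (rank \<delta>)" if "\<delta> \<in> outer" for \<delta>
    using that unfolding rank_def outer_def by (auto intro: LeastI)
  have rank_le: "rank \<delta> \<le> n" if "\<delta> \<in> layer n" for \<delta> n
    unfolding rank_def using that by (rule Least_le)
  \<comment> \<open>The exits, across which the layer number drops. It cannot drop in both
    directions, so X and its mirror image are disjoint sets of non-contact darts.\<close>
  define X where "X = {\<epsilon> \<in> outer. \<epsilon> \<notin> con \<and> (prod.swap \<epsilon> \<in> inner_darts \<longrightarrow> prod.swap \<epsilon> \<in> outer \<and> rank (prod.swap \<epsilon>) < rank \<epsilon>)}"
  have finO: "finite outer" using outer_subset finite_inner_darts finite_subset by blast
  have finX: "finite X" using finO by (simp add: X_def)
  have exit: "\<exists>\<epsilon>\<in>orb \<delta>. \<epsilon> \<in> X" if o: "\<delta> \<in> outer" for \<delta>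
  proof -
    have i: "\<delta> \<in> inner_darts" using o outer_subset by auto
    obtain n where n: "rank \<delta> = Suc n" using rank_in[OF o] by (cases "rank \<delta>") auto
    then have "\<delta> \<in> layer (Suc n)" using rank_in[OF o] by simp
    then obtain \<epsilon> where e: "\<epsilon> \<in> orb \<delta>" "\<epsilon> \<notin> con" "prod.swap \<epsilon> \<in> inner_darts \<longrightarrow> prod.swap \<epsilon> \<in> layer n"
      by auto
    have oe: "\<epsilon> \<in> outer" using e(1) o outer_rot[OF o] outer_rot[OF outer_rot[OF o]] by (auto simp: orb_def)
    have "\<epsilon> = \<delta> \<or> \<epsilon> = rot \<delta> \<or> \<epsilon> = rot (rot \<delta>)" using e(1) by (simp add: orb_def)
    then have "orb \<epsilon> = orb \<delta>" using orb_rot[OF i] orb_rot[OF rot_inner[OF i]] by (elim disjE) simp_all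
    then have "\<delta> \<in> layer n'" if "\<epsilon> \<in> layer n'" for n'
      using that i by (cases n') auto
    then have "rank \<delta> \<le> rank \<epsilon>" using rank_le rank_in[OF oe] by blast
    then have "prod.swap \<epsilon> \<in> inner_darts \<longrightarrow> prod.swap \<epsilon> \<in> outer \<and> rank (prod.swap \<epsilon>) < rank \<epsilon>"
      using e(3) rank_le n unfolding outer_def by fastforce
    then show ?thesis using e oe by (auto simp: X_def)
  qed
  have "outer \<subseteq> X \<union> rot ` X \<union> (rot \<circ> rot) ` X"
  proof
    fix \<delta> assume o: "\<delta> \<in> outer"
    then have i: "\<delta> \<in> inner_darts" using outer_subset by auto
    obtain \<epsilon> where e: "\<epsilon> \<in> orb \<delta>" "\<epsilon> \<in> X" using exit[OF o] by blast
    then consider "\<epsilon> = \<delta>" | "\<epsilon> = rot \<delta>" | "\<epsilon> = rot (rot \<delta>)" by (auto simp: orb_def)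
    then show "\<delta> \<in> X \<union> rot ` X \<union> (rot \<circ> rot) ` X"
    proof cases
      case 2
      then have "\<delta> = (rot \<circ> rot) \<epsilon>" using rot3[OF i] by simp
      then show ?thesis using e by blast
    next
      case 3
      then have "\<delta> = rot \<epsilon>" using rot3[OF i] by simp
      then show ?thesis using e by blast
    qed (use e in auto)
  qed
  then have "card outer \<le> card (X \<union> rot ` X \<union> (rot \<circ> rot) ` X)" using finX by (intro card_mono) auto
  also have "\<dots> \<le> card X + card (rot ` X) + card ((rot \<circ> rot) ` X)"
    using card_Un_le[of "X \<union> rot ` X" "(rot \<circ> rot) ` X"] card_Un_le[of X "rot ` X"] by linarith
  also have "\<dots> \<le> 3 * card X"
    using card_image_le[OF finX, of rot] card_image_le[OF finX, of "rot \<circ> rot"] by linarith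
  finally have 1: "card outer \<le> 3 * card X" .
  have disj: "X \<inter> prod.swap ` X = {}"
  proof (rule ccontr)
    assume "X \<inter> prod.swap ` X \<noteq> {}"
    then obtain \<epsilon> where e: "\<epsilon> \<in> X" "prod.swap \<epsilon> \<in> X" by auto
    then have "\<epsilon> \<in> inner_darts" "prod.swap \<epsilon> \<in> inner_darts" using outer_subset by (auto simp: X_def)
    then have "rank (prod.swap \<epsilon>) < rank \<epsilon>" "rank \<epsilon> < rank (prod.swap \<epsilon>)" using e by (auto simp: X_def)
    then show False by simp
  qed
  have "X \<union> prod.swap ` X \<subseteq> (outer \<union> hull_darts) - con"
  proof
    fix \<epsilon> assume "\<epsilon> \<in> X \<union> prod.swap ` X"
    then show "\<epsilon> \<in> (outer \<union> hull_darts) - con"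
    proof
      assume "\<epsilon> \<in> prod.swap ` X"
      then have e: "prod.swap \<epsilon> \<in> X" by auto
      have "\<epsilon> \<notin> con" using e con_sym by (cases \<epsilon>) (auto simp: X_def)
      moreover have "\<epsilon> \<in> darts" using e outer_subset inner_darts_subset darts_sym by (cases \<epsilon>) (auto simp: X_def)
      ultimately show ?thesis using e by (auto simp: X_def hull_darts_def)
    qed (auto simp: X_def)
  qed
  moreover have "finite ((outer \<union> hull_darts) - con)" using finO finite_darts by (auto simp: hull_darts_def)
  ultimately have "card (X \<union> prod.swap ` X) \<le> card ((outer \<union> hull_darts) - con)" by (rule card_mono[rotated])
  moreover have "card (X \<union> prod.swap ` X) = 2 * card X"
    using finX disj by (simp add: card_Un_disjoint card_image)
  ultimately show ?thesis using 1 by linarith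
qed

subsection \<open>Corners\<close>

definition nbr :: "complex \<Rightarrow> complex set" where "nbr v = {a. (v, a) \<in> darts}"

definition cnbr :: "complex \<Rightarrow> complex set" where "cnbr v = {a. (v, a) \<in> con}"

text \<open>The angle at v of the face to the left of the contact vb. At a vertex with a single
  contact the face takes the full turn.\<close>

definition corner :: "complex \<Rightarrow> complex \<Rightarrow> real" where
  "corner v b = (if cnbr v = {b} then 2 * pi else Min (ang v b ` (cnbr v - {b})))"

definition fan :: "complex \<Rightarrow> complex \<Rightarrow> complex set" where
  "fan v b = {a \<in> nbr v. ang v b a < corner v b}"

definition tang :: "complex \<times> complex \<Rightarrow> real" where
  "tang \<delta> = ang (fst \<delta>) (snd \<delta>) (apex \<delta>)"

lemma nbr_props: assumes "a \<in> nbr v" shows "a \<in> P" "v \<in> P" "a \<noteq> v" "cmod a < 1" "cmod v < 1" "edge v a"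
  using assms dart_in_P P_disc by (auto simp: nbr_def darts_def dest: edge_in_P)

lemma finite_nbr: "finite (nbr v)"
  using nbr_props(1) finite_P finite_subset by (metis subsetI)

lemma cnbr_subset: "cnbr v \<subseteq> nbr v"
  using con_darts by (auto simp: nbr_def cnbr_def)

lemma finite_cnbr: "finite (cnbr v)"
  using cnbr_subset finite_nbr finite_subset by blast

lemma ang_nbr_relative:
  assumes "a \<in> nbr v" "b \<in> nbr v" "c \<in> nbr v"
  shows "ang v a c = (if ang v b a \<le> ang v b c then ang v b c - ang v b a else ang v b c - ang v b a + 2 * pi)"
  using ang_relative nbr_props assms by metis

lemma ang_nbr_self: "b \<in> nbr v \<Longrightarrow> ang v b b = 0"
  using ang_self nbr_props by metis

text \<open>Equal angles put both neighbours on one ray of the disc centred at v. By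
  \<open>klein_mob_diff\<close> they are then on one ray of the Klein model, where
  \<open>edge_ray_unique\<close> applies.\<close>

lemma ang_nbr_inj:
  assumes "b \<in> nbr v" shows "inj_on (ang v b) (nbr v)"
proof (rule inj_onI)
  fix a c assume ac: "a \<in> nbr v" "c \<in> nbr v" and eq: "ang v b a = ang v b c"
  note pa = nbr_props[OF ac(1)] and pb = nbr_props[OF assms] and pc = nbr_props[OF ac(2)]
  have n: "mob v a \<noteq> 0" "mob v b \<noteq> 0" "mob v c \<noteq> 0" using mob_eq_0_iff pa pb pc by metis+
  then obtain x where x: "x > 0" "mob v c / mob v b = of_real x * (mob v a / mob v b)"
    using eq Arg2pi_eq_iff[of "mob v c / mob v b" "mob v a / mob v b"] unfolding ang_def by auto
  then have xm: "mob v c = of_real x * mob v a" using n by (simp add: field_simps)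
  obtain k where k: "k > 0" "klein a - klein v = of_real k * (mob v a - v\<^sup>2 * cnj (mob v a))"
    using klein_mob_diff pa by metis
  obtain k' where k': "k' > 0" "klein c - klein v = of_real k' * (mob v c - v\<^sup>2 * cnj (mob v c))"
    using klein_mob_diff pc by metis
  have "klein c - klein v = of_real (k' * x / k) * (of_real k * (mob v a - v\<^sup>2 * cnj (mob v a)))"
    unfolding k'(2) xm using k(1) by (simp add: algebra_simps)
  then have "klein c - klein v = of_real (k' * x / k) * (klein a - klein v)" unfolding k(2) .
  moreover have "k' * x / k > 0" using k k' x by simp
  ultimately show "a = c" using edge_ray_unique pa(6) pc(6) by blast
qed

lemma cr_ang: assumes "a \<in> nbr v" "c \<in> nbr v"
  shows "cr v a c > 0 \<longleftrightarrow> 0 < ang v a c \<and> ang v a c < pi"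
  unfolding ang_def Arg2pi_lt_pi using mob_orientation nbr_props[OF assms(1)] nbr_props[OF assms(2)] by metis

text \<open>A neighbour strictly between a and the apex would be an edge inside the cone of the
  triangle.\<close>

lemma apex_next:
  assumes "(v, a) \<in> inner_darts"
  shows "apex (v, a) \<in> nbr v" "a \<in> nbr v" "0 < tang (v, a)" "tang (v, a) < pi"
    "\<And>x. x \<in> nbr v \<Longrightarrow> x \<noteq> a \<Longrightarrow> tang (v, a) \<le> ang v a x"
proof -
  define c where "c = apex (v, a)"
  have t: "tri v a c" using inner_dartsD assms by (simp add: c_def)
  show a: "a \<in> nbr v" using tri_edge[OF t] by (simp add: nbr_def darts_def)
  have "edge v c" using tri_edge tri_rotate edge_sym t by blast
  then show c: "apex (v, a) \<in> nbr v" by (simp add: nbr_def darts_def c_def)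
  show b: "0 < tang (v, a)" "tang (v, a) < pi" using cr_ang[OF a c] tri_pos[OF t] by (auto simp: tang_def c_def)
  fix x assume x: "x \<in> nbr v" "x \<noteq> a"
  show "tang (v, a) \<le> ang v a x"
  proof (rule ccontr)
    assume "\<not> ?thesis"
    then have lt: "ang v a x < ang v a c" by (simp add: tang_def c_def)
    have "ang v a x \<noteq> ang v a a" using inj_onD[OF ang_nbr_inj[OF a]] x a by blast
    then have p: "ang v a x > 0" using ang_range(1)[of v a x] ang_nbr_self[OF a] by simp
    have "cr v a x > 0" using cr_ang[OF a x(1)] p lt b by (auto simp: tang_def c_def)
    moreover have "ang v x c = ang v a c - ang v a x"
      using ang_nbr_relative[OF x(1) a c[folded c_def]] lt by simp
    then have "cr v x c > 0" using cr_ang[OF x(1) c] lt p b by (auto simp: tang_def c_def)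
    ultimately show False using no_edge_in_cone[OF t] nbr_props(6)[OF x(1)] by blast
  qed
qed

lemma contact_angle:
  assumes "b \<in> cnbr v" "c \<in> cnbr v" "b \<noteq> c" shows "\<alpha> \<le> ang v b c"
proof (rule ccontr)
  assume "\<not> ?thesis"
  then have lt: "ang v b c < \<alpha>" by simp
  have bn: "b \<in> nbr v" "c \<in> nbr v" using assms cnbr_subset by auto
  note pb = nbr_props[OF bn(1)] and pc = nbr_props[OF bn(2)]
  have eq: "ch v b = cosh d" "ch v c = cosh d" using assms by (auto simp: cnbr_def con_def)
  then have hd: "hyp_dist v b = d" "hyp_dist v c = d" using hyp_dist_eq_iff pb pc d_pos by auto
  have "ch b c = (cosh d)\<^sup>2 - (sinh d)\<^sup>2 * cos (ang v b c)"
    using cosine_law[of v b c] pb pc eq hd by (simp add: power2_eq_square)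
  moreover have "cosh d \<le> ch b c" using separated pb pc assms by auto
  ultimately have "(sinh d)\<^sup>2 * cos (ang v b c) \<le> (cosh d)\<^sup>2 - cosh d" by simp
  moreover have "cos \<alpha> < cos (ang v b c)"
    using lt ang_range(1)[of v b c] alpha_bounds[OF d_pos] by (intro cos_monotone_0_pi) auto
  then have "(sinh d)\<^sup>2 * cos \<alpha> < (sinh d)\<^sup>2 * cos (ang v b c)" using d_pos by simp
  moreover have "(sinh d)\<^sup>2 * cos \<alpha> = (cosh d)\<^sup>2 - cosh d"
  proof -
    have c: "cosh d > 1" using cosh_gt_1[OF d_pos] .
    have "(sinh d)\<^sup>2 = (cosh d - 1) * (1 + cosh d)"
      unfolding sinh_square_eq by (simp add: power2_eq_square algebra_simps)
    then have "(sinh d)\<^sup>2 * cos \<alpha> = (cosh d - 1) * ((1 + cosh d) * (cosh d / (1 + cosh d)))"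
      unfolding cos_alpha_cosh[OF d_pos] by (simp only: mult.assoc)
    also have "(1 + cosh d) * (cosh d / (1 + cosh d)) = cosh d" using c by simp
    finally show ?thesis by (simp add: power2_eq_square algebra_simps)
  qed
  ultimately show False by linarith
qed

lemma corner_cases:
  assumes "b \<in> cnbr v"
  obtains "cnbr v = {b}" "corner v b = 2 * pi"
  | e where "e \<in> cnbr v" "e \<noteq> b" "corner v b = ang v b e" "\<And>x. x \<in> cnbr v \<Longrightarrow> x \<noteq> b \<Longrightarrow> corner v b \<le> ang v b x"
proof (cases "cnbr v = {b}")
  case True then show thesis using that(1) by (simp add: corner_def)
next
  case False
  then have ne: "cnbr v - {b} \<noteq> {}" using assms by auto
  have f: "finite (ang v b ` (cnbr v - {b}))" using finite_cnbr by simp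
  have "corner v b \<in> ang v b ` (cnbr v - {b})" using False f ne by (auto simp: corner_def intro!: Min_in)
  moreover have "corner v b \<le> ang v b x" if "x \<in> cnbr v" "x \<noteq> b" for x
    using False f that by (auto simp: corner_def intro!: Min_le)
  ultimately show thesis using that(2) by blast
qed

lemma corner_ge: assumes b: "b \<in> cnbr v" shows "\<alpha> \<le> corner v b"
proof (rule corner_cases[OF b])
  fix e assume "e \<in> cnbr v" "e \<noteq> b" "corner v b = ang v b e"
  then show ?thesis using contact_angle[OF b] by auto
qed (use alpha_bounds[OF d_pos] in simp)

lemma corner_le: "b \<in> cnbr v \<Longrightarrow> corner v b \<le> 2 * pi"
  by (erule corner_cases) (use ang_range(2)[of v b] in \<open>auto intro: less_imp_le\<close>)

lemma corner_le_ang: "b \<in> cnbr v \<Longrightarrow> x \<in> cnbr v \<Longrightarrow> x \<noteq> b \<Longrightarrow> corner v b \<le> ang v b x"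
  by (erule corner_cases) auto

text \<open>Let a' be the last neighbour before a, counted from b. The triangle left of va' has a as
  apex, since a is the next neighbour, and two rotations carry (v, a') to (a, v).\<close>

lemma fan_step:
  assumes b: "b \<in> cnbr v" and a: "a \<in> nbr v" "a \<noteq> b"
    and In: "\<And>x. x \<in> nbr v \<Longrightarrow> ang v b x < ang v b a \<Longrightarrow> (v, x) \<in> In"
  shows "(a, v) \<in> In"
proof -
  have bn: "b \<in> nbr v" using b cnbr_subset by auto
  have inj: "inj_on (ang v b) (nbr v)" by (rule ang_nbr_inj[OF bn])
  have b0: "ang v b b = 0" by (rule ang_nbr_self[OF bn])
  have "ang v b a \<noteq> ang v b b" using inj_onD[OF inj] a bn by blast
  then have apos: "ang v b a > 0" using b0 ang_range(1)[of v b a] by simp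
  define L where "L = {x \<in> nbr v. ang v b x < ang v b a}"
  have L: "finite (ang v b ` L)" "b \<in> L" using finite_nbr bn b0 apos by (auto simp: L_def)
  then have "Max (ang v b ` L) \<in> ang v b ` L" by (intro Max_in) auto
  then obtain a' where a': "a' \<in> L" "ang v b a' = Max (ang v b ` L)" by auto
  have mx: "ang v b x \<le> ang v b a'" if "x \<in> L" for x unfolding a'(2) using L that by simp
  have an: "a' \<in> nbr v" "ang v b a' < ang v b a" using a' by (auto simp: L_def)
  have In': "(v, a') \<in> In" using In an by blast
  then have i: "(v, a') \<in> inner_darts" by (rule In_inner)
  define c where "c = apex (v, a')"
  note ap = apex_next[OF i, folded c_def]
  have tc: "tang (v, a') = ang v a' c" by (simp add: tang_def c_def)
  have "tang (v, a') \<le> ang v a' a" using ap(5) a an by auto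
  also have "ang v a' a = ang v b a - ang v b a'" using ang_nbr_relative[OF an(1) bn a(1)] an by simp
  finally have le: "ang v a' c \<le> ang v b a - ang v b a'" unfolding tc .
  have rel: "ang v a' c = (if ang v b a' \<le> ang v b c then ang v b c - ang v b a' else ang v b c - ang v b a' + 2 * pi)"
    by (rule ang_nbr_relative[OF an(1) bn ap(1)])
  have "ang v b c = ang v b a"
  proof (cases "ang v b a' \<le> ang v b c")
    case True
    then have le': "ang v b c \<le> ang v b a" and gt: "ang v b c > ang v b a'" using rel le ap(3) tc by auto
    then have "c \<notin> L" using mx by fastforce
    then show ?thesis using le' ap(1) by (auto simp: L_def)
  next
    case False
    then have "ang v b c + 2 * pi \<le> ang v b a" using rel le by simp
    then show ?thesis using ang_range(1)[of v b c] ang_range(2)[of v b a] by linarith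
  qed
  then have "c = a" using inj_onD[OF inj] ap(1) a by blast
  then have "tri v a' a" using inner_dartsD[OF i] by (simp add: c_def)
  then have "rot (rot (v, a')) = (a, v)" using rot_pair tri_rotate by metis
  then show ?thesis using In_rot[OF In_rot[OF In']] by simp
qed

text \<open>Turning from b, no contact is met before the corner ends, so each step crosses a
  non-contact edge and stays in \<open>In\<close>.\<close>

lemma fan_In:
  assumes b: "b \<in> cnbr v" "(v, b) \<in> In" and "a \<in> fan v b"
  shows "(v, a) \<in> In"
  using assms(3)
proof (induction "card {x \<in> nbr v. ang v b x < ang v b a}" arbitrary: a rule: less_induct)
  case less
  show ?case
  proof (cases "a = b")
    case False
    have a: "a \<in> nbr v" "ang v b a < corner v b" using less.prems by (auto simp: fan_def)
    have "(a, v) \<in> In"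
    proof (rule fan_step[OF b(1) a(1) False])
      fix x assume x: "x \<in> nbr v" "ang v b x < ang v b a"
      show "(v, x) \<in> In"
      proof (rule less.hyps)
        show "x \<in> fan v b" using x a by (simp add: fan_def)
        show "card {y \<in> nbr v. ang v b y < ang v b x} < card {y \<in> nbr v. ang v b y < ang v b a}"
          using x finite_nbr by (intro psubset_card_mono) auto
      qed
    qed
    moreover have "(a, v) \<notin> con"
    proof
      assume "(a, v) \<in> con"
      then have "a \<in> cnbr v" using con_sym by (auto simp: cnbr_def)
      then show False using corner_le_ang[OF b(1) _ False] a by fastforce
    qed
    ultimately show ?thesis using In_cross[of "(a, v)"] by simp
  qed (use b in simp)
qed

lemma corner_end_In:
  assumes b: "b \<in> cnbr v" "(v, b) \<in> In" and e: "e \<in> cnbr v" "e \<noteq> b" "ang v b e = corner v b"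
  shows "(e, v) \<in> In"
proof (rule fan_step[OF b(1)])
  show "(v, x) \<in> In" if "x \<in> nbr v" "ang v b x < ang v b e" for x
    using fan_In[OF b] that e by (simp add: fan_def)
qed (use e cnbr_subset in auto)

lemma b_in_fan: "b \<in> cnbr v \<Longrightarrow> b \<in> fan v b"
  using corner_ge[of b v] alpha_bounds[OF d_pos] ang_nbr_self[of b v] subsetD[OF cnbr_subset, of b v]
  by (auto simp: fan_def)

text \<open>The angle of the triangle at a leads to the next neighbour. This is again in the fan, or
  it ends the corner, or the turn closes up at 2 pi because b is the only contact.\<close>

lemma fan_sum:
  assumes b: "b \<in> cnbr v" "(v, b) \<in> In"
  shows "(\<Sum>a\<in>fan v b. tang (v, a)) = corner v b"
proof (rule sum_gaps[where f = "ang v b" and b = b])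
  have bn: "b \<in> nbr v" using b cnbr_subset by auto
  show "finite (fan v b)" using finite_nbr by (simp add: fan_def)
  show "inj_on (ang v b) (fan v b)" using ang_nbr_inj[OF bn] by (rule inj_on_subset) (auto simp: fan_def)
  show "b \<in> fan v b" "fan v b \<noteq> {}" using b_in_fan b by auto
  show b0: "ang v b b = 0" by (rule ang_nbr_self[OF bn])
  show "0 \<le> ang v b a \<and> ang v b a < corner v b" if "a \<in> fan v b" for a
    using that ang_range(1) by (simp add: fan_def)
  fix a assume a: "a \<in> fan v b"
  then have an: "a \<in> nbr v" "ang v b a < corner v b" by (auto simp: fan_def)
  have i: "(v, a) \<in> inner_darts" using fan_In[OF b a] by (rule In_inner)
  define c where "c = apex (v, a)"
  note ap = apex_next[OF i, folded c_def]
  have tc: "tang (v, a) = ang v a c" by (simp add: tang_def c_def)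
  have rel: "tang (v, a) = (if ang v b a \<le> ang v b c then ang v b c - ang v b a else ang v b c - ang v b a + 2 * pi)"
    unfolding tc by (rule ang_nbr_relative[OF an(1) bn ap(1)])
  have le: "ang v b a + tang (v, a) \<le> ang v b x" if "x \<in> nbr v" "ang v b a < ang v b x" for x
  proof -
    have "tang (v, a) \<le> ang v a x" using ap(5) that by auto
    then show ?thesis using ang_nbr_relative[OF an(1) bn that(1)] that by simp
  qed
  show "ang v b a + tang (v, a) \<le> ang v b x" if "x \<in> fan v b" "ang v b a < ang v b x" for x
    using le that by (simp add: fan_def)
  have le_corner: "ang v b a + tang (v, a) \<le> corner v b" if "corner v b < 2 * pi"
  proof (rule corner_cases[OF b(1)])
    fix e assume "e \<in> cnbr v" "corner v b = ang v b e"
    then show ?thesis using le[of e] an cnbr_subset by auto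
  qed (use that in simp)
  have c2: "corner v b \<le> 2 * pi" using corner_le b by simp
  show "0 < tang (v, a) \<and> (ang v b a + tang (v, a) = corner v b \<or> ang v b a + tang (v, a) \<in> ang v b ` fan v b)"
  proof (cases "ang v b a \<le> ang v b c")
    case True
    then have e: "ang v b a + tang (v, a) = ang v b c" using rel by simp
    show ?thesis
    proof (cases "ang v b c < corner v b")
      case True then show ?thesis using e ap(1,3) by (auto simp: fan_def)
    next
      case False
      then have "corner v b < 2 * pi" using ang_range(2)[of v b c] by simp
      then show ?thesis using le_corner e False ap(3) by simp
    qed
  next
    case False
    then have ab: "a \<noteq> b" using b0 ang_range(1)[of v b c] by auto
    have "tang (v, a) \<le> ang v a b" using ap(5)[OF bn] ab by simp
    also have "ang v a b = 2 * pi - ang v b a"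
      using ang_nbr_relative[OF an(1) bn bn] False b0 ang_range(1)[of v b c] by (auto split: if_splits)
    finally have "ang v b a + tang (v, a) \<le> 2 * pi" by simp
    then have e: "ang v b a + tang (v, a) = 2 * pi" using rel False ang_range(1)[of v b c] by simp
    then have "corner v b = 2 * pi" using le_corner c2 by force
    then show ?thesis using e ap(3) by simp
  qed
qed

lemma fans_disjoint:
  assumes "b \<in> cnbr v" "b' \<in> cnbr v" "b \<noteq> b'" shows "fan v b \<inter> fan v b' = {}"
proof (rule ccontr)
  assume "fan v b \<inter> fan v b' \<noteq> {}"
  then obtain a where a: "a \<in> nbr v" "ang v b a < corner v b" "ang v b' a < corner v b'" by (auto simp: fan_def)
  have bn: "b \<in> nbr v" "b' \<in> nbr v" using assms cnbr_subset by auto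
  have l1: "ang v b a < ang v b b'" using a(2) corner_le_ang[OF assms(1,2)] assms(3) by simp
  have l2: "ang v b' a < ang v b' b" using a(3) corner_le_ang[OF assms(2,1)] assms(3) by simp
  have "ang v b' a = ang v b a - ang v b b' + 2 * pi" using ang_nbr_relative[OF bn(2,1) a(1)] l1 by simp
  moreover have "ang v b' b = (if ang v b b' \<le> 0 then 0 else 2 * pi) - ang v b b'"
    using ang_nbr_relative[OF bn(2,1,1)] ang_nbr_self[OF bn(1)] by simp
  ultimately show False using l1 l2 ang_range(1)[of v b a] by (auto split: if_splits)
qed

text \<open>The right contact is the one from which a is reached by the smallest counterclockwise
  turn.\<close>

lemma fans_cover:
  assumes "cnbr v \<noteq> {}" "a \<in> nbr v" shows "\<exists>b\<in>cnbr v. a \<in> fan v b"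
proof -
  have f: "finite ((\<lambda>b. ang v b a) ` cnbr v)" "(\<lambda>b. ang v b a) ` cnbr v \<noteq> {}" using finite_cnbr assms by auto
  obtain b where b: "b \<in> cnbr v" "ang v b a = Min ((\<lambda>b. ang v b a) ` cnbr v)" using Min_in[OF f] by auto
  have mn: "ang v b a \<le> ang v b' a" if "b' \<in> cnbr v" for b' unfolding b(2) using f that by simp
  have bn: "b \<in> nbr v" using b cnbr_subset by auto
  have "ang v b a < corner v b"
  proof (rule corner_cases[OF b(1)])
    fix e assume e: "e \<in> cnbr v" "e \<noteq> b" "corner v b = ang v b e"
    have en: "e \<in> nbr v" using e cnbr_subset by auto
    show ?thesis
    proof (rule ccontr)
      assume "\<not> ?thesis"
      then have "ang v e a = ang v b a - ang v b e" using ang_nbr_relative[OF en bn assms(2)] e by simp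
      moreover have "ang v b e > 0"
        using contact_angle[OF b(1) e(1)] e(2) alpha_bounds[OF d_pos] by auto
      ultimately show False using mn[OF e(1)] by simp
    qed
  qed (use ang_range(2) in simp)
  then have "a \<in> fan v b" using assms by (simp add: fan_def)
  then show ?thesis using b(1) by blast
qed

lemma corners_sum:
  assumes "cnbr v \<noteq> {}" shows "(\<Sum>b\<in>cnbr v. corner v b) = 2 * pi"
proof -
  obtain b0 where b0: "b0 \<in> cnbr v" using assms by auto
  have bn0: "b0 \<in> nbr v" using b0 cnbr_subset by auto
  show ?thesis
  proof (rule sum_gaps[where f = "ang v b0" and b = b0])
    show "inj_on (ang v b0) (cnbr v)" using ang_nbr_inj[OF bn0] cnbr_subset by (rule inj_on_subset)
    show z: "ang v b0 b0 = 0" by (rule ang_nbr_self[OF bn0])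
    fix b assume b: "b \<in> cnbr v"
    then have bn: "b \<in> nbr v" using cnbr_subset by auto
    show "ang v b0 b + corner v b \<le> ang v b0 x" if "x \<in> cnbr v" "ang v b0 b < ang v b0 x" for x
    proof -
      have "x \<noteq> b" using that(2) by auto
      then show ?thesis
        using corner_le_ang[OF b that(1)] that(2) ang_nbr_relative[OF bn bn0, of x] subsetD[OF cnbr_subset that(1)] by simp
    qed
    have pos: "corner v b > 0" using corner_ge[OF b] alpha_bounds[OF d_pos] by simp
    show "0 < corner v b \<and> (ang v b0 b + corner v b = 2 * pi \<or> ang v b0 b + corner v b \<in> ang v b0 ` cnbr v)"
    proof (rule corner_cases[OF b])
      assume "cnbr v = {b}" "corner v b = 2 * pi"
      then show ?thesis using b0 z pos by auto
    next
      fix e assume e: "e \<in> cnbr v" "e \<noteq> b" "corner v b = ang v b e"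
      have en: "e \<in> nbr v" using e cnbr_subset by auto
      note rel = ang_nbr_relative[OF bn bn0 en]
      show ?thesis
      proof (cases "ang v b0 b \<le> ang v b0 e")
        case True then show ?thesis using rel e pos by auto
      next
        case False
        then have "b \<noteq> b0" using z ang_range(1)[of v b0 e] by auto
        then have "corner v b \<le> ang v b b0" using corner_le_ang[OF b b0] by auto
        also have "\<dots> = 2 * pi - ang v b0 b"
          using ang_nbr_relative[OF bn bn0 bn0] z False ang_range(1)[of v b0 e] by (auto split: if_splits)
        finally have "ang v b0 b + corner v b = 2 * pi" using rel e False ang_range(1)[of v b0 e] by simp
        then show ?thesis using pos by simp
      qed
    qed
  qed (use finite_cnbr assms b0 ang_range in auto)
qed

definition In_at :: "complex \<Rightarrow> complex set" where "In_at v = {a. (v, a) \<in> In}"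

lemma In_at_subset: "In_at v \<subseteq> nbr v"
  using In_inner inner_darts_subset by (auto simp: In_at_def nbr_def)

lemma finite_In_at: "finite (In_at v)"
  using In_at_subset finite_nbr finite_subset by blast

text \<open>The fans of different contacts are disjoint and fill their corners, and a corner
  measures at least \<alpha>.\<close>

lemma inner_angle_ge: "\<alpha> * real (card (cnbr v \<inter> In_at v)) \<le> (\<Sum>a\<in>In_at v. tang (v, a))"
proof -
  have "\<alpha> * real (card (cnbr v \<inter> In_at v)) = (\<Sum>b\<in>cnbr v \<inter> In_at v. \<alpha>)" by simp
  also have "\<dots> \<le> (\<Sum>b\<in>cnbr v \<inter> In_at v. corner v b)" using corner_ge by (intro sum_mono) auto
  also have "\<dots> = (\<Sum>b\<in>cnbr v \<inter> In_at v. \<Sum>a\<in>fan v b. tang (v, a))"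
    by (intro sum.cong refl fan_sum[symmetric]) (auto simp: In_at_def)
  also have "\<dots> = (\<Sum>a\<in>(\<Union>b\<in>cnbr v \<inter> In_at v. fan v b). tang (v, a))"
    using finite_cnbr finite_nbr fans_disjoint
    by (intro sum.UNION_disjoint[symmetric]) (auto simp: fan_def)
  also have "\<dots> \<le> (\<Sum>a\<in>In_at v. tang (v, a))"
  proof (rule sum_mono2[OF finite_In_at])
    show "(\<Union>b\<in>cnbr v \<inter> In_at v. fan v b) \<subseteq> In_at v" using fan_In by (auto simp: In_at_def)
  qed (use apex_next(3) In_inner in \<open>auto simp: In_at_def intro: less_imp_le\<close>)
  finally show ?thesis .
qed

lemma inner_angle_full:
  assumes "cnbr v \<noteq> {}" "cnbr v \<subseteq> In_at v"
  shows "(\<Sum>a\<in>In_at v. tang (v, a)) = 2 * pi"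
proof -
  have "In_at v = (\<Union>b\<in>cnbr v. fan v b)"
    using fan_In fans_cover[OF assms(1)] assms(2) In_at_subset by (fastforce simp: In_at_def)
  then have "(\<Sum>a\<in>In_at v. tang (v, a)) = (\<Sum>a\<in>(\<Union>b\<in>cnbr v. fan v b). tang (v, a))" by simp
  also have "\<dots> = (\<Sum>b\<in>cnbr v. \<Sum>a\<in>fan v b. tang (v, a))"
    using finite_cnbr finite_nbr fans_disjoint by (intro sum.UNION_disjoint) (auto simp: fan_def)
  also have "\<dots> = (\<Sum>b\<in>cnbr v. corner v b)"
    using assms(2) by (intro sum.cong refl fan_sum) (auto simp: In_at_def)
  finally show ?thesis using corners_sum[OF assms(1)] by simp
qed

lemma corner_triangle:
  assumes "(v, b) \<in> con \<inter> In" "(v, apex (v, b)) \<in> con"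
  shows "corner v b = tang (v, b)"
proof -
  have b: "b \<in> cnbr v" "(v, b) \<in> In" using assms by (auto simp: cnbr_def)
  have c: "apex (v, b) \<in> cnbr v" using assms by (auto simp: cnbr_def)
  have i: "(v, b) \<in> inner_darts" using In_inner b by simp
  have "apex (v, b) \<noteq> b" using tri_distinct[OF inner_dartsD[OF i]] by auto
  then have le: "corner v b \<le> tang (v, b)" using corner_le_ang[OF b(1) c] by (simp add: tang_def)
  have "tang (v, b) \<le> (\<Sum>a\<in>fan v b. tang (v, a))"
    using b_in_fan[OF b(1)] fan_In[OF b] apex_next(3) In_inner finite_nbr
    by (intro member_le_sum) (auto simp: fan_def intro: less_imp_le)
  then show ?thesis using le fan_sum[OF b] by simp
qed

text \<open>The corner of a rhombus that is cut by the diagonal vc.\<close>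

lemma corner_two_triangles:
  assumes "(v, b) \<in> con \<inter> In" "apex (v, b) = c" "(v, c) \<notin> con" "apex (v, c) = e" "(v, e) \<in> con" "e \<noteq> b"
  shows "corner v b = tang (v, b) + tang (v, c)"
proof -
  have b: "b \<in> cnbr v" "(v, b) \<in> In" using assms by (auto simp: cnbr_def)
  have bn: "b \<in> nbr v" using b cnbr_subset by auto
  have i: "(v, b) \<in> inner_darts" using In_inner b by simp
  have ap: "c \<in> nbr v" "0 < tang (v, b)" "tang (v, b) < pi" "\<And>x. x \<in> nbr v \<Longrightarrow> x \<noteq> b \<Longrightarrow> tang (v, b) \<le> ang v b x"
    using apex_next[OF i] assms by auto
  have tb: "tang (v, b) = ang v b c" by (simp add: tang_def assms)
  have cb: "c \<noteq> b" using ap(2) tb ang_nbr_self[OF bn] by auto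
  have "ang v b c < corner v b"
  proof (rule corner_cases[OF b(1)])
    fix y assume y: "y \<in> cnbr v" "y \<noteq> b" "corner v b = ang v b y"
    then have yn: "y \<in> nbr v" "y \<noteq> c" using assms(3) cnbr_subset by (auto simp: cnbr_def)
    then have "ang v b y \<noteq> ang v b c" using inj_onD[OF ang_nbr_inj[OF bn]] ap(1) by blast
    then show ?thesis using ap(4)[OF yn(1) y(2)] tb y by simp
  qed (use ang_range(2) in simp)
  then have cf: "c \<in> fan v b" using ap(1) by (simp add: fan_def)
  have ic: "(v, c) \<in> inner_darts" using fan_In[OF b cf] by (rule In_inner)
  have tc: "tang (v, c) = ang v c e" by (simp add: tang_def assms)
  have en: "e \<in> cnbr v" "e \<in> nbr v" using assms cnbr_subset by (auto simp: cnbr_def)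
  have "ang v b e = tang (v, b) + tang (v, c)"
    using ang_nbr_relative[OF ap(1) bn en(2)] ap(2,3) apex_next(3,4)[OF ic] ang_range(1)[of v b e] tb tc
    by (auto split: if_splits)
  then have le: "corner v b \<le> tang (v, b) + tang (v, c)" using corner_le_ang[OF b(1) en(1) assms(6)] by simp
  have "(\<Sum>a\<in>{b, c}. tang (v, a)) \<le> (\<Sum>a\<in>fan v b. tang (v, a))"
    using b_in_fan[OF b(1)] cf fan_In[OF b] apex_next(3) In_inner finite_nbr
    by (intro sum_mono2) (auto simp: fan_def intro: less_imp_le)
  then show ?thesis using le fan_sum[OF b] cb by simp
qed

text \<open>Two rotations map the inner darts leaving v bijectively to those arriving at v. The
  non-contact ones among them match by reversal, so the contacts match in number as well.\<close>

lemma card_In_incoming: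
  "card {a. (v, a) \<in> con \<inter> In} = card {a. (a, v) \<in> con \<inter> In}"
proof -
  have fin: "finite {a. (v, a) \<in> In}" using finite_In_at by (simp add: In_at_def)
  have rr: "rot (rot (v, a)) = (apex (v, a), v)" if "(v, a) \<in> In" for a
    using rot_pair[OF tri_rotate[OF inner_dartsD[OF In_inner[OF that]]]] rot_pair[OF inner_dartsD[OF In_inner[OF that]]] by simp
  have "bij_betw (\<lambda>a. apex (v, a)) {a. (v, a) \<in> In} {a. (a, v) \<in> In}"
  proof (rule bij_betw_imageI)
    show "inj_on (\<lambda>a. apex (v, a)) {a. (v, a) \<in> In}"
    proof (rule inj_onI)
      fix a c assume a: "a \<in> {a. (v, a) \<in> In}" and c: "c \<in> {a. (v, a) \<in> In}" and eq: "apex (v, a) = apex (v, c)"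
      then have "rot (rot (v, a)) = rot (rot (v, c))" using rr by simp
      then have "rot (rot (rot (v, a))) = rot (rot (rot (v, c)))" by simp
      then show "a = c" using rot3 In_inner a c by auto
    qed
    show "(\<lambda>a. apex (v, a)) ` {a. (v, a) \<in> In} = {a. (a, v) \<in> In}"
    proof (intro equalityI subsetI)
      fix a assume "a \<in> (\<lambda>a. apex (v, a)) ` {a. (v, a) \<in> In}"
      then obtain c where "(v, c) \<in> In" "a = apex (v, c)" by auto
      then show "a \<in> {a. (a, v) \<in> In}" using rr[of c] In_rot[OF In_rot[of "(v, c)"]] by simp
    next
      fix a assume "a \<in> {a. (a, v) \<in> In}"
      then have a: "(a, v) \<in> In" by simp
      then have r: "rot (a, v) = (v, apex (a, v))" by (simp add: rot_def)
      then have vi: "(v, apex (a, v)) \<in> In" using In_rot[OF a] by simp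
      have "rot (rot (rot (a, v))) = (a, v)" using rot3 In_inner a by blast
      then have "apex (v, apex (a, v)) = a" using rr[OF vi] r by simp
      then show "a \<in> (\<lambda>a. apex (v, a)) ` {a. (v, a) \<in> In}" using vi by force
    qed
  qed
  then have "card {a. (v, a) \<in> In} = card {a. (a, v) \<in> In}" and fin': "finite {a. (a, v) \<in> In}"
    using fin bij_betw_same_card bij_betw_finite by blast+
  moreover have "{a. (v, a) \<in> In - con} = {a. (a, v) \<in> In - con}"
    using In_cross con_sym by fastforce
  moreover have "card {a. (v, a) \<in> In} = card {a. (v, a) \<in> con \<inter> In} + card {a. (v, a) \<in> In - con}"
    using fin by (subst card_Un_disjoint[symmetric]) (auto intro: finite_subset arg_cong[where f = card])
  moreover have "card {a. (a, v) \<in> In} = card {a. (a, v) \<in> con \<inter> In} + card {a. (a, v) \<in> In - con}"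
    using fin' by (subst card_Un_disjoint[symmetric]) (auto intro: finite_subset arg_cong[where f = card])
  ultimately show ?thesis by simp
qed

end

context packing
begin

subsection \<open>Metric types of triangles\<close>

definition len :: "complex \<times> complex \<Rightarrow> real" where "len \<delta> = hyp_dist (fst \<delta>) (snd \<delta>)"

definition area :: "complex \<times> complex \<Rightarrow> real" where
  "area \<delta> = pi - (tang \<delta> + tang (rot \<delta>) + tang (rot (rot \<delta>)))"

text \<open>A dart is thin if the circumcentre of its left triangle lies to its right.\<close>

definition exc :: "complex \<times> complex \<Rightarrow> real" where
  "exc \<delta> = tang \<delta> + tang (rot \<delta>) - tang (rot (rot \<delta>))"

definition thin :: "complex \<times> complex \<Rightarrow> bool" where "thin \<delta> \<longleftrightarrow> exc \<delta> < 0"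

text \<open>The base of an isosceles triangle whose legs are contact edges.\<close>

definition iso :: "complex \<times> complex \<Rightarrow> bool" where
  "iso \<delta> \<longleftrightarrow> \<delta> \<in> inner_darts \<and> \<delta> \<notin> con \<and> rot \<delta> \<in> con \<and> rot (rot \<delta>) \<in> con"

definition nnc :: "complex \<times> complex \<Rightarrow> real" where
  "nnc \<delta> = of_bool (\<delta> \<notin> con) + of_bool (rot \<delta> \<notin> con) + of_bool (rot (rot \<delta>) \<notin> con)"

abbreviation (input) u :: real where "u \<equiv> pi - 3 * \<alpha>"

lemma u_pos: "u > 0" using alpha_bounds[OF d_pos] by simp

lemma len_swap: "len (prod.swap \<delta>) = len \<delta>"
  by (simp add: len_def hyp_dist_def norm_minus_commute mult.commute)

lemma len_ge: "\<delta> \<in> darts \<Longrightarrow> d \<le> len \<delta>"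
  using dart_in_P[of "fst \<delta>" "snd \<delta>"] P_disc separated d_pos hyp_dist_ge_iff[of "fst \<delta>" "snd \<delta>" d] by (auto simp: len_def)

lemma con_iff: "\<delta> \<in> darts \<Longrightarrow> \<delta> \<in> con \<longleftrightarrow> len \<delta> = d"
  using dart_in_P[of "fst \<delta>" "snd \<delta>"] P_disc d_pos hyp_dist_eq_iff[of "fst \<delta>" "snd \<delta>" d]
  by (cases \<delta>) (auto simp: len_def con_def)

lemma inner_dart: "\<delta> \<in> inner_darts \<Longrightarrow> \<delta> \<in> darts"
  using inner_darts_subset by auto

lemma con_swap: "prod.swap \<delta> \<in> con \<longleftrightarrow> \<delta> \<in> con"
  using con_sym by (cases \<delta>) auto

lemma triangle_pos3: "\<delta> \<in> inner_darts \<Longrightarrow> pos3 (fst \<delta>) (snd \<delta>) (apex \<delta>)"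
  using inner_dartsD[of "fst \<delta>" "snd \<delta>"] tri_pos3 by simp

lemma tang_rot:
  assumes "\<delta> \<in> inner_darts"
  shows "tang (rot \<delta>) = ang (snd \<delta>) (apex \<delta>) (fst \<delta>)" "tang (rot (rot \<delta>)) = ang (apex \<delta>) (fst \<delta>) (snd \<delta>)"
    "len (rot \<delta>) = hyp_dist (snd \<delta>) (apex \<delta>)" "len (rot (rot \<delta>)) = hyp_dist (apex \<delta>) (fst \<delta>)"
proof -
  have t: "tri (fst \<delta>) (snd \<delta>) (apex \<delta>)" using assms inner_dartsD[of "fst \<delta>" "snd \<delta>"] by simp
  note r = rot_pair[OF t] rot_pair[OF tri_rotate[OF t]] apex_eq[OF tri_rotate[OF t]] apex_eq[OF tri_rotate[OF tri_rotate[OF t]]]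
  show "tang (rot \<delta>) = ang (snd \<delta>) (apex \<delta>) (fst \<delta>)" "tang (rot (rot \<delta>)) = ang (apex \<delta>) (fst \<delta>) (snd \<delta>)"
    "len (rot \<delta>) = hyp_dist (snd \<delta>) (apex \<delta>)" "len (rot (rot \<delta>)) = hyp_dist (apex \<delta>) (fst \<delta>)"
    using r by (simp_all add: tang_def len_def)
qed

lemma triangle:
  assumes "\<delta> \<in> inner_darts"
  shows "hyp_triangle (len \<delta>) (len (rot \<delta>)) (len (rot (rot \<delta>))) (tang (rot (rot \<delta>))) (tang \<delta>) (tang (rot \<delta>))"
  using hyp_triangle_pos3[OF pos3_rotate[OF pos3_rotate[OF triangle_pos3[OF assms]]]]
  unfolding tang_rot[OF assms] by (simp add: len_def tang_def)

lemma area_sar: "\<delta> \<in> inner_darts \<Longrightarrow>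
    area \<delta> = sar (fst \<delta>) (snd \<delta>) + sar (fst (rot \<delta>)) (snd (rot \<delta>)) + sar (fst (rot (rot \<delta>))) (snd (rot (rot \<delta>)))"
  using angle_sum_area[OF triangle_pos3] rot3[of \<delta>]
  unfolding area_def by (simp add: tang_rot) (simp add: tang_def rot_def prod_eq_iff)

lemma area_pos: "\<delta> \<in> inner_darts \<Longrightarrow> area \<delta> > 0"
  using hyp_triangle.angle_sum[OF triangle[of \<delta>]] by (simp add: area_def)

lemma area_rot: "\<delta> \<in> inner_darts \<Longrightarrow> area (rot \<delta>) = area \<delta>"
  by (simp add: area_def rot3)

lemma nnc_rot: "\<delta> \<in> inner_darts \<Longrightarrow> nnc (rot \<delta>) = nnc \<delta>"
  by (simp add: nnc_def rot3)

lemma exc_cross: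
  assumes "\<delta> \<in> inner_darts" "prod.swap \<delta> \<in> inner_darts"
  shows "exc \<delta> + exc (prod.swap \<delta>) \<ge> 0"
proof -
  obtain p q where pq: "\<delta> = (p, q)" by (cases \<delta>)
  define r s where "r = apex (p, q)" and "s = apex (q, p)"
  have t: "tri p q r" "tri q p s" using assms inner_dartsD pq by (auto simp: r_def s_def)
  obtain l where l: "aff l (klein p) = klein_height p" "aff l (klein q) = klein_height q"
    "aff l (klein r) = klein_height r" "aff l (klein s) \<le> klein_height s"
    using weakly_delaunay[OF t(1)] tri_in_P[OF t(2)] by blast
  have "excess p q r + excess q p s \<ge> 0"
    by (rule delaunay_excess[OF tri_pos3[OF t(1)] tri_pos3[OF t(2)] l])
  moreover have "exc \<delta> = excess p q r" "exc (prod.swap \<delta>) = excess q p s"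
    unfolding exc_def excess_def tang_rot[OF assms(1)] tang_rot[OF assms(2)]
    by (simp_all add: tang_def pq r_def s_def)
  ultimately show ?thesis by simp
qed

lemma thin_cross: "\<delta> \<in> inner_darts \<Longrightarrow> prod.swap \<delta> \<in> inner_darts \<Longrightarrow> \<not> (thin \<delta> \<and> thin (prod.swap \<delta>))"
  using exc_cross[of \<delta>] by (auto simp: thin_def)

lemma tang_pos: "\<delta> \<in> inner_darts \<Longrightarrow> tang \<delta> > 0"
  using hyp_triangle.angles[OF triangle] by blast

lemma exc_rot: "\<delta> \<in> inner_darts \<Longrightarrow> exc \<delta> + exc (rot \<delta>) = 2 * tang (rot \<delta>)"
  by (simp add: exc_def rot3)

lemma angle_le_iff:
  assumes "\<delta> \<in> inner_darts"
  shows "tang (rot (rot \<delta>)) \<le> tang \<delta> \<longleftrightarrow> len \<delta> \<le> len (rot \<delta>)"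
  using hyp_triangle.side_less_iff[OF hyp_triangle.mirrored[OF hyp_triangle.rotated[OF triangle[OF rot_inner[OF rot_inner[OF assms]]]]]]
    hyp_triangle.side_less_iff[OF triangle[OF assms]]
    hyp_triangle.side_less_iff[OF hyp_triangle.rotated[OF hyp_triangle.mirrored[OF triangle[OF assms]]]]
    hyp_triangle.side_less_iff[OF hyp_triangle.rotated[OF hyp_triangle.rotated[OF hyp_triangle.mirrored[OF triangle[OF assms]]]]]
  by (auto simp: rot3[OF assms] not_less[symmetric])

text \<open>A contact is a shortest side, so the opposite angle does not exceed the others.\<close>

lemma con_not_thin: "\<delta> \<in> inner_darts \<Longrightarrow> \<delta> \<in> con \<Longrightarrow> \<not> thin \<delta>"
  using angle_le_iff[of \<delta>] con_iff[of \<delta>] len_ge[of "rot \<delta>"] inner_dart rot_inner tang_pos[of "rot \<delta>"]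
  by (auto simp: thin_def exc_def)

lemma nonthin_area:
  assumes "\<delta> \<in> inner_darts" "\<not> thin \<delta>" "\<not> thin (rot \<delta>)" "\<not> thin (rot (rot \<delta>))"
  shows "u \<le> area \<delta>"
proof -
  have "tang (rot (rot \<delta>)) + tang \<delta> + tang (rot \<delta>) \<le> 3 * \<alpha>"
  proof (rule hyp_triangle.angle_sum_le[OF triangle[OF assms(1)] d_pos])
    show "d \<le> len \<delta>" "d \<le> len (rot \<delta>)" "d \<le> len (rot (rot \<delta>))"
      using len_ge inner_dart rot_inner assms(1) by auto
  qed (use assms rot3[OF assms(1)] in \<open>auto simp: thin_def exc_def\<close>)
  then show ?thesis by (simp add: area_def)
qed

lemma area_thin:
  assumes "\<delta> \<in> inner_darts"
  shows "area \<delta> / u \<ge> 1 - of_bool (thin \<delta>) - of_bool (thin (rot \<delta>)) - of_bool (thin (rot (rot \<delta>)))"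
proof (cases "thin \<delta> \<or> thin (rot \<delta>) \<or> thin (rot (rot \<delta>))")
  case True
  then have "1 - of_bool (thin \<delta>) - of_bool (thin (rot \<delta>)) - of_bool (thin (rot (rot \<delta>))) \<le> (0::real)" by auto
  also have "0 \<le> area \<delta> / u" using area_pos[OF assms] u_pos by simp
  finally show ?thesis .
next
  case False then show ?thesis using nonthin_area[OF assms] u_pos by simp
qed

lemma equilateral:
  assumes "\<delta> \<in> inner_darts" "\<delta> \<in> con" "rot \<delta> \<in> con" "rot (rot \<delta>) \<in> con"
  shows "tang \<delta> = \<alpha>"
  using hyp_triangle.equilateral_angle[OF hyp_triangle.rotated[OF triangle[OF assms(1)]], of d]
    con_iff inner_dart rot_inner assms by auto

lemma equilateral_area:
  assumes "\<delta> \<in> inner_darts" "nnc \<delta> = 0" shows "area \<delta> = u"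
proof -
  have c: "\<delta> \<in> con" "rot \<delta> \<in> con" "rot (rot \<delta>) \<in> con" using assms(2) by (auto simp: nnc_def of_bool_def split: if_splits)
  then show ?thesis
    using equilateral[of \<delta>] equilateral[of "rot \<delta>"] equilateral[of "rot (rot \<delta>)"] rot_inner assms(1) rot3
    by (simp add: area_def)
qed

lemma isosceles:
  assumes "iso \<delta>"
  shows "isosceles (len \<delta>) (len (rot \<delta>)) (len (rot (rot \<delta>))) (tang (rot (rot \<delta>))) (tang \<delta>) (tang (rot \<delta>)) d"
proof (intro isosceles.intro isosceles_axioms.intro)
  have i: "\<delta> \<in> inner_darts" "rot \<delta> \<in> inner_darts" "rot (rot \<delta>) \<in> inner_darts" using assms rot_inner by (auto simp: iso_def)
  show "hyp_triangle (len \<delta>) (len (rot \<delta>)) (len (rot (rot \<delta>))) (tang (rot (rot \<delta>))) (tang \<delta>) (tang (rot \<delta>))"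
    by (rule triangle[OF i(1)])
  show "len (rot \<delta>) = d" "len (rot (rot \<delta>)) = d" using con_iff inner_dart i assms by (auto simp: iso_def)
  show "d \<le> len \<delta>" using len_ge inner_dart i by auto
qed

lemma iso_inner: "iso \<delta> \<Longrightarrow> \<delta> \<in> inner_darts" by (simp add: iso_def)

lemma iso_len: "iso \<delta> \<Longrightarrow> d < len \<delta>"
  using len_ge[of \<delta>] con_iff[of \<delta>] inner_dart[of \<delta>] by (simp add: iso_def)

lemma iso_exc: "iso \<delta> \<Longrightarrow> exc \<delta> = 2 * tang \<delta> - tang (rot (rot \<delta>))"
  using isosceles.base_angles[OF isosceles] by (simp add: exc_def)

lemma iso_nonthin_area: "iso \<delta> \<Longrightarrow> \<not> thin \<delta> \<Longrightarrow> u \<le> area \<delta>"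
  using nonthin_area[of \<delta>] con_not_thin[of "rot \<delta>"] con_not_thin[of "rot (rot \<delta>)"] rot_inner by (auto simp: iso_def)

lemma iso_bad:
  assumes "iso \<delta>" "area \<delta> < u" shows "tang \<delta> < \<alpha> / 2" "tang (rot (rot \<delta>)) > 2 * \<alpha>"
  using isosceles.large_angle_sum[OF isosceles[OF assms(1)]] assms(2) by (simp_all add: area_def)

lemma rhombus_congruent:
  assumes "iso \<delta>" "iso (prod.swap \<delta>)"
  shows "tang (prod.swap \<delta>) = tang \<delta>" "tang (rot (rot (prod.swap \<delta>))) = tang (rot (rot \<delta>))"
proof -
  interpret X: isosceles "len \<delta>" "len (rot \<delta>)" "len (rot (rot \<delta>))" "tang (rot (rot \<delta>))" "tang \<delta>" "tang (rot \<delta>)" d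
    by (rule isosceles[OF assms(1)])
  let ?e = "prod.swap \<delta>"
  interpret Y: isosceles "len ?e" "len (rot ?e)" "len (rot (rot ?e))" "tang (rot (rot ?e))" "tang ?e" "tang (rot ?e)" d
    by (rule isosceles[OF assms(2)])
  have "cos (tang (rot (rot ?e))) = cos (tang (rot (rot \<delta>)))"
    unfolding X.apex_angle[OF X.legs] Y.apex_angle[OF Y.legs] len_swap ..
  then show A: "tang (rot (rot ?e)) = tang (rot (rot \<delta>))"
    using X.angles X.angle_sum Y.angles Y.angle_sum
      cos_inj_pi[of "tang (rot (rot ?e))" "tang (rot (rot \<delta>))"] by linarith
  have "tan (tang (rot (rot \<delta>)) / 2) * tan (tang ?e) = tan (tang (rot (rot \<delta>)) / 2) * tan (tang \<delta>)"
    using X.tan_rel Y.tan_rel unfolding A by simp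
  then have "tan (tang ?e) = tan (tang \<delta>)" using X.tan_pos by simp
  moreover have "tang ?e \<le> tang \<delta> \<longleftrightarrow> tan (tang ?e) \<le> tan (tang \<delta>)" "tang \<delta> \<le> tang ?e \<longleftrightarrow> tan (tang \<delta>) \<le> tan (tang ?e)"
    using X.half_angles Y.half_angles by (auto simp: tan_mono_le_eq)
  ultimately show "tang ?e = tang \<delta>" by simp
qed

text \<open>The halves are congruent and thus have equal excess on the diagonal; as the two excesses
  have a nonnegative sum, neither is negative.\<close>

lemma rhombus:
  assumes "iso \<delta>" "iso (prod.swap \<delta>)"
  shows "\<not> thin \<delta>" "u \<le> area \<delta>" "tang (rot (rot \<delta>)) \<le> 2 * tang \<delta>"
    "\<alpha> < tang (rot (rot \<delta>))" "tang \<delta> < \<alpha>"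
proof -
  interpret X: isosceles "len \<delta>" "len (rot \<delta>)" "len (rot (rot \<delta>))" "tang (rot (rot \<delta>))" "tang \<delta>" "tang (rot \<delta>)" d
    by (rule isosceles[OF assms(1)])
  have "exc (prod.swap \<delta>) = exc \<delta>" using rhombus_congruent[OF assms] iso_exc assms by simp
  then have e: "exc \<delta> \<ge> 0" using exc_cross[of \<delta>] iso_inner assms by simp
  then show "\<not> thin \<delta>" by (simp add: thin_def)
  then show "u \<le> area \<delta>" by (rule iso_nonthin_area[OF assms(1)])
  show "tang (rot (rot \<delta>)) \<le> 2 * tang \<delta>" using e iso_exc[OF assms(1)] by simp
  show "tang \<delta> < \<alpha>" by (rule X.base_angle_less[OF iso_len[OF assms(1)]])
  show "\<alpha> < tang (rot (rot \<delta>))" by (rule X.apex_angle_gt[OF X.legs iso_len[OF assms(1)]])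
qed

text \<open>A bad triangle has base angles below \<alpha> / 2 and apex angle above 2 \<alpha>, hence
  excess below - \<alpha> on its base. With two of them the triangle between has excess above
  \<alpha> on both common sides; the sum is twice the angle opposite the contact, which is at most
  \<alpha> by \<open>base_angle_le\<close>.\<close>

lemma not_both_bad:
  assumes "\<delta> \<in> inner_darts" "\<delta> \<in> con" "iso (prod.swap (rot \<delta>))" "iso (prod.swap (rot (rot \<delta>)))"
  shows "\<not> (area (prod.swap (rot \<delta>)) < u \<and> area (prod.swap (rot (rot \<delta>))) < u)"
proof
  let ?e1 = "prod.swap (rot \<delta>)" and ?e2 = "prod.swap (rot (rot \<delta>))"
  assume bad: "area ?e1 < u \<and> area ?e2 < u"
  have i: "rot \<delta> \<in> inner_darts" "rot (rot \<delta>) \<in> inner_darts" using rot_inner assms(1) by auto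
  have "exc ?e1 < - \<alpha>" "exc ?e2 < - \<alpha>"
    using iso_bad[of ?e1] iso_bad[of ?e2] iso_exc[OF assms(3)] iso_exc[OF assms(4)] assms bad by simp_all
  then have "exc (rot \<delta>) + exc (rot (rot \<delta>)) > 2 * \<alpha>"
    using exc_cross[OF i(1) iso_inner[OF assms(3)]] exc_cross[OF i(2) iso_inner[OF assms(4)]] by linarith
  then have "tang (rot (rot \<delta>)) > \<alpha>" using exc_rot[OF i(1)] by simp
  moreover have "tang (rot (rot \<delta>)) \<le> \<alpha>"
    by (rule hyp_triangle.base_angle_le[OF triangle[OF assms(1)]])
      (use con_iff[of \<delta>] len_ge inner_dart i assms in auto)
  ultimately show False by simp
qed

lemma pentagon_aux:
  assumes "\<delta> \<in> inner_darts" "\<delta> \<in> inner_darts" "iso e1" "iso e2" "len e1 = len \<eta>1" "len e2 = len \<eta>2"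
    "thin e1" "\<not> thin e2" "len \<eta>1 \<le> len \<eta>2"
  shows False
proof -
  have "len e2 < len e1"
  proof (rule isosceles_apex_less[OF isosceles[OF assms(3)] isosceles[OF assms(4)]])
    show "2 * tang e1 < tang (rot (rot e1))" using assms iso_exc[of e1] by (simp add: thin_def)
    show "tang (rot (rot e2)) \<le> 2 * tang e2" using assms iso_exc[of e2] by (simp add: thin_def)
  qed
  then show False using assms by simp
qed

text \<open>If e1 and e2 are both thin, the middle triangle is thin nowhere and one of the two is
  not bad. If only e1 is thin, its base is the longer one, so the middle triangle is not thin on the
  other side either and has area at least u, as has e2. If neither is thin, both have area at least
  u.\<close>

lemma pentagon:
  assumes "\<delta> \<in> inner_darts" "\<delta> \<in> con" "iso (prod.swap (rot \<delta>))" "iso (prod.swap (rot (rot \<delta>)))"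
  shows "area \<delta> + area (prod.swap (rot \<delta>)) + area (prod.swap (rot (rot \<delta>))) \<ge> 2 * u"
proof -
  define \<eta>1 \<eta>2 where "\<eta>1 = rot \<delta>" and "\<eta>2 = rot (rot \<delta>)"
  define e1 e2 where "e1 = prod.swap \<eta>1" and "e2 = prod.swap \<eta>2"
  have iso: "iso e1" "iso e2" using assms by (auto simp: e1_def e2_def \<eta>1_def \<eta>2_def)
  have i: "\<eta>1 \<in> inner_darts" "\<eta>2 \<in> inner_darts" using rot_inner assms(1) by (auto simp: \<eta>1_def \<eta>2_def)
  have r: "rot \<eta>1 = \<eta>2" "rot \<eta>2 = \<delta>" "rot (rot \<eta>1) = \<delta>" "rot (rot \<eta>2) = \<eta>1"
    using rot3[OF assms(1)] by (auto simp: \<eta>1_def \<eta>2_def)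
  have x: "\<not> (thin \<eta>1 \<and> thin e1)" "\<not> (thin \<eta>2 \<and> thin e2)"
    using thin_cross[of \<eta>1] thin_cross[of \<eta>2] i iso_inner iso by (auto simp: e1_def e2_def)
  have nd: "\<not> thin \<delta>" using con_not_thin assms by auto
  have pos: "area \<delta> > 0" "area e1 > 0" "area e2 > 0" using area_pos assms(1) iso iso_inner by auto
  have a1: "u \<le> area e1" if "\<not> thin e1" using iso_nonthin_area iso that by auto
  have a2: "u \<le> area e2" if "\<not> thin e2" using iso_nonthin_area iso that by auto
  have a: "u \<le> area \<delta>" if "\<not> thin \<eta>1" "\<not> thin \<eta>2"
    using nonthin_area[OF assms(1) nd] that by (simp add: \<eta>1_def \<eta>2_def)
  have l: "len e1 = len \<eta>1" "len e2 = len \<eta>2" by (simp_all add: e1_def e2_def len_swap)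
  have le12: "len \<eta>1 \<le> len \<eta>2" if "thin \<eta>2"
  proof -
    have "tang (rot (rot \<eta>2)) > tang (rot \<eta>2)" using that tang_pos[OF i(2)] by (simp add: thin_def exc_def)
    then have "tang \<eta>1 > tang (rot (rot \<eta>1))" using r by simp
    then show ?thesis using angle_le_iff[OF i(1)] r by simp
  qed
  have le21: "len \<eta>2 \<le> len \<eta>1" if "thin \<eta>1"
  proof -
    have "tang (rot (rot \<eta>1)) > tang \<eta>1" using that tang_pos[OF rot_inner[OF i(1)]] by (simp add: thin_def exc_def)
    then have "\<not> len \<eta>1 \<le> len (rot \<eta>1)" using angle_le_iff[OF i(1)] by simp
    then show ?thesis using r by simp
  qed
  have "area \<delta> + area e1 + area e2 \<ge> 2 * u"
  proof (cases "thin e1"; cases "thin e2")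
    assume "thin e1" "thin e2"
    then have "u \<le> area \<delta>" using a x by auto
    moreover have "\<not> (area e1 < u \<and> area e2 < u)"
      using not_both_bad[OF assms] by (simp add: e1_def e2_def \<eta>1_def \<eta>2_def)
    ultimately show ?thesis using pos by auto
  next
    assume t: "thin e1" "\<not> thin e2"
    have "\<not> thin \<eta>2" using pentagon_aux[OF assms(1,1) iso l t] le12 by blast
    then show ?thesis using a a2 t x pos by auto
  next
    assume t: "\<not> thin e1" "thin e2"
    have "\<not> thin \<eta>1" using pentagon_aux[OF assms(1,1) iso(2,1) l(2,1) t(2,1)] le21 by blast
    then show ?thesis using a a1 t x pos by auto
  next
    assume t: "\<not> thin e1" "\<not> thin e2"
    have "area e1 + area e2 \<ge> u + u" by (rule add_mono[OF a1[OF t(1)] a2[OF t(2)]])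
    then show ?thesis using pos(1) by (simp add: algebra_simps)
  qed
  then show ?thesis by (simp add: e1_def e2_def \<eta>1_def \<eta>2_def)
qed

subsection \<open>Discharging\<close>

lemma sum_swap_zero:
  assumes "\<And>\<epsilon>. \<epsilon> \<in> In \<Longrightarrow> \<epsilon> \<notin> con \<Longrightarrow> p (prod.swap \<epsilon>) = - p \<epsilon>"
  shows "(\<Sum>\<epsilon>\<in>In - con. p \<epsilon>) = (0::real)"
proof -
  have img: "prod.swap ` (In - con) = In - con"
  proof -
    have sub: "prod.swap \<epsilon> \<in> In - con" if "\<epsilon> \<in> In - con" for \<epsilon>
      using that In_cross[of \<epsilon>] con_swap[of \<epsilon>] by auto
    moreover have "\<epsilon> \<in> prod.swap ` (In - con)" if "\<epsilon> \<in> In - con" for \<epsilon>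
      using sub[OF that] image_eqI[of \<epsilon> prod.swap "prod.swap \<epsilon>"] by simp
    ultimately show ?thesis by blast
  qed
  have "(\<Sum>\<epsilon>\<in>In - con. p \<epsilon>) = (\<Sum>\<epsilon>\<in>prod.swap ` (In - con). p \<epsilon>)" unfolding img ..
  also have "\<dots> = (\<Sum>\<epsilon>\<in>In - con. p (prod.swap \<epsilon>))" by (subst sum.reindex) auto
  also have "\<dots> = (\<Sum>\<epsilon>\<in>In - con. - p \<epsilon>)" using assms by (intro sum.cong) auto
  finally show ?thesis by (simp add: sum_negf)
qed

definition ncp :: "(complex \<times> complex \<Rightarrow> real) \<Rightarrow> complex \<times> complex \<Rightarrow> real" where
  "ncp p \<epsilon> = (if \<epsilon> \<in> con then 0 else p \<epsilon>)"

text \<open>p is what a triangle receives across a side; antisymmetry keeps the total. Sums over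
  \<open>In\<close> count each triangle three times, once for each dart, which is why transfers over
  all three sides are added at every dart.\<close>

lemma transfer_sum:
  assumes "\<And>\<epsilon>. \<epsilon> \<in> In \<Longrightarrow> \<epsilon> \<notin> con \<Longrightarrow> p (prod.swap \<epsilon>) = - p \<epsilon>"
    and "\<And>\<delta>. \<delta> \<in> In \<Longrightarrow> w \<delta> \<le> f \<delta> + (ncp p \<delta> + ncp p (rot \<delta>) + ncp p (rot (rot \<delta>)))"
  shows "(\<Sum>\<delta>\<in>In. w \<delta>) \<le> (\<Sum>\<delta>\<in>In. f \<delta>)"
proof -
  have "(\<Sum>\<delta>\<in>In. ncp p \<delta>) = (\<Sum>\<delta>\<in>In - con. p \<delta>)"
    unfolding ncp_def using finite_In by (simp add: sum.If_cases Diff_eq Int_commute)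
  then have z: "(\<Sum>\<delta>\<in>In. ncp p \<delta>) = 0" using sum_swap_zero assms(1) by simp
  have "(\<Sum>\<delta>\<in>In. w \<delta>) \<le> (\<Sum>\<delta>\<in>In. f \<delta> + (ncp p \<delta> + ncp p (rot \<delta>) + ncp p (rot (rot \<delta>))))"
    using assms(2) by (rule sum_mono)
  also have "\<dots> = (\<Sum>\<delta>\<in>In. f \<delta>)"
    using z sum_In_rot[of "ncp p"] sum_In_rot[of "\<lambda>\<delta>. ncp p (rot \<delta>)"] by (simp add: sum.distrib)
  finally show ?thesis .
qed

lemma In_cases:
  assumes "\<delta> \<in> In"
  obtains "nnc \<delta> = 0" "\<delta> \<in> con" "rot \<delta> \<in> con" "rot (rot \<delta>) \<in> con"
  | \<epsilon> where "\<epsilon> \<in> {\<delta>, rot \<delta>, rot (rot \<delta>)}" "\<epsilon> \<in> In" "iso \<epsilon>" "nnc \<delta> = 1"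
  | \<eta> where "\<eta> \<in> {\<delta>, rot \<delta>, rot (rot \<delta>)}" "\<eta> \<in> In" "\<eta> \<in> con" "rot \<eta> \<notin> con" "rot (rot \<eta>) \<notin> con" "nnc \<delta> = 2"
  | "\<delta> \<notin> con" "rot \<delta> \<notin> con" "rot (rot \<delta>) \<notin> con" "nnc \<delta> = 3"
proof -
  have r: "rot (rot (rot \<delta>)) = \<delta>" using rot3 In_inner assms by blast
  have I: "rot \<delta> \<in> In" "rot (rot \<delta>) \<in> In" using In_rot assms by auto
  note i = In_inner[OF assms] In_inner[OF I(1)] In_inner[OF I(2)]
  show thesis
    by (cases "\<delta> \<in> con"; cases "rot \<delta> \<in> con"; cases "rot (rot \<delta>) \<in> con")
      (use that(1) that(2)[of \<delta>] that(2)[of "rot \<delta>"] that(2)[of "rot (rot \<delta>)"]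
        that(3)[of \<delta>] that(3)[of "rot \<delta>"] that(3)[of "rot (rot \<delta>)"] that(4) r I i assms in \<open>auto simp: nnc_def iso_def\<close>)
qed

lemma orb_sum:
  fixes F :: "complex \<times> complex \<Rightarrow> real"
  assumes "\<delta> \<in> inner_darts" "\<epsilon> \<in> {\<delta>, rot \<delta>, rot (rot \<delta>)}"
  shows "F \<delta> + F (rot \<delta>) + F (rot (rot \<delta>)) = F \<epsilon> + F (rot \<epsilon>) + F (rot (rot \<epsilon>))"
  using assms rot3[OF assms(1)] by auto

lemma orb_area: "\<delta> \<in> inner_darts \<Longrightarrow> \<epsilon> \<in> {\<delta>, rot \<delta>, rot (rot \<delta>)} \<Longrightarrow> area \<epsilon> = area \<delta>"
  using area_rot[of \<delta>] area_rot[of "rot \<delta>"] rot_inner[of \<delta>] by auto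

lemma In_swap_inner: "\<epsilon> \<in> In \<Longrightarrow> \<epsilon> \<notin> con \<Longrightarrow> prod.swap \<epsilon> \<in> inner_darts"
  using In_cross In_inner by blast

lemma iso_swap_notcon: "iso (prod.swap \<epsilon>) \<Longrightarrow> \<epsilon> \<notin> con"
  using con_swap by (auto simp: iso_def)

text \<open>Each bad triangle receives one unit from its only neighbour.\<close>

lemma area_weight_square:
  "(\<Sum>\<delta>\<in>In. if nnc \<delta> = 0 then 1 else 3 - 2 * nnc \<delta>) \<le> (\<Sum>\<delta>\<in>In. area \<delta> / u)"
proof -
  \<comment> \<open>The weights for 0, 1, 2, 3 non-contact sides are 1, 1, -1, -3. A triangle with
    two such sides pays at most once, by \<open>not_both_bad\<close>, and one with three at most
    three times.\<close>
  define bad where "bad \<epsilon> \<longleftrightarrow> iso \<epsilon> \<and> area \<epsilon> < u" for \<epsilon>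
  define p where "p \<epsilon> = (of_bool (bad \<epsilon>) - of_bool (bad (prod.swap \<epsilon>)) :: real)" for \<epsilon>
  show ?thesis
  proof (rule transfer_sum[where p = p])
    show "p (prod.swap \<epsilon>) = - p \<epsilon>" for \<epsilon> by (simp add: p_def)
    fix \<delta> assume I: "\<delta> \<in> In"
    note i = In_inner[OF I]
    have a0: "area \<delta> / u \<ge> 0" using area_pos[OF i] u_pos by simp
    have p1: "ncp p \<epsilon> \<ge> -1" for \<epsilon> by (simp add: ncp_def p_def)
    show "(if nnc \<delta> = 0 then 1 else 3 - 2 * nnc \<delta>) \<le> area \<delta> / u + (ncp p \<delta> + ncp p (rot \<delta>) + ncp p (rot (rot \<delta>)))"
    proof (rule In_cases[OF I])
      assume "nnc \<delta> = 0" "\<delta> \<in> con" "rot \<delta> \<in> con" "rot (rot \<delta>) \<in> con"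
      then show ?thesis using equilateral_area[OF i] u_pos by (simp add: ncp_def)
    next
      fix \<epsilon> assume e: "\<epsilon> \<in> {\<delta>, rot \<delta>, rot (rot \<delta>)}" "\<epsilon> \<in> In" "iso \<epsilon>" "nnc \<delta> = 1"
      have s: "ncp p \<delta> + ncp p (rot \<delta>) + ncp p (rot (rot \<delta>)) = p \<epsilon>"
        unfolding orb_sum[OF i e(1), of "ncp p"] using e(3) by (simp add: ncp_def iso_def)
      have ns: "\<not> bad (prod.swap \<epsilon>)" using rhombus(2)[of "prod.swap \<epsilon>"] e(3) by (auto simp: bad_def)
      have "1 \<le> area \<epsilon> / u + p \<epsilon>"
      proof (cases "bad \<epsilon>")
        case True then show ?thesis using ns a0 orb_area[OF i e(1)] by (simp add: p_def)
      next
        case False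
        then have "p \<epsilon> = 0" "1 \<le> area \<epsilon> / u" using ns e(3) u_pos by (auto simp: p_def bad_def)
        then show ?thesis by simp
      qed
      then show ?thesis using e s orb_area[OF i e(1)] by simp
    next
      fix \<eta> assume e: "\<eta> \<in> {\<delta>, rot \<delta>, rot (rot \<delta>)}" "\<eta> \<in> In" "\<eta> \<in> con" "rot \<eta> \<notin> con" "rot (rot \<eta>) \<notin> con" "nnc \<delta> = 2"
      have s: "ncp p \<delta> + ncp p (rot \<delta>) + ncp p (rot (rot \<delta>)) = p (rot \<eta>) + p (rot (rot \<eta>))"
        unfolding orb_sum[OF i e(1), of "ncp p"] using e by (simp add: ncp_def)
      have "\<not> (bad (prod.swap (rot \<eta>)) \<and> bad (prod.swap (rot (rot \<eta>))))"
        using not_both_bad[OF In_inner[OF e(2)] e(3)] by (auto simp: bad_def)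
      then have "p (rot \<eta>) + p (rot (rot \<eta>)) \<ge> -1" by (auto simp: p_def)
      then show ?thesis using e s a0 by simp
    next
      assume "nnc \<delta> = 3"
      then show ?thesis using a0 p1[of \<delta>] p1[of "rot \<delta>"] p1[of "rot (rot \<delta>)"] by simp
    qed
  qed
qed

definition rhomb :: "complex \<times> complex \<Rightarrow> bool" where
  "rhomb \<delta> \<longleftrightarrow> (\<exists>\<epsilon>\<in>{\<delta>, rot \<delta>, rot (rot \<delta>)}. iso \<epsilon> \<and> iso (prod.swap \<epsilon>))"

lemma rhomb_rot: "\<delta> \<in> inner_darts \<Longrightarrow> rhomb (rot \<delta>) \<longleftrightarrow> rhomb \<delta>"
  using rot3[of \<delta>] by (auto simp: rhomb_def)

lemma iso_unique:
  assumes "\<delta> \<in> inner_darts" "\<epsilon> \<in> {\<delta>, rot \<delta>, rot (rot \<delta>)}" "\<epsilon>' \<in> {\<delta>, rot \<delta>, rot (rot \<delta>)}" "iso \<epsilon>" "\<epsilon>' \<notin> con"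
  shows "\<epsilon>' = \<epsilon>"
  using assms rot3[OF assms(1)] by (auto simp: iso_def)

text \<open>Marks an isosceles triangle that is not half of a rhombus. The marked triangle is the
  one that receives; the neighbour across the base gives.\<close>

definition gives :: "complex \<times> complex \<Rightarrow> real" where
  "gives \<epsilon> = of_bool (iso \<epsilon> \<and> \<not> iso (prod.swap \<epsilon>))"

lemma gives_le: "0 \<le> gives \<epsilon>" "gives \<epsilon> \<le> 1"
  by (simp_all add: gives_def)

lemma rhomb_iff:
  assumes "\<delta> \<in> inner_darts" "\<epsilon> \<in> {\<delta>, rot \<delta>, rot (rot \<delta>)}" "iso \<epsilon>"
  shows "rhomb \<delta> \<longleftrightarrow> iso (prod.swap \<epsilon>)"
proof
  assume "rhomb \<delta>"
  then obtain \<epsilon>' where e: "\<epsilon>' \<in> {\<delta>, rot \<delta>, rot (rot \<delta>)}" "iso \<epsilon>'" "iso (prod.swap \<epsilon>')"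
    unfolding rhomb_def by blast
  moreover have "\<epsilon>' = \<epsilon>" by (rule iso_unique[OF assms(1,2) e(1) assms(3)]) (use e(2) in \<open>simp add: iso_def\<close>)
  ultimately show "iso (prod.swap \<epsilon>)" by simp
next
  assume "iso (prod.swap \<epsilon>)"
  then show "rhomb \<delta>" unfolding rhomb_def using assms(2,3) by blast
qed

lemma not_rhomb: "\<delta> \<in> In \<Longrightarrow> nnc \<delta> \<noteq> 1 \<Longrightarrow> \<not> rhomb \<delta>"
proof
  assume I: "\<delta> \<in> In" and n: "nnc \<delta> \<noteq> 1" and "rhomb \<delta>"
  then obtain \<epsilon> where e: "\<epsilon> \<in> {\<delta>, rot \<delta>, rot (rot \<delta>)}" "iso \<epsilon>" unfolding rhomb_def by blast
  have "nnc \<delta> = nnc \<epsilon>"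
    using e(1) nnc_rot[OF In_inner[OF I]] nnc_rot[OF rot_inner[OF In_inner[OF I]]] by auto
  then show False using n e(2) by (simp add: nnc_def iso_def)
qed

text \<open>The summands are -1/2, 2 and 9/2 for one, two and three non-contact sides. A marked
  isosceles triangle takes 1/2 across its base, and others lose at most 1/2 per non-contact side.
  This supplies the condition 0 \<le> D of \<open>edge_bound\<close>.\<close>

lemma deficit_nonneg:
  "0 \<le> (\<Sum>\<delta>\<in>In. if nnc \<delta> = 0 \<or> rhomb \<delta> then 0 else 5 / 2 * nnc \<delta> - 3)"
proof -
  define p where "p \<epsilon> = (gives \<epsilon> - gives (prod.swap \<epsilon>)) / 2" for \<epsilon>
  have "(\<Sum>\<delta>\<in>In. 0 :: real) \<le> (\<Sum>\<delta>\<in>In. if nnc \<delta> = 0 \<or> rhomb \<delta> then 0 else 5 / 2 * nnc \<delta> - 3)"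
  proof (rule transfer_sum[where p = p])
    show "p (prod.swap \<epsilon>) = - p \<epsilon>" for \<epsilon> by (simp add: p_def field_simps)
    fix \<delta> assume I: "\<delta> \<in> In"
    note i = In_inner[OF I]
    have p1: "ncp p \<epsilon> \<ge> -1/2" for \<epsilon> using gives_le[of \<epsilon>] gives_le[of "prod.swap \<epsilon>"] by (simp add: ncp_def p_def)
    show "0 \<le> (if nnc \<delta> = 0 \<or> rhomb \<delta> then 0 else 5 / 2 * nnc \<delta> - 3) + (ncp p \<delta> + ncp p (rot \<delta>) + ncp p (rot (rot \<delta>)))"
    proof (rule In_cases[OF I])
      assume "nnc \<delta> = 0" "\<delta> \<in> con" "rot \<delta> \<in> con" "rot (rot \<delta>) \<in> con"
      then show ?thesis by (simp add: ncp_def)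
    next
      fix \<epsilon> assume e: "\<epsilon> \<in> {\<delta>, rot \<delta>, rot (rot \<delta>)}" "\<epsilon> \<in> In" "iso \<epsilon>" "nnc \<delta> = 1"
      have s: "ncp p \<delta> + ncp p (rot \<delta>) + ncp p (rot (rot \<delta>)) = p \<epsilon>"
        unfolding orb_sum[OF i e(1), of "ncp p"] using e(3) by (simp add: ncp_def iso_def)
      show ?thesis unfolding s using e rhomb_iff[OF i e(1,3)] by (simp add: p_def gives_def)
    next
      fix \<eta> assume e: "\<eta> \<in> {\<delta>, rot \<delta>, rot (rot \<delta>)}" "\<eta> \<in> In" "\<eta> \<in> con" "rot \<eta> \<notin> con" "rot (rot \<eta>) \<notin> con" "nnc \<delta> = 2"
      have s: "ncp p \<delta> + ncp p (rot \<delta>) + ncp p (rot (rot \<delta>)) \<ge> -1"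
        unfolding orb_sum[OF i e(1), of "ncp p"] using e(3) p1[of "rot \<eta>"] p1[of "rot (rot \<eta>)"] by (simp add: ncp_def[of p \<eta>])
      then show ?thesis using e not_rhomb[OF I] by simp
    next
      assume "nnc \<delta> = 3"
      then show ?thesis using not_rhomb[OF I] p1[of \<delta>] p1[of "rot \<delta>"] p1[of "rot (rot \<delta>)"] by simp
    qed
  qed
  then show ?thesis by simp
qed

text \<open>The middle triangle of a pentagonal face.\<close>

definition middle :: "complex \<times> complex \<Rightarrow> bool" where
  "middle \<delta> \<longleftrightarrow> (\<exists>\<eta>\<in>{\<delta>, rot \<delta>, rot (rot \<delta>)}. \<eta> \<in> con \<and> iso (prod.swap (rot \<eta>)) \<and> iso (prod.swap (rot (rot \<eta>))))"

lemma middle_rot: "\<delta> \<in> inner_darts \<Longrightarrow> middle (rot \<delta>) \<longleftrightarrow> middle \<delta>"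
  using rot3[of \<delta>] by (auto simp: middle_def)

lemma middle_nnc: assumes "\<delta> \<in> inner_darts" "middle \<delta>" shows "nnc \<delta> = 2"
proof -
  obtain \<eta> where e: "\<eta> \<in> {\<delta>, rot \<delta>, rot (rot \<delta>)}" "\<eta> \<in> con" "iso (prod.swap (rot \<eta>))" "iso (prod.swap (rot (rot \<eta>)))"
    using assms unfolding middle_def by blast
  have "nnc \<delta> = nnc \<eta>"
    using e(1) nnc_rot[OF assms(1)] nnc_rot[OF rot_inner[OF assms(1)]] by auto
  then show ?thesis using e iso_swap_notcon by (simp add: nnc_def)
qed

lemma iso_nnc: "iso \<delta> \<Longrightarrow> nnc \<delta> = 1"
  by (simp add: nnc_def iso_def)

text \<open>Equilateral triangles and halves of rhombi weigh 1; otherwise one, two, three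
  non-contact sides weigh 3/2, -1, -7/2. Half a unit flows to the triangle that is thin at the side,
  and a whole unit to an isosceles triangle that is not half of a rhombus. The middle of a pentagon
  could not afford this at both sides: there each isosceles triangle takes just the difference to
  3/2, and \<open>pentagon\<close> leaves the middle with at least -1.\<close>

lemma area_weight_generic:
  "(\<Sum>\<delta>\<in>In. if nnc \<delta> = 0 \<or> rhomb \<delta> then 1 else 4 - 5 / 2 * nnc \<delta>) \<le> (\<Sum>\<delta>\<in>In. area \<delta> / u)"
proof -
  define p where "p \<epsilon> = (if iso \<epsilon> \<and> middle (prod.swap \<epsilon>) then 3 / 2 - area \<epsilon> / u
     else if iso (prod.swap \<epsilon>) \<and> middle \<epsilon> then - (3 / 2 - area (prod.swap \<epsilon>) / u)
     else (of_bool (thin \<epsilon>) - of_bool (thin (prod.swap \<epsilon>))) / 2 + gives \<epsilon> - gives (prod.swap \<epsilon>))" for \<epsilon>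
  have nim: "\<not> (iso \<epsilon> \<and> middle \<epsilon>)" for \<epsilon> using iso_nnc[of \<epsilon>] middle_nnc[of \<epsilon>] iso_inner[of \<epsilon>] by auto
  show ?thesis
  proof (rule transfer_sum[where p = p])
    show "p (prod.swap \<epsilon>) = - p \<epsilon>" for \<epsilon> using nim[of \<epsilon>] nim[of "prod.swap \<epsilon>"] by (auto simp: p_def)
    fix \<delta> assume I: "\<delta> \<in> In"
    note i = In_inner[OF I]
    have tx: "of_bool (thin \<epsilon>) + of_bool (thin (prod.swap \<epsilon>)) \<le> (1::real)" if "\<epsilon> \<in> In" "\<epsilon> \<notin> con" for \<epsilon>
      using thin_cross[OF In_inner[OF that(1)] In_swap_inner[OF that]] by auto
    show "(if nnc \<delta> = 0 \<or> rhomb \<delta> then 1 else 4 - 5 / 2 * nnc \<delta>)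
        \<le> area \<delta> / u + (ncp p \<delta> + ncp p (rot \<delta>) + ncp p (rot (rot \<delta>)))"
    proof (rule In_cases[OF I])
      assume "nnc \<delta> = 0" "\<delta> \<in> con" "rot \<delta> \<in> con" "rot (rot \<delta>) \<in> con"
      then show ?thesis using equilateral_area[OF i] u_pos by (simp add: ncp_def)
    next
      fix \<epsilon> assume e: "\<epsilon> \<in> {\<delta>, rot \<delta>, rot (rot \<delta>)}" "\<epsilon> \<in> In" "iso \<epsilon>" "nnc \<delta> = 1"
      have nc: "\<epsilon> \<notin> con" using e(3) by (simp add: iso_def)
      have s: "ncp p \<delta> + ncp p (rot \<delta>) + ncp p (rot (rot \<delta>)) = p \<epsilon>"
        unfolding orb_sum[OF i e(1), of "ncp p"] using e(3) by (simp add: ncp_def iso_def)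
      have ar: "area \<delta> = area \<epsilon>" using orb_area[OF i e(1)] by simp
      have at: "area \<epsilon> / u \<ge> 1 - of_bool (thin \<epsilon>)"
        using area_thin[OF In_inner[OF e(2)]] con_not_thin[of "rot \<epsilon>"] con_not_thin[of "rot (rot \<epsilon>)"] e(3) rot_inner
        by (auto simp: iso_def)
      show ?thesis
      proof (cases "iso (prod.swap \<epsilon>)")
        case True
        have "\<not> thin \<epsilon>" "\<not> thin (prod.swap \<epsilon>)" using rhombus(1)[OF e(3) True] rhombus(1)[OF True] e(3) by auto
        then have "p \<epsilon> = 0" using True e(3) nim[of \<epsilon>] nim[of "prod.swap \<epsilon>"] by (simp add: p_def gives_def)
        then show ?thesis using s ar rhombus(2)[OF e(3) True] u_pos rhomb_iff[OF i e(1,3)] True by simp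
      next
        case False
        have "3 / 2 \<le> area \<epsilon> / u + p \<epsilon>"
        proof (cases "middle (prod.swap \<epsilon>)")
          case True then show ?thesis using e(3) by (simp add: p_def)
        next
          case m: False
          then have "p \<epsilon> = (of_bool (thin \<epsilon>) - of_bool (thin (prod.swap \<epsilon>))) / 2 + 1"
            using e(3) False by (simp add: p_def gives_def)
          moreover have "3 / 2 \<le> R + q" if "q = (t - t') / 2 + 1" "1 - t \<le> R" "t + t' \<le> 1" for R q t t' :: real
            using that by (simp add: field_simps)
          ultimately show ?thesis using at tx[OF e(2) nc] by blast
        qed
        then show ?thesis using s ar e(4) rhomb_iff[OF i e(1,3)] False by simp
      qed
    next
      fix \<eta> assume e: "\<eta> \<in> {\<delta>, rot \<delta>, rot (rot \<delta>)}" "\<eta> \<in> In" "\<eta> \<in> con" "rot \<eta> \<notin> con" "rot (rot \<eta>) \<notin> con" "nnc \<delta> = 2"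
      have s: "ncp p \<delta> + ncp p (rot \<delta>) + ncp p (rot (rot \<delta>)) = p (rot \<eta>) + p (rot (rot \<eta>))"
        unfolding orb_sum[OF i e(1), of "ncp p"] using e by (simp add: ncp_def)
      have ar: "area \<delta> = area \<eta>" using orb_area[OF i e(1)] by simp
      have ie: "\<eta> \<in> inner_darts" "rot \<eta> \<in> inner_darts" "rot (rot \<eta>) \<in> inner_darts" using In_inner[OF e(2)] rot_inner by auto
      have rI: "rot \<eta> \<in> In" "rot (rot \<eta>) \<in> In" using In_rot e(2) by auto
      have ni: "\<not> iso (rot \<eta>)" "\<not> iso (rot (rot \<eta>))" using e(4,5) rot3[OF ie(1)] by (auto simp: iso_def)
      have "area \<eta> / u + (p (rot \<eta>) + p (rot (rot \<eta>))) \<ge> -1"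
      proof (cases "iso (prod.swap (rot \<eta>)) \<and> iso (prod.swap (rot (rot \<eta>)))")
        case True
        then have "middle \<eta>" using e(3) by (auto simp: middle_def)
        then have m: "middle (rot \<eta>)" "middle (rot (rot \<eta>))" using middle_rot ie by auto
        have "(2 * u) / u \<le> (area \<eta> + area (prod.swap (rot \<eta>)) + area (prod.swap (rot (rot \<eta>)))) / u"
          using pentagon[OF ie(1) e(3)] True u_pos by (intro divide_right_mono) auto
        then have "2 \<le> area \<eta> / u + area (prod.swap (rot \<eta>)) / u + area (prod.swap (rot (rot \<eta>))) / u"
        proof -
          assume "(2 * u) / u \<le> (area \<eta> + area (prod.swap (rot \<eta>)) + area (prod.swap (rot (rot \<eta>)))) / u"
          moreover have "(2 * u) / u = 2" by (rule nonzero_mult_div_cancel_right) (use u_pos in simp)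
          ultimately show ?thesis by (simp only: add_divide_distrib)
        qed
        moreover have "p (rot \<eta>) = - (3 / 2 - area (prod.swap (rot \<eta>)) / u)"
          "p (rot (rot \<eta>)) = - (3 / 2 - area (prod.swap (rot (rot \<eta>))) / u)"
          using True m ni by (auto simp: p_def)
        ultimately show ?thesis by simp
      next
        case False
        have nm: "\<not> middle (rot \<eta>)" "\<not> middle (rot (rot \<eta>))"
        proof -
          have "\<not> middle \<eta>"
          proof
            assume "middle \<eta>"
            then obtain \<zeta> where z: "\<zeta> \<in> {\<eta>, rot \<eta>, rot (rot \<eta>)}" "\<zeta> \<in> con" "iso (prod.swap (rot \<zeta>))" "iso (prod.swap (rot (rot \<zeta>)))"
              unfolding middle_def by blast
            then have "\<zeta> = \<eta>" using e by auto
            then show False using z False by simp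
          qed
          then show "\<not> middle (rot \<eta>)" "\<not> middle (rot (rot \<eta>))" using middle_rot ie by auto
        qed
        have pe: "p \<epsilon> = (of_bool (thin \<epsilon>) - of_bool (thin (prod.swap \<epsilon>))) / 2 - of_bool (iso (prod.swap \<epsilon>))"
          if "\<epsilon> \<in> {rot \<eta>, rot (rot \<eta>)}" for \<epsilon>
          using that nm ni by (auto simp: p_def gives_def)
        have "area \<eta> / u \<ge> 1 - of_bool (thin (rot \<eta>)) - of_bool (thin (rot (rot \<eta>)))"
          using area_thin[OF ie(1)] con_not_thin[OF ie(1) e(3)] by simp
        moreover have "of_bool (iso (prod.swap (rot \<eta>))) + of_bool (iso (prod.swap (rot (rot \<eta>)))) \<le> (1::real)"
          using False by auto
        moreover have "- 1 \<le> R + (p1 + p2)"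
          if "p1 = (t1 - s1) / 2 - i1" "p2 = (t2 - s2) / 2 - i2" "1 - t1 - t2 \<le> R" "t1 + s1 \<le> 1" "t2 + s2 \<le> 1"
            "i1 + i2 \<le> 1" for R p1 p2 t1 t2 s1 s2 i1 i2 :: real
          using that by (simp add: field_simps)
        ultimately show ?thesis
          using tx[OF rI(1) e(4)] tx[OF rI(2) e(5)] pe[of "rot \<eta>"] pe[of "rot (rot \<eta>)"] by blast
      qed
      then show ?thesis using s ar e(6) not_rhomb[OF I] by simp
    next
      assume e: "\<delta> \<notin> con" "rot \<delta> \<notin> con" "rot (rot \<delta>) \<notin> con" "nnc \<delta> = 3"
      have I': "rot \<delta> \<in> In" "rot (rot \<delta>) \<in> In" using In_rot I by auto
      have m: "\<not> middle \<delta>" "\<not> middle (rot \<delta>)" "\<not> middle (rot (rot \<delta>))"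
        using middle_nnc[OF i] e(4) middle_rot i rot_inner by auto
      have ni: "\<not> iso \<delta>" "\<not> iso (rot \<delta>)" "\<not> iso (rot (rot \<delta>))" using e rot3[OF i] by (auto simp: iso_def)
      have pe: "p \<epsilon> \<ge> (of_bool (thin \<epsilon>) - of_bool (thin (prod.swap \<epsilon>))) / 2 - 1"
        if "\<epsilon> \<in> {\<delta>, rot \<delta>, rot (rot \<delta>)}" for \<epsilon>
        using that m ni gives_le[of "prod.swap \<epsilon>"] gives_le[of \<epsilon>] by (auto simp: p_def)
      have "- 7 / 2 \<le> R + (p1 + p2 + p3)"
        if "1 - t1 - t2 - t3 \<le> R" "t1 + s1 \<le> 1" "t2 + s2 \<le> 1" "t3 + s3 \<le> 1"
          "(t1 - s1) / 2 - 1 \<le> p1" "(t2 - s2) / 2 - 1 \<le> p2" "(t3 - s3) / 2 - 1 \<le> p3"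
        for R p1 p2 p3 t1 t2 t3 s1 s2 s3 :: real
        using that by (simp add: field_simps)
      from this[OF area_thin[OF i] tx[OF I e(1)] tx[OF I'(1) e(2)] tx[OF I'(2) e(3)]
          pe[of \<delta>] pe[of "rot \<delta>"] pe[of "rot (rot \<delta>)"]]
      have "area \<delta> / u + (p \<delta> + p (rot \<delta>) + p (rot (rot \<delta>))) \<ge> - 7 / 2" by blast
      then show ?thesis using e not_rhomb[OF I] by (simp add: ncp_def)
    qed
  qed
qed

end

context packing
begin

subsection \<open>Global counting\<close>

lemma finite_outer: "finite outer"
  using outer_subset finite_inner_darts finite_subset by blast

lemma finite_hull_darts: "finite hull_darts"
  using finite_darts by (simp add: hull_darts_def)

lemma card_splits:
  "card inner_darts = card In + card outer"
  "card darts = card inner_darts + card hull_darts"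
  "card darts = card con + card (In - con) + card ((outer \<union> hull_darts) - con)"
  "card outer + card hull_darts = card (con - In) + card ((outer \<union> hull_darts) - con)"
proof -
  have "inner_darts = In \<union> outer" "In \<inter> outer = {}" using outer_subset by (auto simp: In_def)
  then show "card inner_darts = card In + card outer"
    using card_Un_disjoint[OF finite_In finite_outer] by simp
  have "darts = inner_darts \<union> hull_darts" "inner_darts \<inter> hull_darts = {}"
    using inner_darts_subset by (auto simp: hull_darts_def)
  then show "card darts = card inner_darts + card hull_darts"
    using card_Un_disjoint[OF finite_inner_darts finite_hull_darts] by simp
  have d: "darts = In \<union> (outer \<union> hull_darts)" "In \<inter> (outer \<union> hull_darts) = {}" "outer \<inter> hull_darts = {}"
    using inner_darts_subset outer_subset by (auto simp: hull_darts_def In_def)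
  have fin: "finite (In - con)" "finite (outer \<union> hull_darts)" using finite_In finite_outer finite_hull_darts by auto
  have "darts = con \<union> ((In - con) \<union> ((outer \<union> hull_darts) - con))" using d(1) con_darts by auto
  moreover have "card (con \<union> ((In - con) \<union> ((outer \<union> hull_darts) - con)))
     = card con + card ((In - con) \<union> ((outer \<union> hull_darts) - con))"
    using finite_con fin by (intro card_Un_disjoint) auto
  moreover have "card ((In - con) \<union> ((outer \<union> hull_darts) - con)) = card (In - con) + card ((outer \<union> hull_darts) - con)"
    using fin d(2) by (intro card_Un_disjoint) auto
  ultimately show "card darts = card con + card (In - con) + card ((outer \<union> hull_darts) - con)" by simp
  have "outer \<union> hull_darts = (con - In) \<union> ((outer \<union> hull_darts) - con)" using d con_darts by auto
  moreover have "card ((con - In) \<union> ((outer \<union> hull_darts) - con)) = card (con - In) + card ((outer \<union> hull_darts) - con)"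
    using finite_con fin by (intro card_Un_disjoint) auto
  moreover have "card (outer \<union> hull_darts) = card outer + card hull_darts"
    using finite_outer finite_hull_darts d(3) by (intro card_Un_disjoint) auto
  ultimately show "card outer + card hull_darts = card (con - In) + card ((outer \<union> hull_darts) - con)" by simp
qed

text \<open>b counts the hull darts and the outer triangles. By \<open>card_outer\<close> there are
  at least two non-contact darts outside \<open>In\<close> for each outer triangle; hence such a
  triangle costs as much as one more hull dart, both in the number of contacts and in the bound for
  \<open>con - In\<close>.\<close>

lemma counting:
  assumes "P \<noteq> {}"
  obtains \<sigma> b :: real where "\<sigma> \<ge> 0"
    "real (card con) / 2 \<le> 3 * (real (card P) - 1) - b - 3 * \<sigma> - real (card (In - con)) / 2"
    "real (card In) / 3 = 2 * (real (card P) - 1) - b - 2 * \<sigma>"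
    "real (card (con - In)) \<le> b"
proof -
  obtain \<sigma> :: real where s: "\<sigma> \<ge> 0"
    "real (card inner_darts) / 3 = 2 * (real (card P) - 1) - (real (card darts) - real (card inner_darts)) - 2 * \<sigma>"
    using euler[OF assms] by blast
  note c = card_splits[THEN arg_cong[where f = real], simplified of_nat_add]
  have o: "2 * real (card outer) \<le> 3 * real (card ((outer \<union> hull_darts) - con))"
    using card_outer by linarith
  define b where "b = real (card hull_darts) + real (card outer) / 3"
  show thesis
    by (rule that[of \<sigma> b]) (use s c o in \<open>simp_all add: b_def field_simps\<close>)
qed

lemma sum_swap_closed:
  assumes "finite S" "\<And>\<epsilon>. \<epsilon> \<in> S \<Longrightarrow> prod.swap \<epsilon> \<in> S" "\<And>\<epsilon>. \<epsilon> \<in> S \<Longrightarrow> p (prod.swap \<epsilon>) = - p \<epsilon>"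
  shows "(\<Sum>\<epsilon>\<in>S. p \<epsilon>) = (0::real)"
proof -
  have "\<epsilon> \<in> prod.swap ` S" if "\<epsilon> \<in> S" for \<epsilon>
    using image_eqI[of \<epsilon> prod.swap "prod.swap \<epsilon>"] assms(2)[OF that] by simp
  then have img: "prod.swap ` S = S" using assms(2) by blast
  have "(\<Sum>\<epsilon>\<in>S. p \<epsilon>) = (\<Sum>\<epsilon>\<in>prod.swap ` S. p \<epsilon>)" unfolding img ..
  also have "\<dots> = (\<Sum>\<epsilon>\<in>S. p (prod.swap \<epsilon>))" by (subst sum.reindex) auto
  also have "\<dots> = (\<Sum>\<epsilon>\<in>S. - p \<epsilon>)" using assms by (intro sum.cong) auto
  finally show ?thesis by (simp add: sum_negf)
qed

text \<open>The isoperimetric inequality: the area is a sum over the boundary edges of the areas of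
  the triangles that they span with the origin.\<close>

lemma total_area_le: "(\<Sum>\<delta>\<in>In. area \<delta>) / 3 \<le> real (card (con - In)) * d"
proof -
  define S where "S \<delta> = sar (fst \<delta>) (snd \<delta>)" for \<delta>
  have disc: "cmod (fst \<delta>) < 1" "cmod (snd \<delta>) < 1" if "\<delta> \<in> darts" for \<delta>
    using dart_in_P[of "fst \<delta>" "snd \<delta>"] that P_disc by auto
  have anti: "S (prod.swap \<delta>) = - S \<delta>" if "\<delta> \<in> darts" for \<delta>
    using sar_antisym[OF disc[OF that]] by (simp add: S_def)
  have dI: "\<delta> \<in> darts" if "\<delta> \<in> In" for \<delta> using that In_inner inner_dart by auto
  have "(\<Sum>\<delta>\<in>In. area \<delta>) = (\<Sum>\<delta>\<in>In. S \<delta> + S (rot \<delta>) + S (rot (rot \<delta>)))"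
    by (intro sum.cong refl) (simp add: area_sar In_inner S_def)
  also have "\<dots> = 3 * (\<Sum>\<delta>\<in>In. S \<delta>)"
    using sum_In_rot[of S] sum_In_rot[of "\<lambda>\<delta>. S (rot \<delta>)"] by (simp add: sum.distrib)
  finally have 1: "(\<Sum>\<delta>\<in>In. area \<delta>) / 3 = (\<Sum>\<delta>\<in>In. S \<delta>)" by simp
  define A where "A = {\<delta> \<in> In. prod.swap \<delta> \<in> In}"
  have "(\<Sum>\<delta>\<in>In. S \<delta>) = (\<Sum>\<delta>\<in>A. S \<delta>) + (\<Sum>\<delta>\<in>In - A. S \<delta>)"
    using finite_In by (subst sum.subset_diff[of A]) (auto simp: A_def)
  also have "(\<Sum>\<delta>\<in>A. S \<delta>) = 0"
    by (rule sum_swap_closed) (use finite_In anti dI in \<open>auto simp: A_def\<close>)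
  also have "(\<Sum>\<delta>\<in>In - A. S \<delta>) \<le> (\<Sum>\<delta>\<in>In - A. d)"
  proof (rule sum_mono)
    fix \<delta> assume "\<delta> \<in> In - A"
    then have "\<delta> \<in> In" "\<delta> \<in> con" using In_cross[of \<delta>] by (auto simp: A_def)
    then show "S \<delta> \<le> d"
      using sar_le_dist[OF disc[OF dI[of \<delta>]]] con_iff[OF dI[of \<delta>]] by (simp add: S_def len_def)
  qed
  also have "(\<Sum>\<delta>\<in>In - A. d) = real (card (In - A)) * d" by simp
  also have "\<dots> \<le> real (card (con - In)) * d"
  proof -
    have "prod.swap ` (In - A) \<subseteq> con - In"
    proof
      fix \<epsilon> assume "\<epsilon> \<in> prod.swap ` (In - A)"
      then obtain \<delta> where d: "\<epsilon> = prod.swap \<delta>" "\<delta> \<in> In - A" by auto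
      then have "\<delta> \<in> con" using In_cross[of \<delta>] by (auto simp: A_def)
      then show "\<epsilon> \<in> con - In" using d con_swap[of \<delta>] by (auto simp: A_def)
    qed
    then have "card (prod.swap ` (In - A)) \<le> card (con - In)" using finite_con by (intro card_mono) auto
    then have "card (In - A) \<le> card (con - In)" by (simp add: card_image)
    then show ?thesis using d_pos by simp
  qed
  finally show ?thesis using 1 by simp
qed

lemma total_angle: "(\<Sum>\<delta>\<in>In. tang \<delta>) = pi * (real (card In) / 3) - (\<Sum>\<delta>\<in>In. area \<delta>) / 3"
proof -
  have "3 * (\<Sum>\<delta>\<in>In. tang \<delta>) = (\<Sum>\<delta>\<in>In. tang \<delta> + tang (rot \<delta>) + tang (rot (rot \<delta>)))"
    using sum_In_rot[of tang] sum_In_rot[of "\<lambda>\<delta>. tang (rot \<delta>)"] by (simp add: sum.distrib)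
  also have "\<dots> = (\<Sum>\<delta>\<in>In. pi - area \<delta>)"
  proof (rule sum.cong[OF refl])
    show "tang \<delta> + tang (rot \<delta>) + tang (rot (rot \<delta>)) = pi - area \<delta>" for \<delta> by (simp add: area_def)
  qed
  also have "\<dots> = pi * real (card In) - (\<Sum>\<delta>\<in>In. area \<delta>)" by (simp add: sum_subtractf)
  finally show ?thesis by (simp add: field_simps)
qed

definition bd :: "complex set" where "bd = {v \<in> P. \<exists>a. (v, a) \<in> con - In}"

definition out_deg :: "complex \<Rightarrow> nat" where "out_deg v = card (cnbr v - In_at v)"

definition in_deg :: "complex \<Rightarrow> nat" where "in_deg v = card (cnbr v \<inter> In_at v)"

lemma finite_bd: "finite bd"
  using finite_P by (simp add: bd_def)

lemma bd_subset: "bd \<subseteq> P"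
  by (auto simp: bd_def)

lemma not_bd: "v \<in> P - bd \<Longrightarrow> cnbr v \<subseteq> In_at v"
  by (auto simp: bd_def cnbr_def In_at_def)

lemma deg_split: "card (cnbr v) = in_deg v + out_deg v"
proof -
  have "card (cnbr v) = card ((cnbr v \<inter> In_at v) \<union> (cnbr v - In_at v))" by (rule arg_cong[where f = card]) auto
  also have "\<dots> = in_deg v + out_deg v"
    unfolding in_deg_def out_deg_def using finite_cnbr by (intro card_Un_disjoint) auto
  finally show ?thesis .
qed

lemma boundary_angle:
  assumes "\<And>v. v \<in> P \<Longrightarrow> cnbr v \<noteq> {}"
  shows "\<alpha> * real (\<Sum>v\<in>bd. in_deg v) + 2 * pi * (real (card P) - real (card bd)) \<le> (\<Sum>\<delta>\<in>In. tang \<delta>)"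
proof -
  have "v \<in> P" if "(v, a) \<in> In" for v a
    using dart_in_P[of v a] inner_dart[of "(v, a)"] In_inner[OF that] by simp
  then have "In = Sigma P In_at" by (auto simp: In_at_def)
  then have "(\<Sum>\<delta>\<in>In. tang \<delta>) = (\<Sum>v\<in>P. \<Sum>a\<in>In_at v. tang (v, a))"
    using finite_P finite_In_at by (simp add: sum.Sigma)
  also have "\<dots> = (\<Sum>v\<in>bd. \<Sum>a\<in>In_at v. tang (v, a)) + (\<Sum>v\<in>P - bd. \<Sum>a\<in>In_at v. tang (v, a))"
    using finite_P bd_subset by (subst sum.subset_diff[of bd]) auto
  also have "(\<Sum>v\<in>P - bd. \<Sum>a\<in>In_at v. tang (v, a)) = (\<Sum>v\<in>P - bd. 2 * pi)"
    using inner_angle_full not_bd assms by (intro sum.cong) auto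
  also have "\<dots> = 2 * pi * (real (card P) - real (card bd))"
    using finite_bd bd_subset finite_P by (simp add: card_Diff_subset of_nat_diff card_mono)
  finally have e: "(\<Sum>\<delta>\<in>In. tang \<delta>)
    = (\<Sum>v\<in>bd. \<Sum>a\<in>In_at v. tang (v, a)) + 2 * pi * (real (card P) - real (card bd))" .
  have "(\<Sum>v\<in>bd. \<alpha> * real (in_deg v)) \<le> (\<Sum>v\<in>bd. \<Sum>a\<in>In_at v. tang (v, a))"
    unfolding in_deg_def by (intro sum_mono inner_angle_ge)
  then show ?thesis unfolding e by (simp add: sum_distrib_left)
qed

text \<open>The other ends of the boundary edges at v. An edge with non-inner triangles on both
  sides appears once here, though both of its darts lie in \<open>con - In\<close>.\<close>

definition bd_nbr :: "complex \<Rightarrow> complex set" where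
  "bd_nbr v = {a \<in> cnbr v. (v, a) \<notin> In \<or> (a, v) \<notin> In}"

lemma out_incoming: "card {a. (a, v) \<in> con - In} = out_deg v"
proof -
  have i: "{a. (v, a) \<in> con \<inter> In} = cnbr v \<inter> In_at v" "{a. (a, v) \<in> con} = cnbr v"
    using con_sym by (auto simp: cnbr_def In_at_def)
  then have c: "card {a. (a, v) \<in> con \<inter> In} = in_deg v" using card_In_incoming[of v] by (simp add: in_deg_def)
  have "card (cnbr v) = card ({a. (a, v) \<in> con \<inter> In} \<union> {a. (a, v) \<in> con - In})"
    using i(2) by (intro arg_cong[where f = card]) auto
  also have "\<dots> = card {a. (a, v) \<in> con \<inter> In} + card {a. (a, v) \<in> con - In}"
    by (intro card_Un_disjoint) (use finite_cnbr[of v] i(2) in \<open>auto intro: finite_subset\<close>)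
  finally show ?thesis using c deg_split[of v] by simp
qed

lemma bd_nbr_in_bd: assumes "v \<in> P" "a \<in> bd_nbr v" shows "v \<in> bd" "a \<in> bd"
proof -
  have c: "(v, a) \<in> con" "(a, v) \<in> con" using assms con_sym by (auto simp: bd_nbr_def cnbr_def)
  have aP: "a \<in> P" using c by (auto simp: con_def)
  have gen: "w \<in> bd" if "w \<in> P" "(x, w) \<in> con - In" for w x
  proof -
    have "out_deg w \<noteq> 0"
      unfolding out_incoming[symmetric] using that finite_cnbr[of w] con_sym
      by (auto simp: card_eq_0_iff cnbr_def intro: finite_subset)
    then have "cnbr w - In_at w \<noteq> {}" unfolding out_deg_def by (metis card.empty)
    then show ?thesis using that(1) by (auto simp: bd_def cnbr_def In_at_def)
  qed
  have gen': "w \<in> bd" if "w \<in> P" "(w, x) \<in> con - In" for w x using that by (auto simp: bd_def)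
  show "v \<in> bd" "a \<in> bd" using assms c aP gen gen' by (auto simp: bd_nbr_def)
qed

text \<open>Suppose va is the only boundary edge. Outgoing and incoming boundary darts are equal in
  number, so neither side of va is inner. But the last contact before a starts an inner dart whose
  corner ends at a, and by \<open>corner_end_In\<close> that side of va is inner.\<close>

lemma bd_nbr_ge:
  assumes "v \<in> bd" "card (cnbr v) \<ge> 2"
  shows "2 \<le> card (bd_nbr v)" "1 \<le> out_deg v"
proof -
  have vP: "v \<in> P" using assms by (simp add: bd_def)
  have fin: "finite (bd_nbr v)" using finite_cnbr by (simp add: bd_nbr_def)
  have ne: "cnbr v - In_at v \<noteq> {}" using assms(1) by (auto simp: bd_def cnbr_def In_at_def)
  then show o1: "1 \<le> out_deg v" unfolding out_deg_def using finite_cnbr by (simp add: Suc_le_eq card_gt_0_iff)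
  show "2 \<le> card (bd_nbr v)"
  proof (rule ccontr)
    assume lt: "\<not> 2 \<le> card (bd_nbr v)"
    obtain a where a: "a \<in> cnbr v" "(v, a) \<notin> In" using ne by (auto simp: In_at_def)
    then have ab: "a \<in> bd_nbr v" by (simp add: bd_nbr_def)
    then have "card (bd_nbr v) = 1" using lt fin card_gt_0_iff[of "bd_nbr v"] by force
    then have bs: "bd_nbr v = {a}" using ab by (auto simp: card_1_singleton_iff)
    have "{x. (x, v) \<in> con - In} \<noteq> {}" using o1 out_incoming[of v] by (metis card.empty not_one_le_zero)
    then obtain c where c: "(c, v) \<in> con - In" by auto
    then have "c \<in> bd_nbr v" using con_sym by (auto simp: bd_nbr_def cnbr_def)
    then have av: "(a, v) \<notin> In" using c bs by simp
    have an: "a \<in> nbr v" using a cnbr_subset by auto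
    have oth: "cnbr v - {a} \<noteq> {}" "finite (cnbr v - {a})"
      using assms(2) a(1) finite_cnbr by (auto simp: subset_singleton_iff)
    define F where "F x = ang v x a" for x
    have f: "finite (F ` (cnbr v - {a}))" "F ` (cnbr v - {a}) \<noteq> {}" using oth by auto
    obtain b where b: "b \<in> cnbr v - {a}" "F b = Min (F ` (cnbr v - {a}))"
      using Min_in[OF f] by (metis imageE)
    have mn: "F b \<le> F x" if "x \<in> cnbr v - {a}" for x unfolding b(2) using f(1) that by simp
    have bn: "b \<in> cnbr v" "b \<noteq> a" "b \<in> nbr v" using b cnbr_subset by auto
    have bI: "(v, b) \<in> In" using bs bn by (auto simp: bd_nbr_def)
    have "ang v b a = corner v b"
    proof (rule ccontr)
      assume neq: "ang v b a \<noteq> corner v b"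
      have le: "corner v b \<le> ang v b a" using corner_le_ang[OF bn(1) a(1)] bn(2) by auto
      show False
      proof (rule corner_cases[OF bn(1)])
        assume "cnbr v = {b}" then show False using a bn by auto
      next
        fix e assume e: "e \<in> cnbr v" "e \<noteq> b" "corner v b = ang v b e"
        have en: "e \<in> nbr v" "e \<noteq> a" using e cnbr_subset neq by auto
        have "ang v e a = ang v b a - ang v b e" using ang_nbr_relative[OF en(1) bn(3) an] e le by simp
        moreover have "ang v b e > 0" using e(3) corner_ge[OF bn(1)] alpha_bounds[OF d_pos] by simp
        ultimately show False using mn[of e] e en by (simp add: F_def)
      qed
    qed
    then have "(a, v) \<in> In" using corner_end_In[OF bn(1) bI a(1)] bn(2) by simp
    then show False using av by simp
  qed
qed

lemma out_deg_le_bd_nbr: "out_deg v \<le> card (bd_nbr v)"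
  unfolding out_deg_def using finite_cnbr by (intro card_mono) (auto simp: bd_nbr_def In_at_def)

text \<open>X and Y are the darts leaving and entering the boundary vertices. A boundary edge joins
  two boundary vertices, so its darts are in both sets, and inclusion-exclusion subtracts them
  once.\<close>

lemma card_con_peel:
  "card con + (\<Sum>v\<in>bd. card (bd_nbr v)) \<le> card (con \<inter> (P - bd) \<times> (P - bd)) + 2 * (\<Sum>v\<in>bd. card (cnbr v))"
proof -
  define X Y where "X = Sigma bd cnbr" and "Y = prod.swap ` X"
  have X: "finite X" "card X = (\<Sum>v\<in>bd. card (cnbr v))" using finite_bd finite_cnbr by (auto simp: X_def)
  have Y: "finite Y" "card Y = card X" using X by (auto simp: Y_def card_image)
  have "con = (con \<inter> (P - bd) \<times> (P - bd)) \<union> (X \<union> Y)"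
  proof (intro equalityI subsetI)
    fix \<delta> assume "\<delta> \<in> con"
    then obtain v a where va: "\<delta> = (v, a)" "(v, a) \<in> con" "(a, v) \<in> con" "v \<in> P" "a \<in> P"
      using con_sym by (cases \<delta>) (auto simp: con_def)
    have "(v, a) \<in> Y" if "a \<in> bd" using that va unfolding Y_def X_def cnbr_def by force
    then show "\<delta> \<in> (con \<inter> (P - bd) \<times> (P - bd)) \<union> (X \<union> Y)" using va by (auto simp: X_def cnbr_def)
  qed (use con_sym in \<open>auto simp: X_def Y_def cnbr_def\<close>)
  then have "card con = card ((con \<inter> (P - bd) \<times> (P - bd)) \<union> (X \<union> Y))" by simp
  also have "\<dots> \<le> card (con \<inter> (P - bd) \<times> (P - bd)) + card (X \<union> Y)" by (rule card_Un_le)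
  finally have 1: "card con \<le> card (con \<inter> (P - bd) \<times> (P - bd)) + card (X \<union> Y)" .
  have "Sigma bd bd_nbr \<subseteq> X \<inter> Y"
  proof
    fix \<delta> assume "\<delta> \<in> Sigma bd bd_nbr"
    then obtain v a where va: "\<delta> = (v, a)" "v \<in> bd" "a \<in> bd_nbr v" by auto
    then have "a \<in> bd" "a \<in> cnbr v" "v \<in> cnbr a" using bd_nbr_in_bd bd_subset con_sym by (auto simp: bd_nbr_def cnbr_def)
    then show "\<delta> \<in> X \<inter> Y" using va unfolding X_def Y_def by force
  qed
  then have "card (Sigma bd bd_nbr) \<le> card (X \<inter> Y)" using X by (intro card_mono) auto
  moreover have "card (Sigma bd bd_nbr) = (\<Sum>v\<in>bd. card (bd_nbr v))"
    using finite_bd finite_cnbr by (simp add: bd_nbr_def)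
  moreover have "card (X \<union> Y) + card (X \<inter> Y) = 2 * card X" using card_Un_Int[OF X(1) Y(1)] Y(2) by simp
  ultimately show ?thesis using 1 X(2) by linarith
qed

lemma sum_out_deg: "(\<Sum>v\<in>bd. out_deg v) = card (con - In)"
proof -
  have "con - In = (SIGMA v:bd. cnbr v - In_at v)"
    by (auto simp: bd_def cnbr_def In_at_def con_def)
  then show ?thesis using finite_bd finite_cnbr by (simp add: out_deg_def)
qed

text \<open>Angles count the contacts lost with the boundary: the total is pi per triangle minus the
  area, a remaining vertex uses a full turn, and a boundary vertex at least \<alpha> for each inner
  contact dart. Boundary vertices passed several times are settled one by one, using 3 \<le> 2 pi /
  \<alpha> - \<gamma>.\<close>

lemma peel:
  fixes \<gamma> :: real
  assumes deg: "\<And>v. v \<in> P \<Longrightarrow> 2 \<le> card (cnbr v)" and g: "3 \<le> 2 * (pi / \<alpha>) - \<gamma>"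
    and IH: "real (card (con \<inter> (P - bd) \<times> (P - bd))) / 2 \<le> \<gamma> * (real (card P) - real (card bd))"
  shows "real (card con) / 2 \<le> (\<gamma> - 2 * (pi / \<alpha>)) * (real (card P) - real (card (con - In)))
     + pi / \<alpha> * (real (card In) / 3) - (\<Sum>\<delta>\<in>In. area \<delta>) / 3 / \<alpha>"
proof -
  define x where "x = pi / \<alpha>"
  have a: "\<alpha> > 0" using alpha_bounds[OF d_pos] by simp
  define SI SO SB where "SI = real (\<Sum>v\<in>bd. in_deg v)" and "SO = real (\<Sum>v\<in>bd. out_deg v)" and "SB = real (\<Sum>v\<in>bd. card (bd_nbr v))"
  define n m where "n = real (card P)" and "m = real (card bd)"
  define k A where "k = real (card In) / 3" and "A = (\<Sum>\<delta>\<in>In. area \<delta>) / 3"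
  have SO: "SO = real (card (con - In))" by (simp add: SO_def sum_out_deg)
  have "real (card con) + SB \<le> real (card (con \<inter> (P - bd) \<times> (P - bd))) + 2 * real (\<Sum>v\<in>bd. card (cnbr v))"
    using card_con_peel unfolding SB_def by linarith
  also have "real (\<Sum>v\<in>bd. card (cnbr v)) = SI + SO" by (simp add: SI_def SO_def deg_split sum.distrib)
  finally have 1: "real (card con) / 2 \<le> \<gamma> * (n - m) + SI + SO - SB / 2" using IH by (simp add: n_def m_def)
  have "cnbr v \<noteq> {}" if "v \<in> P" for v using deg[OF that] by auto
  then have "\<alpha> * SI + 2 * pi * (n - m) \<le> pi * k - A"
    using boundary_angle total_angle by (simp add: SI_def n_def m_def k_def A_def)
  then have "(\<alpha> * SI + 2 * pi * (n - m)) / \<alpha> \<le> (pi * k - A) / \<alpha>" using a by (intro divide_right_mono) auto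
  then have 2: "SI + 2 * x * (n - m) \<le> x * k - A / \<alpha>"
    using a by (simp add: x_def add_divide_distrib diff_divide_distrib mult.commute)
  have "SO - SB / 2 = (\<Sum>v\<in>bd. real (out_deg v) - real (card (bd_nbr v)) / 2)"
    by (simp add: SO_def SB_def sum_subtractf sum_divide_distrib)
  also have "\<dots> \<le> (\<Sum>v\<in>bd. (2 * x - \<gamma>) * (real (out_deg v) - 1))"
  proof (rule sum_mono)
    fix v assume v: "v \<in> bd"
    have d2: "2 \<le> card (cnbr v)" using deg v bd_subset by auto
    have o: "1 \<le> out_deg v" "2 \<le> card (bd_nbr v)" using bd_nbr_ge[OF v d2] by auto
    have le: "real (out_deg v) \<le> real (card (bd_nbr v))" using out_deg_le_bd_nbr by simp
    \<comment> \<open>A vertex passed once has two boundary edges and contributes nothing. Otherwise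
      there are at least as many boundary edges as outgoing darts, and at most half the number of
      these darts remains.\<close>
    have "real (out_deg v) - real (card (bd_nbr v)) / 2 \<le> 3 * (real (out_deg v) - 1)"
    proof (cases "out_deg v = 1")
      case True then show ?thesis using o by simp
    next
      case False then show ?thesis using o le by simp
    qed
    also have "\<dots> \<le> (2 * x - \<gamma>) * (real (out_deg v) - 1)"
      using g o by (intro mult_right_mono) (auto simp: x_def)
    finally show "real (out_deg v) - real (card (bd_nbr v)) / 2 \<le> (2 * x - \<gamma>) * (real (out_deg v) - 1)" .
  qed
  also have "\<dots> = (2 * x - \<gamma>) * (SO - m)"
    by (simp add: SO_def m_def sum_subtractf flip: sum_distrib_left)
  finally have 3: "SO - SB / 2 \<le> (2 * x - \<gamma>) * (SO - m)" .
  have "real (card con) / 2 \<le> \<gamma> * (n - m) + (x * k - A / \<alpha> - 2 * x * (n - m)) + (2 * x - \<gamma>) * (SO - m)"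
    using 1 2 3 by linarith
  also have "\<dots> = (\<gamma> - 2 * x) * (n - SO) + x * k - A / \<alpha>" by (simp add: algebra_simps)
  finally show ?thesis by (simp add: SO x_def n_def k_def A_def)
qed

text \<open>\<open>D\<close> is the area deficit of the inner faces in units of \<open>u\<close>.\<close>

definition edge_bound :: "real \<Rightarrow> real \<Rightarrow> bool" where
  "edge_bound A B \<longleftrightarrow> (\<exists>\<sigma> b D. 0 \<le> \<sigma> \<and> 0 \<le> D \<and>
     real (card con) / 2 \<le> A * (real (card P) - 1) - B * (b + D / 2) - 3 * \<sigma> \<and>
     real (card In) / 3 = 2 * (real (card P) - 1) - b - 2 * \<sigma> \<and>
     u * (real (card In) / 3 - D) \<le> (\<Sum>\<delta>\<in>In. area \<delta>) / 3 \<and>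
     real (card (con - In)) \<le> b)"

lemma edge_boundI:
  assumes "0 \<le> \<sigma>" "0 \<le> D"
    "real (card con) / 2 \<le> A * (real (card P) - 1) - B * (b + D / 2) - 3 * \<sigma>"
    "real (card In) / 3 = 2 * (real (card P) - 1) - b - 2 * \<sigma>"
    "u * (real (card In) / 3 - D) \<le> (\<Sum>\<delta>\<in>In. area \<delta>) / 3"
    "real (card (con - In)) \<le> b"
  shows "edge_bound A B"
  unfolding edge_bound_def using assms by blast

text \<open>Area at least u per triangle up to the deficit, and area at most perimeter, give b \<ge>
  r (2 N - 2 \<sigma> - D) with r = u / (d + u). The condition u \<le> d makes r at most 1/2, so
  that the terms in \<sigma> and D are absorbed by - 3 \<sigma> and - B D / 2.\<close>

lemma isoperimetric_bound:
  assumes eb: "edge_bound A B" and B: "0 \<le> B" "B \<le> 1" and ud: "u \<le> d"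
  shows "real (card con) / 2 \<le> (A - 2 * B * (u / (d + u))) * (real (card P) - 1)"
proof -
  define N where "N = real (card P) - 1"
  obtain \<sigma> b D where s: "0 \<le> \<sigma>" "0 \<le> D" "real (card con) / 2 \<le> A * N - B * (b + D / 2) - 3 * \<sigma>"
    "real (card In) / 3 = 2 * N - b - 2 * \<sigma>"
    "u * (real (card In) / 3 - D) \<le> (\<Sum>\<delta>\<in>In. area \<delta>) / 3" "real (card (con - In)) \<le> b"
    using eb unfolding edge_bound_def N_def by blast
  have "real (card (con - In)) * d \<le> b * d" using s(6) d_pos by (intro mult_right_mono) auto
  then have "u * (2 * N - b - 2 * \<sigma> - D) \<le> b * d" using s(5) total_area_le unfolding s(4) by linarith
  then have le: "u * (2 * N - 2 * \<sigma> - D) \<le> b * (d + u)" by (simp add: algebra_simps)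
  define r where "r = u / (d + u)"
  have du: "d + u > 0" using d_pos u_pos by simp
  have r: "0 \<le> r" "r \<le> 1 / 2" using ud u_pos d_pos by (auto simp: r_def field_simps)
  have "r * (2 * N - 2 * \<sigma> - D) \<le> b" using le du unfolding r_def by (simp add: pos_divide_le_eq)
  then have "B * (r * (2 * N - 2 * \<sigma> - D)) \<le> B * b" using B by (intro mult_left_mono) auto
  moreover have "B * r * \<sigma> \<le> 1 * 1 * \<sigma>" using B r s(1) by (intro mult_right_mono mult_mono) auto
  moreover have "B * r * D \<le> B * (1 / 2) * D" using B r s(2) by (intro mult_right_mono mult_left_mono) auto
  ultimately have "real (card con) / 2 \<le> (A - 2 * B * r) * N" using s(1,3) by (simp add: algebra_simps)
  then show ?thesis by (simp add: r_def N_def)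
qed

text \<open>With x = pi / \<alpha>, the negated claim and \<open>peel\<close> give b \<ge> r (2 N -
  D) for r = (x - 3) / (2 x - \<gamma> - 3). Inserted into the edge bound this yields (A - 2 B r) N,
  and the equation imposed on \<gamma> says that A - 2 B r = \<gamma>.\<close>

lemma peeling_bound:
  assumes eb: "edge_bound A B" and B: "0 \<le> B" and deg: "\<And>v. v \<in> P \<Longrightarrow> 2 \<le> card (cnbr v)"
    and g: "\<gamma> \<le> 3" "\<gamma> = A - 2 * B * ((pi / \<alpha> - 3) / (2 * (pi / \<alpha>) - \<gamma> - 3))"
    and IH: "real (card (con \<inter> (P - bd) \<times> (P - bd))) / 2 \<le> \<gamma> * (real (card P) - real (card bd))"
  shows "real (card con) / 2 \<le> \<gamma> * (real (card P) - 1)"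
proof (rule ccontr)
  define N where "N = real (card P) - 1"
  define x where "x = pi / \<alpha>"
  have a: "0 < \<alpha>" "\<alpha> < pi / 3" using alpha_bounds[OF d_pos] by auto
  have x: "x > 3" using a by (simp add: x_def field_simps)
  assume "\<not> ?thesis"
  then have gt: "\<gamma> * N < real (card con) / 2" by (simp add: N_def)
  obtain \<sigma> b D where s: "0 \<le> \<sigma>" "0 \<le> D" "real (card con) / 2 \<le> A * N - B * (b + D / 2) - 3 * \<sigma>"
    "real (card In) / 3 = 2 * N - b - 2 * \<sigma>"
    "u * (real (card In) / 3 - D) \<le> (\<Sum>\<delta>\<in>In. area \<delta>) / 3" "real (card (con - In)) \<le> b"
    using eb unfolding edge_bound_def N_def by blast
  define k where "k = real (card In) / 3"
  have "real (card con) / 2 \<le> (\<gamma> - 2 * x) * (N + 1 - real (card (con - In))) + x * k - (\<Sum>\<delta>\<in>In. area \<delta>) / 3 / \<alpha>"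
    using peel[OF deg _ IH] g(1) x by (simp add: x_def N_def k_def)
  moreover have "(x - 3) * (k - D) \<le> (\<Sum>\<delta>\<in>In. area \<delta>) / 3 / \<alpha>"
  proof -
    have "u * (k - D) / \<alpha> \<le> (\<Sum>\<delta>\<in>In. area \<delta>) / 3 / \<alpha>" using s(5) a by (intro divide_right_mono) (auto simp: k_def)
    moreover have "u * (k - D) / \<alpha> = (x - 3) * (k - D)" using a by (simp add: x_def field_simps)
    ultimately show ?thesis by simp
  qed
  moreover have "(\<gamma> - 2 * x) * (N + 1 - real (card (con - In))) \<le> (\<gamma> - 2 * x) * (N - b)"
    using s(6) g(1) x by (intro mult_left_mono_neg) auto
  ultimately have "\<gamma> * N < (\<gamma> - 2 * x) * (N - b) + x * k - (x - 3) * (k - D)" using gt by linarith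
  also have "\<dots> = (\<gamma> - 2 * x) * (N - b) + 3 * k + (x - 3) * D" by (simp add: algebra_simps)
  also have "\<dots> \<le> (\<gamma> - 2 * x) * (N - b) + 3 * (2 * N - b) + (x - 3) * D" using s(1,4) by (simp add: k_def)
  finally have "(x - 3) * (2 * N - D) < (2 * x - \<gamma> - 3) * b" by (simp add: algebra_simps)
  moreover define r where "r = (x - 3) / (2 * x - \<gamma> - 3)"
  have q: "2 * x - \<gamma> - 3 > 0" using g x by simp
  have r: "0 \<le> r" "r \<le> 1 / 2" using g x q by (auto simp: r_def field_simps)
  ultimately have "r * (2 * N - D) \<le> b" using q unfolding r_def by (simp add: pos_divide_le_eq mult.commute less_imp_le)
  then have "B * (r * (2 * N - D)) \<le> B * b" using B by (intro mult_left_mono) auto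
  moreover have "B * r * D \<le> B * (1 / 2) * D" using B r s(2) by (intro mult_right_mono mult_left_mono) auto
  ultimately have "real (card con) / 2 \<le> (A - 2 * B * r) * N" using s(1,3) by (simp add: algebra_simps)
  also have "A - 2 * B * r = \<gamma>" using g(2) by (simp add: r_def x_def)
  finally show False using gt by simp
qed

subsection \<open>The three edge bounds\<close>

lemma nnc_sum: "(\<Sum>\<delta>\<in>In. nnc \<delta>) = 3 * real (card (In - con))"
proof -
  let ?f = "\<lambda>\<delta>. of_bool (\<delta> \<notin> con) :: real"
  have "(\<Sum>\<delta>\<in>In. nnc \<delta>) = 3 * (\<Sum>\<delta>\<in>In. ?f \<delta>)"
    using sum_In_rot[of ?f] sum_In_rot[of "\<lambda>\<delta>. ?f (rot \<delta>)"] by (simp add: nnc_def sum.distrib)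
  also have "(\<Sum>\<delta>\<in>In. ?f \<delta>) = real (card (In - con))"
    using finite_In by (simp add: of_bool_def sum.If_cases Diff_eq Compl_eq)
  finally show ?thesis .
qed

lemma nnc_ge: "\<delta> \<in> In \<Longrightarrow> nnc \<delta> = 0 \<or> 1 \<le> nnc \<delta>"
  by (auto simp: nnc_def of_bool_def)

lemma area_units: "(\<Sum>\<delta>\<in>In. w \<delta>) \<le> (\<Sum>\<delta>\<in>In. area \<delta> / u) \<Longrightarrow> u * ((\<Sum>\<delta>\<in>In. w \<delta>) / 3) \<le> (\<Sum>\<delta>\<in>In. area \<delta>) / 3"
  using u_pos by (simp add: sum_divide_distrib[symmetric] pos_le_divide_eq mult.commute)

text \<open>The weight 1 - nnc is at most 0 unless the triangle is equilateral, so positivity of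
  areas suffices. D is the number of inner non-contact darts.\<close>

lemma edge_bound_1: assumes "P \<noteq> {}" shows "edge_bound 3 1"
proof -
  obtain \<sigma> b where s: "\<sigma> \<ge> 0"
    "real (card con) / 2 \<le> 3 * (real (card P) - 1) - b - 3 * \<sigma> - real (card (In - con)) / 2"
    "real (card In) / 3 = 2 * (real (card P) - 1) - b - 2 * \<sigma>" "real (card (con - In)) \<le> b"
    using counting[OF assms] by blast
  have "(\<Sum>\<delta>\<in>In. 1 - nnc \<delta>) \<le> (\<Sum>\<delta>\<in>In. area \<delta> / u)"
  proof (rule sum_mono)
    fix \<delta> assume I: "\<delta> \<in> In"
    show "1 - nnc \<delta> \<le> area \<delta> / u"
    proof (cases "nnc \<delta> = 0")
      case True then show ?thesis using equilateral_area[OF In_inner[OF I]] u_pos by simp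
    next
      case False
      then have "1 - nnc \<delta> \<le> 0" using nnc_ge[OF I] by simp
      also have "0 \<le> area \<delta> / u" using area_pos[OF In_inner[OF I]] u_pos by simp
      finally show ?thesis .
    qed
  qed
  from area_units[OF this] have ar: "u * (real (card In) / 3 - real (card (In - con))) \<le> (\<Sum>\<delta>\<in>In. area \<delta>) / 3"
    by (rule back_subst[of "\<lambda>t. u * t \<le> _"]) (simp add: sum_subtractf nnc_sum diff_divide_distrib)
  show ?thesis
    by (rule edge_boundI[of \<sigma> "real (card (In - con))" _ _ b]) (use s ar in simp_all)
qed

text \<open>The contacts at v whose left triangle is faulty, that is, has a non-contact side. All
  other inner corners at v measure exactly \<alpha>.\<close>

definition nt :: "complex \<Rightarrow> complex set" where "nt v = {a \<in> cnbr v. nnc (v, a) \<noteq> 0}"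

lemma corner_alpha:
  assumes "b \<in> cnbr v" "(v, b) \<in> In" "nnc (v, b) = 0" shows "corner v b = \<alpha>"
proof -
  have i: "(v, b) \<in> inner_darts" using In_inner assms by blast
  have c: "(v, b) \<in> con" "rot (v, b) \<in> con" "rot (rot (v, b)) \<in> con"
    using assms(3) by (auto simp: nnc_def of_bool_def split: if_splits)
  have "rot (rot (v, b)) = (apex (v, b), v)"
    using rot_pair[OF tri_rotate[OF inner_dartsD[OF i]]] rot_pair[OF inner_dartsD[OF i]] by simp
  then have "(v, apex (v, b)) \<in> con" using c(3) con_sym by simp
  then have "corner v b = tang (v, b)" using corner_triangle[of v b] c assms by simp
  then show ?thesis using equilateral[OF i c] by simp
qed

lemma corner_sum_nt:
  assumes "v \<in> P - bd" "cnbr v \<noteq> {}"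
  shows "2 * pi = (\<Sum>b\<in>nt v. corner v b) + (real (card (cnbr v)) - real (card (nt v))) * \<alpha>"
proof -
  have sub: "nt v \<subseteq> cnbr v" by (auto simp: nt_def)
  have "2 * pi = (\<Sum>b\<in>cnbr v. corner v b)" using corners_sum[OF assms(2)] by simp
  also have "\<dots> = (\<Sum>b\<in>nt v. corner v b) + (\<Sum>b\<in>cnbr v - nt v. corner v b)"
    by (subst sum.subset_diff[OF sub finite_cnbr]) (rule add.commute)
  also have "(\<Sum>b\<in>cnbr v - nt v. corner v b) = (\<Sum>b\<in>cnbr v - nt v. \<alpha>)"
    using corner_alpha not_bd[OF assms(1)] by (intro sum.cong) (auto simp: nt_def In_at_def)
  also have "\<dots> = (real (card (cnbr v)) - real (card (nt v))) * \<alpha>"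
    using sub finite_cnbr finite_subset[OF sub] by (simp add: card_Diff_subset of_nat_diff card_mono)
  finally show ?thesis .
qed

lemma d_tri_eqI: assumes "k \<ge> 7" "\<alpha> = 2 * pi / real k" shows "d = d_tri k"
  unfolding d_tri_def using ex1_d_tri[OF assms(1)] d_pos assms(2) by (intro the1_equality[symmetric]) auto

lemma d_semi_eqI: assumes "k \<ge> 6" "alpha4 d + (real k - 1) * \<alpha> = 2 * pi" shows "d = d_semi k"
  unfolding d_semi_def using ex1_d_semi[OF assms(1)] d_pos assms(2) by (intro the1_equality[symmetric]) auto

text \<open>Otherwise k corners of size \<alpha> fill the turn, and \<alpha> < pi / 3 forces k \<ge>
  7: the equation of a triangular tiling.\<close>

lemma nt_nonempty:
  assumes "\<forall>k\<ge>7. d \<noteq> d_tri k" "v \<in> P - bd" "cnbr v \<noteq> {}" shows "nt v \<noteq> {}"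
proof
  assume "nt v = {}"
  then have e: "2 * pi = real (card (cnbr v)) * \<alpha>" using corner_sum_nt[OF assms(2,3)] by simp
  have k: "card (cnbr v) > 0" using assms(3) finite_cnbr by (simp add: card_gt_0_iff)
  have "2 * pi < real (card (cnbr v)) * (pi / 3)"
    unfolding e using alpha_bounds[OF d_pos] k by (intro mult_strict_left_mono) auto
  then have "6 * pi < real (card (cnbr v)) * pi" by simp
  then have "6 < real (card (cnbr v))" by (subst (asm) mult_less_cancel_right_pos) auto
  then have "7 \<le> card (cnbr v)" by simp
  moreover have "\<alpha> = 2 * pi / real (card (cnbr v))" using e k by (simp add: field_simps)
  ultimately show False using d_tri_eqI assms(1) by blast
qed

definition faulty :: "(complex \<times> complex) set" where "faulty = {\<delta> \<in> In. nnc \<delta> \<noteq> 0}"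

lemma finite_faulty: "finite faulty" using finite_In by (simp add: faulty_def)

lemma Sigma_nt: "Sigma (P - bd) nt \<subseteq> faulty \<inter> con"
proof
  fix \<delta> assume "\<delta> \<in> Sigma (P - bd) nt"
  then obtain v a where va: "\<delta> = (v, a)" "v \<in> P - bd" "a \<in> cnbr v" "nnc (v, a) \<noteq> 0" by (auto simp: nt_def)
  then have "a \<in> In_at v" using not_bd by blast
  then show "\<delta> \<in> faulty \<inter> con" using va by (simp add: faulty_def cnbr_def In_at_def)
qed

lemma not_con_faulty: "In - con \<subseteq> faulty"
  by (auto simp: faulty_def nnc_def of_bool_def)

text \<open>Every vertex off the boundary starts a faulty contact dart, so n - 1 - b \<le> F - M,
  where F counts the faulty darts and M the inner non-contact ones. A quarter of this added to
  \<open>counting\<close> gives the coefficients 11/4 and 3/4; the weights of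
  \<open>area_weight_square\<close> give the deficit D = 2 M - 2 F / 3.\<close>

lemma edge_bound_2:
  assumes ne: "P \<noteq> {}" and deg: "\<And>v. v \<in> P \<Longrightarrow> cnbr v \<noteq> {}" and nd: "\<forall>k\<ge>7. d \<noteq> d_tri k"
  shows "edge_bound (11 / 4) (3 / 4)"
proof -
  obtain \<sigma> b where s: "\<sigma> \<ge> 0"
    "real (card con) / 2 \<le> 3 * (real (card P) - 1) - b - 3 * \<sigma> - real (card (In - con)) / 2"
    "real (card In) / 3 = 2 * (real (card P) - 1) - b - 2 * \<sigma>" "real (card (con - In)) \<le> b"
    using counting[OF ne] by blast
  define F M where "F = real (card faulty)" and "M = real (card (In - con))"
  have cardF: "real (card (faulty \<inter> con)) = F - M"
  proof -
    have "faulty = (faulty \<inter> con) \<union> (In - con)" using not_con_faulty by (auto simp: faulty_def)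
    then have "card faulty = card (faulty \<inter> con) + card (In - con)"
      using finite_faulty finite_In by (metis card_Un_disjoint finite_Diff finite_Int Int_Diff_disjoint Int_assoc Int_commute Diff_disjoint Int_empty_right)
    then show ?thesis by (simp add: F_def M_def)
  qed
  have "real (card P) - real (card bd) \<le> F - M"
  proof -
    have "card (P - bd) = (\<Sum>v\<in>P - bd. 1)" by simp
    also have "\<dots> \<le> (\<Sum>v\<in>P - bd. card (nt v))"
      using nt_nonempty[OF nd] deg finite_cnbr by (intro sum_mono) (simp add: Suc_le_eq card_gt_0_iff nt_def)
    also have "\<dots> = card (Sigma (P - bd) nt)" using finite_P finite_cnbr by (simp add: nt_def)
    also have "\<dots> \<le> card (faulty \<inter> con)" using finite_faulty Sigma_nt by (intro card_mono) auto
    finally have "real (card (P - bd)) \<le> F - M" unfolding cardF[symmetric] by simp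
    then show ?thesis using finite_P finite_bd bd_subset by (simp add: card_Diff_subset of_nat_diff card_mono)
  qed
  moreover have "real (card bd) \<le> b"
  proof -
    have "card bd = (\<Sum>v\<in>bd. 1)" by simp
    also have "\<dots> \<le> (\<Sum>v\<in>bd. out_deg v)"
    proof (rule sum_mono)
      fix v assume "v \<in> bd"
      then have "cnbr v - In_at v \<noteq> {}" by (auto simp: bd_def cnbr_def In_at_def)
      then show "1 \<le> out_deg v" using finite_cnbr by (simp add: out_deg_def Suc_le_eq card_gt_0_iff)
    qed
    finally show ?thesis using s(4) sum_out_deg by linarith
  qed
  ultimately have cover: "real (card P) - 1 - b \<le> F - M" by simp
  have "(\<Sum>\<delta>\<in>In. if nnc \<delta> = 0 then 1 else 3 - 2 * nnc \<delta>) = (\<Sum>\<delta>\<in>In. 1 + 2 * of_bool (\<delta> \<in> faulty) - 2 * nnc \<delta>)"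
    by (intro sum.cong) (auto simp: faulty_def)
  also have "\<dots> = real (card In) + 2 * F - 6 * M"
  proof -
    have "(\<Sum>\<delta>\<in>In. of_bool (\<delta> \<in> faulty)) = F"
      using finite_In by (simp add: of_bool_def sum.If_cases F_def faulty_def Int_def)
    then show ?thesis
      by (simp add: sum_subtractf sum.distrib nnc_sum M_def flip: sum_distrib_left)
  qed
  finally have "(\<Sum>\<delta>\<in>In. if nnc \<delta> = 0 then 1 else 3 - 2 * nnc \<delta>) = real (card In) + 2 * F - 6 * M" .
  from area_units[OF area_weight_square, unfolded this]
  have ar: "u * (real (card In) / 3 - (2 * M - 2 * F / 3)) \<le> (\<Sum>\<delta>\<in>In. area \<delta>) / 3"
    by (rule back_subst[of "\<lambda>t. u * t \<le> _"]) (simp add: field_simps)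
  have FM: "F \<le> 3 * M"
  proof -
    have "F = (\<Sum>\<delta>\<in>faulty. 1)" by (simp add: F_def)
    also have "\<dots> \<le> (\<Sum>\<delta>\<in>faulty. nnc \<delta>)" using nnc_ge by (intro sum_mono) (auto simp: faulty_def)
    also have "\<dots> \<le> (\<Sum>\<delta>\<in>In. nnc \<delta>)" using finite_In by (intro sum_mono2) (auto simp: faulty_def nnc_def)
    finally show ?thesis by (simp add: nnc_sum M_def)
  qed
  have le: "real (card con) / 2 \<le> 11 / 4 * (real (card P) - 1) - 3 / 4 * (b + (2 * M - 2 * F / 3) / 2) - 3 * \<sigma>"
    using s(2) cover by (simp add: M_def[symmetric] field_simps)
  show ?thesis
    by (rule edge_boundI[OF s(1) _ le s(3) ar s(4)]) (use FM in simp)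
qed

lemma rhombus_corners:
  assumes e: "\<epsilon> \<in> In" "iso \<epsilon>" "iso (prod.swap \<epsilon>)"
  shows "corner (fst (rot \<epsilon>)) (snd (rot \<epsilon>)) = 2 * tang \<epsilon>"
    "corner (fst (rot (rot \<epsilon>))) (snd (rot (rot \<epsilon>))) = tang (rot (rot \<epsilon>))"
proof -
  obtain p q where pq: "\<epsilon> = (p, q)" by (cases \<epsilon>)
  define r s where "r = apex (p, q)" and "s = apex (q, p)"
  have t: "tri p q r" "tri q p s"
    using inner_dartsD iso_inner[OF e(2)] iso_inner[OF e(3)] pq by (auto simp: r_def s_def)
  have ro: "rot \<epsilon> = (q, r)" "rot (rot \<epsilon>) = (r, p)" using rot_pair[OF t(1)] rot_pair[OF tri_rotate[OF t(1)]] pq by auto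
  have so: "rot (q, p) = (p, s)" "rot (p, s) = (s, q)" using rot_pair[OF t(2)] rot_pair[OF tri_rotate[OF t(2)]] by auto
  have ap: "apex (q, r) = p" "apex (r, p) = q" using apex_eq tri_rotate t(1) by blast+
  have I: "(q, r) \<in> In" "(r, p) \<in> In" using In_rot[OF e(1)] In_rot[OF In_rot[OF e(1)]] ro by auto
  have c: "(q, r) \<in> con" "(r, p) \<in> con" "(q, p) \<notin> con" "(q, s) \<in> con" "(r, q) \<in> con"
    using e(2,3) ro so pq con_sym by (auto simp: iso_def)
  have "s \<noteq> r"
  proof
    assume "s = r"
    then have "cr p q r > 0" "cr q p r > 0" using tri_pos t by auto
    then show False using crs_swap[of "klein q" "klein p" "klein r"] by simp
  qed
  then have "corner q r = tang (q, r) + tang (q, p)"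
    by (intro corner_two_triangles[where c = p and e = s]) (use I c ap in \<open>auto simp: s_def\<close>)
  also have "tang (q, r) = tang \<epsilon>" using isosceles.base_angles[OF isosceles[OF e(2)]] ro by simp
  also have "tang (q, p) = tang \<epsilon>" using rhombus_congruent(1)[OF e(2,3)] pq by simp
  finally show "corner (fst (rot \<epsilon>)) (snd (rot \<epsilon>)) = 2 * tang \<epsilon>" by (simp add: ro)
  show "corner (fst (rot (rot \<epsilon>))) (snd (rot (rot \<epsilon>))) = tang (rot (rot \<epsilon>))"
    using corner_triangle[of r p] I c ap con_sym unfolding ro(2) fst_conv snd_conv by simp
qed

text \<open>If two neighbouring vertices of a rhombus had no other fault, then the two angles would
  differ by a multiple of \<open>\<alpha>\<close>; both lying between \<open>\<alpha>\<close> and \<open>2 \<alpha>\<close>, the rhombus would be a square.\<close>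

lemma rhombus_not_unique:
  assumes nd: "\<forall>k\<ge>6. d \<noteq> d_semi k" and e: "\<epsilon> \<in> In" "iso \<epsilon>" "iso (prod.swap \<epsilon>)"
  shows "\<not> (fst (rot \<epsilon>) \<in> P - bd \<and> card (nt (fst (rot \<epsilon>))) = 1 \<and>
    fst (rot (rot \<epsilon>)) \<in> P - bd \<and> card (nt (fst (rot (rot \<epsilon>)))) = 1)"
proof
  define v w where "v = fst (rot \<epsilon>)" and "w = fst (rot (rot \<epsilon>))"
  assume "fst (rot \<epsilon>) \<in> P - bd \<and> card (nt (fst (rot \<epsilon>))) = 1 \<and>
    fst (rot (rot \<epsilon>)) \<in> P - bd \<and> card (nt (fst (rot (rot \<epsilon>)))) = 1"
  then have vw: "v \<in> P - bd" "card (nt v) = 1" "w \<in> P - bd" "card (nt w) = 1" by (auto simp: v_def w_def)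
  have c: "rot \<epsilon> \<in> con" "rot (rot \<epsilon>) \<in> con" using e(2) by (auto simp: iso_def)
  have n: "nnc (rot \<epsilon>) \<noteq> 0" "nnc (rot (rot \<epsilon>)) \<noteq> 0"
    using nnc_rot[OF iso_inner[OF e(2)]] nnc_rot[OF rot_inner[OF iso_inner[OF e(2)]]] iso_nnc[OF e(2)] by auto
  have mem: "snd (rot \<epsilon>) \<in> nt v" "snd (rot (rot \<epsilon>)) \<in> nt w" using c n by (auto simp: nt_def cnbr_def v_def w_def)
  have nv: "nt v = {snd (rot \<epsilon>)}" "nt w = {snd (rot (rot \<epsilon>))}"
    using vw(2,4) mem by (auto simp: card_1_singleton_iff)
  have cn: "cnbr v \<noteq> {}" "cnbr w \<noteq> {}" using mem by (auto simp: nt_def)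
  define j l where "j = real (card (cnbr v)) - 1" and "l = real (card (cnbr w)) - 1"
  have ev: "2 * pi = 2 * tang \<epsilon> + j * \<alpha>"
    using corner_sum_nt[OF vw(1) cn(1)] rhombus_corners(1)[OF e] nv(1) by (simp add: v_def j_def)
  have ew: "2 * pi = tang (rot (rot \<epsilon>)) + l * \<alpha>"
    using corner_sum_nt[OF vw(3) cn(2)] rhombus_corners(2)[OF e] nv(2) by (simp add: w_def l_def)
  note rh = rhombus[OF e(2,3)]
  have a: "\<alpha> > 0" "\<alpha> < pi / 3" using alpha_bounds[OF d_pos] by auto
  have "(l - j) * \<alpha> = 2 * tang \<epsilon> - tang (rot (rot \<epsilon>))" using ev ew by (simp add: algebra_simps)
  then have "0 \<le> (l - j) * \<alpha>" "(l - j) * \<alpha> < 1 * \<alpha>" using rh by auto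
  then have "0 \<le> l - j" "l - j < 1" using a by (simp_all add: zero_le_mult_iff)
  then have "l = j" by (simp add: l_def j_def)
  then have "tang (rot (rot \<epsilon>)) = 2 * tang \<epsilon>" using ev ew by simp
  then have "tang (rot (rot \<epsilon>)) = alpha4 d" by (rule isosceles.square_angle[OF isosceles[OF e(2)]])
  then have eq: "alpha4 d + (real (card (cnbr w)) - 1) * \<alpha> = 2 * pi" using ew by (simp add: l_def)
  have "l * \<alpha> > 2 * pi - 2 * \<alpha>" using ew rh by simp
  then have "(l + 2) * \<alpha> > 6 * (pi / 3)" by (simp add: algebra_simps)
  moreover have "6 * (pi / 3) > 6 * \<alpha>" using a by simp
  ultimately have "6 * \<alpha> < (l + 2) * \<alpha>" by simp
  then have "6 < l + 2" using a by (simp only: mult_less_cancel_right_pos)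
  then have "6 \<le> card (cnbr w)" by (simp add: l_def)
  then show False using d_semi_eqI[OF _ eq] nd by blast
qed

text \<open>R consists of the halves of rhombi and X of the other faulty triangles. Halves of rhombi
  have weight 1 and add nothing to the deficit D = 5/2 m - x, but as faults they may count only 1/2
  per dart. With M = m + r / 3, a third of the covering inequality n - 1 - b \<le> x - m + r / 2
  gives the coefficients 8/3 and 2/3.\<close>

lemma edge_bound_3:
  assumes ne: "P \<noteq> {}" and deg: "\<And>v. v \<in> P \<Longrightarrow> cnbr v \<noteq> {}" and nd: "\<forall>k\<ge>7. d \<noteq> d_tri k" "\<forall>k\<ge>6. d \<noteq> d_semi k"
  shows "edge_bound (8 / 3) (2 / 3)"
proof -
  obtain \<sigma> b where s: "\<sigma> \<ge> 0"
    "real (card con) / 2 \<le> 3 * (real (card P) - 1) - b - 3 * \<sigma> - real (card (In - con)) / 2"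
    "real (card In) / 3 = 2 * (real (card P) - 1) - b - 2 * \<sigma>" "real (card (con - In)) \<le> b"
    using counting[OF ne] by blast
  define X R where "X = {\<delta> \<in> faulty. \<not> rhomb \<delta>}" and "R = {\<delta> \<in> In. rhomb \<delta>}"
  have nR: "nnc \<delta> = 1" if "\<delta> \<in> R" for \<delta> using that not_rhomb[of \<delta>] unfolding R_def by blast
  have RX: "faulty = X \<union> R" "X \<inter> R = {}"
    using nR by (force simp: X_def R_def faulty_def)+
  have fin: "finite X" "finite R" using finite_faulty finite_In by (auto simp: X_def R_def)
  have Xrot: "rot \<delta> \<in> X" if "\<delta> \<in> X" for \<delta>
    using that rhomb_rot nnc_rot In_inner In_rot by (auto simp: X_def faulty_def)
  have Rrot: "rot \<delta> \<in> R" if "\<delta> \<in> R" for \<delta>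
    using that rhomb_rot In_inner In_rot by (auto simp: R_def)
  have sub: "X \<subseteq> inner_darts" "R \<subseteq> inner_darts" using In_inner by (auto simp: X_def R_def faulty_def)
  define x r m where "x = real (card X)" and "r = real (card R)" and "m = real (card (X - con))"
  let ?f = "\<lambda>\<delta>. of_bool (\<delta> \<notin> con) :: real"
  have nncX: "(\<Sum>\<delta>\<in>X. nnc \<delta>) = 3 * m"
  proof -
    have "(\<Sum>\<delta>\<in>X. nnc \<delta>) = 3 * (\<Sum>\<delta>\<in>X. ?f \<delta>)"
      using sum_rot[OF sub(1) Xrot, of ?f] sum_rot[OF sub(1) Xrot, of "\<lambda>\<delta>. ?f (rot \<delta>)"]
      by (simp add: nnc_def sum.distrib)
    also have "(\<Sum>\<delta>\<in>X. ?f \<delta>) = m"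
      using fin by (simp add: of_bool_def sum.If_cases Diff_eq Compl_eq m_def)
    finally show ?thesis .
  qed
  have nncR: "(\<Sum>\<delta>\<in>R. nnc \<delta>) = r" using nR by (simp add: r_def)
  have M: "3 * real (card (In - con)) = 3 * m + r"
  proof -
    have "(\<Sum>\<delta>\<in>In. nnc \<delta>) = (\<Sum>\<delta>\<in>faulty. nnc \<delta>)"
      using finite_In by (intro sum.mono_neutral_right) (auto simp: faulty_def)
    also have "\<dots> = (\<Sum>\<delta>\<in>X. nnc \<delta>) + (\<Sum>\<delta>\<in>R. nnc \<delta>)"
      unfolding RX(1) using fin RX(2) by (rule sum.union_disjoint)
    finally show ?thesis by (simp add: nnc_sum nncX nncR)
  qed
  \<comment> \<open>A rhombus corner weighs 1 if it is the only fault of an inner vertex and 1/2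
    otherwise, so each inner vertex collects at least 1. By \<open>rhombus_not_unique\<close> the
    two contact darts of a half weigh at most 3/2 together, which is 1/2 for each of its three
    darts.\<close>
  define wt where "wt \<delta> = (if \<not> rhomb \<delta> \<or> (fst \<delta> \<in> P - bd \<and> card (nt (fst \<delta>)) = 1) then 1 else 1 / 2 :: real)" for \<delta>
  have wt: "1 / 2 \<le> wt \<delta>" "wt \<delta> \<le> 1" for \<delta> by (auto simp: wt_def)
  have "real (card (P - bd)) = (\<Sum>v\<in>P - bd. 1)" by simp
  also have "\<dots> \<le> (\<Sum>v\<in>P - bd. \<Sum>a\<in>nt v. wt (v, a))"
  proof (rule sum_mono)
    fix v assume v: "v \<in> P - bd"
    have nn: "nt v \<noteq> {}" "finite (nt v)" using nt_nonempty[OF nd(1) v] deg v finite_cnbr by (auto simp: nt_def)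
    show "1 \<le> (\<Sum>a\<in>nt v. wt (v, a))"
    proof (cases "card (nt v) = 1")
      case True
      then obtain a where "nt v = {a}" by (auto simp: card_1_singleton_iff)
      then show ?thesis using v True by (simp add: wt_def)
    next
      case False
      then have "2 \<le> card (nt v)" using nn by (simp add: Suc_le_eq numeral_2_eq_2 card_gt_0_iff le_neq_implies_less)
      then have "1 \<le> (\<Sum>a\<in>nt v. 1 / 2 :: real)" by simp
      also have "\<dots> \<le> (\<Sum>a\<in>nt v. wt (v, a))" using wt by (intro sum_mono) auto
      finally show ?thesis .
    qed
  qed
  also have "\<dots> = (\<Sum>\<delta>\<in>Sigma (P - bd) nt. wt \<delta>)" 
    by (subst sum.Sigma) (auto simp: nt_def finite_P finite_cnbr)
  also have "\<dots> \<le> (\<Sum>\<delta>\<in>faulty \<inter> con. wt \<delta>)"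
    using finite_faulty Sigma_nt wt(1) by (intro sum_mono2) (auto intro: order_trans[of 0 "1/2"])
  also have "faulty \<inter> con = (X \<inter> con) \<union> (R \<inter> con)" using RX by auto
  also have "(\<Sum>\<delta>\<in>(X \<inter> con) \<union> (R \<inter> con). wt \<delta>) = (\<Sum>\<delta>\<in>X \<inter> con. wt \<delta>) + (\<Sum>\<delta>\<in>R \<inter> con. wt \<delta>)"
    using fin RX(2) by (intro sum.union_disjoint) auto
  also have "(\<Sum>\<delta>\<in>X \<inter> con. wt \<delta>) \<le> (\<Sum>\<delta>\<in>X \<inter> con. 1)" using wt by (intro sum_mono) auto
  also have "(\<Sum>\<delta>\<in>X \<inter> con. 1) = x - m"
  proof -
    have "card X = card (X \<inter> con) + card (X - con)" using fin(1) by (rule card_Int_Diff)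
    then show ?thesis by (simp add: x_def m_def)
  qed
  also have "(\<Sum>\<delta>\<in>R \<inter> con. wt \<delta>) \<le> r / 2"
  proof -
    define g where "g \<delta> = (if \<delta> \<in> con then wt \<delta> else 0)" for \<delta>
    have le: "g \<delta> + g (rot \<delta>) + g (rot (rot \<delta>)) \<le> 3 / 2" if d: "\<delta> \<in> R" for \<delta>
    proof -
      have I: "\<delta> \<in> In" using d by (simp add: R_def)
      obtain \<epsilon> where e: "\<epsilon> \<in> {\<delta>, rot \<delta>, rot (rot \<delta>)}" "iso \<epsilon>" "iso (prod.swap \<epsilon>)"
        using d unfolding R_def rhomb_def by blast
      have eI: "\<epsilon> \<in> In" using e(1) I In_rot[OF I] In_rot[OF In_rot[OF I]] by auto
      have eR: "rot \<epsilon> \<in> R" "rot (rot \<epsilon>) \<in> R" "\<epsilon> \<notin> con"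
        using e d Rrot[OF d] Rrot[OF Rrot[OF d]] rot3[OF In_inner[OF I]] by (auto simp: iso_def)
      have "g \<epsilon> + g (rot \<epsilon>) + g (rot (rot \<epsilon>)) \<le> 3 / 2"
        using rhombus_not_unique[OF nd(2) eI e(2,3)] eR by (auto simp: g_def wt_def R_def)
      then show ?thesis unfolding orb_sum[OF In_inner[OF I] e(1), of g] .
    qed
    have "(\<Sum>\<delta>\<in>R \<inter> con. wt \<delta>) = (\<Sum>\<delta>\<in>R. g \<delta>)"
      unfolding g_def using fin by (simp add: sum.inter_restrict)
    moreover have "3 * (\<Sum>\<delta>\<in>R. g \<delta>) = (\<Sum>\<delta>\<in>R. g \<delta> + g (rot \<delta>) + g (rot (rot \<delta>)))"
      using sum_rot[OF sub(2) Rrot, of g] sum_rot[OF sub(2) Rrot, of "\<lambda>\<delta>. g (rot \<delta>)"] by (simp add: sum.distrib)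
    moreover have "\<dots> \<le> (\<Sum>\<delta>\<in>R. 3 / 2)" using le by (rule sum_mono)
    ultimately show ?thesis by (simp add: r_def)
  qed
  finally have "real (card (P - bd)) \<le> (x - m) + r / 2" by simp
  then have "real (card P) - real (card bd) \<le> (x - m) + r / 2"
    using finite_P finite_bd bd_subset by (simp add: card_Diff_subset of_nat_diff card_mono)
  moreover have "real (card bd) \<le> b"
  proof -
    have "card bd = (\<Sum>v\<in>bd. 1)" by simp
    also have "\<dots> \<le> (\<Sum>v\<in>bd. out_deg v)"
    proof (rule sum_mono)
      fix v assume "v \<in> bd"
      then have "cnbr v - In_at v \<noteq> {}" by (auto simp: bd_def cnbr_def In_at_def)
      then show "1 \<le> out_deg v" using finite_cnbr by (simp add: out_deg_def Suc_le_eq card_gt_0_iff)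
    qed
    finally show ?thesis using s(4) sum_out_deg by linarith
  qed
  ultimately have cover: "real (card P) - 1 - b \<le> x - m + r / 2" by simp
  have restrict: "(\<Sum>\<delta>\<in>In. of_bool (\<delta> \<in> X) * F \<delta>) = (\<Sum>\<delta>\<in>X. F \<delta>)" for F :: "complex \<times> complex \<Rightarrow> real"
    using finite_In by (simp add: of_bool_def if_distrib[of "\<lambda>x. x * _"] sum.If_cases X_def faulty_def Int_def cong: if_cong)
  have sX: "(\<Sum>\<delta>\<in>X. 5 / 2 * nnc \<delta> - 3) = 5 / 2 * (3 * m) - 3 * x"
    unfolding sum_subtractf sum_distrib_left[symmetric] nncX by (simp add: x_def)
  have mem: "\<delta> \<in> X \<longleftrightarrow> \<not> (nnc \<delta> = 0 \<or> rhomb \<delta>)" if "\<delta> \<in> In" for \<delta> using that by (auto simp: X_def faulty_def)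
  have y: "0 \<le> 5 / 2 * (3 * m) - 3 * x"
  proof -
    have "(\<Sum>\<delta>\<in>In. if nnc \<delta> = 0 \<or> rhomb \<delta> then 0 else 5 / 2 * nnc \<delta> - 3) = (\<Sum>\<delta>\<in>In. of_bool (\<delta> \<in> X) * (5 / 2 * nnc \<delta> - 3))"
      using mem by (intro sum.cong) auto
    also have "\<dots> = 5 / 2 * (3 * m) - 3 * x"
      unfolding restrict sX ..
    finally show ?thesis using deficit_nonneg by simp
  qed
  have "(\<Sum>\<delta>\<in>In. if nnc \<delta> = 0 \<or> rhomb \<delta> then 1 else 4 - 5 / 2 * nnc \<delta>) = (\<Sum>\<delta>\<in>In. 1 - of_bool (\<delta> \<in> X) * (5 / 2 * nnc \<delta> - 3))"
    using mem by (intro sum.cong) auto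
  also have "\<dots> = real (card In) - (5 / 2 * (3 * m) - 3 * x)"
    unfolding sum_subtractf[of "\<lambda>_. 1"] restrict sX by simp
  finally have sm: "(\<Sum>\<delta>\<in>In. if nnc \<delta> = 0 \<or> rhomb \<delta> then 1 else 4 - 5 / 2 * nnc \<delta>)
     = real (card In) - (5 / 2 * (3 * m) - 3 * x)" .
  from area_units[OF area_weight_generic, unfolded this]
  have ar: "u * (real (card In) / 3 - (5 / 2 * m - x)) \<le> (\<Sum>\<delta>\<in>In. area \<delta>) / 3"
    by (rule back_subst[of "\<lambda>t. u * t \<le> _"]) (simp add: field_simps)
  have le: "real (card con) / 2 \<le> 8 / 3 * (real (card P) - 1) - 2 / 3 * (b + (5 / 2 * m - x) / 2) - 3 * \<sigma>"
    using s(2) cover M by (simp add: field_simps)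
  show ?thesis
    by (rule edge_boundI[OF s(1) _ le s(3) ar s(4)]) (use y in simp)
qed

end

section \<open>Upper bounds for finite packings\<close>

definition packs :: "real \<Rightarrow> complex set \<Rightarrow> bool" where
  "packs d P \<longleftrightarrow> finite P \<and> (\<forall>p\<in>P. cmod p < 1) \<and> (\<forall>p\<in>P. \<forall>q\<in>P. p \<noteq> q \<longrightarrow> cosh d \<le> ch p q)"

definition contacts :: "real \<Rightarrow> complex set \<Rightarrow> (complex \<times> complex) set" where
  "contacts d P = {(u, v). u \<in> P \<and> v \<in> P \<and> ch u v = cosh d}"

lemma packs_iff: "d > 0 \<Longrightarrow> packs d P \<longleftrightarrow> finite P \<and> hyp_packing d P"
  by (auto simp: packs_def hyp_packing_def subset_iff in_disc_iff hyp_dist_ge_iff)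

lemma packs_subset: "packs d P \<Longrightarrow> Q \<subseteq> P \<Longrightarrow> packs d Q"
  by (auto simp: packs_def finite_subset)

lemma finite_contacts: "finite P \<Longrightarrow> finite (contacts d P)"
  by (rule finite_subset[of _ "P \<times> P"]) (auto simp: contacts_def)

lemma contacts_neq: "d > 0 \<Longrightarrow> (u, v) \<in> contacts d P \<Longrightarrow> u \<noteq> v"
  using cosh_gt_1[of d] by (auto simp: contacts_def ch_def)

lemma card_contacts:
  assumes "d > 0" "packs d P"
  shows "card (contacts d P) = 2 * card (touching_pairs d P)"
proof -
  define g where "g \<delta> = {fst \<delta>, snd \<delta>}" for \<delta> :: "complex \<times> complex"
  have eq: "touching_pairs d P = g ` contacts d P"
  proof -
    have iff: "p \<noteq> q \<and> hyp_dist p q = d \<longleftrightarrow> ch p q = cosh d" if "p \<in> P" "q \<in> P" for p q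
      using that assms hyp_dist_eq_iff[of p q d] cosh_gt_1[of d] by (auto simp: packs_def ch_def)
    show ?thesis
    proof (intro equalityI subsetI)
      fix e assume "e \<in> touching_pairs d P"
      then obtain p q where "e = {p, q}" "p \<in> P" "q \<in> P" "ch p q = cosh d"
        using iff by (auto simp: touching_pairs_def)
      then show "e \<in> g ` contacts d P" by (intro image_eqI[of _ _ "(p, q)"]) (auto simp: g_def contacts_def)
    next
      fix e assume "e \<in> g ` contacts d P"
      then obtain p q where "e = {p, q}" "p \<in> P" "q \<in> P" "ch p q = cosh d" by (auto simp: g_def contacts_def)
      then show "e \<in> touching_pairs d P" using iff[of p q] unfolding touching_pairs_def by blast
    qed
  qed
  have fin: "finite (contacts d P)" using assms finite_contacts by (simp add: packs_def)
  have fib: "card {\<delta> \<in> contacts d P. g \<delta> = e} = 2" if e: "e \<in> g ` contacts d P" for e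
  proof -
    obtain \<delta> where "\<delta> \<in> contacts d P" "e = g \<delta>" using e by blast
    then obtain p q where pq: "e = {p, q}" "(p, q) \<in> contacts d P" unfolding g_def by (metis prod.collapse)
    have "p \<noteq> q" "(q, p) \<in> contacts d P" using contacts_neq[OF assms(1) pq(2)] pq(2) by (auto simp: contacts_def ch_sym)
    then have "{\<delta> \<in> contacts d P. g \<delta> = e} = {(p, q), (q, p)}"
      using pq by (auto simp: g_def doubleton_eq_iff)
    then show ?thesis using \<open>p \<noteq> q\<close> by simp
  qed
  have "card (contacts d P) = (\<Sum>\<delta>\<in>contacts d P. 1)" by simp
  also have "\<dots> = (\<Sum>e\<in>g ` contacts d P. \<Sum>\<delta>\<in>{\<delta> \<in> contacts d P. g \<delta> = e}. 1)"
    using fin by (intro sum.group[symmetric]) auto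
  also have "\<dots> = (\<Sum>e\<in>g ` contacts d P. 2)" using fib by (intro sum.cong) auto
  finally show ?thesis unfolding eq by simp
qed

lemma packing_triangulation:
  assumes d: "d > 0" and P: "packs d P"
  obtains h where "packing P d h"
proof -
  have disc: "cmod p < 1" if "p \<in> P" for p using P that by (simp add: packs_def)
  have sep: "cosh d \<le> ch p q" if "p \<in> P" "q \<in> P" "p \<noteq> q" for p q using P that by (simp add: packs_def)
  have inj: "inj_on klein P" using inj_on_klein by (rule inj_on_subset) (use disc in auto)
  have supp: "p \<noteq> q \<and> (\<exists>l. aff l (klein p) = klein_height p \<and> aff l (klein q) = klein_height q
      \<and> (\<forall>s\<in>P - {p, q}. aff l (klein s) < klein_height s))" if "(p, q) \<in> contacts d P" for p q
  proof
    have c: "p \<in> P" "q \<in> P" "ch p q = cosh d" using that by (auto simp: contacts_def)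
    show "\<exists>l. aff l (klein p) = klein_height p \<and> aff l (klein q) = klein_height q
      \<and> (\<forall>s\<in>P - {p, q}. aff l (klein s) < klein_height s)"
      by (rule contact_support[OF d]) (use c disc sep in auto)
  qed (rule contacts_neq[OF d that])
  have fin: "finite P" and sub: "contacts d P \<subseteq> P \<times> P" using P by (auto simp: packs_def contacts_def)
  obtain h where h: "regular_triangulation P klein h"
    "\<And>p q. (p, q) \<in> contacts d P \<Longrightarrow> regular_triangulation.edge P klein h p q"
    "\<And>u v w s. regular_triangulation.tri P klein h u v w \<Longrightarrow> s \<in> P \<Longrightarrow>
       \<exists>l. aff l (klein u) = klein_height u \<and> aff l (klein v) = klein_height v \<and> aff l (klein w) = klein_height w
         \<and> aff l (klein s) \<le> klein_height s"
    using perturbed_heights[OF fin inj sub supp] by metis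
  have "packing P d h"
    by (rule packing.intro) (use d disc sep h in \<open>simp_all add: contacts_def\<close>)
  then show thesis by (rule that)
qed

context packing
begin

lemma contacts_con: "contacts d P = con"
  by (simp add: contacts_def con_def)

text \<open>Without boundary the isoperimetric inequality would make a positive area vanish. This
  guarantees that peeling removes something.\<close>

lemma bd_nonempty: assumes "con \<noteq> {}" shows "bd \<noteq> {}"
proof
  assume "bd = {}"
  then have c: "con \<subseteq> In" by (auto simp: bd_def con_def)
  then have "card (con - In) = 0" by (metis Diff_eq_empty_iff card.empty)
  then have "(\<Sum>\<delta>\<in>In. area \<delta>) \<le> 0" using total_area_le by simp
  moreover have "(\<Sum>\<delta>\<in>In. area \<delta>) > 0"
    using c assms finite_In area_pos[OF In_inner] by (intro sum_pos) auto
  ultimately show False by simp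
qed

end

text \<open>A vertex with at most one contact is removed at the cost of one contact, covered by
  \<gamma> \<ge> 2; otherwise the whole boundary goes. For the remainder the hypothesis is weakened
  from |Q| - 1 to |Q|, which also admits an empty Q.\<close>

lemma contact_bound_induct:
  fixes \<gamma> :: real
  assumes d: "d > 0" and g: "2 \<le> \<gamma>"
    and step: "\<And>P h. packing P d h \<Longrightarrow> P \<noteq> {} \<Longrightarrow> (\<And>v. v \<in> P \<Longrightarrow> 2 \<le> card (packing.cnbr P d v)) \<Longrightarrow>
      real (card (packing.con P d \<inter> (P - packing.bd P d h) \<times> (P - packing.bd P d h))) / 2
        \<le> \<gamma> * (real (card P) - real (card (packing.bd P d h))) \<Longrightarrow>
      real (card (packing.con P d)) / 2 \<le> \<gamma> * (real (card P) - 1)"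
  shows "packs d P \<Longrightarrow> P \<noteq> {} \<Longrightarrow> real (card (contacts d P)) / 2 \<le> \<gamma> * (real (card P) - 1)"
proof (induction "card P" arbitrary: P rule: less_induct)
  case less
  have fin: "finite P" using less.prems by (simp add: packs_def)
  obtain h where "packing P d h" using packing_triangulation[OF d less.prems(1)] .
  then interpret packing P d h .
  show ?case
  proof (cases "\<exists>v\<in>P. card (cnbr v) < 2")
    case True
    then obtain v where v: "v \<in> P" "card (cnbr v) \<le> 1" by auto
    define Q where "Q = P - {v}"
    have "card P = Suc (card Q)" unfolding Q_def using card.remove[OF fin v(1)] .
    then have cQ: "real (card Q) = real (card P) - 1" "card Q < card P" by simp_all
    have Q: "packs d Q" using packs_subset[OF less.prems(1)] by (simp add: Q_def)
    have "contacts d P \<subseteq> contacts d Q \<union> (Pair v ` cnbr v \<union> (\<lambda>a. (a, v)) ` cnbr v)"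
      using con_sym by (auto simp: contacts_con[symmetric] contacts_def Q_def cnbr_def ch_sym)
    then have "card (contacts d P) \<le> card (contacts d Q \<union> (Pair v ` cnbr v \<union> (\<lambda>a. (a, v)) ` cnbr v))"
      using finite_contacts[of Q d] finite_cnbr fin by (intro card_mono) (auto simp: Q_def)
    also have "\<dots> \<le> card (contacts d Q) + (card (Pair v ` cnbr v) + card ((\<lambda>a. (a, v)) ` cnbr v))"
      by (meson add_left_mono card_Un_le order_trans)
    also have "\<dots> \<le> card (contacts d Q) + (1 + 1)"
      using v(2) card_image_le[OF finite_cnbr] by (meson add_left_mono add_mono order_trans)
    finally have le: "card (contacts d P) \<le> card (contacts d Q) + 2" by simp
    show ?thesis
    proof (cases "Q = {}")
      case True
      then have P: "P = {v}" using v by (auto simp: Q_def)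
      have "contacts d P = {}" using contacts_neq[OF d] unfolding P by (force simp: contacts_def)
      then show ?thesis using P by simp
    next
      case False
      have "real (card (contacts d Q)) / 2 \<le> \<gamma> * (real (card Q) - 1)" using less.hyps[OF cQ(2) Q False] .
      then have "real (card (contacts d P)) / 2 \<le> \<gamma> * (real (card P) - 1) - \<gamma> + 1"
        using le unfolding cQ(1) by (simp add: algebra_simps)
      then show ?thesis using g by simp
    qed
  next
    case False
    then have deg: "2 \<le> card (cnbr v)" if "v \<in> P" for v using that by force
    obtain v where "v \<in> P" using less.prems by auto
    then have "cnbr v \<noteq> {}" using deg[of v] by auto
    then have "bd \<noteq> {}" by (intro bd_nonempty) (auto simp: cnbr_def)
    define Q where "Q = P - bd"
    have cQ: "real (card Q) = real (card P) - real (card bd)"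
      using finite_bd bd_subset fin by (simp add: Q_def card_Diff_subset of_nat_diff card_mono)
    have lt: "card Q < card P" using \<open>bd \<noteq> {}\<close> bd_subset fin unfolding Q_def by (intro psubset_card_mono) auto
    have Q: "packs d Q" using packs_subset[OF less.prems(1)] by (simp add: Q_def)
    have "real (card (contacts d Q)) / 2 \<le> \<gamma> * real (card Q)"
    proof (cases "Q = {}")
      case True
      then show ?thesis by (simp add: contacts_def)
    next
      case False
      have "real (card (contacts d Q)) / 2 \<le> \<gamma> * (real (card Q) - 1)" using less.hyps[OF lt Q False] .
      also have "\<dots> \<le> \<gamma> * real (card Q)" using g by (intro mult_left_mono) auto
      finally show ?thesis .
    qed
    moreover have "con \<inter> (P - bd) \<times> (P - bd) = contacts d Q" by (auto simp: con_def contacts_def Q_def)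
    ultimately show ?thesis
      unfolding contacts_con using step[OF \<open>packing P d h\<close> less.prems(2) deg] by (simp add: cQ)
  qed
qed

lemma peeling_upper_bound:
  assumes d: "d > 0" and g: "2 \<le> \<gamma>" "\<gamma> \<le> 3" "\<gamma> = A - 2 * B * ((pi / alpha d - 3) / (2 * (pi / alpha d) - \<gamma> - 3))"
    and B: "0 \<le> B"
    and eb: "\<And>P h. packing P d h \<Longrightarrow> P \<noteq> {} \<Longrightarrow> (\<And>v. v \<in> P \<Longrightarrow> packing.cnbr P d v \<noteq> {}) \<Longrightarrow> packing.edge_bound P d h A B"
    and P: "packs d P" "P \<noteq> {}"
  shows "real (card (contacts d P)) / 2 \<le> \<gamma> * (real (card P) - 1)"
proof (rule contact_bound_induct[OF d g(1) _ P])
  fix P h assume p: "packing P d h" "P \<noteq> {}" and deg: "\<And>v. v \<in> P \<Longrightarrow> 2 \<le> card (packing.cnbr P d v)"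
    and IH: "real (card (packing.con P d \<inter> (P - packing.bd P d h) \<times> (P - packing.bd P d h))) / 2
        \<le> \<gamma> * (real (card P) - real (card (packing.bd P d h)))"
  interpret packing P d h by (rule p)
  have "cnbr v \<noteq> {}" if "v \<in> P" for v using deg[OF that] by auto
  then have "edge_bound A B" using eb[OF p] by blast
  then show "real (card con) / 2 \<le> \<gamma> * (real (card P) - 1)" by (rule peeling_bound[OF _ B deg g(2,3) IH])
qed

lemma isoperimetric_upper_bound:
  assumes d: "d > 0" and u: "u = pi - 3 * alpha d" "u \<le> d" and g: "\<gamma> = A - 2 * B * (u / (d + u))" "2 \<le> \<gamma>"
    and B: "0 \<le> B" "B \<le> 1"
    and eb: "\<And>P h. packing P d h \<Longrightarrow> P \<noteq> {} \<Longrightarrow> (\<And>v. v \<in> P \<Longrightarrow> packing.cnbr P d v \<noteq> {}) \<Longrightarrow> packing.edge_bound P d h A B"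
    and P: "packs d P" "P \<noteq> {}"
  shows "real (card (contacts d P)) / 2 \<le> \<gamma> * (real (card P) - 1)"
proof (rule contact_bound_induct[OF d g(2) _ P])
  fix P h assume p: "packing P d h" "P \<noteq> {}" and deg: "\<And>v. v \<in> P \<Longrightarrow> 2 \<le> card (packing.cnbr P d v)"
  interpret packing P d h by (rule p)
  have "cnbr v \<noteq> {}" if "v \<in> P" for v using deg[OF that] by auto
  then have "edge_bound A B" using eb[OF p] by blast
  from isoperimetric_bound[OF this B u(2)[unfolded u(1)]]
  show "real (card con) / 2 \<le> \<gamma> * (real (card P) - 1)" unfolding g(1) u(1) .
qed

subsection \<open>The numbers \<open>\<gamma>\<^sub>i\<close>\<close>

text \<open>The peeling bounds are the cases t = 0, 1/8, 1/6. The radicand lies between the squares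
  of x - t - 3 and x - t - 2, which places \<gamma> between 2 and 3; the last claim is the quadratic
  equation in the form demanded by \<open>peeling_bound\<close>, with A = 3 - 2 t and B = 1 - 2
  t.\<close>

lemma quadratic_root_bounds:
  fixes x t \<gamma> :: real
  assumes x: "x > 3" and t: "0 \<le> t" "t \<le> 1 / 2" and g: "\<gamma> = x - t - sqrt (x\<^sup>2 - (4 + 2 * t) * x + t\<^sup>2 + 6 * t + 3)"
  shows "2 \<le> \<gamma>" "\<gamma> \<le> 3" "\<gamma> = (3 - 2 * t) - 2 * (1 - 2 * t) * ((x - 3) / (2 * x - \<gamma> - 3))"
proof -
  define D where "D = x\<^sup>2 - (4 + 2 * t) * x + t\<^sup>2 + 6 * t + 3"
  have g': "\<gamma> = x - t - sqrt D" by (simp add: g D_def)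
  have lo: "(x - t - 3)\<^sup>2 \<le> D" using x by (simp add: D_def power2_eq_square algebra_simps)
  have hi: "D \<le> (x - t - 2)\<^sup>2" using t by (simp add: D_def power2_eq_square algebra_simps)
  have D: "0 \<le> D" using lo zero_le_power2[of "x - t - 3"] by linarith
  have "sqrt D \<le> x - t - 2" using hi x t by (intro real_le_lsqrt) auto
  then show "2 \<le> \<gamma>" using g' by simp
  have "x - t - 3 \<le> sqrt D" using lo by (intro real_le_rsqrt)
  then show g3: "\<gamma> \<le> 3" using g' by simp
  have "(x - t - \<gamma>)\<^sup>2 = D" using D by (simp add: g')
  then have "\<gamma> * (2 * x - \<gamma> - 3) = (3 - 2 * t) * (2 * x - \<gamma> - 3) - 2 * (1 - 2 * t) * (x - 3)"
    unfolding D_def by (simp add: power2_eq_square algebra_simps)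
  moreover have "2 * x - \<gamma> - 3 > 0" using x g3 by simp
  ultimately show "\<gamma> = (3 - 2 * t) - 2 * (1 - 2 * t) * ((x - 3) / (2 * x - \<gamma> - 3))"
    by (simp add: field_simps)
qed

lemma pi_over_alpha: "d > 0 \<Longrightarrow> pi / alpha d > 3"
  using alpha_bounds[of d] by (simp add: field_simps)

lemma gamma1_root:
  "gamma1 d = pi / alpha d - 0 - sqrt ((pi / alpha d)\<^sup>2 - (4 + 2 * 0) * (pi / alpha d) + 0\<^sup>2 + 6 * 0 + 3)"
proof -
  have "(x - 1) * (x - 3) = x\<^sup>2 - (4 + 2 * 0) * x + 0\<^sup>2 + 6 * 0 + 3" for x :: real
    by (simp add: power2_eq_square algebra_simps)
  then show ?thesis unfolding gamma1_def by simp
qed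

lemma gamma2_root:
  "gamma2 d = pi / alpha d - 1 / 8 - sqrt ((pi / alpha d)\<^sup>2 - (4 + 2 * (1 / 8)) * (pi / alpha d) + (1 / 8)\<^sup>2 + 6 * (1 / 8) + 3)"
proof -
  have "17 * pi / (4 * alpha d) = (4 + 2 * (1 / 8)) * (pi / alpha d)" by simp
  moreover have "x + (1 / 8)\<^sup>2 + 6 * (1 / 8) + 3 = x + 241 / 64" for x :: real by (simp add: power2_eq_square)
  ultimately show ?thesis unfolding gamma2_def by (simp only:)
qed

lemma gamma4_root:
  "gamma4 d = pi / alpha d - 1 / 6 - sqrt ((pi / alpha d)\<^sup>2 - (4 + 2 * (1 / 6)) * (pi / alpha d) + (1 / 6)\<^sup>2 + 6 * (1 / 6) + 3)"
proof -
  have "13 * pi / (3 * alpha d) = (4 + 2 * (1 / 6)) * (pi / alpha d)" by simp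
  moreover have "x + (1 / 6)\<^sup>2 + 6 * (1 / 6) + 3 = x + 145 / 36" for x :: real by (simp add: power2_eq_square)
  ultimately show ?thesis unfolding gamma4_def by (simp only:)
qed

text \<open>Keeps u / (d + u) at most 1/2. For y = d / 2 the Gudermannian arctan (sinh y) is at most
  y and has sine tanh y; half the deficit has sine cos (3 \<alpha> / 2) = cos (\<alpha> / 2) tanh^2
  y, which is not larger.\<close>

lemma deficit_le_side:
  assumes "d > 0" shows "pi - 3 * alpha d \<le> d"
proof -
  define a y where "a = alpha d / 2" and "y = d / 2"
  have a: "0 < a" "a < pi / 6" using alpha_half_bounds[OF assms] by (auto simp: a_def)
  have y: "y > 0" using assms by (simp add: y_def)
  have c: "cosh y > 1" using cosh_gt_1[OF y] .
  define f where "f t = t - arctan (sinh t)" for t :: real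
  have "f 0 \<le> f y"
  proof (rule DERIV_nonneg_imp_nondecreasing[of 0 y f])
    fix t :: real
    have "(f has_real_derivative 1 - cosh t * inverse (1 + (sinh t)\<^sup>2)) (at t)"
      unfolding f_def by (auto intro!: derivative_eq_intros simp: divide_inverse)
    moreover have "cosh t * inverse (1 + (sinh t)\<^sup>2) \<le> 1"
    proof -
      have "1 + (sinh t)\<^sup>2 = (cosh t)\<^sup>2" by (simp add: cosh_square_eq)
      then show ?thesis using cosh_real_ge_1[of t] by (simp add: power2_eq_square field_simps)
    qed
    ultimately show "\<exists>z. (f has_real_derivative z) (at t) \<and> 0 \<le> z" by (metis diff_ge_0_iff_ge)
  qed (use y in simp)
  then have gd: "arctan (sinh y) \<le> y" by (simp add: f_def)
  have "sin (arctan (sinh y)) = tanh y"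
  proof -
    have "sqrt (1 + (sinh y)\<^sup>2) = cosh y" using c by (intro real_sqrt_unique) (simp_all add: cosh_square_eq)
    then show ?thesis unfolding sin_arctan tanh_def by simp
  qed
  moreover have "sin (pi / 2 - 3 * a) \<le> tanh y"
  proof -
    have s: "sin a = 1 / (2 * cosh y)" using sin_half_alpha[OF assms] by (simp add: a_def y_def)
    have "cos (3 * a) = cos a * (4 * (cos a)\<^sup>2 - 3)"
      unfolding cos_treble_cos by (simp add: power3_eq_cube power2_eq_square algebra_simps)
    also have "4 * (cos a)\<^sup>2 - 3 = 1 - 1 / (cosh y)\<^sup>2"
      unfolding cos_squared_eq s by (simp add: power_divide power_mult_distrib)
    also have "\<dots> = (tanh y)\<^sup>2"
      using c by (simp add: tanh_def power_divide sinh_square_eq diff_divide_distrib)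
    finally have e: "sin (pi / 2 - 3 * a) = cos a * (tanh y)\<^sup>2" by (simp add: sin_diff)
    have t: "0 \<le> tanh y" "tanh y \<le> 1" using y tanh_real_lt_1[of y] by auto
    have "cos a * (tanh y)\<^sup>2 \<le> 1 * (tanh y)\<^sup>2" by (intro mult_right_mono) auto
    also have "\<dots> \<le> tanh y" using t by (simp add: power2_eq_square mult_left_le)
    finally show ?thesis unfolding e .
  qed
  ultimately have "sin (pi / 2 - 3 * a) \<le> sin (arctan (sinh y))" by simp
  moreover have "0 \<le> arctan (sinh y)" "arctan (sinh y) < pi / 2" using y arctan_ubound by auto
  ultimately have "pi / 2 - 3 * a \<le> arctan (sinh y)"
    using a sin_mono_le_eq[of "pi / 2 - 3 * a" "arctan (sinh y)"] by simp
  then show ?thesis using gd by (simp add: a_def y_def)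
qed

lemma gamma3_5:
  assumes d: "d > 0" and u: "u = pi - 3 * alpha d"
  shows "gamma3 d = 11 / 4 - 2 * (3 / 4) * (u / (d + u))" "gamma5 d = 8 / 3 - 2 * (2 / 3) * (u / (d + u))"
    "2 \<le> gamma3 d" "2 \<le> gamma5 d"
proof -
  have u0: "u > 0" "u \<le> d" using alpha_bounds[OF d] deficit_le_side[OF d] by (auto simp: u)
  then have r: "u / (d + u) \<le> 1 / 2" by (simp add: field_simps)
  have "2 + 3 * (d - u) / (4 * (d + u)) = 11 / 4 - 2 * (3 / 4) * (u / (d + u))" using u0 by (simp add: field_simps)
  then show g3: "gamma3 d = 11 / 4 - 2 * (3 / 4) * (u / (d + u))" by (simp add: gamma3_def u algebra_simps)
  have "8 / 3 - 4 * u / (3 * (d + u)) = 8 / 3 - 2 * (2 / 3) * (u / (d + u))" using u0 by (simp add: field_simps)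
  then show g5: "gamma5 d = 8 / 3 - 2 * (2 / 3) * (u / (d + u))" by (simp add: gamma5_def u algebra_simps)
  have "2 \<le> 11 / 4 - 2 * (3 / 4) * t" "2 \<le> 8 / 3 - 2 * (2 / 3) * t" if "t \<le> 1 / 2" for t :: real
    using that by simp_all
  from this[OF r] show "2 \<le> gamma3 d" "2 \<le> gamma5 d" unfolding g3 g5 .
qed

lemma alpha4_bounds:
  assumes "d > 0" shows "alpha d < alpha4 d" "alpha4 d < 2 * alpha d" "alpha4 d < pi / 2"
proof -
  define a s where "a = alpha d / 2" and "s = sin a"
  have a: "0 < a" "a < pi / 6" using alpha_half_bounds[OF assms] by (auto simp: a_def)
  have "sin a < sin (pi / 6)" "sin 0 < sin a" using a by (intro sin_monotone_2pi; simp)+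
  then have s: "0 < s" "s < 1 / 2" by (auto simp: s_def sin_30)
  have r: "1 < sqrt 2" "sqrt 2 \<le> 2" by (auto intro: real_le_lsqrt)
  have h: "alpha4 d = 2 * arcsin (sqrt 2 * s)" by (simp add: alpha4_def s_def a_def)
  have b: "sqrt 2 * s < sqrt 2 / 2" "s < sqrt 2 * s" "sqrt 2 / 2 \<le> 1" using r s by auto
  have b': "sqrt 2 * s \<le> 1" "- 1 \<le> sqrt 2 * s" using b s by linarith+
  have "arcsin s < arcsin (sqrt 2 * s)" using b b' s by (intro arcsin_less_arcsin) auto
  moreover have "arcsin s = a" unfolding s_def using a by (intro arcsin_sin) auto
  ultimately show "alpha d < alpha4 d" using h by (simp add: a_def)
  have "arcsin (sqrt 2 * s) < arcsin (sqrt 2 / 2)" using b b' s by (intro arcsin_less_arcsin) auto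
  also have "arcsin (sqrt 2 / 2) = pi / 4" by (intro arcsin_unique) (auto simp: sin_45)
  finally show "alpha4 d < pi / 2" using h by simp
  have "cos (pi / 4) < cos a" using a by (intro cos_monotone_0_pi) auto
  then have "s * (sqrt 2 / 2) < s * cos a" using s by (simp add: cos_45)
  then have "sqrt 2 * s < sin (2 * a)" unfolding sin_double by (simp add: s_def mult.commute)
  then have "arcsin (sqrt 2 * s) < arcsin (sin (2 * a))" using b b' s by (intro arcsin_less_arcsin) auto
  also have "arcsin (sin (2 * a)) = 2 * a" using a by (intro arcsin_sin) auto
  finally show "alpha4 d < 2 * alpha d" using h by (simp add: a_def)
qed

text \<open>Both tiling equations together make \<open>alpha4 d\<close> an integer multiple of
  \<alpha>, but it lies strictly between \<alpha> and 2 \<alpha>.\<close>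

lemma d_semi_not_tri:
  assumes "k \<ge> 6" "d = d_semi k" "k' \<ge> 7" shows "d \<noteq> d_tri k'"
proof
  assume t: "d = d_tri k'"
  have s: "d > 0" "alpha4 d + (real k - 1) * alpha d = 2 * pi"
    using theI'[OF ex1_d_semi[OF assms(1)]] unfolding assms(2) d_semi_def by auto
  have "alpha d = 2 * pi / real k'" using theI'[OF ex1_d_tri[OF assms(3)]] unfolding t d_tri_def by auto
  then have "2 * pi = real k' * alpha d" using assms(3) by simp
  then have "alpha4 d = (real k' - real k + 1) * alpha d" using s(2) by (simp add: algebra_simps)
  moreover have a: "alpha d > 0" using alpha_bounds[OF s(1)] by simp
  ultimately have "1 * alpha d < (real k' - real k + 1) * alpha d" "(real k' - real k + 1) * alpha d < 2 * alpha d"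
    using alpha4_bounds[OF s(1)] by auto
  then have "1 < real k' - real k + 1" "real k' - real k + 1 < 2" using a by (simp_all only: mult_less_cancel_right_pos)
  then have "real k < real k'" "real k' < real (Suc k)" by simp_all
  then show False by simp
qed

lemma finite_packing_bounds:
  assumes d: "d > 0" and P: "packs d P" "P \<noteq> {}"
  shows "real (card (contacts d P)) / 2 \<le> gamma1 d * (real (card P) - 1)"
    "\<forall>k\<ge>7. d \<noteq> d_tri k \<Longrightarrow> real (card (contacts d P)) / 2 \<le> gamma2 d * (real (card P) - 1)"
    "\<forall>k\<ge>7. d \<noteq> d_tri k \<Longrightarrow> real (card (contacts d P)) / 2 \<le> gamma3 d * (real (card P) - 1)"
    "\<forall>k\<ge>7. d \<noteq> d_tri k \<Longrightarrow> \<forall>k\<ge>6. d \<noteq> d_semi k \<Longrightarrow> real (card (contacts d P)) / 2 \<le> gamma4 d * (real (card P) - 1)"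
    "\<forall>k\<ge>7. d \<noteq> d_tri k \<Longrightarrow> \<forall>k\<ge>6. d \<noteq> d_semi k \<Longrightarrow> real (card (contacts d P)) / 2 \<le> gamma5 d * (real (card P) - 1)"
proof -
  note x = pi_over_alpha[OF d]
  note q1 = quadratic_root_bounds[OF x _ _ gamma1_root] and q2 = quadratic_root_bounds[OF x _ _ gamma2_root]
    and q4 = quadratic_root_bounds[OF x _ _ gamma4_root]
  note le = deficit_le_side[OF d] and g35 = gamma3_5[OF d refl]
  show "real (card (contacts d P)) / 2 \<le> gamma1 d * (real (card P) - 1)"
  proof (rule peeling_upper_bound[where A = 3 and B = 1, OF d _ _ _ _ _ P])
    show "packing.edge_bound P d h 3 1" if "packing P d h" "P \<noteq> {}" for P h
      using packing.edge_bound_1[OF that] .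
  qed (use q1 in simp_all)
  assume n: "\<forall>k\<ge>7. d \<noteq> d_tri k"
  have e: "packing.edge_bound P d h (11 / 4) (3 / 4)"
    if "packing P d h" "P \<noteq> {}" "\<And>v. v \<in> P \<Longrightarrow> packing.cnbr P d v \<noteq> {}" for P h
    using packing.edge_bound_2[OF that n] .
  show "real (card (contacts d P)) / 2 \<le> gamma2 d * (real (card P) - 1)"
    by (rule peeling_upper_bound[where A = "11 / 4" and B = "3 / 4", OF d _ _ _ _ e P]) (use q2 in simp_all)
  show "real (card (contacts d P)) / 2 \<le> gamma3 d * (real (card P) - 1)"
    by (rule isoperimetric_upper_bound[OF d refl le g35(1,3) _ _ e P]) simp_all
  assume n': "\<forall>k\<ge>6. d \<noteq> d_semi k"
  have e: "packing.edge_bound P d h (8 / 3) (2 / 3)"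
    if "packing P d h" "P \<noteq> {}" "\<And>v. v \<in> P \<Longrightarrow> packing.cnbr P d v \<noteq> {}" for P h
    using packing.edge_bound_3[OF that n n'] .
  show "real (card (contacts d P)) / 2 \<le> gamma4 d * (real (card P) - 1)"
    by (rule peeling_upper_bound[where A = "8 / 3" and B = "2 / 3", OF d _ _ _ _ e P]) (use q4 in simp_all)
  show "real (card (contacts d P)) / 2 \<le> gamma5 d * (real (card P) - 1)"
    by (rule isoperimetric_upper_bound[OF d refl le g35(2,4) _ _ e P]) simp_all
qed

section \<open>The limit\<close>

text \<open>Fekete's lemma. That the limit bounds every single quotient is what turns an explicit
  packing into a lower bound.\<close>

lemma superadditive_limit:
  fixes f :: "nat \<Rightarrow> real"
  assumes super: "\<And>m n. f m + f n \<le> f (m + n)" and nonneg: "\<And>n. 0 \<le> f n" and bnd: "\<And>n. f n \<le> C * real n"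
  obtains L where "(\<lambda>n. f n / real n) \<longlonglongrightarrow> L" "\<And>n. n > 0 \<Longrightarrow> f n / real n \<le> L"
proof -
  define S where "S = (\<lambda>n. f n / real n) ` {0<..}"
  define L where "L = Sup S"
  have le: "f n / real n \<le> C" if "n > 0" for n using bnd[of n] that by (simp add: divide_le_eq)
  then have bdd: "bdd_above S" by (auto simp: S_def intro!: bdd_aboveI)
  have up: "f n / real n \<le> L" if "n > 0" for n
    unfolding L_def by (rule cSup_upper[OF _ bdd]) (use that in \<open>auto simp: S_def\<close>)
  have "0 \<le> f 1 / real 1" using nonneg[of 1] by simp
  then have C: "0 \<le> C" using le[of 1] by simp
  have mult: "real k * f m \<le> f (k * m + r)" for k m r
  proof (induction k)
    case (Suc k)
    have "f m + f (k * m + r) \<le> f (Suc k * m + r)" using super[of m "k * m + r"] by (simp add: algebra_simps)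
    then show ?case using Suc by (simp add: algebra_simps)
  qed (simp add: nonneg)
  have "(\<lambda>n. f n / real n) \<longlonglongrightarrow> L"
  proof (rule LIMSEQ_I)
    fix e :: real assume e: "e > 0"
    have "S \<noteq> {}" by (auto simp: S_def)
    then obtain m where m: "m > 0" "L - e / 2 < f m / real m"
      using less_cSupD[of S "L - e / 2"] e by (auto simp: L_def S_def)
    obtain N :: nat where N: "real N > 2 * C * real m / e" using reals_Archimedean2 by blast
    have "norm (f n / real n - L) < e" if n: "n \<ge> max 1 N" for n
    proof -
      have n0: "n > 0" "real n > 2 * C * real m / e" using n N by auto
      have nm: "n = (n div m) * m + n mod m" by simp
      have "real (n div m) * f m \<le> f n" using mult[of "n div m" m "n mod m"] by simp
      have "real n < (real (n div m) + 1) * real m"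
      proof -
        have "n < (n div m + 1) * m" using m(1) by (metis Suc_eq_plus1 dividend_less_div_times div_mult_self1_is_m mult.commute add.commute less_mult_imp_div_less mult_Suc div_less_iff_less_mult lessI)
        then show ?thesis by (metis of_nat_1 of_nat_add of_nat_less_iff of_nat_mult)
      qed
      then have q: "real n / real m - 1 \<le> real (n div m)" using m(1) by (simp add: field_simps)
      have "(real n / real m - 1) * f m \<le> f n"
        using mult_right_mono[OF q nonneg[of m]] \<open>real (n div m) * f m \<le> f n\<close> by linarith
      then have "real n * (f m / real m) \<le> f n + f m" by (simp add: algebra_simps)
      then have "real n * (f m / real m) \<le> f n + C * real m" using bnd[of m] by linarith
      then have "f m / real m \<le> f n / real n + C * real m / real n" using n0(1) by (simp add: field_simps)
      moreover have "C * real m / real n < e / 2" using n0 e by (simp add: field_simps)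
      moreover have "\<bar>x - L\<bar> < e" if "y \<le> x + z" "z < e / 2" "L - e / 2 < y" "x \<le> L" for x y z
        using that by linarith
      ultimately show ?thesis using m(2) up[OF n0(1)] unfolding real_norm_def by blast
    qed
    then show "\<exists>no. \<forall>n\<ge>no. norm (f n / real n - L) < e" by blast
  qed
  then show thesis using up by (rule that)
qed

lemma inj_on_mob: assumes "cmod a < 1" "\<And>q. q \<in> Q \<Longrightarrow> cmod q < 1" shows "inj_on (mob a) Q"
proof (rule inj_onI, rule ccontr)
  fix x y assume xy: "x \<in> Q" "y \<in> Q" "mob a x = mob a y" "x \<noteq> y"
  then have "ch x y > 1" using assms by (intro ch_gt_1) auto
  moreover have "ch x y = 1" using ch_mob[OF assms(1), of x y] assms(2) xy by (simp add: ch_def)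
  ultimately show False by simp
qed

text \<open>As a tends to 1, \<open>mob a\<close> pushes every point of the disc to the boundary
  point -1, so Q moves arbitrarily far away from P.\<close>

lemma packs_merge:
  assumes d: "d > 0" and P: "packs d P" and Q: "packs d Q"
  obtains R where "packs d R" "card R = card P + card Q" "card (contacts d R) \<ge> card (contacts d P) + card (contacts d Q)"
proof -
  have discP: "cmod p < 1" if "p \<in> P" for p using P that by (simp add: packs_def)
  have discQ: "cmod p < 1" if "p \<in> Q" for p using Q that by (simp add: packs_def)
  have fin: "finite P" "finite Q" using P Q by (auto simp: packs_def)
  have evd: "\<forall>\<^sub>F a in at_left (1::real). 0 < a \<and> a < 1" by (intro eventually_at_leftI[of 0]) auto
  have far: "\<forall>\<^sub>F a in at_left (1::real). cosh d \<le> ch p (mob (of_real a) q)" if pq: "p \<in> P" "q \<in> Q" for p q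
  proof -
    have q1: "q \<noteq> 1" "p \<noteq> -1" using discP[OF pq(1)] discQ[OF pq(2)] by auto
    have lim: "((\<lambda>a. mob (of_real a) q) \<longlongrightarrow> (q - of_real 1) / (1 - cnj (of_real 1) * q)) (at_left (1::real))"
      unfolding mob_def by (intro tendsto_intros) (use q1 in auto)
    have m1: "(q - of_real 1) / (1 - cnj (of_real 1) * q) = -1" using q1 by (simp add: field_simps)
    note lim = lim[unfolded m1]
    \<comment> \<open>The inequality is cleared of denominators to have a limit: 1 - |w|^2 tends to
      0 for the moved point w, while its distance from p stays positive.\<close>
    have "((\<lambda>a. cosh d * ((1 - (cmod p)\<^sup>2) * (1 - (cmod (mob (of_real a) q))\<^sup>2))) \<longlongrightarrow>
        cosh d * ((1 - (cmod p)\<^sup>2) * (1 - (cmod (-1))\<^sup>2))) (at_left (1::real))"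
      by (intro tendsto_intros lim)
    moreover have "((\<lambda>a. 2 * (cmod (p - mob (of_real a) q))\<^sup>2) \<longlongrightarrow> 2 * (cmod (p - (-1)))\<^sup>2) (at_left (1::real))"
      by (intro tendsto_intros lim)
    ultimately have l: "((\<lambda>a. 2 * (cmod (p - mob (of_real a) q))\<^sup>2 - cosh d * ((1 - (cmod p)\<^sup>2) * (1 - (cmod (mob (of_real a) q))\<^sup>2)))
        \<longlongrightarrow> 2 * (cmod (p - (-1)))\<^sup>2 - cosh d * ((1 - (cmod p)\<^sup>2) * (1 - (cmod (-1))\<^sup>2))) (at_left (1::real))"
      by (intro tendsto_diff)
    have "p - (-1) \<noteq> 0" using q1(2) by (metis right_minus_eq)
    then have "cmod (p - (-1)) > 0" by (rule zero_less_norm_iff[THEN iffD2])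
    then have pos: "0 < 2 * (cmod (p - (-1)))\<^sup>2 - cosh d * ((1 - (cmod p)\<^sup>2) * (1 - (cmod (-1))\<^sup>2))" by simp
    show ?thesis using order_tendstoD(1)[OF l pos] evd
    proof eventually_elim
      case (elim a)
      have m: "cmod (mob (of_real a) q) < 1" using elim discQ pq by (intro mob_in_disc) auto
      have "(1 - (cmod p)\<^sup>2) * (1 - (cmod (mob (of_real a) q))\<^sup>2) > 0" using disc_sq m discP[OF pq(1)] by simp
      then have "cosh d \<le> 2 * (cmod (p - mob (of_real a) q))\<^sup>2 / ((1 - (cmod p)\<^sup>2) * (1 - (cmod (mob (of_real a) q))\<^sup>2))"
        using elim by (simp add: pos_le_divide_eq)
      then show ?case by (simp add: ch_def)
    qed
  qed
  have "\<forall>\<^sub>F a in at_left (1::real). \<forall>p\<in>P. \<forall>q\<in>Q. cosh d \<le> ch p (mob (of_real a) q)"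
    using fin far by (intro eventually_ball_finite ballI) auto
  then have "\<forall>\<^sub>F a in at_left (1::real). (0 < a \<and> a < 1) \<and> (\<forall>p\<in>P. \<forall>q\<in>Q. cosh d \<le> ch p (mob (of_real a) q))"
    using evd by (simp add: eventually_conj_iff)
  from eventually_happens'[OF trivial_limit_at_left_real this]
  obtain a where a: "0 < a" "a < (1::real)" "\<And>p q. p \<in> P \<Longrightarrow> q \<in> Q \<Longrightarrow> cosh d \<le> ch p (mob (of_real a) q)"
    by blast
  define m where "m = mob (of_real a)"
  have a1: "cmod (of_real a) < 1" using a by simp
  have mD: "cmod (m q) < 1" if "q \<in> Q" for q using mob_in_disc[OF a1 discQ[OF that]] by (simp add: m_def)
  have mC: "ch (m x) (m y) = ch x y" if "x \<in> Q" "y \<in> Q" for x y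
    using ch_mob[OF a1] discQ that by (simp add: m_def)
  have inj: "inj_on m Q" unfolding m_def using a1 discQ by (rule inj_on_mob)
  have sep: "cosh d \<le> ch p (m q)" if "p \<in> P" "q \<in> Q" for p q using a(3) that by (simp add: m_def)
  have disj: "P \<inter> m ` Q = {}"
  proof (rule ccontr)
    assume "P \<inter> m ` Q \<noteq> {}"
    then obtain q where "q \<in> Q" "m q \<in> P" by auto
    then have "cosh d \<le> ch (m q) (m q)" using sep by blast
    then show False using cosh_gt_1[OF d] by (simp add: ch_def)
  qed
  show thesis
  proof (rule that[of "P \<union> m ` Q"])
    show "packs d (P \<union> m ` Q)"
      unfolding packs_def
    proof (intro conjI ballI impI)
      fix p q assume pq: "p \<in> P \<union> m ` Q" "q \<in> P \<union> m ` Q" "p \<noteq> q"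
      have 1: "cosh d \<le> ch x y" if "x \<in> P" "y \<in> P" "x \<noteq> y" for x y using P that by (simp add: packs_def)
      have 2: "cosh d \<le> ch (m x) (m y)" if "x \<in> Q" "y \<in> Q" "m x \<noteq> m y" for x y
        using Q that mC by (auto simp: packs_def)
      show "cosh d \<le> ch p q" using pq 1 2 sep ch_sym by (auto simp: ch_sym)
    qed (use fin discP mD in auto)
    show "card (P \<union> m ` Q) = card P + card Q" using fin disj inj by (simp add: card_Un_disjoint card_image)
    have "card (contacts d P) + card (contacts d Q) = card (contacts d P \<union> map_prod m m ` contacts d Q)"
    proof -
      have "inj_on (map_prod m m) (contacts d Q)"
        using map_prod_inj_on[OF inj inj] by (rule inj_on_subset) (auto simp: contacts_def)
      moreover have "contacts d P \<inter> map_prod m m ` contacts d Q = {}" using disj by (auto simp: contacts_def)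
      ultimately show ?thesis using fin finite_contacts by (simp add: card_Un_disjoint card_image)
    qed
    also have "\<dots> \<le> card (contacts d (P \<union> m ` Q))"
      by (rule card_mono[OF finite_contacts]) (use fin mC in \<open>auto simp: contacts_def\<close>)
    finally show "card (contacts d P) + card (contacts d Q) \<le> card (contacts d (P \<union> m ` Q))" .
  qed
qed

lemma packs_exists: assumes "d > 0" shows "\<exists>P. packs d P \<and> card P = n"
proof (induction n)
  case (Suc n)
  then obtain P where P: "packs d P" "card P = n" by blast
  have "packs d {0}" by (simp add: packs_def)
  from packs_merge[OF assms P(1) this] obtain Q where "packs d Q" "card Q = card P + card {0::complex}" by blast
  then show ?case using P(2) by auto
next
  case 0
  have "packs d {}" by (simp add: packs_def)
  then show ?case by (intro exI[of _ "{}"]) simp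
qed

lemma max_contacts_props:
  assumes d: "d > 0"
  shows "packs d P \<Longrightarrow> card (touching_pairs d P) \<le> max_contacts d (card P)"
    "\<exists>P. packs d P \<and> card P = n \<and> card (touching_pairs d P) = max_contacts d n"
proof -
  define S where "S n = {card (touching_pairs d P) | P. finite P \<and> card P = n \<and> hyp_packing d P}" for n
  have S: "S n = {card (touching_pairs d P) | P. packs d P \<and> card P = n}" for n
    unfolding S_def packs_iff[OF d] by blast
  have le: "card (touching_pairs d P) \<le> n * n" if "packs d P" "card P = n" for P n
  proof -
    have "finite P" using that by (simp add: packs_def)
    then have "card (contacts d P) \<le> card (P \<times> P)" by (intro card_mono) (auto simp: contacts_def)
    then show ?thesis using card_contacts[OF d that(1)] that(2) by (simp add: card_cartesian_product)
  qed
  have fin: "finite (S n)" for n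
  proof (rule finite_subset)
    show "S n \<subseteq> {..n * n}" unfolding S using le by blast
  qed simp
  have ne: "S n \<noteq> {}" for n unfolding S using packs_exists[OF d, of n] by blast
  show "card (touching_pairs d P) \<le> max_contacts d (card P)" if "packs d P"
    unfolding max_contacts_def S_def[symmetric] by (rule Max_ge[OF fin]) (use that S in blast)
  have "max_contacts d n \<in> S n" unfolding max_contacts_def S_def[symmetric] by (rule Max_in[OF fin ne])
  then show "\<exists>P. packs d P \<and> card P = n \<and> card (touching_pairs d P) = max_contacts d n" unfolding S by (elim CollectE exE conjE) metis
qed

lemma contact_limit_props:
  assumes d: "d > 0"
  shows "(\<And>P. packs d P \<Longrightarrow> P \<noteq> {} \<Longrightarrow> real (card (contacts d P)) / 2 \<le> \<gamma> * (real (card P) - 1)) \<Longrightarrow> 0 \<le> \<gamma> \<Longrightarrow>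
      contact_limit d \<le> \<gamma>"
    "packs d P \<Longrightarrow> P \<noteq> {} \<Longrightarrow> real (card (contacts d P)) / 2 / real (card P) \<le> contact_limit d"
proof -
  define f where "f n = real (max_contacts d n)" for n
  have bound: "f n \<le> \<gamma> * real n"
    if b: "\<And>P. packs d P \<Longrightarrow> P \<noteq> {} \<Longrightarrow> real (card (contacts d P)) / 2 \<le> \<gamma> * (real (card P) - 1)" and g: "0 \<le> \<gamma>" for \<gamma> n
  proof -
    obtain P where P: "packs d P" "card P = n" "card (touching_pairs d P) = max_contacts d n"
      using max_contacts_props(2)[OF d] by blast
    have e: "f n = real (card (contacts d P)) / 2" using card_contacts[OF d P(1)] P(3) by (simp add: f_def)
    show ?thesis
    proof (cases "P = {}")
      case True then show ?thesis using g P(2) e by (simp add: contacts_def)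
    next
      case False
      have "f n \<le> \<gamma> * (real n - 1)" unfolding e using b[OF P(1) False] P(2) by simp
      then show ?thesis using g by (simp add: algebra_simps)
    qed
  qed
  have g1: "0 \<le> gamma1 d"
    using quadratic_root_bounds(1)[OF pi_over_alpha[OF d] _ _ gamma1_root] by simp
  have super: "f m + f n \<le> f (m + n)" for m n
  proof -
    obtain P Q where PQ: "packs d P" "card P = m" "card (touching_pairs d P) = max_contacts d m"
        "packs d Q" "card Q = n" "card (touching_pairs d Q) = max_contacts d n"
      using max_contacts_props(2)[OF d] by metis
    obtain R where R: "packs d R" "card R = m + n" "card (contacts d R) \<ge> card (contacts d P) + card (contacts d Q)"
      using packs_merge[OF d PQ(1,4)] PQ(2,5) by metis
    have "card (touching_pairs d R) \<ge> max_contacts d m + max_contacts d n"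
      using R card_contacts[OF d] PQ by simp
    then show ?thesis using max_contacts_props(1)[OF d R(1)] R(2) by (simp add: f_def)
  qed
  obtain L where L: "(\<lambda>n. f n / real n) \<longlonglongrightarrow> L" "\<And>n. n > 0 \<Longrightarrow> f n / real n \<le> L"
    using superadditive_limit[OF super _ bound[OF finite_packing_bounds(1)[OF d] g1]] by (auto simp: f_def)
  have c: "contact_limit d = L" using limI[OF L(1)] by (simp add: contact_limit_def f_def)
  show "contact_limit d \<le> \<gamma>"
    if b: "\<And>P. packs d P \<Longrightarrow> P \<noteq> {} \<Longrightarrow> real (card (contacts d P)) / 2 \<le> \<gamma> * (real (card P) - 1)" and g: "0 \<le> \<gamma>"
    unfolding c
  proof (rule LIMSEQ_le_const2[OF L(1)])
    show "\<exists>N. \<forall>n\<ge>N. f n / real n \<le> \<gamma>"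
      using bound[OF b g] by (intro exI[of _ 1]) (auto simp: divide_le_eq)
  qed
  show "real (card (contacts d P)) / 2 / real (card P) \<le> contact_limit d" if P: "packs d P" "P \<noteq> {}"
  proof -
    have n: "card P > 0" using P by (simp add: card_gt_0_iff packs_def)
    have "real (card (contacts d P)) / 2 \<le> f (card P)"
      using max_contacts_props(1)[OF d P(1)] card_contacts[OF d P(1)] by (simp add: f_def)
    then have "real (card (contacts d P)) / 2 / real (card P) \<le> f (card P) / real (card P)" by (intro divide_right_mono) auto
    then show ?thesis using L(2)[OF n] c by simp
  qed
qed

section \<open>The lower bound\<close>

subsection \<open>Reflections in the hyperboloid model\<close>

text \<open>The Lorentz form. Points of the plane have square 1 and positive first coordinate; a
  line is given by a normal N of square -1, and \<open>bil N p\<close> is then sinh of the signed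
  distance of p from it.\<close>

definition bil :: "real \<times> complex \<Rightarrow> real \<times> complex \<Rightarrow> real" where
  "bil p q = fst p * fst q - inner (snd p) (snd q)"

definition to_disc :: "real \<times> complex \<Rightarrow> complex" where
  "to_disc p = snd p /\<^sub>R (1 + fst p)"

definition reflect :: "real \<times> complex \<Rightarrow> real \<times> complex \<Rightarrow> real \<times> complex" where
  "reflect N p = p + (2 * bil N p) *\<^sub>R N"

lemma bil_sym: "bil p q = bil q p"
  by (simp add: bil_def inner_commute mult.commute)

lemma bil_linear: "bil p (q + r) = bil p q + bil p r" "bil p (c *\<^sub>R q) = c * bil p q"
  "bil (q + r) p = bil q p + bil r p" "bil (c *\<^sub>R q) p = c * bil q p"
  by (simp_all add: bil_def algebra_simps inner_simps)

lemma bil_reflect: "bil q (reflect N p) = bil q p + 2 * bil N p * bil q N"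
  by (simp add: reflect_def bil_linear)

lemma bil_reflect_reflect: assumes "bil N N = -1" shows "bil (reflect N p) (reflect N q) = bil p q"
proof -
  have "bil (reflect N p) (reflect N q) = bil p (reflect N q) + 2 * bil N p * bil N (reflect N q)"
    by (simp add: reflect_def[of N p] bil_linear)
  also have "\<dots> = bil p q + 2 * bil N q * bil p N + 2 * bil N p * (bil N q + 2 * bil N q * bil N N)"
    by (simp add: bil_reflect)
  finally show ?thesis using assms by (simp add: bil_sym[of p N] algebra_simps)
qed

lemma to_disc:
  assumes "fst p > 0" "bil p p = 1" "fst q > 0" "bil q q = 1"
  shows "cmod (to_disc p) < 1" "ch (to_disc p) (to_disc q) = bil p q"
proof -
  define t z s w where "t = fst p" and "z = snd p" and "s = fst q" and "w = snd q"
  have pos: "1 + t > 0" "1 + s > 0" using assms by (auto simp: t_def s_def)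
  have zw: "inner z z = t\<^sup>2 - 1" "inner w w = s\<^sup>2 - 1"
    using assms by (auto simp: bil_def t_def s_def z_def w_def power2_eq_square)
  have n: "1 - (cmod (x /\<^sub>R (1 + r)))\<^sup>2 = 2 / (1 + r)" if "inner x x = r\<^sup>2 - 1" "1 + r > 0" for x :: complex and r
  proof -
    have "(cmod (x /\<^sub>R (1 + r)))\<^sup>2 = inner x x / (1 + r)\<^sup>2"
      by (simp add: power_mult_distrib power_inverse divide_inverse mult.commute power2_norm_eq_inner)
    also have "inner x x = (r - 1) * (1 + r)" unfolding that(1) by (simp add: power2_eq_square algebra_simps)
    also have "(r - 1) * (1 + r) / (1 + r)\<^sup>2 = (r - 1) / (1 + r)" using that(2) by (simp add: power2_eq_square)
    finally have "(cmod (x /\<^sub>R (1 + r)))\<^sup>2 = (r - 1) / (1 + r)" .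
    then show ?thesis using that(2) by (simp add: field_simps)
  qed
  note n1 = n[OF zw(1) pos(1)] and n2 = n[OF zw(2) pos(2)]
  have "1 - (cmod (to_disc p))\<^sup>2 > 0" unfolding to_disc_def t_def[symmetric] z_def[symmetric] n1 using pos by simp
  then show "cmod (to_disc p) < 1" by (metis diff_gt_0_iff_gt norm_ge_zero power2_less_imp_less power_one zero_le_one)
  have "(cmod (z /\<^sub>R a - w /\<^sub>R b))\<^sup>2 * (a * b) = inner z z * b / a + inner w w * a / b - 2 * inner z w"
    if "a > 0" "b > 0" for a b
    unfolding power2_norm_eq_inner using that
    by (simp add: inner_diff_left inner_diff_right inner_commute[of w z] field_simps)
  note this[OF pos]
  also have "inner z z * (1 + s) / (1 + t) = (t - 1) * (1 + s)" unfolding zw using pos by (simp add: field_simps power2_eq_square)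
  also have "inner w w * (1 + t) / (1 + s) = (s - 1) * (1 + t)" unfolding zw using pos by (simp add: field_simps power2_eq_square)
  finally have e: "(cmod (z /\<^sub>R (1 + t) - w /\<^sub>R (1 + s)))\<^sup>2 * ((1 + t) * (1 + s)) = 2 * (t * s - 1 - inner z w)"
    by (simp add: algebra_simps)
  have "ch (to_disc p) (to_disc q) = 1 + 2 * (cmod (z /\<^sub>R (1 + t) - w /\<^sub>R (1 + s)))\<^sup>2 / (2 / (1 + t) * (2 / (1 + s)))"
    unfolding ch_def to_disc_def t_def[symmetric] z_def[symmetric] s_def[symmetric] w_def[symmetric] n1 n2 ..
  also have "\<dots> = 1 + (cmod (z /\<^sub>R (1 + t) - w /\<^sub>R (1 + s)))\<^sup>2 * ((1 + t) * (1 + s)) / 2" by simp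
  also have "\<dots> = t * s - inner z w" unfolding e by (simp add: field_simps)
  finally show "ch (to_disc p) (to_disc q) = bil p q" by (simp add: bil_def t_def s_def z_def w_def)
qed

text \<open>The product of p with its mirror image is 1 + 2 \<open>(bil N p)\<close>^2, hence
  positive, whereas by Cauchy-Schwarz points of opposite sheets have a nonpositive product.\<close>

lemma reflect_sheet:
  assumes N: "bil N N = -1" and p: "fst p > 0" "bil p p = 1" shows "fst (reflect N p) > 0"
proof (rule ccontr)
  define q where "q = reflect N p"
  assume "\<not> ?thesis"
  then have neg: "fst q \<le> 0" by (simp add: q_def)
  have q1: "bil q q = 1" using bil_reflect_reflect[OF N] p by (simp add: q_def)
  have "bil p q = 1 + 2 * (bil N p)\<^sup>2" using p by (simp add: q_def bil_reflect bil_sym[of p N] power2_eq_square)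
  then have pos: "bil p q > 0" by (simp add: add_pos_nonneg)
  have sq: "(cmod (snd p))\<^sup>2 = (fst p)\<^sup>2 - 1" "(cmod (snd q))\<^sup>2 = (fst q)\<^sup>2 - 1"
    unfolding power2_norm_eq_inner using p(2) q1 by (auto simp: bil_def power2_eq_square)
  have "cmod (snd p) \<le> fst p" by (rule power2_le_imp_le) (use sq(1) p(1) in auto)
  moreover have "cmod (snd q) \<le> - fst q" by (rule power2_le_imp_le) (use sq(2) neg in auto)
  ultimately have "cmod (snd p) * cmod (snd q) \<le> fst p * (- fst q)" using p(1) by (intro mult_mono) auto
  then have "bil p q \<le> 0" using Cauchy_Schwarz_ineq2[of "snd p" "snd q"] by (simp add: bil_def)
  then show False using pos by simp
qed

definition config :: "real \<Rightarrow> (real \<times> complex) set \<Rightarrow> bool" where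
  "config d L \<longleftrightarrow> finite L \<and> (\<forall>p\<in>L. fst p > 0 \<and> bil p p = 1) \<and> (\<forall>p\<in>L. \<forall>q\<in>L. p \<noteq> q \<longrightarrow> cosh d \<le> bil p q)"

definition touching :: "real \<Rightarrow> (real \<times> complex) set \<Rightarrow> ((real \<times> complex) \<times> (real \<times> complex)) set" where
  "touching d L = {(p, q). p \<in> L \<and> q \<in> L \<and> bil p q = cosh d}"

text \<open>The packing lies on one side of the line with unit normal \<open>N\<close>: it contains exactly two
  centres on the line, and the circles of the others do not cross it.\<close>

definition wall :: "real \<Rightarrow> real \<times> complex \<Rightarrow> (real \<times> complex) set \<Rightarrow> bool" where
  "wall d N L \<longleftrightarrow> bil N N = -1 \<and> (\<forall>p\<in>L. bil N p = 0 \<or> sinh (d / 2) \<le> bil N p) \<and> card {p \<in> L. bil N p = 0} = 2"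

lemma finite_touching: "finite L \<Longrightarrow> finite (touching d L)"
  by (rule finite_subset[of _ "L \<times> L"]) (auto simp: touching_def)

lemma config_packs:
  assumes d: "d > 0" and L: "config d L"
  shows "packs d (to_disc ` L)" "card (to_disc ` L) = card L" "card (contacts d (to_disc ` L)) = card (touching d L)"
proof -
  have h: "fst p > 0" "bil p p = 1" if "p \<in> L" for p using L that by (auto simp: config_def)
  have c: "ch (to_disc p) (to_disc q) = bil p q" if "p \<in> L" "q \<in> L" for p q using to_disc(2)[OF h(1,2) h(1,2)] that by blast
  have inj: "inj_on to_disc L"
  proof (rule inj_onI, rule ccontr)
    fix p q assume pq: "p \<in> L" "q \<in> L" "to_disc p = to_disc q" "p \<noteq> q"
    then have "bil p q = bil p p" using c[of p q] c[of p p] by simp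
    then show False using pq L h[of p] cosh_gt_1[OF d] by (force simp: config_def)
  qed
  show "packs d (to_disc ` L)"
    unfolding packs_def
  proof (intro conjI ballI impI)
    show "finite (to_disc ` L)" using L by (simp add: config_def)
    show "cmod p < 1" if "p \<in> to_disc ` L" for p using that to_disc(1)[OF h(1,2) h(1,2)] by blast
    fix p q assume "p \<in> to_disc ` L" "q \<in> to_disc ` L" "p \<noteq> q"
    then obtain x y where "p = to_disc x" "q = to_disc y" "x \<in> L" "y \<in> L" "x \<noteq> y" by blast
    then show "cosh d \<le> ch p q" using L c[of x y] by (simp add: config_def)
  qed
  show "card (to_disc ` L) = card L" using inj by (rule card_image)
  have "contacts d (to_disc ` L) = map_prod to_disc to_disc ` touching d L"
  proof (intro equalityI subsetI)
    fix \<delta> assume "\<delta> \<in> contacts d (to_disc ` L)"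
    then obtain x y where "\<delta> = (to_disc x, to_disc y)" "x \<in> L" "y \<in> L" "ch (to_disc x) (to_disc y) = cosh d"
      by (auto simp: contacts_def)
    then show "\<delta> \<in> map_prod to_disc to_disc ` touching d L"
      using c by (intro image_eqI[of _ _ "(x, y)"]) (auto simp: touching_def)
  qed (use c in \<open>auto simp: contacts_def touching_def\<close>)
  moreover have "inj_on (map_prod to_disc to_disc) (touching d L)"
    using map_prod_inj_on[OF inj inj] by (rule inj_on_subset) (auto simp: touching_def)
  ultimately show "card (contacts d (to_disc ` L)) = card (touching d L)" by (simp add: card_image)
qed

lemma reflect_fix: "bil N p = 0 \<Longrightarrow> reflect N p = p"
  by (simp add: reflect_def)

lemma reflect_reflect: assumes "bil N N = -1" shows "reflect N (reflect N p) = p"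
proof -
  have "bil N (reflect N p) = - bil N p" using assms by (simp add: bil_reflect)
  then show ?thesis by (simp add: reflect_def[of N "reflect N p"]) (simp add: reflect_def)
qed

lemma cosh_sinh_half: "cosh d = 1 + 2 * (sinh (d / 2))\<^sup>2" for d :: real
  using cosh_double[of "d / 2"] by (simp add: cosh_square_eq)

text \<open>Since \<open>bil p (reflect N q)\<close> is \<open>bil p q\<close> plus twice the
  product of the heights over the line, mirroring one of two points on the same side never brings
  them closer. A point off the line is at distance at least d from its own image because of the
  bound sinh (d / 2). Only the two points on the line, and a contact between them, are
  shared.\<close>

lemma reflect_config:
  assumes d: "d > 0" and L: "config d L" and W: "wall d N L"
  shows "config d (L \<union> reflect N ` L)" "card (L \<union> reflect N ` L) + 2 = 2 * card L"
    "2 * card (touching d L) \<le> card (touching d (L \<union> reflect N ` L)) + card (touching d {p \<in> L. bil N p = 0})"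
proof -
  have N: "bil N N = -1" and g: "\<And>p. p \<in> L \<Longrightarrow> bil N p = 0 \<or> sinh (d / 2) \<le> bil N p"
    and Z: "card {p \<in> L. bil N p = 0} = 2" using W by (auto simp: wall_def)
  have fin: "finite L" and h: "\<And>p. p \<in> L \<Longrightarrow> fst p > 0 \<and> bil p p = 1"
    and sep: "\<And>p q. p \<in> L \<Longrightarrow> q \<in> L \<Longrightarrow> p \<noteq> q \<Longrightarrow> cosh d \<le> bil p q" using L by (auto simp: config_def)
  have s: "sinh (d / 2) > 0" using d by simp
  have g0: "0 \<le> bil N p" if "p \<in> L" for p using g[OF that] s by (elim disjE) linarith+
  have e: "bil p (reflect N q) = bil p q + 2 * (bil N p * bil N q)" for p q
    by (simp add: bil_reflect bil_sym[of p N])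
  have cross: "cosh d \<le> bil p (reflect N q)" if "p \<in> L" "q \<in> L" "p \<noteq> reflect N q" for p q
  proof (cases "p = q")
    case True
    then have "bil N p \<noteq> 0" using that(3) reflect_fix[of N p] by auto
    then have "sinh (d / 2) \<le> bil N p" using g[OF that(1)] by simp
    then have "(sinh (d / 2))\<^sup>2 \<le> (bil N p)\<^sup>2" using s by (intro power_mono) auto
    then show ?thesis using h[OF that(1)] True cosh_sinh_half[of d] by (simp add: e power2_eq_square)
  next
    case False
    then have "cosh d \<le> bil p q" "0 \<le> bil N p * bil N q" using sep g0 that by auto
    then show ?thesis by (simp add: e)
  qed
  show cfg: "config d (L \<union> reflect N ` L)"
    unfolding config_def
  proof (intro conjI ballI impI)
    show "finite (L \<union> reflect N ` L)" using fin by simp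
    show "fst p > 0" if "p \<in> L \<union> reflect N ` L" for p using that h reflect_sheet[OF N] unfolding Un_iff image_iff by metis
    show "bil p p = 1" if "p \<in> L \<union> reflect N ` L" for p using that h bil_reflect_reflect[OF N] unfolding Un_iff image_iff by metis
    fix p q assume pq: "p \<in> L \<union> reflect N ` L" "q \<in> L \<union> reflect N ` L" "p \<noteq> q"
    consider "p \<in> L" "q \<in> L" | q' where "p \<in> L" "q = reflect N q'" "q' \<in> L" | p' where "p = reflect N p'" "p' \<in> L" "q \<in> L"
      | p' q' where "p = reflect N p'" "p' \<in> L" "q = reflect N q'" "q' \<in> L" using pq by blast
    then show "cosh d \<le> bil p q"
    proof cases
      case 1 then show ?thesis using sep pq by blast
    next
      case 2 then show ?thesis using cross pq(3) by blast
    next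
      case 3 then show ?thesis using cross[of q p'] pq(3) by (metis bil_sym)
    next
      case 4
      then have "p' \<noteq> q'" using pq(3) by auto
      then show ?thesis using 4 sep by (simp add: bil_reflect_reflect[OF N])
    qed
  qed
  have inj: "inj_on (reflect N) X" for X by (metis inj_on_inverseI reflect_reflect[OF N])
  have zero: "L \<inter> reflect N ` L = {p \<in> L. bil N p = 0}"
  proof (intro equalityI subsetI)
    fix p assume "p \<in> L \<inter> reflect N ` L"
    then obtain q where q: "p \<in> L" "q \<in> L" "p = reflect N q" by auto
    have 1: "bil p q + 2 * (bil N p * bil N q) = 1" using h[OF q(1)] e[of p q] q(3) by simp
    have "p = q"
    proof (rule ccontr)
      assume "p \<noteq> q"
      then have "cosh d \<le> bil p q" "0 \<le> bil N p * bil N q" using sep g0 q(1,2) by auto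
      then show False using 1 cosh_gt_1[OF d] by simp
    qed
    then show "p \<in> {p \<in> L. bil N p = 0}" using 1 h[OF q(1)] q(1) by simp
  next
    fix p assume "p \<in> {p \<in> L. bil N p = 0}"
    then show "p \<in> L \<inter> reflect N ` L" using reflect_fix[of N p] by (auto simp: image_iff intro: bexI[of _ p])
  qed
  have "card (L \<union> reflect N ` L) + card (L \<inter> reflect N ` L) = card L + card (reflect N ` L)"
    using card_Un_Int[of L "reflect N ` L"] fin by simp
  then show "card (L \<union> reflect N ` L) + 2 = 2 * card L" unfolding zero Z by (simp add: card_image[OF inj])
  define T where "T = map_prod (reflect N) (reflect N) ` touching d L"
  have finT: "finite (touching d L)" "finite T" using finite_touching fin by (auto simp: T_def)
  have cT: "card T = card (touching d L)"
    unfolding T_def by (rule card_image, rule inj_on_subset[OF map_prod_inj_on[OF inj inj]]) auto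
  have "touching d L \<union> T \<subseteq> touching d (L \<union> reflect N ` L)"
    by (auto simp: T_def touching_def bil_reflect_reflect[OF N])
  then have "card (touching d L \<union> T) \<le> card (touching d (L \<union> reflect N ` L))"
    using fin finite_touching by (intro card_mono) auto
  moreover have "touching d L \<inter> T \<subseteq> touching d {p \<in> L. bil N p = 0}"
    unfolding zero[symmetric] by (auto simp: T_def touching_def)
  then have "card (touching d L \<inter> T) \<le> card (touching d {p \<in> L. bil N p = 0})"
    using fin finite_touching by (intro card_mono) auto
  moreover have "card (touching d L \<union> T) + card (touching d L \<inter> T) = 2 * card (touching d L)"
    using card_Un_Int[OF finT] cT by simp
  ultimately show "2 * card (touching d L) \<le> card (touching d (L \<union> reflect N ` L)) + card (touching d {p \<in> L. bil N p = 0})"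
    by linarith
qed

text \<open>A product of at least 1 means that the lines do not meet and that both normals point
  into the strip between them. The mirror image of the second line then closes the doubled strip, as
  2 x^2 - 1 \<ge> 1 for x \<ge> 1.\<close>

lemma reflect_wall:
  assumes d: "d > 0" and L: "config d L" and W: "wall d N L" "wall d M L" and k: "bil N M \<ge> 1"
  shows "wall d M (L \<union> reflect N ` L)" "wall d (reflect N M) (L \<union> reflect N ` L)" "bil M (reflect N M) \<ge> 1"
proof -
  have N: "bil N N = -1" and g: "\<And>p. p \<in> L \<Longrightarrow> bil N p = 0 \<or> sinh (d / 2) \<le> bil N p" using W by (auto simp: wall_def)
  have M: "bil M M = -1" and gM: "\<And>p. p \<in> L \<Longrightarrow> bil M p = 0 \<or> sinh (d / 2) \<le> bil M p"
    and Z: "card {p \<in> L. bil M p = 0} = 2" using W by (auto simp: wall_def)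
  have s: "sinh (d / 2) > 0" using d by simp
  have far: "sinh (d / 2) \<le> bil M (reflect N p)" if p: "p \<in> L" "bil N p \<noteq> 0" for p
  proof -
    have n: "sinh (d / 2) \<le> bil N p" using g[OF p(1)] p(2) by simp
    have "0 \<le> bil M p" using gM[OF p(1)] s by (elim disjE) linarith+
    moreover have "0 \<le> bil N p" using n s by linarith
    then have "sinh (d / 2) * 1 \<le> bil N p * bil N M" using n k by (intro mult_mono) auto
    ultimately show ?thesis using s unfolding bil_reflect bil_sym[of M N] by linarith
  qed
  have new: "p \<in> L \<or> (\<exists>q\<in>L. p = reflect N q \<and> bil N q \<noteq> 0)" if "p \<in> L \<union> reflect N ` L" for p
    using that reflect_fix by fastforce
  show W': "wall d M (L \<union> reflect N ` L)"
    unfolding wall_def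
  proof (intro conjI ballI)
    show "bil M p = 0 \<or> sinh (d / 2) \<le> bil M p" if "p \<in> L \<union> reflect N ` L" for p using new[OF that] gM far by blast
    have "{p \<in> L \<union> reflect N ` L. bil M p = 0} = {p \<in> L. bil M p = 0}"
    proof (intro equalityI subsetI)
      fix p assume p: "p \<in> {p \<in> L \<union> reflect N ` L. bil M p = 0}"
      then have "\<not> (\<exists>q\<in>L. p = reflect N q \<and> bil N q \<noteq> 0)" using far s by fastforce
      then show "p \<in> {p \<in> L. bil M p = 0}" using p new by blast
    qed auto
    then show "card {p \<in> L \<union> reflect N ` L. bil M p = 0} = 2" using Z by simp
  qed (rule M)
  have img: "reflect N ` (L \<union> reflect N ` L) = L \<union> reflect N ` L" by (auto simp: image_Un image_image reflect_reflect[OF N])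
  have e: "bil (reflect N M) p = bil M (reflect N p)" for p using bil_reflect_reflect[OF N, of M "reflect N p"] by (simp add: reflect_reflect[OF N])
  show "wall d (reflect N M) (L \<union> reflect N ` L)"
    unfolding wall_def
  proof (intro conjI ballI)
    show "bil (reflect N M) (reflect N M) = -1" using M by (simp add: bil_reflect_reflect[OF N])
    show "bil (reflect N M) p = 0 \<or> sinh (d / 2) \<le> bil (reflect N M) p" if "p \<in> L \<union> reflect N ` L" for p
    proof -
      have "reflect N p \<in> L \<union> reflect N ` L" using img that by blast
      then show ?thesis using W' unfolding wall_def e by blast
    qed
    have "{p \<in> L \<union> reflect N ` L. bil (reflect N M) p = 0} = reflect N ` {p \<in> L \<union> reflect N ` L. bil M p = 0}"
    proof (intro equalityI subsetI)
      fix p assume p: "p \<in> {p \<in> L \<union> reflect N ` L. bil (reflect N M) p = 0}"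
      then have "reflect N p \<in> {p \<in> L \<union> reflect N ` L. bil M p = 0}" using img e by auto
      then show "p \<in> reflect N ` {p \<in> L \<union> reflect N ` L. bil M p = 0}" by (rule rev_image_eqI) (simp add: reflect_reflect[OF N])
    next
      fix p assume "p \<in> reflect N ` {p \<in> L \<union> reflect N ` L. bil M p = 0}"
      then show "p \<in> {p \<in> L \<union> reflect N ` L. bil (reflect N M) p = 0}" using img by (auto simp: e reflect_reflect[OF N])
    qed
    moreover have "inj_on (reflect N) X" for X by (metis inj_on_inverseI reflect_reflect[OF N])
    ultimately show "card {p \<in> L \<union> reflect N ` L. bil (reflect N M) p = 0} = 2"
      using W' by (simp add: card_image wall_def)
  qed
  have "1 \<le> bil N M * bil N M" using mult_mono[OF k k] k by simp
  then show "bil M (reflect N M) \<ge> 1" using M by (simp add: bil_reflect bil_sym[of M N])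
qed

text \<open>Reflecting alternately in the two lines doubles \<open>n - 2\<close> and, because only one contact can
  lie on a line, at least doubles the number of contacts minus one.\<close>

lemma strip_bound:
  assumes d: "d > 0" and L: "config d L" "wall d M L" "wall d N L" "bil M N \<ge> 1"
    and n: "card L = 2 + k" "k > 0" and e: "2 * (1 + c) \<le> card (touching d L)"
  shows "real c / real k \<le> contact_limit d"
proof -
  have strips: "\<exists>L M N. config d L \<and> wall d M L \<and> wall d N L \<and> bil M N \<ge> 1
    \<and> card L = 2 + 2 ^ i * k \<and> 2 * (1 + 2 ^ i * c) \<le> card (touching d L)" for i
  proof (induction i)
    case 0
    then show ?case using L n e by (intro exI[of _ L] exI[of _ M] exI[of _ N]) auto
  next
    case (Suc i)
    then obtain L M N where S: "config d L" "wall d M L" "wall d N L" "bil M N \<ge> 1"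
      "card L = 2 + 2 ^ i * k" "2 * (1 + 2 ^ i * c) \<le> card (touching d L)" by blast
    define L' where "L' = L \<union> reflect M ` L"
    note R = reflect_config[OF d S(1,2), folded L'_def] and W = reflect_wall[OF d S(1,2,3,4), folded L'_def]
    define Z where "Z = {p \<in> L. bil M p = 0}"
    have "card (touching d Z) \<le> 2"
    proof -
      have "card Z = 2" using S(2) by (simp add: wall_def Z_def)
      then obtain x y where xy: "Z = {x, y}" by (auto simp: card_2_iff)
      have "touching d Z \<subseteq> {(x, y), (y, x)}"
      proof -
        have "bil p p \<noteq> cosh d" if "p \<in> Z" for p using that S(1) cosh_gt_1[OF d] by (auto simp: Z_def config_def)
        then show ?thesis unfolding touching_def xy by auto
      qed
      then have "card (touching d Z) \<le> card {(x, y), (y, x)}" by (intro card_mono) auto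
      also have "\<dots> \<le> 2" using card_insert_le_m1[of 2 "{(y, x)}" "(x, y)"] by simp
      finally show ?thesis .
    qed
    \<comment> \<open>Ordered pairs are counted: doubling 2 (1 + C) and losing at most 2 leaves 2 (1
      + 2 C).\<close>
    then have "2 * (1 + 2 ^ Suc i * c) \<le> card (touching d L')" using R(3) S(6) unfolding Z_def by simp
    moreover have "card L' = 2 + 2 ^ Suc i * k" using R(2) S(5) by simp
    ultimately show ?case using R(1) W by blast
  qed
  define l where "l = contact_limit d"
  have b: "1 + 2 ^ i * real c \<le> l * (2 + 2 ^ i * real k)" for i
  proof -
    obtain L where S: "config d L" "card L = 2 + 2 ^ i * k" "2 * (1 + 2 ^ i * c) \<le> card (touching d L)"
      using strips by blast
    note P = config_packs[OF d S(1)]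
    have "L \<noteq> {}" using S(2) by auto
    then have "real (card (touching d L)) / 2 / real (card L) \<le> l"
      using contact_limit_props(2)[OF d P(1)] by (simp add: P l_def)
    moreover have "x \<le> l * y" if "x / y \<le> l" "y > 0" for x y using that by (simp add: pos_divide_le_eq)
    moreover have "real (card L) > 0" unfolding S(2) by (simp add: add_pos_nonneg)
    ultimately have "real (card (touching d L)) / 2 \<le> l * real (card L)" by blast
    moreover have "real (2 * (1 + 2 ^ i * c)) \<le> real (card (touching d L))" using S(3) by (rule of_nat_mono)
    moreover have "real (card L) = 2 + 2 ^ i * real k" unfolding S(2) by simp
    moreover have "real (2 * (1 + 2 ^ i * c)) = 2 * (1 + 2 ^ i * real c)" by simp
    ultimately show ?thesis by simp
  qed
  have "real c \<le> l * real k"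
  proof (rule ccontr)
    assume "\<not> ?thesis"
    then have D: "real c - l * real k > 0" by simp
    obtain i where "(2 * l) / (real c - l * real k) < 2 ^ i" using real_arch_pow[of 2] by auto
    then have "2 * l < 2 ^ i * (real c - l * real k)" using D by (simp add: pos_divide_less_eq)
    then show False using b[of i] by (simp add: algebra_simps)
  qed
  then show ?thesis using n(2) by (simp add: pos_divide_le_eq l_def)
qed

subsection \<open>The fan\<close>

definition rim :: "real \<Rightarrow> real \<Rightarrow> real \<times> complex" where
  "rim d \<theta> = (cosh d, sinh d *\<^sub>R cis \<theta>)"

text \<open>Unit normal of the line perpendicular to the direction \<open>\<phi>\<close> at distance \<open>h\<close> from the
  centre. It meets the circle of radius \<open>d\<close> at the directions \<open>\<phi> \<plusminus> \<beta>\<close> with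
  \<open>tanh h = tanh d cos \<beta>\<close>.\<close>

definition chord :: "real \<Rightarrow> real \<Rightarrow> real \<times> complex" where
  "chord h \<phi> = (sinh h, cosh h *\<^sub>R cis \<phi>)"

lemma inner_cis: "inner (cis a) (cis b) = cos (a - b)"
  by (simp add: inner_complex_def cos_diff)

lemma bil_rim: "bil (rim d a) (rim d b) = (cosh d)\<^sup>2 - (sinh d)\<^sup>2 * cos (a - b)"
  by (simp add: bil_def rim_def inner_cis power2_eq_square)

lemma bil_chord: "bil (chord h a) (chord k b) = sinh h * sinh k - cosh h * cosh k * cos (a - b)"
  by (simp add: bil_def chord_def inner_cis)

lemma bil_rim_contact:
  assumes "d > 0"
  shows "cos (a - b) = cos (alpha d) \<Longrightarrow> bil (rim d a) (rim d b) = cosh d"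
    "cos (a - b) \<le> cos (alpha d) \<Longrightarrow> cosh d \<le> bil (rim d a) (rim d b)"
proof -
  have e: "(cosh d)\<^sup>2 - (sinh d)\<^sup>2 * cos (alpha d) = cosh d"
    using cosh_gt_1[OF assms] unfolding cos_alpha_cosh[OF assms] sinh_square_eq
    by (simp add: field_simps power2_eq_square)
  show "cos (a - b) = cos (alpha d) \<Longrightarrow> bil (rim d a) (rim d b) = cosh d" unfolding bil_rim using e by simp
  assume "cos (a - b) \<le> cos (alpha d)"
  then have "(sinh d)\<^sup>2 * cos (a - b) \<le> (sinh d)\<^sup>2 * cos (alpha d)" by (intro mult_left_mono) auto
  then show "cosh d \<le> bil (rim d a) (rim d b)" unfolding bil_rim using e by linarith
qed

text \<open>As tanh d cos \<alpha> = tanh (d / 2), the condition \<beta> \<le> \<alpha> places the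
  solution of tanh h = tanh d cos \<beta> between d / 2 and d. From d / 2 on, the circle at the
  centre of the fan does not cross the line.\<close>

lemma chord_exists:
  assumes d: "d > 0" and b: "0 \<le> \<beta>" "\<beta> \<le> alpha d"
  obtains h where "d / 2 \<le> h" "\<And>\<phi> \<theta>. bil (chord h \<phi>) (rim d \<theta>) = cosh h * sinh d * (cos \<beta> - cos (\<phi> - \<theta>))"
proof -
  have t: "tanh d > 0" using d by simp
  have "cos (alpha d) \<le> cos \<beta>" using b alpha_bounds[OF d] by (intro cos_monotone_0_pi_le) auto
  then have "tanh d * cos (alpha d) \<le> tanh d * cos \<beta>" using t by (intro mult_left_mono) auto
  then have lo: "tanh (d / 2) \<le> tanh d * cos \<beta>" using t by (simp add: cos_alpha[OF d])
  have hi: "tanh d * cos \<beta> \<le> tanh d" using t by (simp add: mult_left_le)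
  have "continuous_on {d / 2..d} tanh" by (intro continuous_intros) (auto simp: less_imp_neq)
  then obtain h where h: "d / 2 \<le> h" "tanh h = tanh d * cos \<beta>"
    using IVT'[of tanh "d / 2" "tanh d * cos \<beta>" d] lo hi d by auto
  have "sinh h * cosh d = cosh h * sinh d * cos \<beta>" using h(2) by (simp add: tanh_def field_simps)
  then have "bil (chord h \<phi>) (rim d \<theta>) = cosh h * sinh d * (cos \<beta> - cos (\<phi> - \<theta>))" for \<phi> \<theta>
    by (simp add: bil_def chord_def rim_def inner_cis algebra_simps)
  then show thesis using h(1) that by blast
qed

text \<open>At the extreme angle, cos \<beta> - cos (\<beta> + \<alpha>) = 2 sin (\<beta> + \<alpha>
  / 2) sin (\<alpha> / 2). Here sin (\<alpha> / 2) = 1 / (2 cosh (d / 2)) cancels a factor of sinh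
  d, and the rest is at least sinh (d / 2) because h \<ge> d / 2 and \<beta> \<ge> 0.\<close>

lemma chord_far:
  assumes d: "d > 0" and b: "0 \<le> \<beta>" "\<beta> \<le> alpha d" and h: "d / 2 \<le> h" and c: "c \<le> cos (\<beta> + alpha d)"
  shows "sinh (d / 2) \<le> cosh h * sinh d * (cos \<beta> - c)"
proof -
  define a where "a = alpha d / 2"
  have a: "0 < a" "a < pi / 6" using alpha_half_bounds[OF d] by (auto simp: a_def)
  have s: "sin a = 1 / (2 * cosh (d / 2))" using sin_half_alpha[OF d] by (simp add: a_def)
  have p: "sinh (d / 2) > 0" "cosh (d / 2) > 0" using d by auto
  have sd: "sinh d = 2 * sinh (d / 2) * cosh (d / 2)" using sinh_double[of "d / 2"] by simp
  have "cosh (d / 2) \<le> cosh h" using h d cosh_real_nonneg_le_iff[of "d / 2" h] by simp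
  moreover have "sin a \<le> sin (\<beta> + a)" using a b by (intro sin_monotone_2pi_le) (auto simp: a_def)
  ultimately have 1: "cosh (d / 2) * sin a \<le> cosh h * sin (\<beta> + a)"
    using a by (intro mult_mono) (auto simp: sin_ge_zero)
  have "2 * (sin (\<beta> + a) * sin a) = cos \<beta> - cos (\<beta> + alpha d)"
  proof -
    have aa: "\<beta> + a + a = \<beta> + alpha d" by (simp add: a_def)
    show ?thesis unfolding sin_times_sin aa by simp
  qed
  then have "2 * (sin (\<beta> + a) * sin a) \<le> cos \<beta> - c" using c by simp
  then have "cosh h * sinh d * (2 * (sin (\<beta> + a) * sin a)) \<le> cosh h * sinh d * (cos \<beta> - c)"
    using d by (intro mult_left_mono) auto
  moreover have "cosh h * sinh d * (2 * (sin (\<beta> + a) * sin a)) = 2 * sinh (d / 2) * (cosh h * sin (\<beta> + a))"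
    using p unfolding sd s by simp
  moreover have "2 * sinh (d / 2) * (cosh (d / 2) * sin a) \<le> 2 * sinh (d / 2) * (cosh h * sin (\<beta> + a))"
    using 1 p by (intro mult_left_mono) auto
  moreover have "2 * sinh (d / 2) * (cosh (d / 2) * sin a) = sinh (d / 2)" using p unfolding s by simp
  ultimately show ?thesis by linarith
qed

text \<open>Index 0 is the centre; the rim starts at index 1 with angle 0, so j triangles use the
  indices up to j + 1.\<close>

definition fan_point :: "real \<Rightarrow> nat \<Rightarrow> real \<times> complex" where
  "fan_point d k = (if k = 0 then (1, 0) else rim d ((real k - 1) * alpha d))"

lemma cos_le_cos_abs:
  assumes "0 \<le> b" "b \<le> \<bar>x\<bar>" "\<bar>x\<bar> \<le> pi" shows "cos x \<le> cos (b :: real)"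
  using cos_monotone_0_pi_le[of b "\<bar>x\<bar>"] assms by simp

text \<open>A fan of \<open>j\<close> equilateral triangles leaves an angle between \<open>\<alpha>\<close> and \<open>2 \<alpha>\<close> free.\<close>

context
  fixes d :: real and j :: nat
  assumes d: "d > 0" and j: "j \<ge> 5" and gap: "(real j + 1) * alpha d \<le> 2 * pi" "2 * pi < (real j + 2) * alpha d"
begin

lemma fan_rim_sep:
  assumes "i < k" "k \<le> j" shows "cos (real i * alpha d - real k * alpha d) \<le> cos (alpha d)"
proof -
  have a: "alpha d > 0" "alpha d < pi / 3" using alpha_bounds[OF d] by auto
  define x where "x = real k * alpha d - real i * alpha d"
  have x1: "alpha d \<le> x"
  proof -
    have "1 * alpha d \<le> (real k - real i) * alpha d" using assms a by (intro mult_right_mono) auto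
    then show ?thesis by (simp add: x_def algebra_simps)
  qed
  have x2: "x \<le> 2 * pi - alpha d"
  proof -
    have "(real k - real i) * alpha d \<le> real j * alpha d" using assms a by (intro mult_right_mono) auto
    then show ?thesis using gap by (simp add: x_def algebra_simps)
  qed
  have "cos x \<le> cos (alpha d)"
  proof (cases "x \<le> pi")
    case True then show ?thesis using x1 a by (intro cos_le_cos_abs) auto
  next
    case False
    have "cos x = cos (2 * pi - x)" by simp
    also have "\<dots> \<le> cos (alpha d)" using x2 a False by (intro cos_le_cos_abs) auto
    finally show ?thesis .
  qed
  moreover have "cos (real i * alpha d - real k * alpha d) = cos x" using cos_minus[of x] by (simp add: x_def)
  ultimately show ?thesis by simp
qed

lemma fan_config: "config d (fan_point d ` {..Suc j})" and inj_fan: "inj_on (fan_point d) {..Suc j}"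
proof -
  have h: "fst (fan_point d k) > 0" "bil (fan_point d k) (fan_point d k) = 1" for k
    using cosh_gt_1[OF d] by (auto simp: fan_point_def rim_def bil_def inner_cis cosh_square_eq simp flip: power2_eq_square)
  have lt: "cosh d \<le> bil (fan_point d i) (fan_point d k)" if "i < k" "k \<le> Suc j" for i k
  proof (cases "i = 0")
    case True
    then show ?thesis using that by (simp add: fan_point_def rim_def bil_def)
  next
    case False
    then have "cos (real (i - 1) * alpha d - real (k - 1) * alpha d) \<le> cos (alpha d)"
      using that by (intro fan_rim_sep) auto
    then have "cosh d \<le> bil (rim d (real (i - 1) * alpha d)) (rim d (real (k - 1) * alpha d))"
      by (rule bil_rim_contact(2)[OF d])
    then show ?thesis using False that by (simp add: fan_point_def of_nat_diff)
  qed
  have ne: "cosh d \<le> bil (fan_point d i) (fan_point d k)" if "i \<noteq> k" "i \<le> Suc j" "k \<le> Suc j" for i k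
    using lt[of i k] lt[of k i] that bil_sym by (metis linorder_neqE_nat)
  show "config d (fan_point d ` {..Suc j})"
    unfolding config_def
  proof (intro conjI ballI impI)
    fix p q assume pq: "p \<in> fan_point d ` {..Suc j}" "q \<in> fan_point d ` {..Suc j}" "p \<noteq> q"
    then obtain i k where "p = fan_point d i" "q = fan_point d k" "i \<le> Suc j" "k \<le> Suc j" by auto
    then show "cosh d \<le> bil p q" using ne[of i k] pq(3) by blast
  qed (use h in auto)
  show "inj_on (fan_point d) {..Suc j}"
  proof (rule inj_onI, rule ccontr)
    fix i k assume "i \<in> {..Suc j}" "k \<in> {..Suc j}" "fan_point d i = fan_point d k" "i \<noteq> k"
    then show False using ne[of i k] h(2)[of k] cosh_gt_1[OF d] by simp
  qed
qed

text \<open>As ordered pairs, 2 (j + 1) contacts with the centre and 2 j along the rim. The ends of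
  the gap may touch as well; this contact lies on a wall, is not doubled by reflection and is
  therefore kept apart.\<close>

lemma fan_touching:
  assumes "Z = fan_point d ` {1, Suc j}"
  shows "4 * j + 2 + card (touching d Z) \<le> card (touching d (fan_point d ` {..Suc j}))"
proof -
  define Q where "Q = map_prod (fan_point d) (fan_point d)"
  define I where "I = Pair 0 ` {1..Suc j} \<union> (\<lambda>k. (k, 0)) ` {1..Suc j} \<union> ((\<lambda>k. (k, Suc k)) ` {1..j} \<union> (\<lambda>k. (Suc k, k)) ` {1..j})"
  have "card I = card (Pair 0 ` {1..Suc j} \<union> (\<lambda>k. (k, 0::nat)) ` {1..Suc j}) + card ((\<lambda>k. (k, Suc k)) ` {1..j} \<union> (\<lambda>k. (Suc k, k)) ` {1..j})"
    unfolding I_def by (rule card_Un_disjoint) auto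
  also have "card (Pair 0 ` {1..Suc j} \<union> (\<lambda>k. (k, 0::nat)) ` {1..Suc j}) = Suc j + Suc j"
    by (subst card_Un_disjoint) (auto simp: card_image inj_on_def)
  also have "card ((\<lambda>k. (k, Suc k)) ` {1..j} \<union> (\<lambda>k. (Suc k, k)) ` {1..j}) = j + j"
    by (subst card_Un_disjoint) (auto simp: card_image inj_on_def)
  finally have cI: "card I = 4 * j + 2" by simp
  have injQ: "inj_on Q ({..Suc j} \<times> {..Suc j})" unfolding Q_def using inj_fan by (rule map_prod_inj_on[OF inj_fan])
  have subI: "I \<subseteq> {..Suc j} \<times> {..Suc j}" by (auto simp: I_def)
  define J where "J = {1, Suc j} \<times> {1, Suc j}"
  have subJ: "J \<subseteq> {..Suc j} \<times> {..Suc j}" and IJ: "I \<inter> J = {}" using j by (auto simp: I_def J_def)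
  have tI: "Q ` I \<subseteq> touching d (fan_point d ` {..Suc j})"
  proof -
    have c0: "bil (fan_point d 0) (fan_point d k) = cosh d" "bil (fan_point d k) (fan_point d 0) = cosh d" if "k \<in> {1..Suc j}" for k
      using that by (simp_all add: fan_point_def rim_def bil_def)
    have c1: "bil (fan_point d k) (fan_point d (Suc k)) = cosh d" if "k \<in> {1..j}" for k
    proof -
      have "cos ((real k - 1) * alpha d - real k * alpha d) = cos (alpha d)"
        using cos_minus[of "alpha d"] by (simp add: algebra_simps)
      from bil_rim_contact(1)[OF d this] show ?thesis using that by (simp add: fan_point_def)
    qed
    have c1': "bil (fan_point d (Suc k)) (fan_point d k) = cosh d" if "k \<in> {1..j}" for k
      using c1[OF that] by (subst bil_sym)
    show ?thesis using c0 c1 c1' unfolding I_def Q_def image_Un by (auto simp: touching_def)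
  qed
  have "touching d Z \<subseteq> Q ` J" unfolding assms touching_def Q_def J_def by (auto simp: map_prod_def)
  then have disj: "Q ` I \<inter> touching d Z = {}"
    using inj_on_image_Int[OF injQ subI subJ] IJ by blast
  have "4 * j + 2 + card (touching d Z) = card (Q ` I) + card (touching d Z)"
    using cI card_image[OF inj_on_subset[OF injQ subI]] by simp
  also have "\<dots> = card (Q ` I \<union> touching d Z)"
    using disj finite_subset[OF subI] finite_touching[of Z d] by (intro card_Un_disjoint[symmetric]) (auto simp: assms)
  also have "\<dots> \<le> card (touching d (fan_point d ` {..Suc j}))"
    using tI by (intro card_mono finite_touching) (auto simp: touching_def assms)
  finally show ?thesis .
qed

lemma fan_wall:
  assumes b: "0 \<le> \<beta>" "\<beta> \<le> alpha d" and ik: "i < k" "k \<le> j"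
    and on: "cos (\<phi> - real i * alpha d) = cos \<beta>" "cos (\<phi> - real k * alpha d) = cos \<beta>"
    and off: "\<And>l. l \<le> j \<Longrightarrow> l \<noteq> i \<Longrightarrow> l \<noteq> k \<Longrightarrow> cos (\<phi> - real l * alpha d) \<le> cos (\<beta> + alpha d)"
  obtains h where "d / 2 \<le> h" "wall d (chord h \<phi>) (fan_point d ` {..Suc j})"
    "{p \<in> fan_point d ` {..Suc j}. bil (chord h \<phi>) p = 0} = fan_point d ` {Suc i, Suc k}"
proof -
  obtain h where h: "d / 2 \<le> h" "\<And>\<phi> \<theta>. bil (chord h \<phi>) (rim d \<theta>) = cosh h * sinh d * (cos \<beta> - cos (\<phi> - \<theta>))"
    using chord_exists[OF d b] by blast
  define N where "N = chord h \<phi>"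
  have g0: "bil N (fan_point d 0) = sinh h" by (simp add: N_def chord_def fan_point_def bil_def)
  have gS: "bil N (fan_point d (Suc l)) = cosh h * sinh d * (cos \<beta> - cos (\<phi> - real l * alpha d))" for l
    by (simp add: N_def fan_point_def h(2))
  have s: "sinh (d / 2) > 0" using d by simp
  have zero: "bil N (fan_point d l) = 0" if "l \<in> {Suc i, Suc k}" for l using that gS on by auto
  have far: "sinh (d / 2) \<le> bil N (fan_point d l)" if l: "l \<in> {..Suc j}" "l \<notin> {Suc i, Suc k}" for l
  proof (cases l)
    case 0 then show ?thesis using g0 h(1) by simp
  next
    case (Suc l')
    then show ?thesis using chord_far[OF d b h(1) off[of l']] l gS by simp
  qed
  have Z: "{p \<in> fan_point d ` {..Suc j}. bil N p = 0} = fan_point d ` {Suc i, Suc k}"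
  proof (intro equalityI subsetI)
    fix p assume "p \<in> {p \<in> fan_point d ` {..Suc j}. bil N p = 0}"
    then obtain l where l: "l \<in> {..Suc j}" "p = fan_point d l" "bil N (fan_point d l) = 0" by auto
    then have "l \<in> {Suc i, Suc k}" using far[of l] s by force
    then show "p \<in> fan_point d ` {Suc i, Suc k}" using l(2) by blast
  next
    fix p assume "p \<in> fan_point d ` {Suc i, Suc k}"
    then obtain l where "l \<in> {Suc i, Suc k}" "p = fan_point d l" by blast
    then show "p \<in> {p \<in> fan_point d ` {..Suc j}. bil N p = 0}" using zero ik by auto
  qed
  have "card (fan_point d ` {Suc i, Suc k}) = card {Suc i, Suc k}"
    using ik by (intro card_image inj_on_subset[OF inj_fan]) auto
  then have "wall d N (fan_point d ` {..Suc j})"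
    unfolding wall_def Z using zero far ik
    by (auto simp: N_def bil_chord cosh_square_eq simp flip: power2_eq_square)
  then show thesis using that h(1) Z by (simp add: N_def)
qed

text \<open>An even j is at least 6, so 7 \<alpha> \<le> 2 pi and the cosine is at least cos (pi /
  7), about 0.9. The estimate comes from cos (pi - 4 x) \<le> cos (3 x) as polynomials in cos x; the
  constant 7/8 is what the even case of \<open>fan_bound\<close> requires.\<close>

lemma cos_half_alpha_ge: assumes "even j" shows "7 / 8 \<le> cos (alpha d / 2)"
proof (rule ccontr)
  define x k where "x = alpha d / 2" and "k = cos x"
  assume "\<not> ?thesis"
  then have k: "k < 7 / 8" by (simp add: k_def x_def)
  have x: "0 < x" "x < pi / 6" using alpha_half_bounds[OF d] by (auto simp: x_def)
  have "j \<ge> 6" using j assms by (cases "j = 5") auto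
  then have "7 * alpha d \<le> (real j + 1) * alpha d" using alpha_bounds[OF d] by (intro mult_right_mono) auto
  then have x7: "3 * x \<le> pi - 4 * x" using gap by (simp add: x_def)
  have "cos (pi / 6) < k" unfolding k_def using x by (intro cos_monotone_0_pi) auto
  moreover have "3 / 2 < sqrt 3" by (rule real_less_rsqrt) (simp add: power2_eq_square)
  ultimately have k0: "3 / 4 < k" by (simp add: cos_30)
  have "cos (pi - 4 * x) \<le> cos (3 * x)" using x x7 by (intro cos_monotone_0_pi_le) auto
  moreover have "cos (pi - 4 * x) = - cos (2 * (2 * x))" by simp
  moreover have "cos (2 * (2 * x)) = 2 * (2 * k\<^sup>2 - 1)\<^sup>2 - 1" unfolding cos_double_cos k_def by simp
  moreover have "cos (3 * x) = 4 * k ^ 3 - 3 * k" unfolding cos_treble_cos k_def by simp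
  ultimately have le: "1 - 2 * (2 * k\<^sup>2 - 1)\<^sup>2 \<le> 4 * k ^ 3 - 3 * k" by simp
  have k2: "k\<^sup>2 \<le> 49 / 64" "1 / 2 \<le> k\<^sup>2"
    using power_mono[of k "7/8" 2] power_mono[of "3/4" k 2] k k0 by (auto simp: power2_eq_square)
  have "(2 * k\<^sup>2 - 1)\<^sup>2 \<le> (17 / 32)\<^sup>2" using k2 by (intro power_mono) auto
  then have 1: "1 - 2 * (17 / 32)\<^sup>2 \<le> 1 - 2 * (2 * k\<^sup>2 - 1)\<^sup>2" by simp
  have "4 * k ^ 3 - 3 * k = k * (4 * k\<^sup>2 - 3)" by (simp add: power2_eq_square power3_eq_cube algebra_simps)
  also have "\<dots> \<le> k * (1 / 16)" using k2 k0 by (intro mult_left_mono) auto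
  also have "\<dots> \<le> 7 / 128" using k by simp
  finally show False using le 1 by (simp add: power2_eq_square)
qed

lemma fan_bound: "2 + 1 / (2 * real j) \<le> contact_limit d"
proof -
  define L where "L = fan_point d ` {..Suc j}"
  define \<omega> where "\<omega> = 2 * pi - real j * alpha d"
  have a: "0 < alpha d" "alpha d < pi / 3" using alpha_bounds[OF d] by auto
  have om: "alpha d \<le> \<omega>" "\<omega> < 2 * alpha d" using gap by (auto simp: \<omega>_def algebra_simps)
  define \<phi> where "\<phi> = pi + real j * alpha d / 2"
  have ph: "\<phi> = 2 * pi - \<omega> / 2" "\<phi> - real j * alpha d = \<omega> / 2" by (simp_all add: \<phi>_def \<omega>_def field_simps)
  have onA: "cos (\<phi> - real 0 * alpha d) = cos (\<omega> / 2)" "cos (\<phi> - real j * alpha d) = cos (\<omega> / 2)"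
    unfolding ph(2) by (simp_all add: ph(1))
  have offA: "cos (\<phi> - real l * alpha d) \<le> cos (\<omega> / 2 + alpha d)" if l: "l \<le> j" "l \<noteq> 0" "l \<noteq> j" for l
  proof -
    define y where "y = (real j / 2 - real l) * alpha d"
    have "\<phi> - real l * alpha d = y + pi" by (simp add: \<phi>_def y_def algebra_simps)
    then have e: "cos (\<phi> - real l * alpha d) = - cos y" by simp
    have "\<bar>y\<bar> \<le> pi - (\<omega> / 2 + alpha d)"
    proof -
      have "\<bar>y\<bar> = \<bar>real j / 2 - real l\<bar> * alpha d" using a by (simp add: y_def abs_mult)
      also have "\<dots> \<le> (real j / 2 - 1) * alpha d" using l a by (intro mult_right_mono) (auto simp: abs_le_iff)
      also have "\<dots> = pi - (\<omega> / 2 + alpha d)" by (simp add: \<omega>_def field_simps)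
      finally show ?thesis .
    qed
    then have "cos (pi - (\<omega> / 2 + alpha d)) \<le> cos \<bar>y\<bar>" using a om by (intro cos_monotone_0_pi_le) auto
    then show ?thesis using e by simp
  qed
  obtain h where h: "d / 2 \<le> h" "wall d (chord h \<phi>) L" "{p \<in> L. bil (chord h \<phi>) p = 0} = fan_point d ` {Suc 0, Suc j}"
  proof (rule fan_wall[of "\<omega> / 2" 0 j \<phi>])
    show "0 \<le> \<omega> / 2" "\<omega> / 2 \<le> alpha d" "0 < j" using om a j by auto
  qed (use onA offA that in \<open>auto simp: L_def\<close>)
  \<comment> \<open>The rim edge from index i to i + 1 (counting the rim from 0) is opposite to the
    gap, exactly for odd j and up to half a step for even j.\<close>
  define i where "i = (j - 1) div 2"
  have i: "2 * i + 1 \<le> j" "j \<le> 2 * i + 2" "Suc i \<le> j" using j by (auto simp: i_def)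
  define \<psi> where "\<psi> = (real i + 1 / 2) * alpha d"
  have onB: "cos (\<psi> - real i * alpha d) = cos (alpha d / 2)" "cos (\<psi> - real (Suc i) * alpha d) = cos (alpha d / 2)"
  proof -
    have "\<psi> - real i * alpha d = alpha d / 2" "\<psi> - real (Suc i) * alpha d = - (alpha d / 2)" by (auto simp: \<psi>_def algebra_simps)
    then show "cos (\<psi> - real i * alpha d) = cos (alpha d / 2)" "cos (\<psi> - real (Suc i) * alpha d) = cos (alpha d / 2)"
      by (simp_all only: cos_minus)
  qed
  have offB: "cos (\<psi> - real l * alpha d) \<le> cos (alpha d / 2 + alpha d)" if l: "l \<le> j" "l \<noteq> i" "l \<noteq> Suc i" for l
  proof (rule cos_le_cos_abs)
    have e: "\<bar>\<psi> - real l * alpha d\<bar> = \<bar>real i + 1 / 2 - real l\<bar> * alpha d"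
      using a by (simp add: \<psi>_def abs_mult flip: left_diff_distrib)
    have "real l \<le> real i - 1 \<or> real i + 2 \<le> real l" using l by linarith
    then have "3 / 2 * alpha d \<le> \<bar>real i + 1 / 2 - real l\<bar> * alpha d" using a by (intro mult_right_mono) auto
    then show "alpha d / 2 + alpha d \<le> \<bar>\<psi> - real l * alpha d\<bar>" unfolding e by simp
    have "\<bar>real i + 1 / 2 - real l\<bar> \<le> (real j + 1) / 2"
    proof -
      have "0 \<le> real l" "real l \<le> real j" "2 * real i + 1 \<le> real j" "real j \<le> 2 * real i + 2" using l i by linarith+
      moreover have "\<bar>x + 1 / 2 - y\<bar> \<le> (z + 1) / 2" if "0 \<le> y" "y \<le> z" "2 * x + 1 \<le> z" "z \<le> 2 * x + 2" for x y z :: real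
        using that by (auto simp: abs_real_def field_simps)
      ultimately show ?thesis by blast
    qed
    then have "\<bar>real i + 1 / 2 - real l\<bar> * alpha d \<le> (real j + 1) / 2 * alpha d" using a by (intro mult_right_mono) auto
    then show "\<bar>\<psi> - real l * alpha d\<bar> \<le> pi" unfolding e using gap(1) by simp
  qed (use a in simp)
  obtain k where k: "d / 2 \<le> k" "wall d (chord k \<psi>) L"
  proof (rule fan_wall[of "alpha d / 2" i "Suc i" \<psi>])
    show "0 \<le> alpha d / 2" "alpha d / 2 \<le> alpha d" "i < Suc i" "Suc i \<le> j" using i a by auto
  qed (use onB offB that in \<open>auto simp: L_def\<close>)
  \<comment> \<open>For odd j the two normals have opposite directions. For even j they are off by
    \<alpha> / 2; with q its cosine and C = cosh^2 (d / 2) = 1 / (4 (1 - q^2)) the product is at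
    least C (1 + q) - 1 = 1 / (4 (1 - q)) - 1, which reaches 1 at q = 7/8.\<close>
  have kappa: "1 \<le> bil (chord h \<phi>) (chord k \<psi>)"
  proof -
    have p: "0 < d / 2" using d by simp
    have "sinh (d / 2) \<le> sinh h" "sinh (d / 2) \<le> sinh k" "cosh (d / 2) \<le> cosh h" "cosh (d / 2) \<le> cosh k"
      using h(1) k(1) p cosh_real_nonneg_le_iff[of "d / 2" h] cosh_real_nonneg_le_iff[of "d / 2" k] by simp_all
    moreover have "0 \<le> sinh (d / 2)" "0 \<le> cosh (d / 2)" using p by simp_all
    ultimately have m: "sinh (d / 2) * sinh (d / 2) \<le> sinh h * sinh k" "cosh (d / 2) * cosh (d / 2) \<le> cosh h * cosh k"
      by (meson mult_mono order_trans)+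
    have dif: "\<phi> - \<psi> = (real j - 1 - 2 * real i) * (alpha d / 2) + pi" by (simp add: \<phi>_def \<psi>_def algebra_simps)
    have c: "bil (chord h \<phi>) (chord k \<psi>) = sinh h * sinh k + cosh h * cosh k * cos ((real j - 1 - 2 * real i) * (alpha d / 2))"
      unfolding bil_chord dif by simp
    define C where "C = (cosh (d / 2))\<^sup>2"
    have SC: "sinh (d / 2) * sinh (d / 2) = C - 1" "cosh (d / 2) * cosh (d / 2) = C"
      by (simp_all add: C_def cosh_square_eq power2_eq_square flip: power2_eq_square)
    have C1: "1 < C" using cosh_gt_1[OF p] by (simp add: C_def)
    show ?thesis
    proof (cases "even j")
      case True
      then have "j = 2 * i + 2" using i(1,2) by presburger
      then have c: "bil (chord h \<phi>) (chord k \<psi>) = sinh h * sinh k + cosh h * cosh k * cos (alpha d / 2)" using c by simp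
      define q where "q = cos (alpha d / 2)"
      have q: "7 / 8 \<le> q" "q < 1" using cos_half_alpha_ge[OF True] alpha_half_bounds[OF d] cos_monotone_0_pi[of 0 "alpha d / 2"]
        by (auto simp: q_def)
      have "C = 1 / (4 * (1 - q\<^sup>2))"
        unfolding C_def cosh_half_sq_alpha[OF d] q_def sin_squared_eq ..
      moreover have "q * q < 1 * 1" using q by (intro mult_strict_mono) auto
      then have "0 < 1 - q\<^sup>2" by (simp add: power2_eq_square)
      ultimately have "C * (4 * (1 - q\<^sup>2)) = 1" by simp
      moreover have "C * (1 + q) * (4 * (1 - q)) = C * (4 * (1 - q\<^sup>2))" by (simp add: power2_eq_square algebra_simps)
      ultimately have "C * (1 + q) * (4 * (1 - q)) = 1" by simp
      moreover have "C * (1 + q) * (4 * (1 - q)) \<le> C * (1 + q) * (1 / 2)" using q C1 by (intro mult_left_mono) auto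
      ultimately have "2 \<le> C * (1 + q)" by simp
      then have "1 \<le> (C - 1) + C * q" by (simp add: algebra_simps)
      also have "\<dots> \<le> sinh h * sinh k + cosh h * cosh k * q" using m q unfolding SC by (intro add_mono mult_right_mono) auto
      finally show ?thesis using c by (simp add: q_def)
    next
      case False
      then have "j = 2 * i + 1" using i(1,2) by presburger
      then show ?thesis using c m C1 unfolding SC by simp
    qed
  qed
  have cfg: "config d L" unfolding L_def by (rule fan_config)
  have cardL: "card L = j + 2" unfolding L_def by (subst card_image[OF inj_fan]) simp
  define Z where "Z = {p \<in> L. bil (chord h \<phi>) p = 0}"
  have T: "4 * j + 2 + card (touching d Z) \<le> card (touching d L)"
    using fan_touching[of Z] h(3) by (simp add: Z_def L_def)
  define M where "M = chord k \<psi>"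
  note R = reflect_config[OF d cfg h(2)] and W = reflect_wall[OF d cfg h(2) k(2) kappa, folded M_def]
  \<comment> \<open>One reflection across the gap makes 2 j + 2 points with at least 4 j + 2
    contacts; the wall opposite to the gap and its image bound the strip that is continued. In the
    limit two points and one contact drop out.\<close>
  have "real (4 * j + 1) / real (2 * j) \<le> contact_limit d"
  proof (rule strip_bound[OF d R(1) W])
    show "card (L \<union> reflect (chord h \<phi>) ` L) = 2 + 2 * j" using R(2) cardL by simp
    show "2 * (1 + (4 * j + 1)) \<le> card (touching d (L \<union> reflect (chord h \<phi>) ` L))" using R(3) T by (simp add: Z_def)
    show "2 * j > 0" using j by simp
  qed
  moreover have "real (4 * j + 1) / real (2 * j) = 2 + 1 / (2 * real j)" using j by (simp add: field_simps)
  ultimately show ?thesis by simp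
qed

end

text \<open>With m the number of angles \<alpha> that fit into a full turn, j = m - 1 triangles
  leave a gap of at least \<alpha>. As \<open>alpha4 d\<close> is below 2 \<alpha>, the floor in
  \<open>gamma6\<close> is at least m - 2, and 4 (m - 2) - 6 \<ge> 2 (m - 1) because m \<ge>
  6.\<close>

lemma gamma6_le: assumes d: "d > 0" shows "gamma6 d \<le> contact_limit d"
proof -
  have a: "0 < alpha d" "alpha d < pi / 3" using alpha_bounds[OF d] by auto
  define m where "m = \<lfloor>2 * pi / alpha d\<rfloor>"
  have "6 \<le> 2 * pi / alpha d" using a by (simp add: field_simps)
  then have m6: "6 \<le> m" by (simp add: m_def le_floor_iff)
  define j where "j = nat (m - 1)"
  have j: "5 \<le> j" "real j = of_int m - 1" using m6 by (auto simp: j_def)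
  have "of_int m \<le> 2 * pi / alpha d" "2 * pi / alpha d < of_int m + 1" by (auto simp: m_def)
  then have "of_int m * alpha d \<le> 2 * pi" "2 * pi < (of_int m + 1) * alpha d" using a by (auto simp: field_simps)
  then have gap: "(real j + 1) * alpha d \<le> 2 * pi" "2 * pi < (real j + 2) * alpha d" unfolding j(2) by (simp_all add: algebra_simps)
  define M where "M = \<lfloor>(2 * pi - alpha4 d) / alpha d\<rfloor>"
  have "m - 2 \<le> M"
  proof -
    have "2 * pi / alpha d - 2 \<le> (2 * pi - alpha4 d) / alpha d"
      using alpha4_bounds(2)[OF d] a by (simp add: field_simps)
    then have "\<lfloor>2 * pi / alpha d - 2\<rfloor> \<le> M" unfolding M_def by (rule floor_mono)
    moreover have "\<lfloor>2 * pi / alpha d - 2\<rfloor> = m - 2" using floor_diff_of_int[of "2 * pi / alpha d" 2] by (simp add: m_def)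
    ultimately show ?thesis by simp
  qed
  then have "real j \<le> of_int M + 1" "4 \<le> (of_int M :: real)" using m6 unfolding j(2) by linarith+
  then have "2 * real j \<le> 4 * of_int M - 6" by linarith
  then have "1 / (4 * of_int M - 6) \<le> 1 / (2 * real j)" using j(1) by (intro divide_left_mono mult_pos_pos) auto
  then have "gamma6 d \<le> 2 + 1 / (2 * real j)" by (simp add: gamma6_def M_def)
  also have "\<dots> \<le> contact_limit d" by (rule fan_bound[OF d j(1) gap])
  finally show ?thesis .
qed

theorem mainTheorem1:
  fixes d :: real
  assumes "d > 0"
  shows "contact_limit d \<le> gamma1 d
    \<and> ((\<exists>k\<ge>6. d = d_semi k) \<longrightarrow> contact_limit d \<le> gamma2 d)
    \<and> ((\<exists>k\<ge>6. d = d_semi k) \<longrightarrow> contact_limit d \<le> gamma3 d)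
    \<and> ((\<forall>k\<ge>7. d \<noteq> d_tri k) \<and> (\<forall>k\<ge>6. d \<noteq> d_semi k) \<longrightarrow> contact_limit d \<le> gamma4 d)
    \<and> ((\<forall>k\<ge>7. d \<noteq> d_tri k) \<and> (\<forall>k\<ge>6. d \<noteq> d_semi k) \<longrightarrow> contact_limit d \<le> gamma5 d)
    \<and> contact_limit d \<ge> gamma6 d"
proof (intro conjI impI)
  note lim = contact_limit_props(1)[OF assms] and fin = finite_packing_bounds[OF assms]
  note x = pi_over_alpha[OF assms]
  have pos: "0 \<le> gamma1 d" "0 \<le> gamma2 d" "0 \<le> gamma4 d"
    using quadratic_root_bounds(1)[OF x _ _ gamma1_root] quadratic_root_bounds(1)[OF x _ _ gamma2_root]
      quadratic_root_bounds(1)[OF x _ _ gamma4_root] by auto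
  have pos': "0 \<le> gamma3 d" "0 \<le> gamma5 d" using gamma3_5(3,4)[OF assms refl] by auto
  show "contact_limit d \<le> gamma1 d" by (rule lim[OF fin(1) pos(1)])
  show "gamma6 d \<le> contact_limit d" by (rule gamma6_le[OF assms])
  {
    assume "\<exists>k\<ge>6. d = d_semi k"
    then have n: "\<forall>k\<ge>7. d \<noteq> d_tri k" using d_semi_not_tri by blast
    show "contact_limit d \<le> gamma2 d" by (rule lim[OF fin(2)[OF _ _ n] pos(2)])
    show "contact_limit d \<le> gamma3 d" by (rule lim[OF fin(3)[OF _ _ n] pos'(1)])
  }
  {
    assume n: "(\<forall>k\<ge>7. d \<noteq> d_tri k) \<and> (\<forall>k\<ge>6. d \<noteq> d_semi k)"
    show "contact_limit d \<le> gamma4 d" by (rule lim[OF fin(4)[OF _ _ n[THEN conjunct1] n[THEN conjunct2]] pos(3)])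
    show "contact_limit d \<le> gamma5 d" by (rule lim[OF fin(5)[OF _ _ n[THEN conjunct1] n[THEN conjunct2]] pos'(2)])
  }
qed

end
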